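(* Let $1\le p_0<\infty$ and let $\mathcal F$ be a collection of pairs $(f,g)$ of nonnegative measurable functions on $\mathbb{R}^n$. Assume that for every $(f,g)\in\mathcal F$ and every $v\in A_{p_0}$, $$\|g\|_{L^{p_0}(v)}\le C\|f\|_{L^{p_0}(v)},$$ where $C$ does not depend on the pair $(f,g)$ and depends on $v$ only through $[v]_{A_{p_0}}$. Then for $1<p<\infty$ and every weight $w\in A_{p,\mathrm{loc}}$ satisfying $$\sup_B \frac 1{|B|} \|\chi _B\|_{\mathcal M^{q}(\varphi,w)} \|M(\chi_B)^{1/s}\|_{\mathcal M^{q}(\varphi,w)'} <\infty \quad(\ast)$$ for some $1\le q<p$ and some $s>1$ (supremum over all balls), it holds that $\|g\|_{\mathcal M^{p}(\varphi,w)}\le C'\|f\|_{\mathcal M^{p}(\varphi,w)}$ for all $(f,g)\in\mathcal F$, with $C'$ independent of the pair. If the hypothesis holds for $p_0=1$, then one may take $q=p$ in $(\ast)$, and moreover the conclusion is valid also for $p=1$ (that is, for $w\in A_{1,\mathrm{loc}}$ satisfying $(\ast)$ with $q=p=1$ and some $s>1$).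
   Context: A weight is a nonnegative locally integrable function on $\mathbb{R}^n$. $M$ denotes the Hardy–Littlewood maximal operator. $A_{p_0}$ is the Muckenhoupt class ($v\in A_{p_0}$, $p_0>1$, iff $[v]_{A_{p_0}}:=\sup_B (|B|^{-1}\int_Bv)(|B|^{-1}\int_Bv^{1-p_0'})^{p_0-1}<\infty$; $v\in A_1$ iff $Mv\le Cv$ a.e.). Let $\varphi$ be a function from the set of Euclidean balls of $\mathbb{R}^n$ to $(0,\infty)$; standing assumptions: $\varphi$ is doubling ($\varphi(2B)\le C\varphi(B)$) and reverse doubling (there are $\delta>0$, $C$ with $\varphi(B_1)/\varphi(B_2)\le C(|B_1|/|B_2|)^\delta$ for balls $B_1\subset B_2$), and characteristic functions of balls belong to the Morrey spaces considered. $\mathcal M^{p}(\varphi,w)$: measurable $f$ with $\|f\|_{\mathcal M^{p}(\varphi,w)}:=\sup_B\big(\varphi(B)^{-1}\int_B|f|^pw\big)^{1/p}<\infty$, over all balls. Köthe dual: $\|g\|_{X'}:=\sup\{\int|fg|:\|f\|_X\le1\}$. For a ball $B$, $c_B$ is its center and $r_B$ its radius. Fix $\kappa\in(0,1)$; $A_{p,\mathrm{loc}}$ ($1<p<\infty$): $\sup_B w(B)^{1/p}\big(\int_Bw^{1-p'}\big)^{1/p'}/|B|<\infty$; $A_{1,\mathrm{loc}}$: $w(B)/|B|\le C\operatorname{ess\,inf}_Bw$; both over balls with $r_B<\kappa|c_B|$ (the classes do not depend on $\kappa$). *)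

theory Defs
  imports "HOL-Analysis.Analysis"
begin

text \<open>Real power of an extended nonnegative real (used only with positive exponents);
  \<open>\<infinity>\<close> is sent to \<open>\<infinity>\<close>.\<close>
definition enn_powr :: "real \<Rightarrow> ennreal \<Rightarrow> ennreal" where
  "enn_powr a x = (if x = top then top else ennreal (enn2real x powr a))"

definition weight :: "('a::euclidean_space \<Rightarrow> real) \<Rightarrow> bool" where
  "weight w \<longleftrightarrow> (\<forall>x. 0 \<le> w x) \<and> w \<in> borel_measurable lebesgue \<and>
     (\<forall>K. compact K \<longrightarrow> set_integrable lebesgue K w)"

definition wLp_norm :: "real \<Rightarrow> ('a::euclidean_space \<Rightarrow> real) \<Rightarrow> ('a \<Rightarrow> real) \<Rightarrow> ennreal" where
  "wLp_norm p v f = enn_powr (1/p) (\<integral>\<^sup>+ x. ennreal (\<bar>f x\<bar> powr p * v x) \<partial>lebesgue)"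

definition ball_avg :: "'a::euclidean_space \<Rightarrow> real \<Rightarrow> ('a \<Rightarrow> ennreal) \<Rightarrow> ennreal" where
  "ball_avg c r h = ennreal (1 / measure lebesgue (ball c r)) *
      (\<integral>\<^sup>+ x \<in> ball c r. h x \<partial>lebesgue)"

definition maximal :: "('a::euclidean_space \<Rightarrow> real) \<Rightarrow> 'a \<Rightarrow> ennreal" where
  "maximal h x = (SUP cr \<in> {(c, r). 0 < r \<and> x \<in> ball c r}.
      ball_avg (fst cr) (snd cr) (\<lambda>y. ennreal \<bar>h y\<bar>))"

definition dual_weight :: "real \<Rightarrow> ('a \<Rightarrow> real) \<Rightarrow> 'a \<Rightarrow> ennreal" where
  "dual_weight p v x = (if v x = 0 then top else ennreal (v x powr (1 - p / (p - 1))))"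

definition Ap_const :: "real \<Rightarrow> ('a::euclidean_space \<Rightarrow> real) \<Rightarrow> ennreal" where
  "Ap_const p v = (if p = 1 then
       Inf {C :: ennreal. AE x in lebesgue. maximal v x \<le> C * ennreal (v x)}
     else (SUP cr \<in> {(c, r). (0::real) < r}.
       ball_avg (fst cr) (snd cr) (\<lambda>y. ennreal (v y)) *
       enn_powr (p - 1) (ball_avg (fst cr) (snd cr) (dual_weight p v))))"

definition A_class :: "real \<Rightarrow> ('a::euclidean_space \<Rightarrow> real) \<Rightarrow> bool" where
  "A_class p v \<longleftrightarrow> weight v \<and> Ap_const p v < top"

definition A_loc :: "real \<Rightarrow> real \<Rightarrow> ('a::euclidean_space \<Rightarrow> real) \<Rightarrow> bool" where
  "A_loc \<kappa> p w \<longleftrightarrow> weight w \<and>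
     (if p = 1 then
        (\<exists>C::real. \<forall>c r. 0 < r \<and> r < \<kappa> * norm c \<longrightarrow>
           (AE x in lebesgue. x \<in> ball c r \<longrightarrow>
              (\<integral>\<^sup>+ y \<in> ball c r. ennreal (w y) \<partial>lebesgue) / ennreal (measure lebesgue (ball c r))
                \<le> ennreal (C * w x)))
      else
        (\<exists>C::real. \<forall>c r. 0 < r \<and> r < \<kappa> * norm c \<longrightarrow>
           enn_powr (1/p) (\<integral>\<^sup>+ y \<in> ball c r. ennreal (w y) \<partial>lebesgue) *
           enn_powr ((p - 1) / p) (\<integral>\<^sup>+ y \<in> ball c r. dual_weight p w y \<partial>lebesgue)
             \<le> ennreal (C * measure lebesgue (ball c r))))"

definition morrey_norm :: "real \<Rightarrow> ('a::euclidean_space set \<Rightarrow> real) \<Rightarrow> ('a \<Rightarrow> real) \<Rightarrow> ('a \<Rightarrow> real) \<Rightarrow> ennreal" where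
  "morrey_norm p \<phi> w f = (SUP cr \<in> {(c, r). (0::real) < r}.
      enn_powr (1/p) (ennreal (1 / \<phi> (ball (fst cr) (snd cr))) *
        (\<integral>\<^sup>+ x \<in> ball (fst cr) (snd cr). ennreal (\<bar>f x\<bar> powr p * w x) \<partial>lebesgue)))"

definition koethe_dual :: "(('a::euclidean_space \<Rightarrow> real) \<Rightarrow> ennreal) \<Rightarrow> ('a \<Rightarrow> real) \<Rightarrow> ennreal" where
  "koethe_dual X g = (SUP f \<in> {f \<in> borel_measurable lebesgue. X f \<le> 1}.
      \<integral>\<^sup>+ x. ennreal \<bar>f x * g x\<bar> \<partial>lebesgue)"

definition cond_star :: "real \<Rightarrow> real \<Rightarrow> ('a::euclidean_space set \<Rightarrow> real) \<Rightarrow> ('a \<Rightarrow> real) \<Rightarrow> bool" where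
  "cond_star q s \<phi> w \<longleftrightarrow>
     (SUP cr \<in> {(c, r). (0::real) < r}.
        ennreal (1 / measure lebesgue (ball (fst cr) (snd cr))) *
        morrey_norm q \<phi> w (indicator (ball (fst cr) (snd cr))) *
        koethe_dual (morrey_norm q \<phi> w)
          (\<lambda>x. enn2real (maximal (indicator (ball (fst cr) (snd cr))) x) powr (1 / s))) < top"

definition extrap_hyp :: "real \<Rightarrow> (('a::euclidean_space \<Rightarrow> real) \<times> ('a \<Rightarrow> real)) set \<Rightarrow> bool" where
  "extrap_hyp p0 F \<longleftrightarrow> (\<forall>t::real. \<exists>C::real. \<forall>v. A_class p0 v \<and> Ap_const p0 v \<le> ennreal t \<longrightarrow>
      (\<forall>(f, g) \<in> F. wLp_norm p0 v g \<le> ennreal C * wLp_norm p0 v f))"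

text \<open>Standing assumption: characteristic functions of balls belong to \<open>M^p(\<phi>,w)\<close>.\<close>
definition balls_in_morrey :: "real \<Rightarrow> ('a::euclidean_space set \<Rightarrow> real) \<Rightarrow> ('a \<Rightarrow> real) \<Rightarrow> bool" where
  "balls_in_morrey p \<phi> w \<longleftrightarrow> (\<forall>c r. 0 < r \<longrightarrow> morrey_norm p \<phi> w (indicator (ball c r)) < top)"

end

theory Submission
  imports Defs
begin

text \<open>
  Suppose first that the hypothesis holds for \<open>p\<^sub>0 = 1\<close>. For a ball \<open>B\<close> whose radius is small compared with its distance
  to the origin, dualize \<open>(\<integral>\<^sub>B g\<^sup>p w)\<^sup>1\<^sup>/\<^sup>p\<close> against \<open>h\<close> and apply the hypothesis with the \<open>A\<^sub>1\<close> weight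
  \<open>v = M((h w \<chi>\<^sub>B)\<^sup>a)\<^sup>1\<^sup>/\<^sup>a\<close>, \<open>a > 1\<close> close to \<open>1\<close> (Coifman-Rochberg). On \<open>2B\<close> the resulting integral of \<open>f v\<close> is
  controlled by the local \<open>A\<^sub>p\<close> theory: the reverse Hoelder inequality makes the dual weight belong to a smaller class, so that
  the maximal operator is bounded on the dual space even after raising to the power \<open>a\<close>. Off \<open>2B\<close> the weight \<open>v\<close> is
  comparable to a multiple of \<open>M(\<chi>\<^sub>B)\<^sup>1\<^sup>/\<^sup>a\<close> and the condition on the Koethe dual norm applies. Any other ball is, up
  to doubling, a ball centred at the origin; it splits into dyadic annuli covered by boundedly many small balls, and reverse
  doubling of \<open>\<phi>\<close> sums the estimates.

  If \<open>p\<^sub>0 > 1\<close>, the classical extrapolation argument with the weights \<open>v (M f)\<^bsup>-(p\<^sub>0 - p\<^sub>1)\<^esup>\<close> gives the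
  inequality in \<open>L\<^bsup>p\<^sub>1\<^esup>(v)\<close>, \<open>v \<in> A\<^sub>1\<close>, for \<open>p\<^sub>1 > 1\<close> close to \<open>1\<close>. Then the powers \<open>(f\<^bsup>p\<^sub>1\<^esup>, g\<^bsup>p\<^sub>1\<^esup>)\<close> satisfy
  the case \<open>p\<^sub>0 = 1\<close>, to be used with the exponent \<open>p / p\<^sub>1\<close>: openness puts \<open>w\<close> in the corresponding local
  class, and interpolating with \<open>\<integral> M(\<chi>\<^sub>B)\<^sup>a \<le> C |B|\<close> raises the exponent \<open>q\<close> of the dual condition to it.
\<close>

section \<open>Covering, layer cake and the Hoelder inequality\<close>

text \<open>The weight is controlled only on balls small compared with the distance to the origin,
  so the maximal operator is estimated only on functions supported in \<open>B\<close>, with the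
  result integrated over \<open>2 B\<close>. Balls of radius at most \<open>4 r\<close> then
  suffice; their five-fold Vitali dilates stay in \<open>26 B\<close>, and the openness step doubles
  this to \<open>52 B\<close>. The exponent \<open>a\<close> must satisfy \<open>a > 1\<close> for
  Coifman-Rochberg, \<open>a \<le> s\<close> so that M(\<chi>_B)^(1/a) is at most M(\<chi>_B)^(1/s),
  and p'/a > t1, where A_t1 is the improved class of the dual weight. The constant must serve all
  pairs and all balls, so each estimate fixes its constant before functions, weights and balls are
  quantified. Two arguments absorb a quantity into itself: reverse Hoelder (Gehring) and the duality
  with h = g^(p-1). Both run on truncations, which make that quantity finite. For p0 > 1 the
  estimate is run at t = p / p1 with q < t < p; the strict inequality q < p leaves this room. The
  weight may vanish almost everywhere on a ball, since \<open>0 * top = 0\<close> in the local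
  condition; such balls are split off.\<close>

lemma emeasure_lebesgue_ball:
  fixes c :: "'a::euclidean_space"
  shows "0 \<le> r \<Longrightarrow> emeasure lebesgue (ball c r) = ennreal (unit_ball_vol (DIM('a)) * r ^ DIM('a))"
  using emeasure_ball[of r c] by simp

lemma measure_lebesgue_ball:
  fixes c :: "'a::euclidean_space"
  shows "0 \<le> r \<Longrightarrow> measure lebesgue (ball c r) = unit_ball_vol (DIM('a)) * r ^ DIM('a)"
  using content_ball[of r c] by simp

lemma emeasure_ball_eq_measure:
  fixes c :: "'a::euclidean_space"
  shows "emeasure lebesgue (ball c r) = ennreal (measure lebesgue (ball c r))"
proof (cases "0 \<le> r")
  case True
  show ?thesis unfolding emeasure_lebesgue_ball[OF True] measure_lebesgue_ball[OF True] ..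
qed (simp add: ball_empty)

lemma measure_ball_pos:
  fixes c :: "'a::euclidean_space"
  shows "0 < r \<Longrightarrow> 0 < measure lebesgue (ball c r)"
  using measure_lebesgue_ball[of r c] by simp

lemma measure_ball_scale:
  fixes c d :: "'a::euclidean_space"
  assumes "0 \<le> k" "0 \<le> r"
  shows "measure lebesgue (ball d (k * r)) = k ^ DIM('a) * measure lebesgue (ball c r)"
proof -
  have "0 \<le> k * r" using assms by simp
  show ?thesis
    unfolding measure_lebesgue_ball[OF \<open>0 \<le> k * r\<close>] measure_lebesgue_ball[OF assms(2)]
    by (simp add: power_mult_distrib)
qed

text \<open>Unbounded radii are harmless: the Vitali covering lemma is applied to finite
  subfamilies, and Lindelof with continuity from below reaches the whole union. Comparing two
  measures puts the constants and densities of the later weak-type bounds into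
  \<open>\<nu>\<close>.\<close>

lemma vitali_measure_le:
  fixes \<mu> \<nu> :: "'a::euclidean_space measure"
  assumes \<mu>: "sets \<mu> = sets lebesgue" and \<nu>: "sets \<nu> = sets lebesgue"
    and B: "\<And>c r. (c, r) \<in> B \<Longrightarrow> 0 < r \<and> emeasure \<mu> (ball c (5 * r)) \<le> emeasure \<nu> (ball c r)"
  shows "emeasure \<mu> (\<Union>(c, r)\<in>B. ball c r) \<le> emeasure \<nu> (\<Union>(c, r)\<in>B. ball c r)"
proof -
  let ?b = "\<lambda>z::'a \<times> real. ball (fst z) (snd z)"
  let ?U = "\<Union>z\<in>B. ?b z"
  have sb: "ball c r \<in> sets \<mu>" "ball c r \<in> sets \<nu>" for c :: 'a and r
    using \<mu> \<nu> by auto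
  have fin: "emeasure \<mu> (\<Union>z\<in>K. ?b z) \<le> emeasure \<nu> ?U" if K: "finite K" "K \<subseteq> B" for K
  proof -
    have r: "0 < snd z \<and> snd z \<le> Max (insert 0 (snd ` K))" if "z \<in> K" for z
      using B[of "fst z" "snd z"] K that by (auto intro!: Max_ge)
    obtain C where "countable C" and C: "C \<subseteq> K" "pairwise (\<lambda>i j. disjnt (?b i) (?b j)) C"
      "(\<Union>z\<in>K. ?b z) \<subseteq> (\<Union>i\<in>C. ball (fst i) (5 * snd i))"
      by (rule Vitali_covering_lemma_balls[where S="\<Union>z\<in>K. ?b z" and K=K and a=fst and r=snd, OF subset_refl r])
    have fC: "finite C" by (rule finite_subset[OF C(1) K(1)])
    have "emeasure \<mu> (\<Union>z\<in>K. ?b z) \<le> emeasure \<mu> (\<Union>i\<in>C. ball (fst i) (5 * snd i))"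
      by (intro emeasure_mono C(3) sets.finite_UN fC sb)
    also have "\<dots> \<le> (\<Sum>i\<in>C. emeasure \<mu> (ball (fst i) (5 * snd i)))"
      by (intro emeasure_subadditive_finite fC) (auto simp: sb)
    also have "\<dots> \<le> (\<Sum>i\<in>C. emeasure \<nu> (?b i))"
    proof (rule sum_mono)
      fix i assume "i \<in> C"
      then have "(fst i, snd i) \<in> B" using C(1) K(2) by auto
      from B[OF this] show "emeasure \<mu> (ball (fst i) (5 * snd i)) \<le> emeasure \<nu> (?b i)" by simp
    qed
    also have "\<dots> = emeasure \<nu> (\<Union>i\<in>C. ?b i)"
    proof (rule sum_emeasure)
      show "disjoint_family_on ?b C"
        unfolding disjoint_family_on_def
      proof (intro ballI impI)
        fix i j assume "i \<in> C" "j \<in> C" "i \<noteq> j"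
        from pairwiseD[OF C(2) this] show "?b i \<inter> ?b j = {}" by (rule disjnt_def[THEN iffD1])
      qed
    qed (use fC sb in auto)
    also have "\<dots> \<le> emeasure \<nu> ?U"
    proof (rule emeasure_mono)
      have "open ?U" by (intro open_UN) simp
      then show "?U \<in> sets \<nu>" using \<nu> by auto
    qed (use C(1) K(2) in blast)
    finally show ?thesis .
  qed
  obtain F where F: "F \<subseteq> ?b ` B" "countable F" "\<Union>F = ?U"
    by (rule Lindelof[of "?b ` B"]) auto
  obtain B' where B': "B' \<subseteq> B" "countable B'" "F = ?b ` B'"
    using countable_subset_image[of F ?b B] F by metis
  have "emeasure \<mu> ?U \<le> emeasure \<nu> ?U"
  proof (cases "B' = {}")
    case True
    have "?U = {}" unfolding F(3)[symmetric] B'(3) True by (simp only: image_empty Union_empty)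
    then show ?thesis by (simp only: emeasure_empty order_refl)
  next
    case False
    define A where "A n = (\<Union>z\<in>from_nat_into B' ` {..n}. ?b z)" for n :: nat
    have "(\<Union>n. A n) = ?U"
    proof -
      have "(\<Union>n. A n) = (\<Union>z\<in>range (from_nat_into B'). ?b z)" unfolding A_def by auto
      then show ?thesis using range_from_nat_into[OF False B'(2)] F(3) B'(3) by simp
    qed
    moreover have "(SUP n. emeasure \<mu> (A n)) = emeasure \<mu> (\<Union>n. A n)"
    proof (rule SUP_emeasure_incseq)
      have "open (A n)" for n unfolding A_def by (intro open_UN) simp
      then show "range A \<subseteq> sets \<mu>" using \<mu> by auto
      show "incseq A" unfolding A_def incseq_def by (intro allI impI UN_mono image_mono) auto
    qed
    moreover have "emeasure \<mu> (A n) \<le> emeasure \<nu> ?U" for n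
      unfolding A_def using from_nat_into[OF False] B'(1) by (intro fin) auto
    ultimately show ?thesis by (metis (no_types, lifting) SUP_least)
  qed
  then show ?thesis by (simp add: case_prod_unfold)
qed

lemma layer_cake:
  assumes "sigma_finite_measure M" and u[measurable]: "u \<in> borel_measurable M"
    and u0: "\<And>x. 0 \<le> u x" and a: "0 < a"
  shows "(\<integral>\<^sup>+x. ennreal (u x powr a) \<partial>M) =
    (\<integral>\<^sup>+t. ennreal (a * t powr (a - 1)) * indicator {0<..} t * emeasure M {x \<in> space M. t < u x} \<partial>lborel)"
proof -
  interpret M: sigma_finite_measure M by fact
  interpret P: pair_sigma_finite M lborel ..
  let ?g = "\<lambda>x t. ennreal (a * t powr (a - 1)) * indicator {0<..} t * indicator {x \<in> space M. t < u x} x"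
  have inner: "(\<integral>\<^sup>+t. ?g x t \<partial>lborel) = ennreal (u x powr a)" if "x \<in> space M" for x
  proof -
    have "((\<lambda>t. a * t powr (a - 1)) has_integral a * (u x powr (a - 1 + 1) / (a - 1 + 1))) {0..u x}"
      using a u0[of x] by (intro has_integral_mult_right has_integral_powr_from_0) auto
    then have I: "((\<lambda>t. a * t powr (a - 1)) has_integral u x powr a) {0..u x}" using a by simp
    have "(\<integral>\<^sup>+t. ?g x t \<partial>lborel) = (\<integral>\<^sup>+t. ennreal (a * t powr (a - 1)) * indicator {0..u x} t \<partial>lborel)"
    proof (rule nn_integral_cong_AE)
      \<comment> \<open>The open conditions \<open>0 < t < u x\<close> and the closed interval
        \<open>{0..u x}\<close> differ only at these two points.\<close>
      have "AE t in lborel. t \<noteq> 0 \<and> t \<noteq> u x"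
        by (intro AE_conjI AE_lborel_singleton)
      then show "AE t in lborel. ?g x t = ennreal (a * t powr (a - 1)) * indicator {0..u x} t"
        by eventually_elim (use that in \<open>auto simp: indicator_def\<close>)
    qed
    also have "\<dots> = ennreal (u x powr a)"
      using a I by (intro nn_integral_has_integral_lebesgue') auto
    finally show ?thesis .
  qed
  have m: "(\<lambda>(x, t). ?g x t) \<in> borel_measurable (M \<Otimes>\<^sub>M lborel)"
  proof -
    have "{z \<in> space (M \<Otimes>\<^sub>M lborel). snd z < u (fst z)} \<in> sets (M \<Otimes>\<^sub>M lborel)"
      by (intro borel_measurable_less) (simp_all add: measurable_compose[OF measurable_fst u])
    then have "(\<lambda>z. indicator {z \<in> space (M \<Otimes>\<^sub>M lborel). snd z < u (fst z)} z :: ennreal) \<in> borel_measurable (M \<Otimes>\<^sub>M lborel)"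
      by measurable
    then have "(\<lambda>z. ennreal (a * snd z powr (a - 1)) * indicator {0<..} (snd z) *
        indicator {z \<in> space (M \<Otimes>\<^sub>M lborel). snd z < u (fst z)} z) \<in> borel_measurable (M \<Otimes>\<^sub>M lborel)"
      by measurable
    then show ?thesis
      by (rule measurable_cong[THEN iffD1, rotated]) (auto simp: space_pair_measure indicator_def)
  qed
  have "(\<integral>\<^sup>+x. ennreal (u x powr a) \<partial>M) = (\<integral>\<^sup>+x. (\<integral>\<^sup>+t. ?g x t \<partial>lborel) \<partial>M)"
    by (intro nn_integral_cong) (simp add: inner)
  also have "\<dots> = (\<integral>\<^sup>+t. (\<integral>\<^sup>+x. ?g x t \<partial>M) \<partial>lborel)"
    by (rule P.Fubini'[OF m, symmetric])
  also have "\<dots> = (\<integral>\<^sup>+t. ennreal (a * t powr (a - 1)) * indicator {0<..} t * emeasure M {x \<in> space M. t < u x} \<partial>lborel)"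
    by (intro nn_integral_cong) (simp add: nn_integral_cmult)
  finally show ?thesis .
qed

text \<open>Phrased with bounds \<open>A\<close>, \<open>B\<close> in place of norms, so that
  weights can be part of \<open>f\<close> and \<open>g\<close>. Division by \<open>A\<close> and
  \<open>B\<close> reduces it to Young's inequality at each point; if a bound is \<open>0\<close>,
  one factor vanishes almost everywhere.\<close>

lemma nn_integral_holder_le:
  assumes [measurable]: "f \<in> borel_measurable M" "g \<in> borel_measurable M"
    and f0: "\<And>x. 0 \<le> f x" and g0: "\<And>x. 0 \<le> g x" and th: "0 < \<theta>" "\<theta> < 1"
    and A: "(\<integral>\<^sup>+x. ennreal (f x) \<partial>M) \<le> ennreal A" "0 \<le> A"
    and B: "(\<integral>\<^sup>+x. ennreal (g x) \<partial>M) \<le> ennreal B" "0 \<le> B"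
  shows "(\<integral>\<^sup>+x. ennreal (f x powr \<theta> * g x powr (1 - \<theta>)) \<partial>M) \<le> ennreal (A powr \<theta> * B powr (1 - \<theta>))"
proof (cases "A = 0 \<or> B = 0")
  case True
  then have "AE x in M. f x = 0 \<or> g x = 0"
  proof
    assume "A = 0"
    then have "(\<integral>\<^sup>+x. ennreal (f x) \<partial>M) = 0" using A by simp
    then have "AE x in M. ennreal (f x) = 0" by (subst (asm) nn_integral_0_iff_AE) auto
    then show ?thesis by eventually_elim (use f0 in \<open>auto simp: ennreal_eq_0_iff antisym\<close>)
  next
    assume "B = 0"
    then have "(\<integral>\<^sup>+x. ennreal (g x) \<partial>M) = 0" using B by simp
    then have "AE x in M. ennreal (g x) = 0" by (subst (asm) nn_integral_0_iff_AE) auto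
    then show ?thesis by eventually_elim (use g0 in \<open>auto simp: ennreal_eq_0_iff antisym\<close>)
  qed
  then have "AE x in M. ennreal (f x powr \<theta> * g x powr (1 - \<theta>)) = 0"
    by eventually_elim auto
  then have "(\<integral>\<^sup>+x. ennreal (f x powr \<theta> * g x powr (1 - \<theta>)) \<partial>M) = 0"
    by (subst nn_integral_0_iff_AE) auto
  then show ?thesis by simp
next
  case False
  with A B have AB: "0 < A" "0 < B" by auto
  let ?K = "A powr \<theta> * B powr (1 - \<theta>)"
  have pt: "f x powr \<theta> * g x powr (1 - \<theta>) \<le> ?K * \<theta> / A * f x + ?K * (1 - \<theta>) / B * g x" for x
  proof (cases "f x = 0 \<or> g x = 0")
    case True
    then show ?thesis using f0[of x] g0[of x] AB th by auto
  next
    case False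
    then have "f x > 0" "g x > 0" using f0[of x] g0[of x] by auto
    then have "(f x / A) powr \<theta> * (g x / B) powr (1 - \<theta>) \<le> \<theta> * (f x / A) + (1 - \<theta>) * (g x / B)"
      using AB th by (intro Youngs_inequality_0) auto
    then have "?K * ((f x / A) powr \<theta> * (g x / B) powr (1 - \<theta>)) \<le> ?K * (\<theta> * (f x / A) + (1 - \<theta>) * (g x / B))"
      by (intro mult_left_mono) auto
    then show ?thesis using AB \<open>f x > 0\<close> \<open>g x > 0\<close> by (simp add: powr_divide algebra_simps)
  qed
  have "(\<integral>\<^sup>+x. ennreal (f x powr \<theta> * g x powr (1 - \<theta>)) \<partial>M) \<le>
     (\<integral>\<^sup>+x. ennreal (?K * \<theta> / A) * ennreal (f x) + ennreal (?K * (1 - \<theta>) / B) * ennreal (g x) \<partial>M)"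
    using pt f0 g0 AB th
    by (intro nn_integral_mono) (simp flip: ennreal_mult ennreal_plus add: ennreal_leI)
  also have "\<dots> = ennreal (?K * \<theta> / A) * (\<integral>\<^sup>+x. ennreal (f x) \<partial>M) + ennreal (?K * (1 - \<theta>) / B) * (\<integral>\<^sup>+x. ennreal (g x) \<partial>M)"
    by (subst nn_integral_add) (auto simp: nn_integral_cmult)
  also have "\<dots> \<le> ennreal (?K * \<theta> / A) * ennreal A + ennreal (?K * (1 - \<theta>) / B) * ennreal B"
    using A B by (intro add_mono mult_left_mono) auto
  also have "\<dots> = ennreal ?K"
    using AB th by (simp flip: ennreal_mult ennreal_plus add: field_simps)
  finally show ?thesis .
qed

section \<open>Maximal operators\<close>

declare measure_completion [simp del]

lemma sets_lebesgue_ball [measurable]: "ball c r \<in> sets lebesgue"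
  by simp

lemma ball_avg_times_measure:
  fixes c :: "'a::euclidean_space"
  assumes "0 < r"
  shows "(\<integral>\<^sup>+x\<in>ball c r. h x \<partial>lebesgue) = ennreal (measure lebesgue (ball c r)) * ball_avg c r h"
proof -
  have "ennreal (measure lebesgue (ball c r)) * ennreal (1 / measure lebesgue (ball c r)) = 1"
    using measure_ball_pos[OF assms, of c] by (subst ennreal_mult[symmetric]) auto
  then show ?thesis unfolding ball_avg_def mult.assoc[symmetric] by simp
qed

lemma ball_avg_le_iff:
  fixes c :: "'a::euclidean_space"
  assumes "0 < r" "0 \<le> A"
  shows "ball_avg c r h \<le> ennreal A \<longleftrightarrow> (\<integral>\<^sup>+x\<in>ball c r. h x \<partial>lebesgue) \<le> ennreal (A * measure lebesgue (ball c r))"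
proof -
  let ?m = "measure lebesgue (ball c r)"
  have m: "0 < ?m" by (rule measure_ball_pos[OF assms(1)])
  have "ennreal (A * ?m) = ennreal ?m * ennreal A"
    using m assms by (subst ennreal_mult[symmetric]) (auto simp: mult.commute)
  then show ?thesis
    unfolding ball_avg_times_measure[OF assms(1)]
    using ennreal_mult_le_mult_iff[of "ennreal ?m"] m by simp
qed

lemma less_maximal_iff:
  "a < maximal h x \<longleftrightarrow> (\<exists>c r. 0 < r \<and> x \<in> ball c r \<and> a < ball_avg c r (\<lambda>y. ennreal \<bar>h y\<bar>))"
  unfolding maximal_def less_SUP_iff by auto

lemma ball_avg_le_maximal:
  "0 < r \<Longrightarrow> x \<in> ball c r \<Longrightarrow> ball_avg c r (\<lambda>y. ennreal \<bar>h y\<bar>) \<le> maximal h x"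
  unfolding maximal_def by (rule SUP_upper2[of "(c, r)"]) auto

lemma maximal_leI:
  "(\<And>c r. 0 < r \<Longrightarrow> x \<in> ball c r \<Longrightarrow> ball_avg c r (\<lambda>y. ennreal \<bar>h y\<bar>) \<le> C) \<Longrightarrow> maximal h x \<le> C"
  unfolding maximal_def by (rule SUP_least) auto

lemma nn_integral_ball_le_maximal:
  fixes c :: "'a::euclidean_space"
  assumes "0 < r" "x \<in> ball c r" "maximal h x \<le> ennreal A" "0 \<le> A"
  shows "(\<integral>\<^sup>+y\<in>ball c r. ennreal \<bar>h y\<bar> \<partial>lebesgue) \<le> ennreal (A * measure lebesgue (ball c r))"
  using order_trans[OF ball_avg_le_maximal[OF assms(1,2)] assms(3)] unfolding ball_avg_le_iff[OF assms(1,4)] .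

text \<open>The balls in \<open>maximal\<close> are uncentred: a ball witnessing a large average at
  one point witnesses it at all its points. Measurability of the maximal function follows for
  arbitrary \<open>h\<close>.\<close>

lemma open_maximal_superlevel: "open {x. a < maximal h x}"
proof -
  have "{x. a < maximal h x} = (\<Union>(c, r)\<in>{(c, r). 0 < r \<and> a < ball_avg c r (\<lambda>y. ennreal \<bar>h y\<bar>)}. ball c r)"
    unfolding less_maximal_iff by fast
  then show ?thesis by (auto intro!: open_UN)
qed

lemma borel_measurable_maximal [measurable]:
  fixes h :: "'a::euclidean_space \<Rightarrow> real"
  shows "maximal h \<in> borel_measurable lebesgue"
  by (rule borel_measurableI_greater) (simp add: open_maximal_superlevel lborelD)

lemma maximal_mono:
  assumes "\<And>x. \<bar>f x\<bar> \<le> \<bar>g x\<bar>"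
  shows "maximal f x \<le> maximal g x"
  unfolding maximal_def ball_avg_def
  by (intro SUP_mono' mult_left_mono nn_integral_mono mult_right_mono ennreal_leI assms) auto

lemma ball_subset_ball_dist:
  fixes c d :: "'a::euclidean_space"
  assumes "dist c d + r \<le> s"
  shows "ball c r \<subseteq> ball d s"
proof
  fix y assume "y \<in> ball c r"
  then have "dist c y < r" by simp
  moreover have "dist d y \<le> dist d c + dist c y" by (rule dist_triangle)
  ultimately show "y \<in> ball d s" using assms by (simp add: dist_commute)
qed

text \<open>Weak type (1,1). A ball with average above \<open>t\<close> has measure at most 1/t
  times the integral of |F| over it; the dilation factor \<open>5 ^ DIM('a)\<close> turns this into
  the input of \<open>vitali_measure_le\<close>.\<close>

lemma emeasure_maximal_gt_le:
  fixes F :: "'a::euclidean_space \<Rightarrow> real"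
  assumes [measurable]: "F \<in> borel_measurable lebesgue" and t: "0 < t"
  shows "emeasure lebesgue {x. ennreal t < maximal F x} \<le> ennreal (5 ^ DIM('a) / t) * (\<integral>\<^sup>+x. ennreal \<bar>F x\<bar> \<partial>lebesgue)"
proof -
  let ?B = "{(c, r). 0 < r \<and> ennreal t < ball_avg c r (\<lambda>y. ennreal \<bar>F y\<bar>)}"
  let ?\<nu> = "density lebesgue (\<lambda>x. ennreal (5 ^ DIM('a) / t) * ennreal \<bar>F x\<bar>)"
  have eq: "{x. ennreal t < maximal F x} = (\<Union>(c, r)\<in>?B. ball c r)"
    unfolding less_maximal_iff by fast
  have "emeasure lebesgue (\<Union>(c, r)\<in>?B. ball c r) \<le> emeasure ?\<nu> (\<Union>(c, r)\<in>?B. ball c r)"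
  proof (rule vitali_measure_le)
    fix c :: 'a and r assume "(c, r) \<in> ?B"
    then have r: "0 < r" and gt: "ennreal t < ball_avg c r (\<lambda>y. ennreal \<bar>F y\<bar>)" by auto
    let ?m = "measure lebesgue (ball c r)"
    have m: "0 < ?m" by (rule measure_ball_pos[OF r])
    have "measure lebesgue (ball c (5 * r)) = 5 ^ DIM('a) * ?m"
      by (rule measure_ball_scale) (use r in auto)
    then have "emeasure lebesgue (ball c (5 * r)) = ennreal (5 ^ DIM('a) / t) * (ennreal ?m * ennreal t)"
      using t m by (simp only: emeasure_ball_eq_measure) (simp flip: ennreal_mult)
    also have "\<dots> \<le> ennreal (5 ^ DIM('a) / t) * (ennreal ?m * ball_avg c r (\<lambda>y. ennreal \<bar>F y\<bar>))"
      using gt by (intro mult_left_mono) auto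
    also have "\<dots> = ennreal (5 ^ DIM('a) / t) * (\<integral>\<^sup>+x\<in>ball c r. ennreal \<bar>F x\<bar> \<partial>lebesgue)"
      by (subst ball_avg_times_measure[OF r]) simp
    also have "\<dots> = emeasure ?\<nu> (ball c r)"
      by (subst emeasure_density) (auto simp: mult.assoc nn_integral_cmult)
    finally show "0 < r \<and> emeasure lebesgue (ball c (5 * r)) \<le> emeasure ?\<nu> (ball c r)" using r by simp
  qed auto
  also have "\<dots> \<le> emeasure ?\<nu> (space ?\<nu>)" by (rule emeasure_space)
  also have "\<dots> = ennreal (5 ^ DIM('a) / t) * (\<integral>\<^sup>+x. ennreal \<bar>F x\<bar> \<partial>lebesgue)"
    by (subst emeasure_density) (auto simp: nn_integral_cmult)
  finally show ?thesis unfolding eq .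
qed

lemma AE_maximal_finite:
  fixes F :: "'a::euclidean_space \<Rightarrow> real"
  assumes [measurable]: "F \<in> borel_measurable lebesgue" and fin: "(\<integral>\<^sup>+x. ennreal \<bar>F x\<bar> \<partial>lebesgue) < top"
  shows "AE x in lebesgue. maximal F x < top"
proof -
  obtain A where A: "(\<integral>\<^sup>+x. ennreal \<bar>F x\<bar> \<partial>lebesgue) = ennreal A" "0 \<le> A"
    using fin by (cases "\<integral>\<^sup>+x. ennreal \<bar>F x\<bar> \<partial>lebesgue") auto
  let ?N = "{x. maximal F x = top}"
  have N: "?N \<in> sets lebesgue"
    using measurable_sets[OF borel_measurable_maximal, of "{top}" F] by (simp add: vimage_def)
  have "emeasure lebesgue ?N \<le> ennreal e" if "0 < e" for e
  proof -
    define t where "t = 5 ^ DIM('a) * (A + 1) / e"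
    have t: "0 < t" using A that by (simp add: t_def)
    have "emeasure lebesgue ?N \<le> emeasure lebesgue {x. ennreal t < maximal F x}"
      by (intro emeasure_mono) (auto simp: open_maximal_superlevel lborelD)
    also have "\<dots> \<le> ennreal (5 ^ DIM('a) / t) * ennreal A"
      using emeasure_maximal_gt_le[OF assms(1) t] A by simp
    also have "\<dots> = ennreal (5 ^ DIM('a) / t * A)" using A t by (simp flip: ennreal_mult)
    also have "\<dots> \<le> ennreal e"
    proof (rule ennreal_leI)
      have "5 ^ DIM('a) / t * A = e * (A / (A + 1))" using A that by (simp add: t_def)
      also have "\<dots> \<le> e" using A that by (intro mult_left_le) auto
      finally show "5 ^ DIM('a) / t * A \<le> e" .
    qed
    finally show ?thesis .
  qed
  then have "emeasure lebesgue ?N = 0"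
    by (metis ennreal_le_epsilon add_0 le_zero_eq zero_less_iff_neq_zero ennreal_zero_less_top)
  then have "AE x in lebesgue. x \<notin> ?N" by (intro AE_not_in) (auto simp: null_sets_def N)
  then show ?thesis by eventually_elim (auto simp: less_top)
qed

text \<open>Marcinkiewicz interpolation between the weak bound and boundedness. Doubling is asked
  only of the family \<open>B\<close>, and \<open>m\<close> is any function whose superlevel sets
  are covered by balls of \<open>B\<close> with large average. This admits weights known only inside
  a fixed ball as well as real-valued or cut-off versions of a maximal function.\<close>

lemma strong_maximal:
  fixes \<mu> :: "'a::euclidean_space measure"
  assumes sets: "sets \<mu> = sets lebesgue" and sf: "sigma_finite_measure \<mu>"
    and s: "1 < s" and D: "0 \<le> D"
    and f[measurable]: "f \<in> borel_measurable \<mu>" and f0: "\<And>x. 0 \<le> f x"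
    and m[measurable]: "m \<in> borel_measurable \<mu>" and m0: "\<And>x. 0 \<le> m x"
    and dbl: "\<And>c r. (c, r) \<in> B \<Longrightarrow> 0 < r \<and> emeasure \<mu> (ball c (5 * r)) \<le> ennreal D * emeasure \<mu> (ball c r)"
    and mB: "\<And>x t. 0 < t \<Longrightarrow> t < m x \<Longrightarrow> \<exists>c r. (c, r) \<in> B \<and> x \<in> ball c r \<and>
        ennreal t * emeasure \<mu> (ball c r) < (\<integral>\<^sup>+y\<in>ball c r. ennreal (f y) \<partial>\<mu>)"
  shows "(\<integral>\<^sup>+x. ennreal (m x powr s) \<partial>\<mu>) \<le> ennreal (D * s / (s - 1) * 2 powr s) * (\<integral>\<^sup>+x. ennreal (f x powr s) \<partial>\<mu>)"
proof -
  interpret sigma_finite_measure \<mu> by fact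
  have sp: "space \<mu> = UNIV" using sets_eq_imp_space_eq[OF sets] by simp
  have sb[measurable]: "ball c r \<in> sets \<mu>" for c r using sets by auto
  let ?\<eta> = "density \<mu> (\<lambda>x. ennreal (f x))"
  have sf\<eta>: "sigma_finite_measure ?\<eta>" by (subst sigma_finite_iff_density_finite) auto
  have weak: "emeasure \<mu> {x \<in> space \<mu>. t < m x} \<le> ennreal (2 * D / t) * emeasure ?\<eta> {x \<in> space ?\<eta>. t < 2 * f x}"
    if t: "0 < t" for t
  proof -
    \<comment> \<open>Only the part of \<open>f\<close> above \<open>t / 2\<close> is charged: the
      rest contributes at most half of an integral that exceeds \<open>t\<close> times the measure
      of the ball.\<close>
    let ?E = "{x \<in> space \<mu>. t < 2 * f x}"
    let ?\<nu> = "density \<mu> (\<lambda>x. ennreal (2 * D / t) * (ennreal (f x) * indicator ?E x))"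
    let ?Bt = "{(c, r). (c, r) \<in> B \<and> ennreal t * emeasure \<mu> (ball c r) < (\<integral>\<^sup>+y\<in>ball c r. ennreal (f y) \<partial>\<mu>)}"
    have E[measurable]: "?E \<in> sets \<mu>" by measurable
    have "emeasure \<mu> {x \<in> space \<mu>. t < m x} \<le> emeasure \<mu> (\<Union>(c, r)\<in>?Bt. ball c r)"
    proof (rule emeasure_mono)
      show "{x \<in> space \<mu>. t < m x} \<subseteq> (\<Union>(c, r)\<in>?Bt. ball c r)"
        using mB[OF t] by fast
      have "open (\<Union>(c, r)\<in>?Bt. ball c r)" by (auto intro!: open_UN)
      then show "(\<Union>(c, r)\<in>?Bt. ball c r) \<in> sets \<mu>" using sets by auto
    qed
    also have "\<dots> \<le> emeasure ?\<nu> (\<Union>(c, r)\<in>?Bt. ball c r)"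
    proof (rule vitali_measure_le)
      fix c r assume "(c, r) \<in> ?Bt"
      then have b: "(c, r) \<in> B" and lt: "ennreal t * emeasure \<mu> (ball c r) < (\<integral>\<^sup>+y\<in>ball c r. ennreal (f y) \<partial>\<mu>)"
        by auto
      let ?J = "\<integral>\<^sup>+y. ennreal (f y) * indicator ?E y * indicator (ball c r) y \<partial>\<mu>"
      have "emeasure \<mu> (ball c r) \<noteq> top"
        using lt t by (auto simp: ennreal_mult_top)
      then obtain z where z: "emeasure \<mu> (ball c r) = ennreal z" "0 \<le> z"
        by (cases "emeasure \<mu> (ball c r)") auto
      have "(\<integral>\<^sup>+y\<in>ball c r. ennreal (f y) \<partial>\<mu>) \<le>
          (\<integral>\<^sup>+y. ennreal (f y) * indicator ?E y * indicator (ball c r) y + ennreal (t / 2) * indicator (ball c r) y \<partial>\<mu>)"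
        using f0 by (intro nn_integral_mono) (auto simp: indicator_def sp intro!: ennreal_leI)
      also have "\<dots> = ?J + ennreal (t / 2) * emeasure \<mu> (ball c r)"
        by (subst nn_integral_add) (auto simp: nn_integral_cmult_indicator)
      finally have lt2: "ennreal (t * z) < ?J + ennreal (t / 2 * z)"
        using lt z t by (simp add: ennreal_mult flip: times_divide_eq_left)
      have "ennreal (t / 2 * z) \<le> ?J"
      proof (cases ?J)
        case (real j)
        then have "t * z < j + t / 2 * z" using lt2 z t by (simp flip: ennreal_plus add: ennreal_less_iff)
        then show ?thesis using real by (simp add: ennreal_leI)
      qed simp
      have "emeasure \<mu> (ball c (5 * r)) \<le> ennreal D * ennreal z" using dbl[OF b] z by simp
      also have "\<dots> = ennreal (2 * D / t) * ennreal (t / 2 * z)"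
        using D t z by (simp flip: ennreal_mult)
      also have "\<dots> \<le> ennreal (2 * D / t) * ?J"
        using \<open>ennreal (t / 2 * z) \<le> ?J\<close> by (intro mult_left_mono) auto
      also have "\<dots> = emeasure ?\<nu> (ball c r)"
        by (subst emeasure_density) (auto simp: mult.assoc nn_integral_cmult)
      finally show "0 < r \<and> emeasure \<mu> (ball c (5 * r)) \<le> emeasure ?\<nu> (ball c r)" using dbl[OF b] by simp
    qed (auto simp: sets)
    also have "\<dots> \<le> emeasure ?\<nu> (space ?\<nu>)" by (rule emeasure_space)
    also have "\<dots> = ennreal (2 * D / t) * emeasure ?\<eta> {x \<in> space ?\<eta>. t < 2 * f x}"
      by (subst (1 2) emeasure_density) (auto simp: nn_integral_cmult)
    finally show ?thesis .
  qed
  have "(\<integral>\<^sup>+x. ennreal (m x powr s) \<partial>\<mu>) =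
    (\<integral>\<^sup>+t. ennreal (s * t powr (s - 1)) * indicator {0<..} t * emeasure \<mu> {x \<in> space \<mu>. t < m x} \<partial>lborel)"
    using s by (intro layer_cake sf m m0) auto
  \<comment> \<open>The factor \<open>1 / t\<close> of the weak bound lowers the exponent by one:
    what appears is the layer cake of \<open>(2 * f x) powr (s - 1)\<close> for the measure
    \<open>f d\<mu>\<close>, and its integral is a multiple of that of
    \<open>f powr s\<close>.\<close>
  also have "\<dots> \<le> (\<integral>\<^sup>+t. ennreal (2 * D * s / (s - 1)) *
     (ennreal ((s - 1) * t powr (s - 1 - 1)) * indicator {0<..} t * emeasure ?\<eta> {x \<in> space ?\<eta>. t < 2 * f x}) \<partial>lborel)"
  proof (rule nn_integral_mono)
    fix t :: real
    show "ennreal (s * t powr (s - 1)) * indicator {0<..} t * emeasure \<mu> {x \<in> space \<mu>. t < m x} \<le>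
      ennreal (2 * D * s / (s - 1)) *
     (ennreal ((s - 1) * t powr (s - 1 - 1)) * indicator {0<..} t * emeasure ?\<eta> {x \<in> space ?\<eta>. t < 2 * f x})"
    proof (cases "0 < t")
      case True
      have e: "s * t powr (s - 1) * (2 * D / t) = 2 * D * s / (s - 1) * ((s - 1) * t powr (s - 1 - 1))"
        using True s by (simp add: powr_diff power2_eq_square)
      have "ennreal (s * t powr (s - 1)) * emeasure \<mu> {x \<in> space \<mu>. t < m x} \<le>
         ennreal (s * t powr (s - 1)) * (ennreal (2 * D / t) * emeasure ?\<eta> {x \<in> space ?\<eta>. t < 2 * f x})"
        by (intro mult_left_mono weak True) auto
      also have "\<dots> = ennreal (s * t powr (s - 1) * (2 * D / t)) * emeasure ?\<eta> {x \<in> space ?\<eta>. t < 2 * f x}"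
        using s D True by (subst ennreal_mult[of "s * t powr (s - 1)" "2 * D / t"]) (auto simp: mult.assoc)
      also have "\<dots> = ennreal (2 * D * s / (s - 1)) * (ennreal ((s - 1) * t powr (s - 1 - 1)) * emeasure ?\<eta> {x \<in> space ?\<eta>. t < 2 * f x})"
        unfolding e using s D True by (subst ennreal_mult) (auto simp: mult.assoc)
      finally show ?thesis using True by simp
    qed simp
  qed
  also have "\<dots> = ennreal (2 * D * s / (s - 1)) * (\<integral>\<^sup>+t.
     (ennreal ((s - 1) * t powr (s - 1 - 1)) * indicator {0<..} t * emeasure ?\<eta> {x \<in> space ?\<eta>. t < 2 * f x}) \<partial>lborel)"
  proof (rule nn_integral_cmult)
    interpret \<eta>: sigma_finite_measure ?\<eta> by (rule sf\<eta>)
    show "(\<lambda>t. ennreal ((s - 1) * t powr (s - 1 - 1)) * indicator {0<..} t * emeasure ?\<eta> {x \<in> space ?\<eta>. t < 2 * f x}) \<in> borel_measurable lborel"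
      by measurable
  qed
  also have "\<dots> = ennreal (2 * D * s / (s - 1)) * (\<integral>\<^sup>+x. ennreal ((2 * f x) powr (s - 1)) \<partial>?\<eta>)"
    using s f0 by (subst layer_cake[OF sf\<eta>, where u="\<lambda>x. 2 * f x"]) auto
  also have "(\<integral>\<^sup>+x. ennreal ((2 * f x) powr (s - 1)) \<partial>?\<eta>) = (\<integral>\<^sup>+x. ennreal (2 powr (s - 1)) * ennreal (f x powr s) \<partial>\<mu>)"
  proof (subst nn_integral_density, measurable, intro nn_integral_cong)
    fix x
    have "f x * (2 * f x) powr (s - 1) = 2 powr (s - 1) * f x powr s"
    proof (cases "f x = 0")
      case False
      then have "0 < f x" using f0[of x] by simp
      then show ?thesis using f0[of x] by (simp add: powr_mult powr_diff)
    qed simp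
    then show "ennreal (f x) * ennreal ((2 * f x) powr (s - 1)) = ennreal (2 powr (s - 1)) * ennreal (f x powr s)"
      using f0[of x] by (simp flip: ennreal_mult)
  qed
  also have "\<dots> = ennreal (2 powr (s - 1)) * (\<integral>\<^sup>+x. ennreal (f x powr s) \<partial>\<mu>)"
    by (rule nn_integral_cmult) measurable
  also have "ennreal (2 * D * s / (s - 1)) * (ennreal (2 powr (s - 1)) * (\<integral>\<^sup>+x. ennreal (f x powr s) \<partial>\<mu>)) =
     ennreal (2 * D * s / (s - 1) * 2 powr (s - 1)) * (\<integral>\<^sup>+x. ennreal (f x powr s) \<partial>\<mu>)"
    using s D by (subst ennreal_mult[of "2 * D * s / (s - 1)"]) (auto simp: mult.assoc)
  also have "2 * D * s / (s - 1) * 2 powr (s - 1) = D * s / (s - 1) * 2 powr s"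
    using s by (simp add: powr_diff field_simps)
  finally show ?thesis .
qed

section \<open>Null sets for families of balls, and differentiation on balls\<close>

lemma sigma_finite_lebesgue: "sigma_finite_measure (lebesgue :: 'a::euclidean_space measure)"
proof
  show "\<exists>A. countable A \<and> A \<subseteq> sets lebesgue \<and> \<Union>A = space (lebesgue :: 'a measure) \<and> (\<forall>a\<in>A. emeasure lebesgue a \<noteq> \<infinity>)"
  proof (intro exI conjI)
    let ?A = "range (\<lambda>n::nat. ball (0::'a) (real n))"
    show "countable ?A" "?A \<subseteq> sets lebesgue" by auto
    show "\<Union>?A = space (lebesgue :: 'a measure)" using reals_Archimedean2 by auto
    show "\<forall>a\<in>?A. emeasure lebesgue a \<noteq> \<infinity>" unfolding infinity_ennreal_def by (auto simp: emeasure_ball_eq_measure simp del: emeasure_completion)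
  qed
qed

lemma sigma_finite_density_real:
  fixes f :: "'a::euclidean_space \<Rightarrow> real"
  assumes "f \<in> borel_measurable lebesgue"
  shows "sigma_finite_measure (density lebesgue (\<lambda>x. ennreal (f x)))"
proof -
  interpret sigma_finite_measure "lebesgue :: 'a measure" by (rule sigma_finite_lebesgue)
  show ?thesis using assms by (subst sigma_finite_iff_density_finite) auto
qed

text \<open>The family is uncountable, so the null sets cannot simply be united. For each rational
  \<open>q\<close>, the balls with value above \<open>q\<close> have the same union as countably
  many of them by Lindelof; countably many null sets remain.\<close>

lemma AE_all_balls:
  fixes u :: "'a::euclidean_space \<Rightarrow> real"
  assumes "\<And>c r. (c, r) \<in> B \<Longrightarrow> AE x in lebesgue. x \<in> ball c r \<longrightarrow> a c r \<le> u x"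
  shows "AE x in lebesgue. \<forall>c r. (c, r) \<in> B \<and> x \<in> ball c r \<longrightarrow> a c r \<le> u x"
proof -
  have 1: "AE x in lebesgue. x \<in> (\<Union>z\<in>{z\<in>B. q < a (fst z) (snd z)}. ball (fst z) (snd z)) \<longrightarrow> q \<le> u x" for q
  proof -
    let ?B = "{z\<in>B. q < a (fst z) (snd z)}" and ?b = "\<lambda>z::'a \<times> real. ball (fst z) (snd z)"
    obtain F where F: "F \<subseteq> ?b ` ?B" "countable F" "\<Union>F = \<Union>(?b ` ?B)"
      by (rule Lindelof[of "?b ` ?B"]) (auto simp only: open_ball image_iff)
    from countable_subset_image[THEN iffD1, OF conjI, OF F(2) F(1)]
    obtain B' where B': "countable B'" "B' \<subseteq> ?B" "F = ?b ` B'" by (elim exE conjE) (rule that)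
    have "AE x in lebesgue. \<forall>z\<in>B'. x \<in> ?b z \<longrightarrow> a (fst z) (snd z) \<le> u x"
    proof (subst AE_ball_countable[OF B'(1)], rule ballI)
      fix z assume "z \<in> B'"
      then have "(fst z, snd z) \<in> B" using B'(2) by auto
      from assms[OF this] show "AE x in lebesgue. x \<in> ?b z \<longrightarrow> a (fst z) (snd z) \<le> u x" .
    qed
    then show ?thesis
    proof eventually_elim
      case (elim x)
      show ?case
      proof
        assume "x \<in> (\<Union>z\<in>?B. ?b z)"
        then have "x \<in> \<Union>F" by (simp only: F(3))
        then obtain z where z: "z \<in> B'" "x \<in> ?b z" unfolding B'(3) by (elim UnionE imageE) simp
        then have "a (fst z) (snd z) \<le> u x" using elim by blast
        moreover have "q < a (fst z) (snd z)" using z(1) B'(2) by auto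
        ultimately show "q \<le> u x" by simp
      qed
    qed
  qed
  have "AE x in lebesgue. \<forall>q\<in>\<rat>. x \<in> (\<Union>z\<in>{z\<in>B. q < a (fst z) (snd z)}. ball (fst z) (snd z)) \<longrightarrow> q \<le> u x"
    by (subst AE_ball_countable[OF countable_rat]) (intro ballI 1)
  then show ?thesis
  proof eventually_elim
    case (elim x)
    show ?case
    proof (intro allI impI)
      fix c r assume cr: "(c, r) \<in> B \<and> x \<in> ball c r"
      show "a c r \<le> u x"
      proof (rule ccontr)
        assume "\<not> a c r \<le> u x"
        then obtain q where q: "q \<in> \<rat>" "u x < q" "q < a c r" using Rats_dense_in_real[of "u x" "a c r"] by auto
        have "x \<in> (\<Union>z\<in>{z\<in>B. q < a (fst z) (snd z)}. ball (fst z) (snd z))"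
          using cr q by (intro UN_I[of "(c, r)"]) auto
        then show False using elim q by force
      qed
    qed
  qed
qed

text \<open>A lower bound up to a dimensional factor, deduced from differentiation along cubes with
  a corner at \<open>x\<close>: a small cube carries at least half of its volume times
  \<open>f x\<close>, and it lies in the ball with a fixed volume ratio.\<close>

lemma lebesgue_differentiation_lower:
  "\<exists>\<gamma>>0. \<forall>f::'a::euclidean_space \<Rightarrow> real. f \<in> borel_measurable lebesgue \<longrightarrow> (\<forall>x. 0 \<le> f x) \<longrightarrow>
     (\<forall>R. (\<integral>\<^sup>+x\<in>ball 0 R. ennreal (f x) \<partial>lebesgue) < top) \<longrightarrow>
     (AE x in lebesgue. \<exists>d>0. \<forall>r. 0 < r \<and> r < d \<longrightarrow>
        ennreal (\<gamma> * f x * measure lebesgue (ball x r)) \<le> (\<integral>\<^sup>+y\<in>ball x r. ennreal (f y) \<partial>lebesgue))"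
proof -
  let ?n = "DIM('a)"
  \<comment> \<open>Half the volume of a cube of side r / (2 n), divided by the volume of the ball
    of radius r; the half is the loss allowed in the limit.\<close>
  define \<gamma> where "\<gamma> = 1 / (2 * (2 * real ?n) ^ ?n * unit_ball_vol (real ?n))"
  have "AE x in lebesgue. \<exists>d>0. \<forall>r. 0 < r \<and> r < d \<longrightarrow>
        ennreal (\<gamma> * f x * measure lebesgue (ball x r)) \<le> (\<integral>\<^sup>+y\<in>ball x r. ennreal (f y) \<partial>lebesgue)"
    if fm[measurable]: "f \<in> borel_measurable lebesgue" and f0: "\<And>x. 0 \<le> f x"
      and fin: "\<And>R. (\<integral>\<^sup>+x\<in>ball 0 R. ennreal (f x) \<partial>lebesgue) < top" for f :: "'a \<Rightarrow> real"
  proof -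
    have int: "set_integrable lebesgue (cbox a b) f" for a b
    proof -
      obtain R where R: "cbox a b \<subseteq> ball 0 R"
        using bounded_subset_ballD[OF bounded_cbox, of a b 0] by auto
      have "(\<integral>\<^sup>+x. ennreal (norm (indicator (cbox a b) x *\<^sub>R f x)) \<partial>lebesgue) \<le> (\<integral>\<^sup>+x\<in>ball 0 R. ennreal (f x) \<partial>lebesgue)"
        using R f0 by (intro nn_integral_mono) (auto simp: indicator_def)
      also have "\<dots> < \<infinity>" using fin by simp
      finally have fi: "(\<integral>\<^sup>+x. ennreal (norm (indicator (cbox a b) x *\<^sub>R f x)) \<partial>lebesgue) < \<infinity>" .
      have [measurable]: "cbox a b \<in> sets lebesgue" by simp
      show ?thesis unfolding set_integrable_def by (intro integrableI_bounded fi) measurable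
    qed
    have io: "f integrable_on cbox a b" for a b by (rule set_lebesgue_integral_eq_integral(1)[OF int])
    have "\<exists>N. negligible N \<and> (\<forall>x e. x \<notin> N \<longrightarrow> 0 < e \<longrightarrow> (\<exists>d>0. \<forall>h. 0 < h \<and> h < d \<longrightarrow>
                         norm(integral (cbox x (x + h *\<^sub>R One)) f /\<^sub>R h ^ DIM('a) - f x) < e))"
      by (rule integrable_ccontinuous_explicit[OF io]) blast
    then obtain N where N: "negligible N"
      "\<And>x e. \<lbrakk>x \<notin> N; 0 < e\<rbrakk> \<Longrightarrow> \<exists>d>0. \<forall>h. 0 < h \<and> h < d \<longrightarrow>
                         norm(integral (cbox x (x + h *\<^sub>R One)) f /\<^sub>R h ^ DIM('a) - f x) < e"
      by auto
    have AEN: "AE x in lebesgue. x \<notin> N"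
      using N(1) by (intro AE_not_in) (simp add: negligible_iff_null_sets)
    have key: "\<exists>d>0. \<forall>r. 0 < r \<and> r < d \<longrightarrow>
        ennreal (\<gamma> * f x * measure lebesgue (ball x r)) \<le> (\<integral>\<^sup>+y\<in>ball x r. ennreal (f y) \<partial>lebesgue)" if xN: "x \<notin> N" for x
    proof (cases "f x = 0")
      case True
      then show ?thesis by (intro exI[of _ 1]) auto
    next
      case False
      then have fx: "0 < f x" using f0[of x] by simp
      then obtain d where d: "0 < d" "\<And>h. 0 < h \<Longrightarrow> h < d \<Longrightarrow>
          norm(integral (cbox x (x + h *\<^sub>R One)) f /\<^sub>R h ^ DIM('a) - f x) < f x / 2"
        using N(2)[OF xN, of "f x / 2"] by auto
      show ?thesis
      proof (intro exI[of _ d] conjI allI impI d(1))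
        fix r assume r: "0 < r \<and> r < d"
        \<comment> \<open>With this side the l1-diameter of the cube is r / 2, which keeps the cube
          inside \<open>ball x r\<close>.\<close>
        define h where "h = r / (2 * real ?n)"
        have n1: "1 \<le> real ?n" using DIM_positive[where 'a='a] by linarith
        have h: "0 < h" using r n1 by (simp add: h_def)
        have "1 < 2 * real ?n" using n1 by linarith
        then have hr: "h < r" using r by (simp add: h_def divide_less_eq)
        have "norm(integral (cbox x (x + h *\<^sub>R One)) f /\<^sub>R h ^ ?n - f x) < f x / 2"
          using d(2)[of h] h hr r by linarith
        then have "\<bar>integral (cbox x (x + h *\<^sub>R One)) f /\<^sub>R h ^ ?n - f x\<bar> < f x / 2" by simp
        then have "f x / 2 < integral (cbox x (x + h *\<^sub>R One)) f /\<^sub>R h ^ ?n" unfolding abs_less_iff by linarith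
        then have i: "f x / 2 * h ^ ?n < integral (cbox x (x + h *\<^sub>R One)) f"
          using h by (simp add: field_simps)
        have sub: "cbox x (x + h *\<^sub>R One) \<subseteq> ball x r"
        proof
          fix y assume y: "y \<in> cbox x (x + h *\<^sub>R One)"
          have "norm (y - x) \<le> (\<Sum>b\<in>Basis. \<bar>(y - x) \<bullet> b\<bar>)" by (rule norm_le_l1)
          also have "\<dots> \<le> (\<Sum>b\<in>(Basis::'a set). h)"
            using y by (intro sum_mono) (auto simp: mem_box inner_diff_left inner_left_distrib abs_le_iff algebra_simps)
          also have "\<dots> = real ?n * h" by simp
          also have "\<dots> < r" using r n1 by (simp add: h_def)
          finally show "y \<in> ball x r" by (simp add: dist_norm norm_minus_commute)
        qed
        have uv: "unit_ball_vol (real ?n) \<noteq> 0" using unit_ball_vol_pos[of "real ?n"] by linarith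
        have eq: "\<gamma> * f x * measure lebesgue (ball x r) = f x / 2 * h ^ ?n"
          unfolding measure_lebesgue_ball[OF less_imp_le[OF conjunct1[OF r]]]
          using n1 uv by (simp add: \<gamma>_def h_def power_divide power_mult_distrib)
        have "ennreal (\<gamma> * f x * measure lebesgue (ball x r)) \<le> ennreal (integral (cbox x (x + h *\<^sub>R One)) f)"
          unfolding eq using i by (intro ennreal_leI) simp
        also have "\<dots> = (\<integral>\<^sup>+y. ennreal (f y) * indicator (cbox x (x + h *\<^sub>R One)) y \<partial>lborel)"
          using f0 io by (intro nn_integral_has_integral_lebesgue'[symmetric] integrable_integral) auto
        also have "\<dots> = (\<integral>\<^sup>+y\<in>cbox x (x + h *\<^sub>R One). ennreal (f y) \<partial>lebesgue)"
          by (simp add: nn_integral_completion)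
        also have "\<dots> \<le> (\<integral>\<^sup>+y\<in>ball x r. ennreal (f y) \<partial>lebesgue)"
          using sub by (intro nn_integral_mono) (auto simp: indicator_def)
        finally show "ennreal (\<gamma> * f x * measure lebesgue (ball x r)) \<le> (\<integral>\<^sup>+y\<in>ball x r. ennreal (f y) \<partial>lebesgue)" .
      qed
    qed
    show ?thesis using AEN by eventually_elim (rule key)
  qed
  moreover have "0 < \<gamma>" by (simp add: \<gamma>_def)
  ultimately show ?thesis by blast
qed

section \<open>Powers of maximal functions as A_1 weights\<close>

text \<open>Kolmogorov's inequality. In the layer cake the superlevel sets inside \<open>E\<close>
  are bounded by \<open>m\<close> below the height \<open>L\<close> and by the weak type bound above
  it. Integrability at infinity of \<open>t powr (\<delta> - 2)\<close> is where
  \<open>\<delta> < 1\<close> enters.\<close>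

lemma kolmogorov_maximal:
  fixes F :: "'a::euclidean_space \<Rightarrow> real"
  assumes F[measurable]: "F \<in> borel_measurable lebesgue" and E[measurable]: "E \<in> sets lebesgue"
    and d: "0 < \<delta>" "\<delta> < 1" and L: "0 < L" and m: "0 \<le> m" "emeasure lebesgue E \<le> ennreal m"
    and I: "ennreal (5 ^ DIM('a)) * (\<integral>\<^sup>+x. ennreal \<bar>F x\<bar> \<partial>lebesgue) \<le> ennreal (L * m)"
  shows "(\<integral>\<^sup>+x\<in>E. ennreal (enn2real (maximal F x) powr \<delta>) \<partial>lebesgue) \<le> ennreal (m * L powr \<delta> / (1 - \<delta>))"
proof -
  define u where "u x = enn2real (maximal F x) * indicator E x" for x
  have [measurable]: "u \<in> borel_measurable lebesgue" unfolding u_def by measurable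
  have u0: "0 \<le> u x" for x by (simp add: u_def)
  have b1: "emeasure lebesgue {x \<in> space lebesgue. t < u x} \<le> ennreal m" if "0 < t" for t
    using that by (intro order_trans[OF emeasure_mono m(2)]) (auto simp: u_def indicator_def split: if_splits)
  have b2: "emeasure lebesgue {x \<in> space lebesgue. t < u x} \<le> ennreal (L * m / t)" if t: "0 < t" for t
  proof -
    have "t < u x \<Longrightarrow> ennreal t < maximal F x" for x
      using t by (cases "maximal F x"; cases "x \<in> E") (auto simp: u_def ennreal_less_iff)
    then have "emeasure lebesgue {x \<in> space lebesgue. t < u x} \<le> emeasure lebesgue {x. ennreal t < maximal F x}"
      by (intro emeasure_mono) (auto simp: open_maximal_superlevel lborelD)
    also have "\<dots> \<le> ennreal (5 ^ DIM('a) / t) * (\<integral>\<^sup>+x. ennreal \<bar>F x\<bar> \<partial>lebesgue)"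
      by (rule emeasure_maximal_gt_le[OF F t])
    also have "\<dots> = ennreal (1 / t) * (ennreal (5 ^ DIM('a)) * (\<integral>\<^sup>+x. ennreal \<bar>F x\<bar> \<partial>lebesgue))"
      using t by (simp flip: mult.assoc ennreal_mult)
    also have "\<dots> \<le> ennreal (1 / t) * ennreal (L * m)" using I by (intro mult_left_mono) auto
    also have "\<dots> = ennreal (L * m / t)" using t L m by (simp flip: ennreal_mult)
    finally show ?thesis .
  qed
  have i1: "((\<lambda>t. (\<delta> * m) * t powr (\<delta> - 1)) has_integral (\<delta> * m) * (L powr (\<delta> - 1 + 1) / (\<delta> - 1 + 1))) {0..L}"
    using d L by (intro has_integral_mult_right has_integral_powr_from_0) auto
  have i2: "((\<lambda>t. (\<delta> * L * m) * t powr (\<delta> - 2)) has_integral (\<delta> * L * m) * (- (L powr (\<delta> - 2 + 1)) / (\<delta> - 2 + 1))) {L..}"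
    using d L by (intro has_integral_mult_right has_integral_powr_to_inf) auto
  have "(\<integral>\<^sup>+x\<in>E. ennreal (enn2real (maximal F x) powr \<delta>) \<partial>lebesgue) = (\<integral>\<^sup>+x. ennreal (u x powr \<delta>) \<partial>lebesgue)"
    by (intro nn_integral_cong) (auto simp: u_def indicator_def)
  also have "\<dots> = (\<integral>\<^sup>+t. ennreal (\<delta> * t powr (\<delta> - 1)) * indicator {0<..} t * emeasure lebesgue {x \<in> space lebesgue. t < u x} \<partial>lborel)"
    by (rule layer_cake[OF sigma_finite_lebesgue _ u0 d(1)]) measurable
  also have "\<dots> \<le> (\<integral>\<^sup>+t. ennreal ((\<delta> * m) * t powr (\<delta> - 1)) * indicator {0..L} t + ennreal ((\<delta> * L * m) * t powr (\<delta> - 2)) * indicator {L..} t \<partial>lborel)"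
  proof (rule nn_integral_mono)
    fix t :: real
    let ?e = "emeasure lebesgue {x \<in> space lebesgue. t < u x}"
    show "ennreal (\<delta> * t powr (\<delta> - 1)) * indicator {0<..} t * ?e \<le>
      ennreal ((\<delta> * m) * t powr (\<delta> - 1)) * indicator {0..L} t + ennreal ((\<delta> * L * m) * t powr (\<delta> - 2)) * indicator {L..} t"
    proof (cases "0 < t")
      case True
      show ?thesis
      proof (cases "t < L")
        case lt: True
        have "ennreal (\<delta> * t powr (\<delta> - 1)) * ?e \<le> ennreal (\<delta> * t powr (\<delta> - 1)) * ennreal m"
          by (intro mult_left_mono b1 True) auto
        also have "\<dots> = ennreal ((\<delta> * m) * t powr (\<delta> - 1))"
          using d m by (simp flip: ennreal_mult add: mult_ac)
        finally show ?thesis using lt True by simp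
      next
        case False
        have "ennreal (\<delta> * t powr (\<delta> - 1)) * ?e \<le> ennreal (\<delta> * t powr (\<delta> - 1)) * ennreal (L * m / t)"
          by (intro mult_left_mono b2 True) auto
        also have "\<dots> = ennreal ((\<delta> * L * m) * t powr (\<delta> - 2))"
          using d m L True by (simp flip: ennreal_mult add: mult_ac powr_diff power2_eq_square)
        finally show ?thesis using False True by (auto intro: order_trans)
      qed
    qed simp
  qed
  also have "\<dots> = ennreal ((\<delta> * m) * (L powr (\<delta> - 1 + 1) / (\<delta> - 1 + 1))) + ennreal ((\<delta> * L * m) * (- (L powr (\<delta> - 2 + 1)) / (\<delta> - 2 + 1)))"
    using d m L i1 i2 nn_integral_has_integral_lebesgue'[OF _ i1] nn_integral_has_integral_lebesgue'[OF _ i2]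
    by (subst nn_integral_add) auto
  also have "\<dots> = ennreal (m * L powr \<delta> + (\<delta> * L * m) * (L powr (\<delta> - 1) / (1 - \<delta>)))"
  proof -
    have a: "(\<delta> * m) * (L powr (\<delta> - 1 + 1) / (\<delta> - 1 + 1)) = m * L powr \<delta>" using d by simp
    have e: "\<delta> - 2 + 1 = \<delta> - 1" by simp
    have b: "(\<delta> * L * m) * (- (L powr (\<delta> - 2 + 1)) / (\<delta> - 2 + 1)) = (\<delta> * L * m) * (L powr (\<delta> - 1) / (1 - \<delta>))"
      unfolding e using d by (simp add: field_simps)
    show ?thesis unfolding a b using d m L by (simp flip: ennreal_plus)
  qed
  also have "m * L powr \<delta> + (\<delta> * L * m) * (L powr (\<delta> - 1) / (1 - \<delta>)) = m * L powr \<delta> / (1 - \<delta>)"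
    using d L by (simp add: powr_diff field_simps)
  finally show ?thesis .
qed

text \<open>The A_1 property of (M F)^\<delta>, tested at one point \<open>x\<close>. A ball of
  radius above \<open>r\<close> through a point of \<open>ball c r\<close> triples to a ball
  containing \<open>x\<close>, so its average is at most \<open>3 ^ DIM('a) * A\<close>. Smaller
  balls see only \<open>G\<close>, the restriction to the tripled ball, and Kolmogorov's inequality
  applies with height 5^n 3^n A = 15^n A.\<close>

lemma nn_integral_powr_maximal_ball_le:
  fixes F :: "'a::euclidean_space \<Rightarrow> real"
  assumes F[measurable]: "F \<in> borel_measurable lebesgue" and d: "0 < \<delta>" "\<delta> < 1"
    and r: "0 < r" and x: "x \<in> ball c r" and A: "maximal F x \<le> ennreal A" "0 \<le> A"
  shows "(\<integral>\<^sup>+y\<in>ball c r. ennreal (enn2real (maximal F y) powr \<delta>) \<partial>lebesgue) \<le>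
    ennreal (((15 ^ DIM('a)) powr \<delta> / (1 - \<delta>) + (3 ^ DIM('a)) powr \<delta>) * A powr \<delta> * measure lebesgue (ball c r))"
proof -
  let ?n = "DIM('a)" and ?m = "measure lebesgue (ball c r)"
  define G where "G y = F y * indicator (ball c (3 * r)) y" for y
  have G[measurable]: "G \<in> borel_measurable lebesgue" unfolding G_def by measurable
  have m: "0 < ?m" by (rule measure_ball_pos[OF r])
  have m3: "measure lebesgue (ball c (3 * r)) = 3 ^ ?n * ?m" by (rule measure_ball_scale) (use r in auto)
  have x3: "x \<in> ball c (3 * r)" using x r by auto
  have IG: "(\<integral>\<^sup>+y. ennreal \<bar>G y\<bar> \<partial>lebesgue) \<le> ennreal (A * (3 ^ ?n * ?m))"
  proof -
    have "(\<integral>\<^sup>+y. ennreal \<bar>G y\<bar> \<partial>lebesgue) = (\<integral>\<^sup>+y\<in>ball c (3 * r). ennreal \<bar>F y\<bar> \<partial>lebesgue)"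
      by (intro nn_integral_cong) (auto simp: G_def indicator_def)
    also have "\<dots> \<le> ennreal (A * measure lebesgue (ball c (3 * r)))"
      using r by (intro nn_integral_ball_le_maximal[OF _ x3 A]) auto
    finally show ?thesis unfolding m3 .
  qed
  have pt: "maximal F y \<le> max (maximal G y) (ennreal (3 ^ ?n * A))" if y: "y \<in> ball c r" for y
  proof (rule maximal_leI)
    fix c' \<rho> assume \<rho>: "0 < \<rho>" and yb: "y \<in> ball c' \<rho>"
    show "ball_avg c' \<rho> (\<lambda>y. ennreal \<bar>F y\<bar>) \<le> max (maximal G y) (ennreal (3 ^ ?n * A))"
    proof (cases "\<rho> \<le> r")
      case True
      have sub: "z \<in> ball c (3 * r)" if "z \<in> ball c' \<rho>" for z
      proof -
        have "dist c z \<le> dist c y + dist y c' + dist c' z"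
          using dist_triangle[of c z y] dist_triangle[of y z c'] by linarith
        then show ?thesis using that y yb True by (simp add: dist_commute)
      qed
      have "(\<integral>\<^sup>+y\<in>ball c' \<rho>. ennreal \<bar>F y\<bar> \<partial>lebesgue) = (\<integral>\<^sup>+y\<in>ball c' \<rho>. ennreal \<bar>G y\<bar> \<partial>lebesgue)"
      proof (rule nn_integral_cong)
        fix z
        show "ennreal \<bar>F z\<bar> * indicator (ball c' \<rho>) z = ennreal \<bar>G z\<bar> * indicator (ball c' \<rho>) z"
          using sub[of z] by (cases "z \<in> ball c' \<rho>") (simp_all add: G_def)
      qed
      then have "ball_avg c' \<rho> (\<lambda>y. ennreal \<bar>F y\<bar>) = ball_avg c' \<rho> (\<lambda>y. ennreal \<bar>G y\<bar>)"
        unfolding ball_avg_def by (rule arg_cong)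
      also have "\<dots> \<le> maximal G y" by (rule ball_avg_le_maximal[OF \<rho> yb])
      finally show ?thesis by (simp add: le_max_iff_disj)
    next
      case False
      have x': "x \<in> ball c' (3 * \<rho>)"
      proof -
        have "dist c' x \<le> dist c' y + dist y c + dist c x"
          using dist_triangle[of c' x y] dist_triangle[of y x c] by linarith
        then show ?thesis using x y yb False by (simp add: dist_commute)
      qed
      have "(\<integral>\<^sup>+y\<in>ball c' \<rho>. ennreal \<bar>F y\<bar> \<partial>lebesgue) \<le> (\<integral>\<^sup>+y\<in>ball c' (3 * \<rho>). ennreal \<bar>F y\<bar> \<partial>lebesgue)"
        using \<rho> by (intro nn_integral_mono) (auto simp: indicator_def)
      also have "\<dots> \<le> ennreal (A * measure lebesgue (ball c' (3 * \<rho>)))"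
        using \<rho> by (intro nn_integral_ball_le_maximal[OF _ x' A]) auto
      also have "A * measure lebesgue (ball c' (3 * \<rho>)) = 3 ^ ?n * A * measure lebesgue (ball c' \<rho>)"
        using measure_ball_scale[of 3 \<rho> c' c'] \<rho> by simp
      finally have "ball_avg c' \<rho> (\<lambda>y. ennreal \<bar>F y\<bar>) \<le> ennreal (3 ^ ?n * A)"
        using ball_avg_le_iff[OF \<rho>, of "3 ^ ?n * A" c'] A by simp
      then show ?thesis by (simp add: le_max_iff_disj)
    qed
  qed
  \<comment> \<open>The height in Kolmogorov's inequality must be positive. If \<open>A = 0\<close>,
    then \<open>G\<close> vanishes almost everywhere and so does the left-hand side.\<close>
  show ?thesis
  proof (cases "A = 0")
    case True
    have "maximal G y = 0" for y
    proof -
      have "(\<integral>\<^sup>+y. ennreal \<bar>G y\<bar> \<partial>lebesgue) = 0" using IG True by simp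
      then have z: "AE y in lebesgue. ennreal \<bar>G y\<bar> = 0" by (subst (asm) nn_integral_0_iff_AE) auto
      have "ball_avg c' \<rho> (\<lambda>y. ennreal \<bar>G y\<bar>) \<le> 0" for c' \<rho>
      proof -
        have "AE y in lebesgue. ennreal \<bar>G y\<bar> * indicator (ball c' \<rho>) y = 0" using z by eventually_elim simp
        then have "(\<integral>\<^sup>+y\<in>ball c' \<rho>. ennreal \<bar>G y\<bar> \<partial>lebesgue) = 0" by (subst nn_integral_0_iff_AE) auto
        then show ?thesis unfolding ball_avg_def by simp
      qed
      then show ?thesis using maximal_leI[of y G 0] by simp
    qed
    then have "maximal F y = 0" if "y \<in> ball c r" for y using pt[OF that] True by simp
    then have "(\<integral>\<^sup>+y\<in>ball c r. ennreal (enn2real (maximal F y) powr \<delta>) \<partial>lebesgue) = (\<integral>\<^sup>+y. 0 \<partial>(lebesgue :: 'a measure))"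
      by (intro nn_integral_cong) (auto simp: indicator_def)
    then show ?thesis by simp
  next
    case False
    then have A0: "0 < A" using A by simp
    have v: "enn2real (maximal F y) powr \<delta> \<le> enn2real (maximal G y) powr \<delta> + (3 ^ ?n * A) powr \<delta>"
      if y: "y \<in> ball c r" for y
    \<comment> \<open>\<open>enn2real\<close> sends \<open>top\<close> to \<open>0\<close>, so
      points of infinite maximal function satisfy the bound trivially.\<close>
    proof (cases "maximal F y = top")
      case False
      then obtain a where a: "maximal F y = ennreal a" "0 \<le> a" by (cases "maximal F y") auto
      have "maximal G y \<le> maximal F y" by (rule maximal_mono) (auto simp: G_def indicator_def)
      then obtain b where b: "maximal G y = ennreal b" "0 \<le> b" using a by (cases "maximal G y") (auto simp: top_unique)
      have "ennreal a \<le> ennreal (max b (3 ^ ?n * A))" using pt[OF y] a b A by (auto simp: max_def split: if_splits)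
      then have "a \<le> max b (3 ^ ?n * A)" using a b by (subst (asm) ennreal_le_iff) auto
      then have "a powr \<delta> \<le> (max b (3 ^ ?n * A)) powr \<delta>" using a d by (intro powr_mono2) auto
      also have "\<dots> \<le> b powr \<delta> + (3 ^ ?n * A) powr \<delta>" by (auto simp: max_def)
      finally show ?thesis using a b by simp
    qed simp
    have "(\<integral>\<^sup>+y\<in>ball c r. ennreal (enn2real (maximal F y) powr \<delta>) \<partial>lebesgue) \<le>
      (\<integral>\<^sup>+y. ennreal (enn2real (maximal G y) powr \<delta>) * indicator (ball c r) y + ennreal ((3 ^ ?n * A) powr \<delta>) * indicator (ball c r) y \<partial>lebesgue)"
      using v by (intro nn_integral_mono) (auto simp: indicator_def simp flip: ennreal_plus intro!: ennreal_leI)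
    also have "\<dots> = (\<integral>\<^sup>+y\<in>ball c r. ennreal (enn2real (maximal G y) powr \<delta>) \<partial>lebesgue) + ennreal ((3 ^ ?n * A) powr \<delta>) * emeasure lebesgue (ball c r)"
      by (subst nn_integral_add) (auto simp: nn_integral_cmult_indicator simp del: emeasure_completion)
    also have "\<dots> \<le> ennreal (?m * (15 ^ ?n * A) powr \<delta> / (1 - \<delta>)) + ennreal ((3 ^ ?n * A) powr \<delta> * ?m)"
    proof (intro add_mono kolmogorov_maximal G d)
      have "ennreal (5 ^ ?n) * (\<integral>\<^sup>+x. ennreal \<bar>G x\<bar> \<partial>lebesgue) \<le> ennreal (5 ^ ?n) * ennreal (A * (3 ^ ?n * ?m))"
        using IG by (intro mult_left_mono) auto
      also have "\<dots> = ennreal (15 ^ ?n * A * ?m)"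
        using A0 m power_mult_distrib[of "5::real" 3 ?n] by (simp flip: ennreal_mult)
      finally show "ennreal (5 ^ ?n) * (\<integral>\<^sup>+x. ennreal \<bar>G x\<bar> \<partial>lebesgue) \<le> ennreal (15 ^ ?n * A * ?m)" .
      show "ennreal ((3 ^ ?n * A) powr \<delta>) * emeasure lebesgue (ball c r) \<le> ennreal ((3 ^ ?n * A) powr \<delta> * ?m)"
        unfolding emeasure_ball_eq_measure using m by (simp flip: ennreal_mult)
    qed (use A0 m emeasure_ball_eq_measure[of c r] in \<open>auto simp del: emeasure_completion\<close>)
    also have "\<dots> = ennreal (((15 ^ ?n) powr \<delta> / (1 - \<delta>) + (3 ^ ?n) powr \<delta>) * A powr \<delta> * ?m)"
    proof -
      have "?m * (15 ^ ?n * A) powr \<delta> / (1 - \<delta>) + (3 ^ ?n * A) powr \<delta> * ?m = ((15 ^ ?n) powr \<delta> / (1 - \<delta>) + (3 ^ ?n) powr \<delta>) * A powr \<delta> * ?m"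
        using A0 by (simp add: powr_mult algebra_simps add_divide_distrib)
      then show ?thesis using m d by (simp flip: ennreal_plus)
    qed
    finally show ?thesis .
  qed
qed

lemma weightI:
  assumes [measurable]: "w \<in> borel_measurable lebesgue" and w0: "\<And>x. 0 \<le> w x"
    and fin: "\<And>R. 0 < R \<Longrightarrow> (\<integral>\<^sup>+x\<in>ball 0 R. ennreal (w x) \<partial>lebesgue) < top"
  shows "weight w"
  unfolding weight_def
proof (intro conjI allI impI)
  fix S :: "'a set" assume S: "compact S"
  obtain R where R: "0 < R" "S \<subseteq> ball 0 R" using bounded_subset_ballD[OF compact_imp_bounded[OF S], of 0] by auto
  have "(\<integral>\<^sup>+y. ennreal (norm (indicator S y *\<^sub>R w y)) \<partial>lebesgue) \<le> (\<integral>\<^sup>+y\<in>ball 0 R. ennreal (w y) \<partial>lebesgue)"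
    using R w0 by (intro nn_integral_mono) (auto simp: indicator_def)
  also have "\<dots> < \<infinity>" using fin[OF R(1)] by simp
  finally have fi: "(\<integral>\<^sup>+y. ennreal (norm (indicator S y *\<^sub>R w y)) \<partial>lebesgue) < \<infinity>" .
  have [measurable]: "S \<in> sets lebesgue" using compact_imp_closed[OF S] by simp
  show "set_integrable lebesgue S w" unfolding set_integrable_def by (intro integrableI_bounded fi) measurable
qed (use assms in auto)

definition A1_bound :: "real \<Rightarrow> ('a::euclidean_space \<Rightarrow> real) \<Rightarrow> bool" where
  "A1_bound K v \<longleftrightarrow> weight v \<and> (AE x in lebesgue. maximal v x \<le> ennreal (K * v x))"

text \<open>\<open>K\<close> depends on \<open>\<delta>\<close> and the dimension alone. This
  uniformity allows one constant of the extrapolation hypothesis to serve for the weights built from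
  all functions \<open>F\<close>.\<close>

lemma coifman_rochberg:
  assumes d: "0 < \<delta>" "\<delta> < 1"
  shows "\<exists>K\<ge>0. \<forall>F::'a::euclidean_space \<Rightarrow> real. F \<in> borel_measurable lebesgue \<longrightarrow>
    (AE x in lebesgue. maximal F x < top) \<longrightarrow> A1_bound K (\<lambda>x. enn2real (maximal F x) powr \<delta>)"
proof -
  define K where "K = (15 ^ DIM('a)) powr \<delta> / (1 - \<delta>) + (3 ^ DIM('a)) powr \<delta>"
  have K0: "0 \<le> K" using d by (simp add: K_def)
  have "A1_bound K (\<lambda>x. enn2real (maximal F x) powr \<delta>)"
    if F[measurable]: "F \<in> borel_measurable lebesgue" and fin: "AE x in lebesgue. maximal F x < top" for F :: "'a \<Rightarrow> real"
  proof -
    let ?v = "\<lambda>x. enn2real (maximal F x) powr \<delta>"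
    have [measurable]: "?v \<in> borel_measurable lebesgue" by measurable
    have est: "(\<integral>\<^sup>+y\<in>ball c r. ennreal (?v y) \<partial>lebesgue) \<le> ennreal (K * ?v x * measure lebesgue (ball c r))"
      if "0 < r" "x \<in> ball c r" "maximal F x < top" for c r x
      unfolding K_def using that by (intro nn_integral_powr_maximal_ball_le F d) auto
    have "weight ?v"
    proof (rule weightI)
      fix R :: real assume R: "0 < R"
      \<comment> \<open>One point of the ball with finite maximal function is enough for local
        integrability, by the estimate \<open>est\<close> at that point.\<close>
      have "\<exists>x\<in>ball 0 R. maximal F x < top"
      proof (rule ccontr)
        assume n: "\<not> ?thesis"
        have "AE x in lebesgue. x \<notin> ball (0::'a) R" using fin by eventually_elim (use n in blast)
        then have "emeasure lebesgue (ball (0::'a) R) = 0"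
          by (subst (asm) AE_iff_null_sets[symmetric]) (auto simp: null_sets_def simp del: emeasure_completion)
        then show False using measure_ball_pos[OF R, of "0::'a"] by (simp add: emeasure_ball_eq_measure del: emeasure_completion)
      qed
      then obtain x where x: "x \<in> ball 0 R" "maximal F x < top" by auto
      show "(\<integral>\<^sup>+y\<in>ball 0 R. ennreal (?v y) \<partial>lebesgue) < top" using est[OF R x] by (simp add: le_less_trans)
    qed auto
    moreover have "AE x in lebesgue. maximal ?v x \<le> ennreal (K * ?v x)"
      using fin
    proof eventually_elim
      case (elim x)
      show ?case
      proof (rule maximal_leI)
        fix c r assume "0 < r" "x \<in> ball c r"
        then show "ball_avg c r (\<lambda>y. ennreal \<bar>?v y\<bar>) \<le> ennreal (K * ?v x)"
          using ball_avg_le_iff[of r "K * ?v x" c] est[of r x c] elim K0 by simp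
      qed
    qed
    ultimately show ?thesis unfolding A1_bound_def by simp
  qed
  then show ?thesis using K0 by blast
qed

section \<open>Reverse Hoelder inequality\<close>

text \<open>A stopping-time argument in the radius; \<open>\<rho>\<close> is the distance from
  \<open>x\<close> to the boundary of the doubled ball. At radius \<open>\<rho> / 12\<close> the
  average of \<tau> is at most \<open>\<theta>\<close> because \<open>t\<close> is large, and at
  tiny radii it exceeds \<open>\<theta>\<close> by differentiation. Two consecutive radii therefore
  lie on opposite sides of the level.\<close>

lemma gehring_stopping_ball:
  fixes \<tau> :: "'a::euclidean_space \<Rightarrow> real" and c x :: 'a
  assumes R: "0 < R" and t0: "\<And>y. 0 \<le> \<tau> y"
    and I0: "0 \<le> I" and I: "(\<integral>\<^sup>+y\<in>ball c (2 * R). ennreal (\<tau> y) \<partial>lebesgue) \<le> ennreal I"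
    and g: "0 < \<gamma>"
    and x: "x \<in> ball c (2 * R)" and t: "t < \<tau> x * (2 * R - dist c x) ^ DIM('a)" "0 < t"
    and tI: "12 ^ DIM('a) * I / (\<gamma> * unit_ball_vol (DIM('a))) \<le> t"
    and ld: "\<exists>d>0. \<forall>r. 0 < r \<and> r < d \<longrightarrow>
      ennreal (\<gamma> * \<tau> x * measure lebesgue (ball x r)) \<le> (\<integral>\<^sup>+y\<in>ball x r. ennreal (\<tau> y) \<partial>lebesgue)"
  defines "\<rho> \<equiv> 2 * R - dist c x"
  defines "\<theta> \<equiv> \<gamma> * t / \<rho> ^ DIM('a)"
  obtains r where "0 < r" "5 * r \<le> \<rho> / 12"
    "ennreal (\<theta> * measure lebesgue (ball x r)) \<le> (\<integral>\<^sup>+y\<in>ball x r. ennreal (\<tau> y) \<partial>lebesgue)"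
    "(\<integral>\<^sup>+y\<in>ball x (5 * r). ennreal (\<tau> y) \<partial>lebesgue) \<le> ennreal (\<theta> * measure lebesgue (ball x (5 * r)))"
proof -
  let ?n = "DIM('a)"
  \<comment> \<open>The ratio \<open>1 / 5\<close> makes each radius the five-fold of its successor,
    as the covering lemma requires.\<close>
  define rk where "rk k = \<rho> / 12 * (1 / 5) ^ k" for k :: nat
  define P where "P k \<longleftrightarrow> ennreal (\<theta> * measure lebesgue (ball x (rk k))) < (\<integral>\<^sup>+y\<in>ball x (rk k). ennreal (\<tau> y) \<partial>lebesgue)" for k
  have \<rho>: "0 < \<rho>" using x by (simp add: \<rho>_def)
  have rk: "0 < rk k" for k using \<rho> by (simp add: rk_def)
  have \<theta>: "0 < \<theta>" using g t \<rho> by (simp add: \<theta>_def)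
  have \<theta>2: "\<theta> < \<gamma> * \<tau> x" using g t \<rho> by (simp add: \<theta>_def \<rho>_def[symmetric] divide_less_eq)
  have "\<exists>k. P k"
  proof -
    obtain d where d: "0 < d" "\<And>r. 0 < r \<Longrightarrow> r < d \<Longrightarrow>
      ennreal (\<gamma> * \<tau> x * measure lebesgue (ball x r)) \<le> (\<integral>\<^sup>+y\<in>ball x r. ennreal (\<tau> y) \<partial>lebesgue)"
      using ld by auto
    obtain k where k: "(1 / 5 :: real) ^ k < d / (\<rho> / 12)"
      using real_arch_pow_inv[of "d / (\<rho> / 12)" "1 / 5"] d \<rho> by auto
    then have "rk k < d" using \<rho> by (simp add: rk_def field_simps)
    then have "ennreal (\<gamma> * \<tau> x * measure lebesgue (ball x (rk k))) \<le> (\<integral>\<^sup>+y\<in>ball x (rk k). ennreal (\<tau> y) \<partial>lebesgue)"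
      by (rule d(2)[OF rk])
    moreover have "ennreal (\<theta> * measure lebesgue (ball x (rk k))) < ennreal (\<gamma> * \<tau> x * measure lebesgue (ball x (rk k)))"
      using \<theta> \<theta>2 measure_ball_pos[OF rk, of x k] by (intro ennreal_lessI) (auto intro!: mult_pos_pos mult_strict_right_mono)
    ultimately show ?thesis unfolding P_def by (meson less_le_trans)
  qed
  \<comment> \<open>The starting radius \<open>\<rho> / 12\<close> is the source of
    \<open>12 ^ DIM('a)\<close> in the lower bound \<open>tI\<close> for \<open>t\<close>.\<close>
  moreover have "\<not> P 0"
  proof -
    have "(\<integral>\<^sup>+y\<in>ball x (rk 0). ennreal (\<tau> y) \<partial>lebesgue) \<le> (\<integral>\<^sup>+y\<in>ball c (2 * R). ennreal (\<tau> y) \<partial>lebesgue)"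
    proof (rule nn_set_integral_set_mono)
      show "ball x (rk 0) \<subseteq> ball c (2 * R)"
        using \<rho> by (intro ball_subset_ball_dist) (simp add: rk_def \<rho>_def dist_commute field_simps)
    qed
    also have "\<dots> \<le> ennreal I" by (rule I)
    also have "\<dots> \<le> ennreal (\<theta> * measure lebesgue (ball x (rk 0)))"
    proof (rule ennreal_leI)
      have "0 \<le> rk 0" using rk[of 0] by simp
      then have e: "\<theta> * measure lebesgue (ball x (rk 0)) = \<gamma> * unit_ball_vol (real ?n) * t / 12 ^ ?n"
        using \<rho> by (subst measure_lebesgue_ball) (auto simp: \<theta>_def rk_def power_divide)
      show "I \<le> \<theta> * measure lebesgue (ball x (rk 0))" unfolding e using tI g by (simp add: field_simps)
    qed
    finally show ?thesis by (simp add: P_def)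
  qed
  ultimately obtain k where k: "\<not> P k" "P (Suc k)"
    using ex_least_nat_less[of P] by (metis lessI less_Suc_eq_le le_refl)
  show ?thesis
  proof (rule that[of "rk (Suc k)"])
    show "0 < rk (Suc k)" by (rule rk)
    have e: "5 * rk (Suc k) = rk k" by (simp add: rk_def)
    have "(1 / 5 :: real) ^ k \<le> 1" by (rule power_le_one) auto
    then show "5 * rk (Suc k) \<le> \<rho> / 12" unfolding e using \<rho> by (simp add: rk_def field_simps)
    show "ennreal (\<theta> * measure lebesgue (ball x (rk (Suc k)))) \<le> (\<integral>\<^sup>+y\<in>ball x (rk (Suc k)). ennreal (\<tau> y) \<partial>lebesgue)"
      using k(2) by (simp add: P_def)
    show "(\<integral>\<^sup>+y\<in>ball x (5 * rk (Suc k)). ennreal (\<tau> y) \<partial>lebesgue) \<le> ennreal (\<theta> * measure lebesgue (ball x (5 * rk (Suc k))))"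
      unfolding e using k(1) by (simp add: P_def not_less)
  qed
qed

text \<open>A quantitative A_\<infinity> condition. It is the form in which a weight enters the
  reverse Hoelder inequality, shared by the dual weights of local A_p pairs and by A_1 weights.
  Quantifying over all \<open>T\<close> below the average also covers infinite averages.\<close>

definition level_condition :: "real \<Rightarrow> 'a::euclidean_space set \<Rightarrow> ('a \<Rightarrow> real) \<Rightarrow> bool" where
  "level_condition \<beta> S \<tau> \<longleftrightarrow> (\<forall>c r T. 0 < r \<and> ball c r \<subseteq> S \<and> 0 \<le> T \<and>
     ennreal (T * measure lebesgue (ball c r)) \<le> (\<integral>\<^sup>+y\<in>ball c r. ennreal (\<tau> y) \<partial>lebesgue) \<longrightarrow>
     emeasure lebesgue (ball c r) \<le> 2 * emeasure lebesgue {y\<in>ball c r. \<beta> * T \<le> \<tau> y})"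

lemma half_less_self: "0 < x \<Longrightarrow> x / 2 < (x::real)"
  by simp

text \<open>The factor (distance to the boundary of \<open>ball c (2 * R)\<close>)^n in
  \<open>W\<close> closes the estimate on itself: the distance varies by a bounded factor on each
  stopping ball, so the same \<open>W\<close> stands on both sides and no larger ball appears. That
  makes the later absorption possible.\<close>

lemma gehring_weak:
  assumes \<beta>: "0 < \<beta>"
  shows "\<exists>\<gamma>>0. \<exists>\<beta>'>0. \<beta>' \<le> 1 \<and> (\<exists>C1>0. \<forall>(\<tau>::'a::euclidean_space \<Rightarrow> real) c R I t.
    \<tau> \<in> borel_measurable lebesgue \<longrightarrow> (\<forall>x. 0 \<le> \<tau> x) \<longrightarrow> 0 < R \<longrightarrow> 0 \<le> I \<longrightarrow>
    (\<integral>\<^sup>+y\<in>ball c (2 * R). ennreal (\<tau> y) \<partial>lebesgue) \<le> ennreal I \<longrightarrow> level_condition \<beta> (ball c (2 * R)) \<tau> \<longrightarrow>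
    0 < t \<longrightarrow> 12 ^ DIM('a) * I / (\<gamma> * unit_ball_vol (DIM('a))) \<le> t \<longrightarrow>
    (let W = (\<lambda>x. \<tau> x * (max 0 (2 * R - dist c x)) ^ DIM('a)) in
    emeasure (density lebesgue (\<lambda>x. ennreal (W x))) {x. t < W x} \<le> ennreal (C1 * t) * emeasure lebesgue {x. \<beta>' * t < W x}))"
proof -
  let ?n = "DIM('a)"
  obtain \<gamma> where \<gamma>: "0 < \<gamma>" and ld: "\<And>f::'a \<Rightarrow> real. f \<in> borel_measurable lebesgue \<Longrightarrow> (\<And>x. 0 \<le> f x) \<Longrightarrow>
     (\<And>R. (\<integral>\<^sup>+x\<in>ball 0 R. ennreal (f x) \<partial>lebesgue) < top) \<Longrightarrow>
     (AE x in lebesgue. \<exists>d>0. \<forall>r. 0 < r \<and> r < d \<longrightarrow>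
        ennreal (\<gamma> * f x * measure lebesgue (ball x r)) \<le> (\<integral>\<^sup>+y\<in>ball x r. ennreal (f y) \<partial>lebesgue))"
    using lebesgue_differentiation_lower[where 'a='a] by blast
  \<comment> \<open>The distance may drop to half on a stopping ball, which costs 2^n; one more
    factor 2 yields a strict inequality. The bound by \<open>1\<close> is used when \<open>W\<close>
    is truncated.\<close>
  define \<beta>' where "\<beta>' = min 1 (\<beta> * \<gamma> / 2 ^ (?n + 1))"
  \<comment> \<open>10 = 2 * 5: the distance is at most doubled on the five-fold ball, and that ball
    has 5^n times the volume. The leading \<open>2\<close> comes from
    \<open>level_condition\<close>.\<close>
  define C1 where "C1 = 2 * 10 ^ ?n * \<gamma>"
  have \<beta>': "0 < \<beta>'" "\<beta>' \<le> 1" "\<beta>' \<le> \<beta> * \<gamma> / 2 ^ (?n + 1)" using \<beta> \<gamma> by (auto simp: \<beta>'_def)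
  have C1: "0 < C1" using \<gamma> by (simp add: C1_def)
  have main: "emeasure (density lebesgue (\<lambda>x. ennreal (W x))) {x. t < W x} \<le> ennreal (C1 * t) * emeasure lebesgue {x. \<beta>' * t < W x}"
    if \<tau>[measurable]: "\<tau> \<in> borel_measurable lebesgue" and \<tau>0: "\<And>x. 0 \<le> \<tau> x" and R: "0 < R" and I0: "0 \<le> I"
      and I: "(\<integral>\<^sup>+y\<in>ball c (2 * R). ennreal (\<tau> y) \<partial>lebesgue) \<le> ennreal I" and lc: "level_condition \<beta> (ball c (2 * R)) \<tau>"
      and t: "0 < t" and tI: "12 ^ ?n * I / (\<gamma> * unit_ball_vol (real ?n)) \<le> t"
      and W_def: "W = (\<lambda>x. \<tau> x * (max 0 (2 * R - dist c x)) ^ ?n)" for \<tau> :: "'a \<Rightarrow> real" and c R I t W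
  proof -
    have [measurable]: "(\<lambda>x. dist c x) \<in> borel_measurable lebesgue"
      by (intro measurable_completion) measurable
    have W[measurable]: "W \<in> borel_measurable lebesgue" unfolding W_def by measurable
    have W0: "0 \<le> W x" for x using \<tau>0 by (simp add: W_def)
    let ?E = "{x. \<beta>' * t < W x}"
    have E[measurable]: "?E \<in> sets lebesgue" using W by (simp add: borel_measurable_iff_greater)
    have Et[measurable]: "{x. t < W x} \<in> sets lebesgue" using W by (simp add: borel_measurable_iff_greater)
    let ?\<mu> = "density lebesgue (\<lambda>x. ennreal (W x))"
    let ?\<nu> = "density lebesgue (\<lambda>x. ennreal (C1 * t) * indicator ?E x)"
    let ?B = "{(x, r). 0 < r \<and> emeasure ?\<mu> (ball x (5 * r)) \<le> emeasure ?\<nu> (ball x r)}"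
    \<comment> \<open>The cut-off supplies the local integrability that differentiation asks for.
      Stopping balls lie in \<open>ball c (2 * R)\<close>, where both functions agree.\<close>
    define \<tau>' where "\<tau>' x = \<tau> x * indicator (ball c (2 * R)) x" for x
    have [measurable]: "\<tau>' \<in> borel_measurable lebesgue" unfolding \<tau>'_def by measurable
    have "(\<integral>\<^sup>+x\<in>ball 0 Q. ennreal (\<tau>' x) \<partial>lebesgue) \<le> (\<integral>\<^sup>+y\<in>ball c (2 * R). ennreal (\<tau> y) \<partial>lebesgue)" for Q
      by (intro nn_integral_mono) (auto simp: \<tau>'_def indicator_def)
    then have "(\<integral>\<^sup>+x\<in>ball 0 Q. ennreal (\<tau>' x) \<partial>lebesgue) < top" for Q
      using I by (meson ennreal_less_top le_less_trans)
    then have AEld: "AE x in lebesgue. \<exists>d>0. \<forall>r. 0 < r \<and> r < d \<longrightarrow>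
        ennreal (\<gamma> * \<tau>' x * measure lebesgue (ball x r)) \<le> (\<integral>\<^sup>+y\<in>ball x r. ennreal (\<tau>' y) \<partial>lebesgue)"
      using \<tau>0 by (intro ld) (auto simp: \<tau>'_def)
    have "AE x in lebesgue. x \<in> {x. t < W x} \<longrightarrow> x \<in> (\<Union>(x, r)\<in>?B. ball x r)"
      using AEld
    proof eventually_elim
      case (elim x)
      show ?case
      proof
        assume "x \<in> {x. t < W x}"
        then have tW: "t < W x" by simp
        have xS: "x \<in> ball c (2 * R)"
        proof (rule ccontr)
          assume "x \<notin> ball c (2 * R)"
          then have "max 0 (2 * R - dist c x) = 0" by simp
          then have "W x = 0" unfolding W_def using DIM_positive[where 'a='a] by simp
          then show False using tW t by simp
        qed
        define \<rho> where "\<rho> = 2 * R - dist c x"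
        define \<theta> where "\<theta> = \<gamma> * t / \<rho> ^ ?n"
        have \<rho>: "0 < \<rho>" using xS by (simp add: \<rho>_def)
        have \<theta>: "0 < \<theta>" using \<gamma> t \<rho> by (simp add: \<theta>_def)
        have "max 0 (2 * R - dist c x) = \<rho>" using \<rho> unfolding \<rho>_def by simp
        then have W': "t < \<tau>' x * (2 * R - dist c x) ^ ?n"
          using tW xS unfolding W_def \<tau>'_def \<rho>_def by simp
        have I': "(\<integral>\<^sup>+y\<in>ball c (2 * R). ennreal (\<tau>' y) \<partial>lebesgue) \<le> ennreal I"
          by (rule order_trans[OF _ I]) (auto simp: \<tau>'_def indicator_def intro!: nn_integral_mono)
        have \<tau>'0: "0 \<le> \<tau>' y" for y using \<tau>0 by (simp add: \<tau>'_def)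
        obtain r where r: "0 < r" "5 * r \<le> \<rho> / 12"
          and r1: "ennreal (\<theta> * measure lebesgue (ball x r)) \<le> (\<integral>\<^sup>+y\<in>ball x r. ennreal (\<tau>' y) \<partial>lebesgue)"
          and r2: "(\<integral>\<^sup>+y\<in>ball x (5 * r). ennreal (\<tau>' y) \<partial>lebesgue) \<le> ennreal (\<theta> * measure lebesgue (ball x (5 * r)))"
          by (rule gehring_stopping_ball[OF R \<tau>'0 I0 I' \<gamma> xS W' t tI elim, folded \<rho>_def, folded \<theta>_def])
        \<comment> \<open>Five-fold stopping balls have radius at most \<open>\<rho> / 12\<close>;
          on them the distance to the boundary stays between \<open>\<rho> / 2\<close> and
          \<open>2 * \<rho>\<close>.\<close>
        have near: "dist x y < \<rho> / 12 \<Longrightarrow> \<rho> / 2 \<le> 2 * R - dist c y \<and> 2 * R - dist c y \<le> 2 * \<rho>" for y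
        proof -
          assume a: "dist x y < \<rho> / 12"
          have "\<rho> - dist x y \<le> 2 * R - dist c y" unfolding \<rho>_def using dist_triangle[of c y x] by simp
          moreover have "2 * R - dist c y \<le> \<rho> + dist x y" unfolding \<rho>_def using dist_triangle[of c x y] by (simp add: dist_commute)
          ultimately have "\<rho> / 2 \<le> 2 * R - dist c y \<and> 2 * R - dist c y \<le> 2 * \<rho>"
            using a \<rho> by auto
          then show ?thesis .
        qed
        have sub: "ball x (5 * r) \<subseteq> ball c (2 * R)"
        proof
          fix y assume "y \<in> ball x (5 * r)"
          then have "\<rho> / 2 \<le> 2 * R - dist c y" using r near[of y] by simp
          then show "y \<in> ball c (2 * R)" using \<rho> by simp
        qed
        have sub1: "ball x r \<subseteq> ball c (2 * R)" by (rule order_trans[OF subset_ball sub]) (use r in simp)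
        have eq1: "(\<integral>\<^sup>+y\<in>ball x r. ennreal (\<tau>' y) \<partial>lebesgue) = (\<integral>\<^sup>+y\<in>ball x r. ennreal (\<tau> y) \<partial>lebesgue)"
        proof (rule nn_integral_cong)
          fix y show "ennreal (\<tau>' y) * indicator (ball x r) y = ennreal (\<tau> y) * indicator (ball x r) y"
            using sub1 unfolding \<tau>'_def by (cases "y \<in> ball x r") (simp_all add: subset_iff)
        qed
        have "emeasure lebesgue (ball x r) \<le> 2 * emeasure lebesgue {y\<in>ball x r. \<beta> * \<theta> \<le> \<tau> y}"
          by (rule lc[unfolded level_condition_def, rule_format])
            (intro conjI r(1) sub1 less_imp_le[OF \<theta>] r1[unfolded eq1])
        also have "\<dots> \<le> 2 * emeasure lebesgue (?E \<inter> ball x r)"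
        proof (intro mult_left_mono emeasure_mono subsetI)
          fix y assume y: "y \<in> {y\<in>ball x r. \<beta> * \<theta> \<le> \<tau> y}"
          then have n: "\<rho> / 2 \<le> 2 * R - dist c y" using r near[of y] by simp
          have "\<beta>' * t \<le> \<beta> * \<gamma> / 2 ^ (?n + 1) * t" using \<beta>' t by (intro mult_right_mono) auto
          also have "\<dots> = \<beta> * \<gamma> / 2 ^ ?n * t / 2" by simp
          also have "\<dots> < \<beta> * \<gamma> / 2 ^ ?n * t"
          proof -
            have "0 < \<beta> * \<gamma> / 2 ^ ?n * t" using \<beta> \<gamma> t by simp
            then show ?thesis by (rule half_less_self)
          qed
          also have "\<dots> = \<beta> * \<theta> * (\<rho> / 2) ^ ?n" using \<rho> by (simp add: \<theta>_def power_divide)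
          also have "\<dots> \<le> \<tau> y * (max 0 (2 * R - dist c y)) ^ ?n"
            using y n \<rho> \<tau>0 \<beta> \<theta> by (intro mult_mono power_mono) auto
          finally show "y \<in> ?E \<inter> ball x r" using y by (simp add: W_def)
        qed auto
        finally have b: "emeasure lebesgue (ball x r) \<le> 2 * emeasure lebesgue (?E \<inter> ball x r)" .
        have "emeasure ?\<mu> (ball x (5 * r)) = (\<integral>\<^sup>+y\<in>ball x (5 * r). ennreal (W y) \<partial>lebesgue)"
          by (subst emeasure_density) auto
        also have "\<dots> \<le> (\<integral>\<^sup>+y. ennreal ((2 * \<rho>) ^ ?n) * (ennreal (\<tau>' y) * indicator (ball x (5 * r)) y) \<partial>lebesgue)"
        proof (rule nn_integral_mono)
          fix y
          show "ennreal (W y) * indicator (ball x (5 * r)) y \<le> ennreal ((2 * \<rho>) ^ ?n) * (ennreal (\<tau>' y) * indicator (ball x (5 * r)) y)"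
          proof (cases "y \<in> ball x (5 * r)")
            case True
            then have n: "2 * R - dist c y \<le> 2 * \<rho>" using r near[of y] by simp
            have "y \<in> ball c (2 * R)" using True sub by blast
            then have "\<tau>' y = \<tau> y" by (simp add: \<tau>'_def)
            have "W y \<le> (2 * \<rho>) ^ ?n * \<tau> y"
              unfolding W_def mult.commute[of "\<tau> y"] using n \<rho> \<tau>0 by (intro mult_right_mono power_mono) auto
            then show ?thesis using True \<rho> \<tau>0 \<open>\<tau>' y = \<tau> y\<close> by (simp flip: ennreal_mult add: ennreal_leI)
          qed simp
        qed
        also have "\<dots> = ennreal ((2 * \<rho>) ^ ?n) * (\<integral>\<^sup>+y\<in>ball x (5 * r). ennreal (\<tau>' y) \<partial>lebesgue)"
          by (rule nn_integral_cmult) measurable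
        also have "\<dots> \<le> ennreal ((2 * \<rho>) ^ ?n) * ennreal (\<theta> * measure lebesgue (ball x (5 * r)))"
          by (intro mult_left_mono r2) auto
        also have "\<dots> = ennreal (10 ^ ?n * \<gamma> * t) * emeasure lebesgue (ball x r)"
        proof -
          have "(10::real) ^ ?n = 2 ^ ?n * 5 ^ ?n" by (simp flip: power_mult_distrib)
          then have "(2 * \<rho>) ^ ?n * (\<theta> * measure lebesgue (ball x (5 * r))) = 10 ^ ?n * \<gamma> * t * measure lebesgue (ball x r)"
            using \<rho> measure_ball_scale[of 5 r x x] r by (simp add: \<theta>_def power_mult_distrib)
          then show ?thesis unfolding emeasure_ball_eq_measure using \<rho> \<theta> \<gamma> t
            by (simp flip: ennreal_mult)
        qed
        also have "\<dots> \<le> ennreal (10 ^ ?n * \<gamma> * t) * (2 * emeasure lebesgue (?E \<inter> ball x r))"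
          by (intro mult_left_mono b) auto
        also have "\<dots> = ennreal (C1 * t) * emeasure lebesgue (?E \<inter> ball x r)"
        proof -
          have "ennreal (C1 * t) = ennreal (10 ^ ?n * \<gamma> * t) * 2"
            unfolding C1_def using \<gamma> t by (simp flip: ennreal_mult ennreal_numeral add: mult_ac)
          then show ?thesis by (simp add: mult.assoc)
        qed
        also have "\<dots> = emeasure ?\<nu> (ball x r)"
          by (subst emeasure_density) (auto simp: mult.assoc nn_integral_cmult_indicator[symmetric] indicator_inter_arith simp del: emeasure_completion)
        finally have "(x, r) \<in> ?B" using r by simp
        then show "x \<in> (\<Union>(x, r)\<in>?B. ball x r)" using r by (intro UN_I[of "(x, r)"]) auto
      qed
    qed
    \<comment> \<open>Differentiation holds almost everywhere only, so the stopping balls miss a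
      null set, which is null for the weighted measure as well.\<close>
    then have "AE x in ?\<mu>. x \<in> {x. t < W x} \<longrightarrow> x \<in> (\<Union>(x, r)\<in>?B. ball x r)"
      by (subst AE_density) (auto elim: eventually_mono)
    then have "emeasure ?\<mu> {x. t < W x} \<le> emeasure ?\<mu> (\<Union>(x, r)\<in>?B. ball x r)"
    proof (rule emeasure_mono_AE)
      have "open (\<Union>(x, r)\<in>?B. ball x r)" by (intro open_UN) auto
      then show "(\<Union>(x, r)\<in>?B. ball x r) \<in> sets ?\<mu>" by auto
    qed
    also have "\<dots> \<le> emeasure ?\<nu> (\<Union>(x, r)\<in>?B. ball x r)"
      by (rule vitali_measure_le) auto
    also have "\<dots> \<le> emeasure ?\<nu> (space ?\<nu>)" by (rule emeasure_space)
    also have "\<dots> = ennreal (C1 * t) * emeasure lebesgue ?E"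
      by (subst emeasure_density) (auto simp: nn_integral_cmult_indicator simp del: emeasure_completion)
    finally show ?thesis .
  qed
  show ?thesis
    unfolding Let_def
    by (rule exI[of _ \<gamma>], intro conjI \<gamma>, rule exI[of _ \<beta>'], intro conjI \<beta>', rule exI[of _ C1], intro conjI C1 allI impI)
       (rule main, auto)
qed

text \<open>Integrating the level estimate against
  \<open>\<epsilon> * t powr (\<epsilon> - 1)\<close> bounds the integral X of W min(W,T)^\<epsilon>
  by M t0^\<epsilon> + (C1 \<epsilon> / \<beta>'^2) X. For small \<epsilon> the last term is at most
  X / 2 and is absorbed; then T tends to infinity.\<close>

theorem reverse_hoelder:
  assumes \<beta>: "0 < \<beta>"
  shows "\<exists>\<epsilon>0>0. \<forall>\<epsilon>. 0 < \<epsilon> \<and> \<epsilon> \<le> \<epsilon>0 \<longrightarrow> (\<exists>C\<ge>0. \<forall>(\<tau>::'a::euclidean_space \<Rightarrow> real) c R A.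
    \<tau> \<in> borel_measurable lebesgue \<longrightarrow> (\<forall>x. 0 \<le> \<tau> x) \<longrightarrow> 0 < R \<longrightarrow> 0 \<le> A \<longrightarrow>
    (\<integral>\<^sup>+y\<in>ball c (2 * R). ennreal (\<tau> y) \<partial>lebesgue) \<le> ennreal (A * measure lebesgue (ball c R)) \<longrightarrow>
    level_condition \<beta> (ball c (2 * R)) \<tau> \<longrightarrow>
    (\<integral>\<^sup>+y\<in>ball c R. ennreal (\<tau> y powr (1 + \<epsilon>)) \<partial>lebesgue) \<le> ennreal (C * A powr (1 + \<epsilon>) * measure lebesgue (ball c R)))"
proof -
  let ?n = "DIM('a)"
  from gehring_weak[OF \<beta>, where 'a='a] obtain \<gamma> \<beta>' C1 where \<gamma>: "0 < \<gamma>" and \<beta>': "0 < \<beta>'" "\<beta>' \<le> 1" and C1: "0 < C1"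
    and weak0: "\<forall>(\<tau>::'a::euclidean_space \<Rightarrow> real) c R I t.
    \<tau> \<in> borel_measurable lebesgue \<longrightarrow> (\<forall>x. 0 \<le> \<tau> x) \<longrightarrow> 0 < R \<longrightarrow> 0 \<le> I \<longrightarrow>
    (\<integral>\<^sup>+y\<in>ball c (2 * R). ennreal (\<tau> y) \<partial>lebesgue) \<le> ennreal I \<longrightarrow> level_condition \<beta> (ball c (2 * R)) \<tau> \<longrightarrow>
    0 < t \<longrightarrow> 12 ^ ?n * I / (\<gamma> * unit_ball_vol ?n) \<le> t \<longrightarrow>
    (let W = (\<lambda>x. \<tau> x * (max 0 (2 * R - dist c x)) ^ ?n) in
    emeasure (density lebesgue (\<lambda>x. ennreal (W x))) {x. t < W x} \<le> ennreal (C1 * t) * emeasure lebesgue {x. \<beta>' * t < W x})"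
    by (elim exE conjE) (rule that)
  have weak: "emeasure (density lebesgue (\<lambda>x. ennreal (W x))) {x. t < W x} \<le> ennreal (C1 * t) * emeasure lebesgue {x. \<beta>' * t < W x}"
    if "\<tau> \<in> borel_measurable lebesgue" "\<And>x. 0 \<le> \<tau> x" "0 < R" "0 \<le> I"
    "(\<integral>\<^sup>+y\<in>ball c (2 * R). ennreal (\<tau> y) \<partial>lebesgue) \<le> ennreal I" "level_condition \<beta> (ball c (2 * R)) \<tau>"
    "0 < t" "12 ^ ?n * I / (\<gamma> * unit_ball_vol (real ?n)) \<le> t"
    "W = (\<lambda>x. \<tau> x * (max 0 (2 * R - dist c x)) ^ ?n)" for \<tau> :: "'a \<Rightarrow> real" and c R I t W
    using weak0[unfolded Let_def, rule_format, OF that(1-8)] unfolding that(9) .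
  \<comment> \<open>The second bound makes the coefficient of the absorbed term at most 1/2; the
    bound by \<open>1\<close> serves to replace \<open>(1 / \<beta>') powr (1 + \<epsilon>)\<close>
    by \<open>1 / \<beta>'\<^sup>2\<close>.\<close>
  define \<epsilon>0 where "\<epsilon>0 = min 1 (\<beta>'\<^sup>2 / (2 * C1))"
  have \<epsilon>0: "0 < \<epsilon>0" using \<beta>' C1 by (simp add: \<epsilon>0_def)
  have main: "(\<integral>\<^sup>+y\<in>ball c R. ennreal (\<tau> y powr (1 + \<epsilon>)) \<partial>lebesgue) \<le>
      ennreal (2 * 2 ^ ?n * (12 ^ ?n / \<gamma>) powr \<epsilon> * A powr (1 + \<epsilon>) * measure lebesgue (ball c R))"
    if \<epsilon>: "0 < \<epsilon>" "\<epsilon> \<le> \<epsilon>0"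
      and \<tau>[measurable]: "\<tau> \<in> borel_measurable lebesgue" and \<tau>0: "\<And>x. 0 \<le> \<tau> x" and R: "0 < R" and A: "0 \<le> A"
      and I: "(\<integral>\<^sup>+y\<in>ball c (2 * R). ennreal (\<tau> y) \<partial>lebesgue) \<le> ennreal (A * measure lebesgue (ball c R))"
      and lc: "level_condition \<beta> (ball c (2 * R)) \<tau>" for \<epsilon> A R c and \<tau> :: "'a \<Rightarrow> real"
  proof -
    let ?m = "measure lebesgue (ball c R)"
    have m: "0 < ?m" by (rule measure_ball_pos[OF R])
    define W where "W = (\<lambda>x. \<tau> x * (max 0 (2 * R - dist c x)) ^ ?n)"
    have [measurable]: "(\<lambda>x. dist c x) \<in> borel_measurable lebesgue"
      by (intro measurable_completion) measurable
    have W[measurable]: "W \<in> borel_measurable lebesgue" unfolding W_def by measurable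
    have W0: "0 \<le> W x" for x using \<tau>0 by (simp add: W_def)
    define M where "M = (2 * R) ^ ?n * (A * ?m)"
    have M0: "0 \<le> M" using R A m by (simp add: M_def)
    let ?\<mu> = "density lebesgue (\<lambda>x. ennreal (W x))"
    have sf: "sigma_finite_measure ?\<mu>" by (rule sigma_finite_density_real[OF W])
    have WM: "(\<integral>\<^sup>+x. ennreal (W x) \<partial>lebesgue) \<le> ennreal M"
    proof -
      have "(\<integral>\<^sup>+x. ennreal (W x) \<partial>lebesgue) \<le> (\<integral>\<^sup>+x. ennreal ((2 * R) ^ ?n) * (ennreal (\<tau> x) * indicator (ball c (2 * R)) x) \<partial>lebesgue)"
      proof (rule nn_integral_mono)
        fix x
        show "ennreal (W x) \<le> ennreal ((2 * R) ^ ?n) * (ennreal (\<tau> x) * indicator (ball c (2 * R)) x)"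
        proof (cases "x \<in> ball c (2 * R)")
          case True
          have "W x \<le> (2 * R) ^ ?n * \<tau> x"
            unfolding W_def mult.commute[of "\<tau> x"] using R \<tau>0 by (intro mult_right_mono power_mono) auto
          then show ?thesis using True R \<tau>0 by (simp flip: ennreal_mult add: ennreal_leI)
        next
          case False
          then have "max 0 (2 * R - dist c x) = 0" by simp
          then have "W x = 0" unfolding W_def using DIM_positive[where 'a='a] by simp
          then show ?thesis by simp
        qed
      qed
      also have "\<dots> = ennreal ((2 * R) ^ ?n) * (\<integral>\<^sup>+x\<in>ball c (2 * R). ennreal (\<tau> x) \<partial>lebesgue)"
        by (rule nn_integral_cmult) measurable
      also have "\<dots> \<le> ennreal ((2 * R) ^ ?n) * ennreal (A * ?m)" by (intro mult_left_mono I) auto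
      also have "\<dots> = ennreal M" unfolding M_def using R A m by (simp flip: ennreal_mult)
      finally show ?thesis .
    qed
    have \<mu>M: "emeasure ?\<mu> S \<le> ennreal M" if "S \<in> sets lebesgue" for S
    proof -
      have "emeasure ?\<mu> S \<le> emeasure ?\<mu> (space ?\<mu>)" by (rule emeasure_space)
      also have "\<dots> \<le> ennreal M" using WM by (subst emeasure_density) auto
      finally show ?thesis .
    qed
    \<comment> \<open>The threshold of the level estimate. Below it only the total mass
      \<open>M\<close> of \<open>W\<close> is used, which gives the main term.\<close>
    define t0 where "t0 = 12 ^ ?n * (A * ?m) / (\<gamma> * unit_ball_vol (real ?n))"
    have uv: "0 < unit_ball_vol (real ?n)" by (rule unit_ball_vol_pos) simp
    have t0: "0 \<le> t0" using A m \<gamma> uv by (simp add: t0_def)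
    have Am: "0 \<le> A * ?m" using A m by simp
    have wk: "emeasure ?\<mu> {x. t < W x} \<le> ennreal (C1 * t) * emeasure lebesgue {x. \<beta>' * t < W x}" if "t0 < t" for t
      using that t0 by (intro weak[OF \<tau> \<tau>0 R Am I lc _ _ W_def]) (auto simp: t0_def)
    \<comment> \<open>Truncation at \<open>T\<close> makes the integral finite, without which half
      of it could not be subtracted; the bound obtained is independent of \<open>T\<close>.\<close>
    have XT: "(\<integral>\<^sup>+x. ennreal (W x * min (W x) T powr \<epsilon>) \<partial>lebesgue) \<le> ennreal (2 * (M * t0 powr \<epsilon>))" if T: "0 < T" for T
    proof -
      define u where "u x = min (W x) T" for x
      have [measurable]: "u \<in> borel_measurable lebesgue" unfolding u_def by measurable
      have u0: "0 \<le> u x" for x using W0[of x] T by (simp add: u_def)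
      let ?X = "\<integral>\<^sup>+x. ennreal (W x * u x powr \<epsilon>) \<partial>lebesgue"
      have X1: "?X = (\<integral>\<^sup>+x. ennreal (u x powr \<epsilon>) \<partial>?\<mu>)"
        using W0 by (subst nn_integral_density) (auto simp: ennreal_mult)
      have Xfin: "?X < top"
      proof -
        have "?X \<le> (\<integral>\<^sup>+x. ennreal (T powr \<epsilon>) * ennreal (W x) \<partial>lebesgue)"
        proof (rule nn_integral_mono)
          fix x
          have "u x powr \<epsilon> \<le> T powr \<epsilon>" using u0 \<epsilon> by (intro powr_mono2) (auto simp: u_def)
          then have "W x * u x powr \<epsilon> \<le> T powr \<epsilon> * W x" using W0[of x] by (subst mult.commute) (rule mult_right_mono)
          then show "ennreal (W x * u x powr \<epsilon>) \<le> ennreal (T powr \<epsilon>) * ennreal (W x)"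
            using W0[of x] by (simp flip: ennreal_mult add: ennreal_leI)
        qed
        also have "\<dots> = ennreal (T powr \<epsilon>) * (\<integral>\<^sup>+x. ennreal (W x) \<partial>lebesgue)" by (rule nn_integral_cmult) measurable
        also have "\<dots> \<le> ennreal (T powr \<epsilon>) * ennreal M" by (intro mult_left_mono WM) auto
        also have "\<dots> < top" by (simp add: ennreal_mult_less_top)
        finally show ?thesis .
      qed
      have ilt: "((\<lambda>t. (\<epsilon> * M) * t powr (\<epsilon> - 1)) has_integral (\<epsilon> * M) * (t0 powr (\<epsilon> - 1 + 1) / (\<epsilon> - 1 + 1))) {0..t0}"
        using \<epsilon> t0 by (intro has_integral_mult_right has_integral_powr_from_0) auto
      let ?G = "\<lambda>t. ennreal ((1 + \<epsilon>) * t powr (1 + \<epsilon> - 1)) * indicator {0<..} t * emeasure lebesgue {x \<in> space lebesgue. t < u x / \<beta>'}"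
      have Gm: "?G \<in> borel_measurable lborel"
      proof -
        interpret L: sigma_finite_measure "lebesgue :: 'a measure" by (rule sigma_finite_lebesgue)
        show ?thesis by measurable
      qed
      have "?X = (\<integral>\<^sup>+t. ennreal (\<epsilon> * t powr (\<epsilon> - 1)) * indicator {0<..} t * emeasure ?\<mu> {x \<in> space ?\<mu>. t < u x} \<partial>lborel)"
        unfolding X1 by (rule layer_cake[OF sf _ u0 \<epsilon>(1)]) measurable
      also have "\<dots> \<le> (\<integral>\<^sup>+t. ennreal ((\<epsilon> * M) * t powr (\<epsilon> - 1)) * indicator {0..t0} t + ennreal (C1 * \<epsilon>) * ?G t \<partial>lborel)"
      proof (rule nn_integral_mono)
        fix t :: real
        have seq: "{x \<in> space ?\<mu>. t < u x} = {x. t < u x}" by simp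
        show "ennreal (\<epsilon> * t powr (\<epsilon> - 1)) * indicator {0<..} t * emeasure ?\<mu> {x \<in> space ?\<mu>. t < u x} \<le>
           ennreal ((\<epsilon> * M) * t powr (\<epsilon> - 1)) * indicator {0..t0} t + ennreal (C1 * \<epsilon>) * ?G t"
        proof (cases "0 < t")
          case True
          show ?thesis
          proof (cases "t \<le> t0")
            case lt: True
            have "{x. t < u x} \<in> sets lebesgue" using borel_measurable_iff_greater[of u lebesgue] by simp
            then have "ennreal (\<epsilon> * t powr (\<epsilon> - 1)) * emeasure ?\<mu> {x \<in> space ?\<mu>. t < u x} \<le> ennreal (\<epsilon> * t powr (\<epsilon> - 1)) * ennreal M"
              unfolding seq by (intro mult_left_mono \<mu>M) auto
            also have "\<dots> = ennreal ((\<epsilon> * M) * t powr (\<epsilon> - 1))"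
              using \<epsilon> M0 by (simp flip: ennreal_mult add: mult_ac)
            finally show ?thesis using lt True by (simp add: add_increasing2)
          next
            case gt: False
            have Wt: "{x. t < W x} \<in> sets ?\<mu>" using borel_measurable_iff_greater[of W lebesgue] W by simp
            have "emeasure ?\<mu> {x. t < u x} \<le> ennreal (C1 * t) * emeasure lebesgue {x \<in> space lebesgue. t < u x / \<beta>'}"
            proof (cases "t < T")
              case tT: True
              have "emeasure ?\<mu> {x. t < u x} \<le> emeasure ?\<mu> {x. t < W x}"
                by (intro emeasure_mono Wt) (auto simp: u_def)
              also have "\<dots> \<le> ennreal (C1 * t) * emeasure lebesgue {x. \<beta>' * t < W x}" using gt by (intro wk) simp
              also have "\<dots> \<le> ennreal (C1 * t) * emeasure lebesgue {x \<in> space lebesgue. t < u x / \<beta>'}"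
              proof (intro mult_left_mono emeasure_mono subsetI)
                fix x assume "x \<in> {x. \<beta>' * t < W x}"
                \<comment> \<open>Together with \<open>t < T\<close> this keeps
                  \<open>\<beta>' * t\<close> below the truncation level, so the truncated function
                  may replace \<open>W\<close> on the right.\<close>
                moreover have "\<beta>' * t \<le> t" using \<beta>' True by (simp add: mult_le_cancel_right1)
                ultimately have "\<beta>' * t < u x" using tT by (simp add: u_def)
                then show "x \<in> {x \<in> space lebesgue. t < u x / \<beta>'}" using \<beta>' by (simp add: field_simps)
              next
                show "{x \<in> space lebesgue. t < u x / \<beta>'} \<in> sets lebesgue" by measurable
              qed auto
              finally show ?thesis .
            next
              case False
              then have "{x. t < u x} = {}" by (auto simp: u_def)
              then show ?thesis by simp
            qed
            then have "ennreal (\<epsilon> * t powr (\<epsilon> - 1)) * emeasure ?\<mu> {x \<in> space ?\<mu>. t < u x} \<le>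
               ennreal (\<epsilon> * t powr (\<epsilon> - 1)) * (ennreal (C1 * t) * emeasure lebesgue {x \<in> space lebesgue. t < u x / \<beta>'})"
              unfolding seq by (intro mult_left_mono) auto
            also have "\<dots> = ennreal (\<epsilon> * t powr (\<epsilon> - 1) * (C1 * t)) * emeasure lebesgue {x \<in> space lebesgue. t < u x / \<beta>'}"
              using \<epsilon> C1 True by (subst ennreal_mult[of "\<epsilon> * t powr (\<epsilon> - 1)"]) (auto simp: mult.assoc)
            also have "\<dots> \<le> ennreal (C1 * \<epsilon> * ((1 + \<epsilon>) * t powr (1 + \<epsilon> - 1))) * emeasure lebesgue {x \<in> space lebesgue. t < u x / \<beta>'}"
            proof (intro mult_right_mono ennreal_leI)
              have "\<epsilon> * t powr (\<epsilon> - 1) * (C1 * t) = C1 * \<epsilon> * (1 * t powr \<epsilon>)" using True by (simp add: powr_diff)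
              also have "\<dots> \<le> C1 * \<epsilon> * ((1 + \<epsilon>) * t powr \<epsilon>)" using C1 \<epsilon> by (intro mult_left_mono mult_right_mono) auto
              finally show "\<epsilon> * t powr (\<epsilon> - 1) * (C1 * t) \<le> C1 * \<epsilon> * ((1 + \<epsilon>) * t powr (1 + \<epsilon> - 1))" by simp
            qed simp
            also have "\<dots> = ennreal (C1 * \<epsilon>) * ?G t"
              using \<epsilon> C1 True by (subst ennreal_mult[of "C1 * \<epsilon>"]) (auto simp: mult.assoc)
            finally show ?thesis using True by (simp add: add_increasing)
          qed
        qed simp
      qed
      also have "\<dots> = (\<integral>\<^sup>+t. ennreal ((\<epsilon> * M) * t powr (\<epsilon> - 1)) * indicator {0..t0} t \<partial>lborel) + ennreal (C1 * \<epsilon>) * (\<integral>\<^sup>+t. ?G t \<partial>lborel)"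
        using Gm by (subst nn_integral_add) (auto simp: nn_integral_cmult)
      also have "(\<integral>\<^sup>+t. ennreal ((\<epsilon> * M) * t powr (\<epsilon> - 1)) * indicator {0..t0} t \<partial>lborel) = ennreal (M * t0 powr \<epsilon>)"
        using nn_integral_has_integral_lebesgue'[OF _ ilt] \<epsilon> M0 by simp
      also have "ennreal (M * t0 powr \<epsilon>) + ennreal (C1 * \<epsilon>) * (\<integral>\<^sup>+t. ?G t \<partial>lborel) \<le>
          ennreal (M * t0 powr \<epsilon>) + ennreal (C1 * \<epsilon>) * (ennreal (1 / \<beta>'\<^sup>2) * ?X)"
      proof (intro add_left_mono mult_left_mono)
        have "(\<integral>\<^sup>+t. ?G t \<partial>lborel) = (\<integral>\<^sup>+x. ennreal ((u x / \<beta>') powr (1 + \<epsilon>)) \<partial>lebesgue)"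
          using \<epsilon> u0 \<beta>' by (intro layer_cake[symmetric] sigma_finite_lebesgue) auto
        also have "\<dots> \<le> (\<integral>\<^sup>+x. ennreal (1 / \<beta>'\<^sup>2) * ennreal (W x * u x powr \<epsilon>) \<partial>lebesgue)"
        proof (rule nn_integral_mono)
          fix x
          have e1: "\<epsilon> \<le> 1" using \<epsilon> by (simp add: \<epsilon>0_def)
          have "(u x / \<beta>') powr (1 + \<epsilon>) = (1 / \<beta>') powr (1 + \<epsilon>) * u x powr (1 + \<epsilon>)"
            using \<beta>' u0[of x] by (simp add: powr_divide)
          also have "\<dots> \<le> (1 / \<beta>'\<^sup>2) * (W x * u x powr \<epsilon>)"
          proof (rule mult_mono)
            have "(1 / \<beta>') powr (1 + \<epsilon>) \<le> (1 / \<beta>') powr 2" using e1 \<beta>' by (intro powr_mono) auto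
            then show "(1 / \<beta>') powr (1 + \<epsilon>) \<le> 1 / \<beta>'\<^sup>2" using \<beta>' by (simp add: power_one_over)
            have "u x powr (1 + \<epsilon>) = u x * u x powr \<epsilon>" using u0[of x] by (simp add: powr_add)
            then show "u x powr (1 + \<epsilon>) \<le> W x * u x powr \<epsilon>" by (simp add: u_def mult_right_mono)
          qed auto
          finally show "ennreal ((u x / \<beta>') powr (1 + \<epsilon>)) \<le> ennreal (1 / \<beta>'\<^sup>2) * ennreal (W x * u x powr \<epsilon>)"
            using W0[of x] by (simp flip: ennreal_mult add: ennreal_leI)
        qed
        also have "\<dots> = ennreal (1 / \<beta>'\<^sup>2) * ?X" by (rule nn_integral_cmult) measurable
        finally show "(\<integral>\<^sup>+t. ?G t \<partial>lborel) \<le> ennreal (1 / \<beta>'\<^sup>2) * ?X" .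
      qed simp
      finally have fin: "?X \<le> ennreal (M * t0 powr \<epsilon>) + ennreal (C1 * \<epsilon>) * (ennreal (1 / \<beta>'\<^sup>2) * ?X)" .
      obtain X where X: "?X = ennreal X" "0 \<le> X" using Xfin by (cases ?X) auto
      have "ennreal X \<le> ennreal (M * t0 powr \<epsilon> + C1 * \<epsilon> * (1 / \<beta>'\<^sup>2 * X))"
        using fin unfolding X(1) using M0 C1 \<epsilon> X(2) by (simp flip: ennreal_mult ennreal_plus)
      then have "X \<le> M * t0 powr \<epsilon> + C1 * \<epsilon> * (1 / \<beta>'\<^sup>2 * X)"
        using M0 C1 \<epsilon> X(2) by (subst (asm) ennreal_le_iff) auto
      moreover have "C1 * \<epsilon> * (1 / \<beta>'\<^sup>2 * X) \<le> X / 2"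
      proof -
        have "\<epsilon> \<le> \<beta>'\<^sup>2 / (2 * C1)" using \<epsilon> by (simp add: \<epsilon>0_def)
        then have "C1 * \<epsilon> * (1 / \<beta>'\<^sup>2) \<le> 1 / 2" using C1 \<beta>' by (simp add: field_simps)
        then have "C1 * \<epsilon> * (1 / \<beta>'\<^sup>2) * X \<le> 1 / 2 * X" using X(2) by (rule mult_right_mono)
        then show ?thesis by simp
      qed
      ultimately have "X \<le> 2 * (M * t0 powr \<epsilon>)" by linarith
      then have "?X \<le> ennreal (2 * (M * t0 powr \<epsilon>))" unfolding X(1) by (rule ennreal_leI)
      then show ?thesis unfolding u_def .
    qed
    have WW: "(\<integral>\<^sup>+x. ennreal (W x powr (1 + \<epsilon>)) \<partial>lebesgue) \<le> ennreal (2 * (M * t0 powr \<epsilon>))"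
    proof -
      let ?f = "\<lambda>(k::nat) x. ennreal (W x * min (W x) (real (Suc k)) powr \<epsilon>)"
      have "ennreal (W x powr (1 + \<epsilon>)) \<le> (SUP k. ?f k x)" for x
      proof -
        obtain k :: nat where k: "W x \<le> real k" using real_arch_simple by blast
        have "ennreal (W x powr (1 + \<epsilon>)) = ?f k x" using k W0[of x] by (simp add: powr_add)
        then show ?thesis by (intro SUP_upper2[of k]) auto
      qed
      then have "(\<integral>\<^sup>+x. ennreal (W x powr (1 + \<epsilon>)) \<partial>lebesgue) \<le> (\<integral>\<^sup>+x. (SUP k. ?f k x) \<partial>lebesgue)"
        by (intro nn_integral_mono)
      also have "\<dots> = (SUP k. \<integral>\<^sup>+x. ?f k x \<partial>lebesgue)"
      proof (rule nn_integral_monotone_convergence_SUP)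
        show "incseq ?f"
          unfolding incseq_def le_fun_def using W0 \<epsilon>
          by (auto intro!: ennreal_leI mult_left_mono powr_mono2)
      qed measurable
      also have "\<dots> \<le> ennreal (2 * (M * t0 powr \<epsilon>))" by (intro SUP_least XT) simp
      finally show ?thesis .
    qed
    have "(\<integral>\<^sup>+y\<in>ball c R. ennreal (\<tau> y powr (1 + \<epsilon>)) \<partial>lebesgue) \<le> (\<integral>\<^sup>+y. ennreal ((1 / R ^ ?n) powr (1 + \<epsilon>)) * ennreal (W y powr (1 + \<epsilon>)) \<partial>lebesgue)"
    proof (rule nn_integral_mono)
      fix y
      show "ennreal (\<tau> y powr (1 + \<epsilon>)) * indicator (ball c R) y \<le> ennreal ((1 / R ^ ?n) powr (1 + \<epsilon>)) * ennreal (W y powr (1 + \<epsilon>))"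
      proof (cases "y \<in> ball c R")
        case True
        \<comment> \<open>Inside \<open>ball c R\<close> the distance to the boundary of the doubled
          ball is at least \<open>R\<close>, so \<tau> is recovered from \<open>W\<close> up to the
          factor R^n.\<close>
        then have "R ^ ?n \<le> (max 0 (2 * R - dist c y)) ^ ?n" using R by (intro power_mono) auto
        then have "\<tau> y * R ^ ?n \<le> W y" unfolding W_def using \<tau>0 by (intro mult_left_mono) auto
        then have "\<tau> y \<le> 1 / R ^ ?n * W y" using R by (simp add: field_simps)
        then have "\<tau> y powr (1 + \<epsilon>) \<le> (1 / R ^ ?n * W y) powr (1 + \<epsilon>)" using \<tau>0[of y] \<epsilon> by (intro powr_mono2) auto
        also have "\<dots> = (1 / R ^ ?n) powr (1 + \<epsilon>) * W y powr (1 + \<epsilon>)" by (rule powr_mult)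
        finally show ?thesis using True by (simp flip: ennreal_mult add: ennreal_leI)
      qed simp
    qed
    also have "\<dots> = ennreal ((1 / R ^ ?n) powr (1 + \<epsilon>)) * (\<integral>\<^sup>+y. ennreal (W y powr (1 + \<epsilon>)) \<partial>lebesgue)"
      by (rule nn_integral_cmult) measurable
    also have "\<dots> \<le> ennreal ((1 / R ^ ?n) powr (1 + \<epsilon>)) * ennreal (2 * (M * t0 powr \<epsilon>))"
      by (intro mult_left_mono WW) auto
    also have "\<dots> = ennreal ((1 / R ^ ?n) powr (1 + \<epsilon>) * (2 * (M * t0 powr \<epsilon>)))"
      using M0 by (simp flip: ennreal_mult)
    also have "(1 / R ^ ?n) powr (1 + \<epsilon>) * (2 * (M * t0 powr \<epsilon>)) = 2 * 2 ^ ?n * (12 ^ ?n / \<gamma>) powr \<epsilon> * A powr (1 + \<epsilon>) * ?m"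
    proof -
      have mR: "?m = unit_ball_vol (real ?n) * R ^ ?n" using R by (intro measure_lebesgue_ball) simp
      have "t0 = 12 ^ ?n / \<gamma> * A * R ^ ?n" unfolding t0_def mR using less_imp_neq[OF uv] by simp
      then have t: "t0 powr \<epsilon> = (12 ^ ?n / \<gamma>) powr \<epsilon> * A powr \<epsilon> * (R ^ ?n) powr \<epsilon>"
        by (simp only: powr_mult)
      have r: "(1 / R ^ ?n) powr (1 + \<epsilon>) * R ^ ?n * (R ^ ?n) powr \<epsilon> = 1"
      proof -
        have "(1 / R ^ ?n) powr (1 + \<epsilon>) = 1 / (R ^ ?n * (R ^ ?n) powr \<epsilon>)" using R by (simp add: powr_divide powr_add)
        then show ?thesis using R by simp
      qed
      have a: "A powr (1 + \<epsilon>) = A * A powr \<epsilon>" using A by (simp add: powr_add)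
      have "(1 / R ^ ?n) powr (1 + \<epsilon>) * (2 * (M * t0 powr \<epsilon>)) =
        ((1 / R ^ ?n) powr (1 + \<epsilon>) * R ^ ?n * (R ^ ?n) powr \<epsilon>) * (2 * 2 ^ ?n * (12 ^ ?n / \<gamma>) powr \<epsilon> * (A * A powr \<epsilon>) * ?m)"
        unfolding t M_def by (simp add: power_mult_distrib mult_ac)
      then show ?thesis unfolding r a by simp
    qed
    finally show ?thesis .
  qed
  show ?thesis
  proof (rule exI[of _ \<epsilon>0], rule conjI[OF \<epsilon>0], rule allI, rule impI)
    fix \<epsilon> assume e: "0 < \<epsilon> \<and> \<epsilon> \<le> \<epsilon>0"
    let ?C = "2 * 2 ^ ?n * (12 ^ ?n / \<gamma>) powr \<epsilon>"
    have "0 \<le> ?C" by simp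
    then show "\<exists>C\<ge>0. \<forall>(\<tau>::'a \<Rightarrow> real) c R A.
    \<tau> \<in> borel_measurable lebesgue \<longrightarrow> (\<forall>x. 0 \<le> \<tau> x) \<longrightarrow> 0 < R \<longrightarrow> 0 \<le> A \<longrightarrow>
    (\<integral>\<^sup>+y\<in>ball c (2 * R). ennreal (\<tau> y) \<partial>lebesgue) \<le> ennreal (A * measure lebesgue (ball c R)) \<longrightarrow>
    level_condition \<beta> (ball c (2 * R)) \<tau> \<longrightarrow>
    (\<integral>\<^sup>+y\<in>ball c R. ennreal (\<tau> y powr (1 + \<epsilon>)) \<partial>lebesgue) \<le> ennreal (C * A powr (1 + \<epsilon>) * measure lebesgue (ball c R))"
      using main e by (intro exI[of _ ?C]) blast
  qed
qed

section \<open>Local Muckenhoupt weights\<close>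

text \<open>\<open>Ap_pair p K S w \<sigma>\<close> is the \<open>A\<^sub>p\<close> condition on the balls inside \<open>S\<close>, with \<open>\<sigma>\<close> in the role of the dual weight
  \<open>w powr (- 1 / (p - 1))\<close>; keeping \<open>\<sigma>\<close> as a parameter makes the duality symmetric.\<close>

definition Ap_pair :: "real \<Rightarrow> real \<Rightarrow> 'a::euclidean_space set \<Rightarrow> ('a \<Rightarrow> real) \<Rightarrow> ('a \<Rightarrow> real) \<Rightarrow> bool" where
  "Ap_pair p K S w \<sigma> \<longleftrightarrow> (\<forall>c r. 0 < r \<and> ball c r \<subseteq> S \<longrightarrow>
     (\<exists>W\<ge>0. \<exists>T\<ge>0. (\<integral>\<^sup>+y\<in>ball c r. ennreal (w y) \<partial>lebesgue) = ennreal W \<and>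
        (\<integral>\<^sup>+y\<in>ball c r. ennreal (\<sigma> y) \<partial>lebesgue) = ennreal T \<and>
        W * T powr (p - 1) \<le> K * measure lebesgue (ball c r) powr p))"

text \<open>Both functions live on the whole space but are linked only on \<open>S\<close>, up to a
  null set. The exponent is 1 - p'. Positivity almost everywhere on \<open>S\<close> singles out the
  nondegenerate weights.\<close>

definition dual_on :: "real \<Rightarrow> 'a::euclidean_space set \<Rightarrow> ('a \<Rightarrow> real) \<Rightarrow> ('a \<Rightarrow> real) \<Rightarrow> bool" where
  "dual_on p S w \<sigma> \<longleftrightarrow> w \<in> borel_measurable lebesgue \<and> \<sigma> \<in> borel_measurable lebesgue \<and>
     (\<forall>x. 0 \<le> w x) \<and> (\<forall>x. 0 \<le> \<sigma> x) \<and>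
     (AE x in lebesgue. x \<in> S \<longrightarrow> 0 < w x \<and> \<sigma> x = w x powr (- 1 / (p - 1)))"

lemma nn_integral_times_indicator:
  "(\<integral>\<^sup>+y. ennreal (f y * indicator A y) \<partial>M) = (\<integral>\<^sup>+y\<in>A. ennreal (f y) \<partial>M)"
  by (intro nn_integral_cong) (auto simp: indicator_def)

lemma Ap_pairE:
  assumes "Ap_pair p K S w \<sigma>" "0 < r" "ball c r \<subseteq> S"
  obtains W T where "0 \<le> W" "0 \<le> T" "(\<integral>\<^sup>+y\<in>ball c r. ennreal (w y) \<partial>lebesgue) = ennreal W"
    "(\<integral>\<^sup>+y\<in>ball c r. ennreal (\<sigma> y) \<partial>lebesgue) = ennreal T"
    "W * T powr (p - 1) \<le> K * measure lebesgue (ball c r) powr p"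
  using assms(1)[unfolded Ap_pair_def, rule_format, OF conjI, OF assms(2,3)] that by blast

lemma dual_on_mono:
  assumes D: "dual_on p S w \<sigma>" and S: "S' \<subseteq> S"
  shows "dual_on p S' w \<sigma>"
proof -
  have "AE x in lebesgue. x \<in> S \<longrightarrow> 0 < w x \<and> \<sigma> x = w x powr (- 1 / (p - 1))" using D by (simp add: dual_on_def)
  then have "AE x in lebesgue. x \<in> S' \<longrightarrow> 0 < w x \<and> \<sigma> x = w x powr (- 1 / (p - 1))"
    by eventually_elim (use S in blast)
  then show ?thesis using D by (simp add: dual_on_def)
qed

text \<open>Raising the A_p inequality to the power 1 / (p - 1) = p' - 1 exchanges the roles of the
  two weights.\<close>

lemma Ap_pair_swap:
  fixes w \<sigma> :: "'a::euclidean_space \<Rightarrow> real"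
  assumes p: "1 < p" and A: "Ap_pair p K S w \<sigma>"
  shows "Ap_pair (p / (p - 1)) (K powr (1 / (p - 1))) S \<sigma> w"
  unfolding Ap_pair_def
proof (intro allI impI)
  fix c :: 'a and r assume b: "0 < r \<and> ball c r \<subseteq> S"
  from A b obtain W T where W: "0 \<le> W" "0 \<le> T" "(\<integral>\<^sup>+y\<in>ball c r. ennreal (w y) \<partial>lebesgue) = ennreal W"
    "(\<integral>\<^sup>+y\<in>ball c r. ennreal (\<sigma> y) \<partial>lebesgue) = ennreal T"
    and le: "W * T powr (p - 1) \<le> K * measure lebesgue (ball c r) powr p"
    by (elim Ap_pairE[of p K S w \<sigma> r c]) auto
  have e: "p / (p - 1) - 1 = 1 / (p - 1)" using p by (simp add: field_simps)
  have "(W * T powr (p - 1)) powr (1 / (p - 1)) \<le> (K * measure lebesgue (ball c r) powr p) powr (1 / (p - 1))"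
    using le W p by (intro powr_mono2) auto
  then have "T * W powr (p / (p - 1) - 1) \<le> K powr (1 / (p - 1)) * measure lebesgue (ball c r) powr (p / (p - 1))"
    unfolding e using p W by (simp add: powr_mult powr_powr mult.commute)
  then show "\<exists>W\<ge>0. \<exists>T\<ge>0. (\<integral>\<^sup>+y\<in>ball c r. ennreal (\<sigma> y) \<partial>lebesgue) = ennreal W \<and>
        (\<integral>\<^sup>+y\<in>ball c r. ennreal (w y) \<partial>lebesgue) = ennreal T \<and>
        W * T powr (p / (p - 1) - 1) \<le> K powr (1 / (p - 1)) * measure lebesgue (ball c r) powr (p / (p - 1))"
    using W by (intro exI[of _ T] exI[of _ W]) auto
qed

lemma dual_on_swap:
  assumes p: "1 < p" and D: "dual_on p S w \<sigma>"
  shows "dual_on (p / (p - 1)) S \<sigma> w"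
proof -
  have e: "- 1 / (p / (p - 1) - 1) = - (p - 1)" using p by (simp add: field_simps)
  have e2: "(1 - p) / (p - 1) = - 1" using p by (simp add: field_simps)
  have "AE x in lebesgue. x \<in> S \<longrightarrow> 0 < w x \<and> \<sigma> x = w x powr (- 1 / (p - 1))" using D by (simp add: dual_on_def)
  then have "AE x in lebesgue. x \<in> S \<longrightarrow> 0 < \<sigma> x \<and> w x = \<sigma> x powr (- 1 / (p / (p - 1) - 1))"
    unfolding e by eventually_elim (use p in \<open>auto simp: powr_powr e2\<close>)
  then show ?thesis using D by (simp add: dual_on_def)
qed

lemma nn_integral_ball_pos:
  fixes w :: "'a::euclidean_space \<Rightarrow> real"
  assumes [measurable]: "w \<in> borel_measurable lebesgue" and pos: "AE x in lebesgue. x \<in> S \<longrightarrow> 0 < w x"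
    and r: "0 < r" "ball c r \<subseteq> S"
  shows "0 < (\<integral>\<^sup>+y\<in>ball c r. ennreal (w y) \<partial>lebesgue)"
proof (rule ccontr)
  assume "\<not> ?thesis"
  then have "(\<integral>\<^sup>+y\<in>ball c r. ennreal (w y) \<partial>lebesgue) = 0" by simp
  then have "AE y in lebesgue. ennreal (w y) * indicator (ball c r) y = 0" by (subst (asm) nn_integral_0_iff_AE) auto
  with pos have "AE y in lebesgue. y \<notin> ball c r"
    by eventually_elim (use r(2) in \<open>force simp: indicator_def split: if_splits\<close>)
  then have "emeasure lebesgue (ball c r) = 0"
    by (subst (asm) AE_iff_null_sets[symmetric]) (auto simp: null_sets_def simp del: emeasure_completion)
  then show False using measure_ball_pos[OF r(1), of c] by (simp add: emeasure_ball_eq_measure del: emeasure_completion)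
qed

text \<open>Where \<open>\<sigma> y < \<beta> * T0\<close>, the weight w = \<sigma>^(1-p) exceeds
  (\<beta> T0)^(1-p). The A_p inequality bounds the mass of \<open>w\<close>, hence the measure of
  this set, by \<open>K * \<beta> powr (p - 1)\<close> times the measure of the ball.\<close>

lemma Ap_pair_level:
  fixes w \<sigma> :: "'a::euclidean_space \<Rightarrow> real"
  assumes p: "1 < p" and A: "Ap_pair p K S w \<sigma>" and D: "dual_on p S w \<sigma>"
    and \<beta>: "0 < \<beta>" "K * \<beta> powr (p - 1) \<le> 1 / 2"
  shows "level_condition \<beta> S \<sigma>"
  unfolding level_condition_def
proof (intro allI impI)
  fix c :: 'a and r T0
  assume a: "0 < r \<and> ball c r \<subseteq> S \<and> 0 \<le> T0 \<and>
     ennreal (T0 * measure lebesgue (ball c r)) \<le> (\<integral>\<^sup>+y\<in>ball c r. ennreal (\<sigma> y) \<partial>lebesgue)"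
  then have r: "0 < r" "ball c r \<subseteq> S" by auto
  have [measurable]: "w \<in> borel_measurable lebesgue" "\<sigma> \<in> borel_measurable lebesgue" and w0: "\<And>x. 0 \<le> w x" "\<And>x. 0 \<le> \<sigma> x"
    and AEd: "AE x in lebesgue. x \<in> S \<longrightarrow> 0 < w x \<and> \<sigma> x = w x powr (- 1 / (p - 1))" using D by (auto simp: dual_on_def)
  let ?m = "measure lebesgue (ball c r)" and ?G = "{y\<in>ball c r. \<beta> * T0 \<le> \<sigma> y}" and ?Z = "{y\<in>ball c r. \<sigma> y < \<beta> * T0}"
  have m: "0 < ?m" by (rule measure_ball_pos[OF r(1)])
  have meas: "?G \<in> sets lebesgue" "?Z \<in> sets lebesgue"
  proof -
    have "?G = {y\<in>space lebesgue. \<beta> * T0 \<le> \<sigma> y} \<inter> ball c r" "?Z = {y\<in>space lebesgue. \<sigma> y < \<beta> * T0} \<inter> ball c r" by auto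
    then show "?G \<in> sets lebesgue" "?Z \<in> sets lebesgue"
      by (simp_all only:) (intro sets.Int sets_lebesgue_ball; measurable)+
  qed
  show "emeasure lebesgue (ball c r) \<le> 2 * emeasure lebesgue ?G"
  proof (cases "T0 = 0")
    case True
    then have "?G = ball c r" using w0 by auto
    then have "emeasure lebesgue (ball c r) = 1 * emeasure lebesgue ?G" by simp
    also have "\<dots> \<le> 2 * emeasure lebesgue ?G" by (intro mult_right_mono) auto
    finally show ?thesis .
  next
    case False
    then have T0: "0 < T0" using a by simp
    obtain W T where W: "0 \<le> W" "0 \<le> T" "(\<integral>\<^sup>+y\<in>ball c r. ennreal (w y) \<partial>lebesgue) = ennreal W"
      "(\<integral>\<^sup>+y\<in>ball c r. ennreal (\<sigma> y) \<partial>lebesgue) = ennreal T"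
      and le: "W * T powr (p - 1) \<le> K * ?m powr p"
      by (rule Ap_pairE[OF A r])
    have T0T: "T0 * ?m \<le> T" using a W T0 m by (simp add: ennreal_le_iff)
    have Zle: "emeasure lebesgue ?Z \<le> ennreal ?m"
      unfolding emeasure_ball_eq_measure[symmetric] by (intro emeasure_mono) auto
    then obtain z where z: "emeasure lebesgue ?Z = ennreal z" "0 \<le> z"
      by (cases "emeasure lebesgue ?Z") (auto simp: top_unique simp del: emeasure_completion)
    let ?e = "(\<beta> * T0) powr (- (p - 1))"
    have "ennreal ?e * emeasure lebesgue ?Z = (\<integral>\<^sup>+y. ennreal ?e * indicator ?Z y \<partial>lebesgue)"
      using meas by (simp add: nn_integral_cmult_indicator del: emeasure_completion)
    also have "\<dots> \<le> (\<integral>\<^sup>+y\<in>ball c r. ennreal (w y) \<partial>lebesgue)"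
    proof (rule nn_integral_mono_AE)
      show "AE y in lebesgue. ennreal ?e * indicator ?Z y \<le> ennreal (w y) * indicator (ball c r) y"
        using AEd
      proof eventually_elim
        case (elim y)
        show ?case
        proof (cases "y \<in> ?Z")
          case True
          then have wy: "0 < w y" "\<sigma> y = w y powr (- 1 / (p - 1))" using elim r by auto
          then have "0 < \<sigma> y" by simp
          then have "?e \<le> \<sigma> y powr (- (p - 1))" using True p by (intro powr_mono2') auto
          also have "\<dots> = w y"
          proof -
            have "(1 - p) / (p - 1) = - 1" using p by (simp add: field_simps)
            then show ?thesis unfolding wy(2) using wy(1) by (simp add: powr_powr)
          qed
          finally show ?thesis using True by (simp add: ennreal_leI)
        qed simp
      qed
    qed
    finally have "?e * z \<le> W" unfolding z W(3) using z W by (simp flip: ennreal_mult)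
    then have "?e * z * (T0 * ?m) powr (p - 1) \<le> W * T powr (p - 1)"
      using T0T T0 m p z W by (intro mult_mono powr_mono2) auto
    also have "\<dots> \<le> K * ?m powr p" by (rule le)
    finally have "?e * z * (T0 * ?m) powr (p - 1) \<le> K * ?m powr p" .
    moreover have "?e * z * (T0 * ?m) powr (p - 1) = z * ?m powr (p - 1) / \<beta> powr (p - 1)"
    proof -
      have "?e = 1 / (\<beta> powr (p - 1) * T0 powr (p - 1))" by (simp only: powr_minus powr_mult inverse_eq_divide)
      then show ?thesis using T0 \<beta> m by (simp only: powr_mult) simp
    qed
    moreover have "?m powr p = ?m * ?m powr (p - 1)" using m by (simp add: powr_diff)
    ultimately have "z * ?m powr (p - 1) / \<beta> powr (p - 1) \<le> K * (?m * ?m powr (p - 1))"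
      by (simp only:)
    moreover have "0 < \<beta> powr (p - 1)" using \<beta> by simp
    ultimately have "z * ?m powr (p - 1) \<le> K * (?m * ?m powr (p - 1)) * \<beta> powr (p - 1)"
      by (simp only: pos_divide_le_eq)
    then have "z * ?m powr (p - 1) \<le> (K * \<beta> powr (p - 1) * ?m) * ?m powr (p - 1)"
      by (simp only: mult_ac)
    then have "z \<le> K * \<beta> powr (p - 1) * ?m" using m by (simp add: mult_le_cancel_right)
    also have "\<dots> \<le> 1 / 2 * ?m" using \<beta> m by (intro mult_right_mono) auto
    finally have zm: "z \<le> ?m / 2" by simp
    have un: "ball c r = ?Z \<union> ?G" by auto
    have "emeasure lebesgue (ball c r) \<le> emeasure lebesgue ?Z + emeasure lebesgue ?G"
      by (subst un) (rule emeasure_subadditive[OF meas(2,1)])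
    then have le2: "ennreal ?m \<le> ennreal z + emeasure lebesgue ?G" unfolding z emeasure_ball_eq_measure .
    show ?thesis
    proof (cases "emeasure lebesgue ?G")
      case (real g)
      have "?m \<le> z + g" using le2 real z m by (simp flip: ennreal_plus)
      then have "?m \<le> 2 * g" using zm by simp
      then have "ennreal ?m \<le> ennreal (2 * g)" by (rule ennreal_leI)
      also have "\<dots> = 2 * ennreal g" using real by (simp add: ennreal_mult)
      finally show ?thesis unfolding emeasure_ball_eq_measure real .
    next
      case top
      then show ?thesis by (simp add: ennreal_mult_top del: emeasure_completion)
    qed
  qed
qed

lemma level_condition_mono:
  assumes "level_condition \<beta> S \<tau>" "S' \<subseteq> S"
  shows "level_condition \<beta> S' \<tau>"
  unfolding level_condition_def
  by (intro allI impI assms(1)[unfolded level_condition_def, rule_format]) (use assms(2) in auto)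

text \<open>Self-improvement of A_p: \<open>\<sigma> powr (1 + \<epsilon>)\<close> is the dual
  weight for the smaller exponent \<open>1 + (p - 1) / (1 + \<epsilon>)\<close>, and reverse Hoelder
  controls its averages by those of \<sigma>. The radius is halved because reverse Hoelder looks at
  the doubled ball.\<close>

theorem Ap_pair_open:
  assumes p: "1 < p"
  shows "\<exists>\<epsilon>0>0. \<forall>\<epsilon>. 0 < \<epsilon> \<and> \<epsilon> \<le> \<epsilon>0 \<longrightarrow> (\<exists>K'\<ge>0. \<forall>(w::'a::euclidean_space \<Rightarrow> real) \<sigma> c R.
    0 < R \<longrightarrow> dual_on p (ball c (2 * R)) w \<sigma> \<longrightarrow> Ap_pair p K (ball c (2 * R)) w \<sigma> \<longrightarrow>
    Ap_pair (1 + (p - 1) / (1 + \<epsilon>)) K' (ball c R) w (\<lambda>x. \<sigma> x powr (1 + \<epsilon>)))"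
proof -
  let ?n = "DIM('a)"
  \<comment> \<open>Chosen so that \<open>\<beta> powr (p - 1)\<close> equals
    \<open>1 / (2 * (\<bar>K\<bar> + 1))\<close>, which meets the smallness asked by
    \<open>Ap_pair_level\<close> for either sign of \<open>K\<close>.\<close>
  define \<beta> where "\<beta> = (1 / (2 * (\<bar>K\<bar> + 1))) powr (1 / (p - 1))"
  have \<beta>: "0 < \<beta>" by (simp add: \<beta>_def)
  have "\<beta> powr (p - 1) = 1 / (2 * (\<bar>K\<bar> + 1))" using p by (simp add: \<beta>_def powr_powr)
  then have "K * \<beta> powr (p - 1) = K / (\<bar>K\<bar> + 1) / 2" by simp
  moreover have "K / (\<bar>K\<bar> + 1) \<le> 1"
    using abs_ge_self[of K] abs_ge_zero[of K] by (subst divide_le_eq_1_pos) linarith+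
  ultimately have K\<beta>: "K * \<beta> powr (p - 1) \<le> 1 / 2" by simp
  obtain \<epsilon>0 where \<epsilon>0: "0 < \<epsilon>0" and RH: "\<forall>\<epsilon>. 0 < \<epsilon> \<and> \<epsilon> \<le> \<epsilon>0 \<longrightarrow> (\<exists>C\<ge>0. \<forall>(\<tau>::'a \<Rightarrow> real) c R A.
    \<tau> \<in> borel_measurable lebesgue \<longrightarrow> (\<forall>x. 0 \<le> \<tau> x) \<longrightarrow> 0 < R \<longrightarrow> 0 \<le> A \<longrightarrow>
    (\<integral>\<^sup>+y\<in>ball c (2 * R). ennreal (\<tau> y) \<partial>lebesgue) \<le> ennreal (A * measure lebesgue (ball c R)) \<longrightarrow>
    level_condition \<beta> (ball c (2 * R)) \<tau> \<longrightarrow>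
    (\<integral>\<^sup>+y\<in>ball c R. ennreal (\<tau> y powr (1 + \<epsilon>)) \<partial>lebesgue) \<le> ennreal (C * A powr (1 + \<epsilon>) * measure lebesgue (ball c R)))"
    using reverse_hoelder[OF \<beta>, where 'a='a] by (elim exE conjE) (rule that)
  have main: "\<exists>K'\<ge>0. \<forall>(w::'a \<Rightarrow> real) \<sigma> c R.
    0 < R \<longrightarrow> dual_on p (ball c (2 * R)) w \<sigma> \<longrightarrow> Ap_pair p K (ball c (2 * R)) w \<sigma> \<longrightarrow>
    Ap_pair (1 + (p - 1) / (1 + \<epsilon>)) K' (ball c R) w (\<lambda>x. \<sigma> x powr (1 + \<epsilon>))" if \<epsilon>: "0 < \<epsilon>" "\<epsilon> \<le> \<epsilon>0" for \<epsilon>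
  proof -
    from RH[rule_format, OF conjI[OF \<epsilon>]] obtain C where C: "0 \<le> C" and rh: "\<forall>(\<tau>::'a \<Rightarrow> real) c R A.
    \<tau> \<in> borel_measurable lebesgue \<longrightarrow> (\<forall>x. 0 \<le> \<tau> x) \<longrightarrow> 0 < R \<longrightarrow> 0 \<le> A \<longrightarrow>
    (\<integral>\<^sup>+y\<in>ball c (2 * R). ennreal (\<tau> y) \<partial>lebesgue) \<le> ennreal (A * measure lebesgue (ball c R)) \<longrightarrow>
    level_condition \<beta> (ball c (2 * R)) \<tau> \<longrightarrow>
    (\<integral>\<^sup>+y\<in>ball c R. ennreal (\<tau> y powr (1 + \<epsilon>)) \<partial>lebesgue) \<le> ennreal (C * A powr (1 + \<epsilon>) * measure lebesgue (ball c R))"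
      by (elim exE conjE) (rule that)
    define q where "q = 1 + (p - 1) / (1 + \<epsilon>)"
    define K' where "K' = \<bar>K\<bar> * (2 ^ ?n) powr p * C powr (q - 1)"
    have q: "1 < q" using p \<epsilon> by (simp add: q_def)
    have qp: "(1 + \<epsilon>) * (q - 1) = p - 1" using \<epsilon> by (simp add: q_def)
    have K'0: "0 \<le> K'" by (simp add: K'_def)
    have *: "Ap_pair q K' (ball c R) w (\<lambda>x. \<sigma> x powr (1 + \<epsilon>))"
      if R: "0 < R" and D: "dual_on p (ball c (2 * R)) w \<sigma>" and A: "Ap_pair p K (ball c (2 * R)) w \<sigma>" for w \<sigma> :: "'a \<Rightarrow> real" and c R
      unfolding Ap_pair_def
    proof (intro allI impI)
      fix x :: 'a and r assume b: "0 < r \<and> ball x r \<subseteq> ball c R"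
      let ?m = "measure lebesgue (ball x r)"
      have m: "0 < ?m" using b by (intro measure_ball_pos) simp
      have [measurable]: "w \<in> borel_measurable lebesgue" "\<sigma> \<in> borel_measurable lebesgue" and w0: "\<And>x. 0 \<le> w x" "\<And>x. 0 \<le> \<sigma> x"
        using D by (auto simp: dual_on_def)
      have "dist x c + r \<le> R" using b by (auto simp: ball_subset_ball_iff)
      then have sub: "ball x (2 * r) \<subseteq> ball c (2 * R)" using zero_le_dist[of x c] by (intro ball_subset_ball_dist) linarith
      have r2: "0 < 2 * r" using b by simp
      obtain W T where W: "0 \<le> W" "0 \<le> T" "(\<integral>\<^sup>+y\<in>ball x (2 * r). ennreal (w y) \<partial>lebesgue) = ennreal W"
        "(\<integral>\<^sup>+y\<in>ball x (2 * r). ennreal (\<sigma> y) \<partial>lebesgue) = ennreal T"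
        and le: "W * T powr (p - 1) \<le> K * measure lebesgue (ball x (2 * r)) powr p"
        by (rule Ap_pairE[OF A r2 sub])
      have lc: "level_condition \<beta> (ball x (2 * r)) \<sigma>"
        by (rule level_condition_mono[OF Ap_pair_level[OF p A D \<beta> K\<beta>] sub])
      have rhs: "(\<integral>\<^sup>+y\<in>ball x r. ennreal (\<sigma> y powr (1 + \<epsilon>)) \<partial>lebesgue) \<le> ennreal (C * (T / ?m) powr (1 + \<epsilon>) * ?m)"
        using b w0 W m lc by (intro rh[rule_format]) auto
      then obtain T' where T': "(\<integral>\<^sup>+y\<in>ball x r. ennreal (\<sigma> y powr (1 + \<epsilon>)) \<partial>lebesgue) = ennreal T'" "0 \<le> T'"
        by (cases "\<integral>\<^sup>+y\<in>ball x r. ennreal (\<sigma> y powr (1 + \<epsilon>)) \<partial>lebesgue") (auto simp: top_unique)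
      have T'le: "T' \<le> C * (T / ?m) powr (1 + \<epsilon>) * ?m" using rhs T' C m by (simp add: ennreal_le_iff)
      have "(\<integral>\<^sup>+y\<in>ball x r. ennreal (w y) \<partial>lebesgue) \<le> ennreal W"
        unfolding W(3)[symmetric] using b by (intro nn_set_integral_set_mono subset_ball) auto
      then obtain W' where W': "(\<integral>\<^sup>+y\<in>ball x r. ennreal (w y) \<partial>lebesgue) = ennreal W'" "0 \<le> W'" "W' \<le> W"
        using W by (cases "\<integral>\<^sup>+y\<in>ball x r. ennreal (w y) \<partial>lebesgue") (auto simp: top_unique)
      have "W' * T' powr (q - 1) \<le> W * (C * (T / ?m) powr (1 + \<epsilon>) * ?m) powr (q - 1)"
        using W' T' T'le W q by (intro mult_mono powr_mono2) auto
      also have "(C * (T / ?m) powr (1 + \<epsilon>) * ?m) powr (q - 1) = C powr (q - 1) * (T / ?m) powr (p - 1) * ?m powr (q - 1)"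
        by (simp add: powr_mult powr_powr qp)
      also have "(T / ?m) powr (p - 1) = T powr (p - 1) / ?m powr (p - 1)" using W m by (intro powr_divide)
      also have "W * (C powr (q - 1) * (T powr (p - 1) / ?m powr (p - 1)) * ?m powr (q - 1)) =
          (W * T powr (p - 1)) * (C powr (q - 1) * ?m powr (q - 1) / ?m powr (p - 1))" by simp
      also have "\<dots> \<le> (\<bar>K\<bar> * ((2 ^ ?n) powr p * ?m powr p)) * (C powr (q - 1) * ?m powr (q - 1) / ?m powr (p - 1))"
      proof (rule mult_right_mono)
        have "measure lebesgue (ball x (2 * r)) = 2 ^ ?n * ?m" using b by (intro measure_ball_scale) auto
        then have "W * T powr (p - 1) \<le> K * ((2 ^ ?n) powr p * ?m powr p)" using le by (simp add: powr_mult)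
        also have "\<dots> \<le> \<bar>K\<bar> * ((2 ^ ?n) powr p * ?m powr p)" by (intro mult_right_mono) auto
        finally show "W * T powr (p - 1) \<le> \<bar>K\<bar> * ((2 ^ ?n) powr p * ?m powr p)" .
      qed simp
      also have "\<dots> = K' * (?m powr p * ?m powr (q - 1) / ?m powr (p - 1))" by (simp add: K'_def)
      also have "?m powr p * ?m powr (q - 1) / ?m powr (p - 1) = ?m powr q"
        using m by (simp add: powr_diff)
      finally have fin: "W' * T' powr (q - 1) \<le> K' * ?m powr q" .
      show "\<exists>W\<ge>0. \<exists>T\<ge>0. (\<integral>\<^sup>+y\<in>ball x r. ennreal (w y) \<partial>lebesgue) = ennreal W \<and>
        (\<integral>\<^sup>+y\<in>ball x r. ennreal (\<sigma> y powr (1 + \<epsilon>)) \<partial>lebesgue) = ennreal T \<and> W * T powr (q - 1) \<le> K' * ?m powr q"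
        using fin W' T' by (intro exI[of _ W'] conjI exI[of _ T']) auto
    qed
    show ?thesis unfolding q_def[symmetric] by (intro exI[of _ K'] conjI K'0 allI impI) (rule *)
  qed
  show ?thesis
  proof (rule exI[of _ \<epsilon>0], rule conjI[OF \<epsilon>0], rule allI, rule impI, elim conjE)
    fix \<epsilon> assume "0 < \<epsilon>" "\<epsilon> \<le> \<epsilon>0"
    then show "\<exists>K'\<ge>0. \<forall>(w::'a \<Rightarrow> real) \<sigma> c R.
    0 < R \<longrightarrow> dual_on p (ball c (2 * R)) w \<sigma> \<longrightarrow> Ap_pair p K (ball c (2 * R)) w \<sigma> \<longrightarrow>
    Ap_pair (1 + (p - 1) / (1 + \<epsilon>)) K' (ball c R) w (\<lambda>x. \<sigma> x powr (1 + \<epsilon>))" by (rule main)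
  qed
qed

lemma dual_on_open:
  assumes p: "1 < p" and e: "0 < \<epsilon>" and D: "dual_on p S w \<sigma>"
  shows "dual_on (1 + (p - 1) / (1 + \<epsilon>)) S w (\<lambda>x. \<sigma> x powr (1 + \<epsilon>))"
proof -
  have [measurable]: "\<sigma> \<in> borel_measurable lebesgue" using D by (simp add: dual_on_def)
  have eq: "- 1 / (1 + (p - 1) / (1 + \<epsilon>) - 1) = - 1 / (p - 1) * (1 + \<epsilon>)" using p e by (simp add: field_simps)
  have "AE x in lebesgue. x \<in> S \<longrightarrow> 0 < w x \<and> \<sigma> x = w x powr (- 1 / (p - 1))" using D by (simp add: dual_on_def)
  then have "AE x in lebesgue. x \<in> S \<longrightarrow> 0 < w x \<and> \<sigma> x powr (1 + \<epsilon>) = w x powr (- 1 / (1 + (p - 1) / (1 + \<epsilon>) - 1))"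
    unfolding eq powr_powr[symmetric] by eventually_elim simp
  then show ?thesis using D by (simp add: dual_on_def)
qed

section \<open>Averages, doubling and the maximal operator for local weights\<close>

text \<open>Hoelder applied to f = (f^t v)^(1/t) \<rho>^(1-1/t), with the A_t condition absorbing
  the mass of \<open>\<rho>\<close>. It bounds unweighted averages by averages with respect to v dx,
  a doubling measure, to which \<open>strong_maximal\<close> applies.\<close>

lemma Ap_pair_average:
  fixes v \<rho> f :: "'a::euclidean_space \<Rightarrow> real"
  assumes t: "1 < t" and A: "Ap_pair t K S v \<rho>" and D: "dual_on t S v \<rho>"
    and f[measurable]: "f \<in> borel_measurable lebesgue" and f0: "\<And>x. 0 \<le> f x"
    and r: "0 < r" "ball c r \<subseteq> S"
    and Y: "0 \<le> Y" "(\<integral>\<^sup>+y\<in>ball c r. ennreal (f y powr t * v y) \<partial>lebesgue) \<le> ennreal Y"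
    and V: "0 < V" "(\<integral>\<^sup>+y\<in>ball c r. ennreal (v y) \<partial>lebesgue) = ennreal V"
  shows "(\<integral>\<^sup>+y\<in>ball c r. ennreal (f y) \<partial>lebesgue) \<le> ennreal ((K * Y / V) powr (1 / t) * measure lebesgue (ball c r))"
proof -
  let ?m = "measure lebesgue (ball c r)"
  have m: "0 < ?m" by (rule measure_ball_pos[OF r(1)])
  have [measurable]: "v \<in> borel_measurable lebesgue" "\<rho> \<in> borel_measurable lebesgue" and v0: "\<And>x. 0 \<le> v x" "\<And>x. 0 \<le> \<rho> x"
    and AEd: "AE x in lebesgue. x \<in> S \<longrightarrow> 0 < v x \<and> \<rho> x = v x powr (- 1 / (t - 1))" using D by (auto simp: dual_on_def)
  obtain W T where W: "0 \<le> W" "0 \<le> T" "(\<integral>\<^sup>+y\<in>ball c r. ennreal (v y) \<partial>lebesgue) = ennreal W"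
      "(\<integral>\<^sup>+y\<in>ball c r. ennreal (\<rho> y) \<partial>lebesgue) = ennreal T"
      and le: "W * T powr (t - 1) \<le> K * ?m powr t"
      by (rule Ap_pairE[OF A r])
  have WV: "W = V" using W V by simp
  have K: "0 \<le> K"
  proof -
    have "0 \<le> K * ?m powr t" using le W by (intro order_trans[OF _ le]) auto
    moreover have "0 < ?m powr t" using m by simp
    ultimately show ?thesis by (simp add: zero_le_mult_iff)
  qed
  let ?f = "\<lambda>y. f y powr t * v y * indicator (ball c r) y" and ?g = "\<lambda>y. \<rho> y * indicator (ball c r) y"
  have "(\<integral>\<^sup>+y\<in>ball c r. ennreal (f y) \<partial>lebesgue) = (\<integral>\<^sup>+y. ennreal (?f y powr (1 / t) * ?g y powr (1 - 1 / t)) \<partial>lebesgue)"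
  proof (rule nn_integral_cong_AE)
    show "AE y in lebesgue. ennreal (f y) * indicator (ball c r) y = ennreal (?f y powr (1 / t) * ?g y powr (1 - 1 / t))"
      using AEd
    proof eventually_elim
      case (elim y)
      show ?case
      proof (cases "y \<in> ball c r")
        case True
        then have vy: "0 < v y" "\<rho> y = v y powr (- 1 / (t - 1))" using elim r by auto
        have e: "(1 - 1 / t) / (t - 1) = 1 / t" using t by (simp add: field_simps)
        have "?f y powr (1 / t) * ?g y powr (1 - 1 / t) = f y * (v y powr (1 / t) * v y powr (- (1 / t)))"
          unfolding vy(2) using True t f0[of y] by (simp add: powr_mult powr_powr e del: powr_minus)
        also have "v y powr (1 / t) * v y powr (- (1 / t)) = 1" using vy(1) by (simp flip: powr_add)
        finally show ?thesis using True by simp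
      qed simp
    qed
  qed
  also have "\<dots> \<le> ennreal (Y powr (1 / t) * T powr (1 - 1 / t))"
  proof (rule nn_integral_holder_le)
    show "(\<integral>\<^sup>+y. ennreal (?f y) \<partial>lebesgue) \<le> ennreal Y"
      using Y(2) by (simp only: nn_integral_times_indicator)
    show "(\<integral>\<^sup>+y. ennreal (?g y) \<partial>lebesgue) \<le> ennreal T"
      unfolding W(4)[symmetric] nn_integral_times_indicator ..
  qed (use t v0 Y W in auto)
  also have "\<dots> \<le> ennreal ((K * Y / V) powr (1 / t) * ?m)"
  proof (rule ennreal_leI)
    have e: "1 - 1 / t = (t - 1) * (1 / t)" using t by (simp add: field_simps)
    have "T powr (t - 1) \<le> K / V * ?m powr t" using le V(1) unfolding WV by (simp add: field_simps)
    then have "(T powr (t - 1)) powr (1 / t) \<le> (K / V * ?m powr t) powr (1 / t)" using t by (intro powr_mono2) auto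
    also have "\<dots> = (K / V) powr (1 / t) * ?m" using t m by (simp add: powr_powr powr_mult[of "K / V"] del: times_divide_eq_left)
    finally have "T powr (1 - 1 / t) \<le> (K / V) powr (1 / t) * ?m" unfolding e powr_powr[symmetric] .
    then have "Y powr (1 / t) * T powr (1 - 1 / t) \<le> Y powr (1 / t) * ((K / V) powr (1 / t) * ?m)"
      by (intro mult_left_mono) auto
    also have "\<dots> = (K * Y / V) powr (1 / t) * ?m"
    proof -
      have "K * Y / V = Y * (K / V)" by simp
      then show ?thesis by (simp only: powr_mult mult_ac)
    qed
    finally show "Y powr (1 / t) * T powr (1 - 1 / t) \<le> (K * Y / V) powr (1 / t) * ?m" .
  qed
  finally show ?thesis .
qed

text \<open>This is \<open>Ap_pair_average\<close> on the large ball, applied to the indicator of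
  the small one.\<close>

lemma Ap_pair_doubling:
  fixes v \<rho> :: "'a::euclidean_space \<Rightarrow> real"
  assumes t: "1 < t" and A: "Ap_pair t K S v \<rho>" and D: "dual_on t S v \<rho>"
    and r: "0 < r" "ball c (5 * r) \<subseteq> S"
  shows "(\<integral>\<^sup>+y\<in>ball c (5 * r). ennreal (v y) \<partial>lebesgue) \<le> ennreal (\<bar>K\<bar> * (5 ^ DIM('a)) powr t) * (\<integral>\<^sup>+y\<in>ball c r. ennreal (v y) \<partial>lebesgue)"
proof -
  let ?m = "measure lebesgue (ball c r)" and ?k = "(5::real) ^ DIM('a)"
  have m: "0 < ?m" by (rule measure_ball_pos[OF r(1)])
  have [measurable]: "v \<in> borel_measurable lebesgue" and v0: "\<And>x. 0 \<le> v x"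
    and AEd: "AE x in lebesgue. x \<in> S \<longrightarrow> 0 < v x"
  proof -
    have "AE x in lebesgue. x \<in> S \<longrightarrow> 0 < v x \<and> \<rho> x = v x powr (- 1 / (t - 1))" using D by (simp add: dual_on_def)
    then show "AE x in lebesgue. x \<in> S \<longrightarrow> 0 < v x" by eventually_elim simp
  qed (use D in \<open>auto simp: dual_on_def\<close>)
  have r5: "0 < 5 * r" using r by simp
  have s1: "ball c r \<subseteq> ball c (5 * r)" using r by (intro subset_ball) simp
  obtain V where V: "0 \<le> V" "(\<integral>\<^sup>+y\<in>ball c (5 * r). ennreal (v y) \<partial>lebesgue) = ennreal V"
    using A r5 r(2) by (elim Ap_pairE[of t K S v \<rho> "5 * r" c]) auto
  then have V0: "0 < V" using nn_integral_ball_pos[OF _ AEd r5 r(2)] by simp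
  obtain Y where Y: "0 \<le> Y" "(\<integral>\<^sup>+y\<in>ball c r. ennreal (v y) \<partial>lebesgue) = ennreal Y"
    using A r(1) s1 r(2) by (elim Ap_pairE[of t K S v \<rho> r c]) auto
  let ?f = "indicator (ball c r) :: 'a \<Rightarrow> real"
  have "(\<integral>\<^sup>+y\<in>ball c (5 * r). ennreal (?f y powr t * v y) \<partial>lebesgue) \<le> ennreal Y"
    unfolding Y(2)[symmetric] using t by (intro nn_integral_mono) (auto simp: indicator_def)
  then have "(\<integral>\<^sup>+y\<in>ball c (5 * r). ennreal (?f y) \<partial>lebesgue) \<le> ennreal ((K * Y / V) powr (1 / t) * measure lebesgue (ball c (5 * r)))"
    by (intro Ap_pair_average[OF t A D _ _ r5 r(2) Y(1) _ V0 V(2)]) auto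
  moreover have "(\<integral>\<^sup>+y\<in>ball c (5 * r). ennreal (?f y) \<partial>lebesgue) = ennreal ?m"
  proof -
    have "(\<integral>\<^sup>+y\<in>ball c (5 * r). ennreal (?f y) \<partial>lebesgue) = (\<integral>\<^sup>+y. indicator (ball c r) y \<partial>lebesgue)"
      using s1 by (intro nn_integral_cong) (auto simp: indicator_def)
    then show ?thesis by (simp add: emeasure_ball_eq_measure del: emeasure_completion)
  qed
  moreover have "measure lebesgue (ball c (5 * r)) = ?k * ?m" using r by (intro measure_ball_scale) auto
  ultimately have "?m \<le> (K * Y / V) powr (1 / t) * (?k * ?m)" using m by (simp add: ennreal_le_iff)
  then have "1 * ?m \<le> ((K * Y / V) powr (1 / t) * ?k) * ?m" by simp
  then have "1 \<le> (K * Y / V) powr (1 / t) * ?k" using m by (simp only: mult_le_cancel_right)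
  then have "1 powr t \<le> ((K * Y / V) powr (1 / t) * ?k) powr t" using t by (intro powr_mono2) auto
  also have "\<dots> = \<bar>K * Y / V\<bar> * ?k powr t" using t by (simp add: powr_mult powr_powr)
  finally have "V \<le> \<bar>K\<bar> * ?k powr t * Y" using V0 Y by (simp add: abs_mult field_simps)
  then show ?thesis unfolding V(2) Y(2) using Y by (simp flip: ennreal_mult add: ennreal_leI)
qed

lemma maximal_indicator_le_1:
  fixes c :: "'a::euclidean_space"
  shows "maximal (indicator (ball c r)) x \<le> 1"
proof (rule maximal_leI)
  fix c' :: 'a and \<rho> :: real assume \<rho>: "0 < \<rho>"
  have "(\<integral>\<^sup>+y\<in>ball c' \<rho>. ennreal \<bar>indicator (ball c r) y\<bar> \<partial>lebesgue) \<le> (\<integral>\<^sup>+y. indicator (ball c' \<rho>) y \<partial>lebesgue)"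
    by (intro nn_integral_mono) (auto simp: indicator_def)
  also have "\<dots> = ennreal (1 * measure lebesgue (ball c' \<rho>))"
    by (simp add: emeasure_ball_eq_measure del: emeasure_completion)
  finally show "ball_avg c' \<rho> (\<lambda>y. ennreal \<bar>indicator (ball c r) y\<bar>) \<le> 1"
    using ball_avg_le_iff[OF \<rho>, of 1 c'] by simp
qed

text \<open>A ball of radius \<rho> that meets \<open>ball c r\<close> and contains a point off the
  doubled ball has r < 2 \<rho>; its five-fold dilate contains \<open>ball c r\<close>. Hence an
  average of \<open>F\<close> is at most 5^n A times an average of the indicator over that
  dilate.\<close>

lemma maximal_far:
  fixes F :: "'a::euclidean_space \<Rightarrow> real"
  assumes F: "\<And>x. x \<notin> ball c r \<Longrightarrow> F x = 0" and r: "0 < r" and A: "0 \<le> A"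
    and I: "(\<integral>\<^sup>+x. ennreal \<bar>F x\<bar> \<partial>lebesgue) \<le> ennreal (A * measure lebesgue (ball c r))"
    and x: "x \<notin> ball c (2 * r)"
  shows "maximal F x \<le> ennreal (5 ^ DIM('a) * A) * maximal (indicator (ball c r)) x"
proof (rule maximal_leI)
  fix c' :: 'a and \<rho> assume \<rho>: "0 < \<rho>" and xb: "x \<in> ball c' \<rho>"
  let ?k = "(5::real) ^ DIM('a)"
  show "ball_avg c' \<rho> (\<lambda>y. ennreal \<bar>F y\<bar>) \<le> ennreal (?k * A) * maximal (indicator (ball c r)) x"
  proof (cases "ball c' \<rho> \<inter> ball c r = {}")
    case True
    have "(\<integral>\<^sup>+y\<in>ball c' \<rho>. ennreal \<bar>F y\<bar> \<partial>lebesgue) = (\<integral>\<^sup>+y. 0 \<partial>(lebesgue::'a measure))"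
    proof (rule nn_integral_cong)
      fix y show "ennreal \<bar>F y\<bar> * indicator (ball c' \<rho>) y = 0"
        using True F[of y] by (cases "y \<in> ball c' \<rho>") (auto simp: disjoint_iff)
    qed
    then show ?thesis unfolding ball_avg_def by simp
  next
    case False
    then obtain z where z: "dist c' z < \<rho>" "dist c z < r" by auto
    have d1: "2 * r \<le> dist c x" using x by simp
    have "dist c x \<le> dist c z + dist z c' + dist c' x"
      using dist_triangle[of c x z] dist_triangle[of z x c'] by linarith
    then have r\<rho>: "r < 2 * \<rho>" using z d1 xb by (simp add: dist_commute)
    have sub: "y \<in> ball c' (5 * \<rho>)" if "y \<in> ball c r" for y
    proof -
      have "dist c' y \<le> dist c' z + dist z c + dist c y"
        using dist_triangle[of c' y z] dist_triangle[of z y c] by linarith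
      then show ?thesis using that z r\<rho> by (simp add: dist_commute)
    qed
    have \<rho>5: "0 < 5 * \<rho>" using \<rho> by simp
    have x5: "x \<in> ball c' (5 * \<rho>)" using xb \<rho> by auto
    let ?m = "measure lebesgue (ball c' \<rho>)"
    have m: "0 < ?m" by (rule measure_ball_pos[OF \<rho>])
    have m5: "measure lebesgue (ball c' (5 * \<rho>)) = ?k * ?m" using \<rho> by (intro measure_ball_scale) auto
    let ?a = "ball_avg c' (5 * \<rho>) (\<lambda>y. ennreal \<bar>indicator (ball c r) y\<bar>)"
    have "(\<integral>\<^sup>+y\<in>ball c' (5 * \<rho>). ennreal \<bar>indicator (ball c r) y\<bar> \<partial>lebesgue) = (\<integral>\<^sup>+y. indicator (ball c r) y \<partial>lebesgue)"
    proof (rule nn_integral_cong)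
      fix y show "ennreal \<bar>indicator (ball c r) y\<bar> * indicator (ball c' (5 * \<rho>)) y = (indicator (ball c r) y :: ennreal)"
        using sub[of y] by (cases "y \<in> ball c r") simp_all
    qed
    also have "\<dots> = ennreal (measure lebesgue (ball c r))" by (simp add: emeasure_ball_eq_measure del: emeasure_completion)
    finally have avg: "ennreal (measure lebesgue (ball c r)) = ennreal (?k * ?m) * ?a"
      unfolding ball_avg_times_measure[OF \<rho>5] m5 by simp
    have "ball_avg c' \<rho> (\<lambda>y. ennreal \<bar>F y\<bar>) \<le> ennreal (1 / ?m) * (\<integral>\<^sup>+y. ennreal \<bar>F y\<bar> \<partial>lebesgue)"
      unfolding ball_avg_def by (intro mult_left_mono nn_integral_mono) (auto simp: indicator_def)
    also have "\<dots> \<le> ennreal (1 / ?m) * ennreal (A * measure lebesgue (ball c r))" by (intro mult_left_mono I) simp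
    also have "\<dots> = ennreal (1 / ?m * A) * ennreal (measure lebesgue (ball c r))"
      using m A by (simp flip: ennreal_mult)
    also have "\<dots> = ennreal (1 / ?m * A * (?k * ?m)) * ?a"
      unfolding avg using m A by (subst (2) ennreal_mult) (auto simp: mult.assoc)
    also have "1 / ?m * A * (?k * ?m) = ?k * A" using m by simp
    also have "ennreal (?k * A) * ?a \<le> ennreal (?k * A) * maximal (indicator (ball c r)) x"
      by (intro mult_left_mono ball_avg_le_maximal[OF \<rho>5 x5]) simp
    finally show ?thesis .
  qed
qed

text \<open>The domination of \<open>F\<close> by its maximal function, with the loss of the
  differentiation lemma. Finiteness of the maximal function at a single point already gives the
  local integrability required there.\<close>

lemma maximal_lower_bound:
  "\<exists>\<gamma>>0. \<forall>F::'a::euclidean_space \<Rightarrow> real. F \<in> borel_measurable lebesgue \<longrightarrow> (\<forall>x. 0 \<le> F x) \<longrightarrow>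
     (AE x in lebesgue. maximal F x < top) \<longrightarrow> (AE x in lebesgue. \<gamma> * F x \<le> enn2real (maximal F x))"
proof -
  obtain \<gamma> where \<gamma>: "0 < \<gamma>" and ld: "\<forall>f::'a::euclidean_space \<Rightarrow> real. f \<in> borel_measurable lebesgue \<longrightarrow> (\<forall>x. 0 \<le> f x) \<longrightarrow>
     (\<forall>R. (\<integral>\<^sup>+x\<in>ball 0 R. ennreal (f x) \<partial>lebesgue) < top) \<longrightarrow>
     (AE x in lebesgue. \<exists>d>0. \<forall>r. 0 < r \<and> r < d \<longrightarrow>
        ennreal (\<gamma> * f x * measure lebesgue (ball x r)) \<le> (\<integral>\<^sup>+y\<in>ball x r. ennreal (f y) \<partial>lebesgue))"
    using lebesgue_differentiation_lower[where 'a='a] by (elim exE conjE) (rule that)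
  have "AE x in lebesgue. \<gamma> * F x \<le> enn2real (maximal F x)"
    if F: "F \<in> borel_measurable lebesgue" "\<And>x. 0 \<le> F x" and fin: "AE x in lebesgue. maximal F x < top" for F :: "'a \<Rightarrow> real"
  proof -
    have fb: "(\<integral>\<^sup>+x\<in>ball 0 R. ennreal (F x) \<partial>lebesgue) < top" for R
    proof -
      have "\<exists>x::'a. maximal F x < top"
      proof (rule ccontr)
        assume n: "\<not> ?thesis"
        have "AE x in lebesgue. x \<notin> ball (0::'a) 1" using fin by eventually_elim (use n in blast)
        then have "emeasure lebesgue (ball (0::'a) 1) = 0"
          by (subst (asm) AE_iff_null_sets[symmetric]) (auto simp: null_sets_def simp del: emeasure_completion)
        then show False using measure_ball_pos[of 1 "0::'a"] by (simp add: emeasure_ball_eq_measure del: emeasure_completion)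
      qed
      then obtain x where x: "maximal F x < top" ..
      then obtain A where A: "maximal F x \<le> ennreal A" "0 \<le> A" by (cases "maximal F x") auto
      define R' where "R' = max R (norm x + 1)"
      have "norm x < R'" unfolding R'_def by (simp add: less_max_iff_disj)
      then have R': "0 < R'" "x \<in> ball 0 R'" using norm_ge_zero[of x] by (linarith, simp)
      have "(\<integral>\<^sup>+x\<in>ball 0 R. ennreal (F x) \<partial>lebesgue) \<le> (\<integral>\<^sup>+x\<in>ball 0 R'. ennreal \<bar>F x\<bar> \<partial>lebesgue)"
        using F(2) by (intro nn_integral_mono) (auto simp: indicator_def R'_def)
      also have "\<dots> \<le> ennreal (A * measure lebesgue (ball (0::'a) R'))"
        by (rule nn_integral_ball_le_maximal[OF R' A])
      finally show ?thesis by (simp add: le_less_trans)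
    qed
    have "AE x in lebesgue. \<exists>d>0. \<forall>r. 0 < r \<and> r < d \<longrightarrow>
        ennreal (\<gamma> * F x * measure lebesgue (ball x r)) \<le> (\<integral>\<^sup>+y\<in>ball x r. ennreal (F y) \<partial>lebesgue)"
      using F fb by (intro ld[rule_format]) auto
    then show ?thesis
      using fin
    proof eventually_elim
      case (elim x)
      then obtain d where d: "0 < d" "\<And>r. 0 < r \<Longrightarrow> r < d \<Longrightarrow>
        ennreal (\<gamma> * F x * measure lebesgue (ball x r)) \<le> (\<integral>\<^sup>+y\<in>ball x r. ennreal (F y) \<partial>lebesgue)" by auto
      obtain A where A: "maximal F x = ennreal A" "0 \<le> A" using elim by (cases "maximal F x") auto
      let ?r = "d / 2"
      have r: "0 < ?r" "?r < d" using d by auto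
      have "ennreal (\<gamma> * F x * measure lebesgue (ball x ?r)) \<le> (\<integral>\<^sup>+y\<in>ball x ?r. ennreal \<bar>F y\<bar> \<partial>lebesgue)"
        using d(2)[OF r] F(2) by simp
      also have "\<dots> \<le> ennreal (A * measure lebesgue (ball x ?r))"
        by (rule nn_integral_ball_le_maximal[of _ x]) (use r A in auto)
      finally have "\<gamma> * F x * measure lebesgue (ball x ?r) \<le> A * measure lebesgue (ball x ?r)"
        using A measure_ball_pos[OF r(1), of x] by (simp add: ennreal_le_iff)
      then have "\<gamma> * F x \<le> A" using measure_ball_pos[OF r(1), of x] by simp
      then show ?case using A by simp
    qed
  qed
  then show ?thesis using \<gamma> by (intro exI[of _ \<gamma>]) simp
qed

text \<open>A ball of radius above \<open>4 * r\<close> may be exchanged for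
  \<open>ball c (4 * r)\<close>, which contains the support of \<open>F\<close> and is smaller. The
  other balls have centre within 6 r of \<open>c\<close>, and 6 + 5 * 4 = 26.\<close>

lemma maximal_near_ball:
  fixes F :: "'a::euclidean_space \<Rightarrow> real"
  assumes F: "\<And>x. x \<notin> ball c r \<Longrightarrow> F x = 0" and r: "0 < r" and x: "x \<in> ball c (2 * r)"
    and \<theta>: "0 \<le> \<theta>" "ennreal \<theta> < maximal F x"
  obtains c' \<rho> where "0 < \<rho>" "\<rho> \<le> 4 * r" "x \<in> ball c' \<rho>" "ball c' (5 * \<rho>) \<subseteq> ball c (26 * r)"
    "ennreal (\<theta> * measure lebesgue (ball c' \<rho>)) < (\<integral>\<^sup>+y\<in>ball c' \<rho>. ennreal \<bar>F y\<bar> \<partial>lebesgue)"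
proof -
  from \<theta>(2) obtain c' \<rho> where \<rho>: "0 < \<rho>" "x \<in> ball c' \<rho>" and gt: "ennreal \<theta> < ball_avg c' \<rho> (\<lambda>y. ennreal \<bar>F y\<bar>)"
    unfolding less_maximal_iff by (elim exE conjE) (rule that)
  have gt: "ennreal (\<theta> * measure lebesgue (ball c' \<rho>)) < (\<integral>\<^sup>+y\<in>ball c' \<rho>. ennreal \<bar>F y\<bar> \<partial>lebesgue)"
    using gt unfolding not_le[symmetric] ball_avg_le_iff[OF \<rho>(1) \<theta>(1)] .
  show ?thesis
  proof (cases "\<rho> \<le> 4 * r")
    case True
    have "dist c' c \<le> dist c' x + dist x c" by (rule dist_triangle)
    then have "dist c' c + 5 * \<rho> \<le> 26 * r" using True x \<rho> by (simp add: dist_commute)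
    then show ?thesis using True \<rho> gt by (intro that[of \<rho> c'] ball_subset_ball_dist) auto
  next
    case False
    show ?thesis
    proof (rule that[of "4 * r" c])
      show "x \<in> ball c (4 * r)" using x r by auto
      show "ball c (5 * (4 * r)) \<subseteq> ball c (26 * r)" using r by (intro subset_ball) simp
      have "(4 * r) ^ DIM('a) \<le> \<rho> ^ DIM('a)" using False r by (intro power_mono) auto
      then have "measure lebesgue (ball c (4 * r)) \<le> measure lebesgue (ball c' \<rho>)"
        using r \<rho> by (simp add: measure_lebesgue_ball)
      then have "ennreal (\<theta> * measure lebesgue (ball c (4 * r))) \<le> ennreal (\<theta> * measure lebesgue (ball c' \<rho>))"
        using \<theta> by (intro ennreal_leI mult_left_mono) auto
      also note gt
      also have "(\<integral>\<^sup>+y\<in>ball c' \<rho>. ennreal \<bar>F y\<bar> \<partial>lebesgue) \<le> (\<integral>\<^sup>+y\<in>ball c (4 * r). ennreal \<bar>F y\<bar> \<partial>lebesgue)"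
      proof (rule nn_integral_mono)
        fix y show "ennreal \<bar>F y\<bar> * indicator (ball c' \<rho>) y \<le> ennreal \<bar>F y\<bar> * indicator (ball c (4 * r)) y"
          using F[of y] r by (cases "y \<in> ball c r") (auto simp: indicator_def)
      qed
      finally show "ennreal (\<theta> * measure lebesgue (ball c (4 * r))) < (\<integral>\<^sup>+y\<in>ball c (4 * r). ennreal \<bar>F y\<bar> \<partial>lebesgue)" .
    qed (use r in auto)
  qed
qed

text \<open>A localized Muckenhoupt theorem. By A_t1, the t1-th power of an average of
  \<open>F\<close> is at most \<open>\<bar>K\<bar>\<close> times the v-average of F^t1. The bound in
  L^t(v) thus follows from the strong type estimate for v dx at exponent t / t1 > 1, over balls that
  stay in the region where the weight is controlled.\<close>

lemma local_maximal:
  assumes t: "1 < t1" "t1 < t"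
  shows "\<exists>C\<ge>0. \<forall>(v::'a::euclidean_space \<Rightarrow> real) \<rho> c r F. 0 < r \<longrightarrow> dual_on t1 (ball c (26 * r)) v \<rho> \<longrightarrow>
    Ap_pair t1 K (ball c (26 * r)) v \<rho> \<longrightarrow> F \<in> borel_measurable lebesgue \<longrightarrow> (\<forall>x. 0 \<le> F x) \<longrightarrow>
    (\<forall>x. x \<notin> ball c r \<longrightarrow> F x = 0) \<longrightarrow>
    (\<integral>\<^sup>+x\<in>ball c (2 * r). ennreal (enn2real (maximal F x) powr t * v x) \<partial>lebesgue) \<le>
      ennreal C * (\<integral>\<^sup>+x. ennreal (F x powr t * v x) \<partial>lebesgue)"
proof -
  define k where "k = \<bar>K\<bar> + 1"
  define D where "D = \<bar>K\<bar> * (5 ^ DIM('a)) powr t1"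
  define s where "s = t / t1"
  define C where "C = D * s / (s - 1) * 2 powr s * k powr s"
  have s: "1 < s" using t by (simp add: s_def)
  have D: "0 \<le> D" by (simp add: D_def)
  have k: "0 < k" by (simp add: k_def add_nonneg_pos)
  have C: "0 \<le> C" using s D by (simp add: C_def)
  have ts: "t1 * s = t" "s * t1 = t" using t by (simp_all add: s_def)
  have "(\<integral>\<^sup>+x\<in>ball c (2 * r). ennreal (enn2real (maximal F x) powr t * v x) \<partial>lebesgue) \<le>
      ennreal C * (\<integral>\<^sup>+x. ennreal (F x powr t * v x) \<partial>lebesgue)"
    if r: "0 < r" and dual: "dual_on t1 (ball c (26 * r)) v \<rho>" and A: "Ap_pair t1 K (ball c (26 * r)) v \<rho>"
      and F[measurable]: "F \<in> borel_measurable lebesgue" and F0: "\<And>x. 0 \<le> F x" and Fb: "\<And>x. x \<notin> ball c r \<Longrightarrow> F x = 0"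
    for v \<rho> F :: "'a \<Rightarrow> real" and c r
  proof -
    let ?S = "ball c (26 * r)"
    have v[measurable]: "v \<in> borel_measurable lebesgue" and v0: "\<And>x. 0 \<le> v x"
      using dual by (auto simp: dual_on_def)
    have AEd: "AE x in lebesgue. x \<in> ?S \<longrightarrow> 0 < v x"
    proof -
      have "AE x in lebesgue. x \<in> ?S \<longrightarrow> 0 < v x \<and> \<rho> x = v x powr (- 1 / (t1 - 1))" using dual by (simp add: dual_on_def)
      then show ?thesis by eventually_elim simp
    qed
    let ?\<mu> = "density lebesgue (\<lambda>x. ennreal (v x))"
    \<comment> \<open>The indicator confines superlevel points to the doubled ball, where
      \<open>maximal_near_ball\<close> applies; the power \<open>t1\<close> fits the comparison of
      averages.\<close>
    define m where "m x = (enn2real (maximal F x) * indicator (ball c (2 * r)) x) powr t1" for x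
    define f where "f x = k * F x powr t1" for x
    have [measurable]: "m \<in> borel_measurable lebesgue" "f \<in> borel_measurable lebesgue"
      unfolding m_def f_def by measurable
    have em: "emeasure ?\<mu> (ball a b) = (\<integral>\<^sup>+y\<in>ball a b. ennreal (v y) \<partial>lebesgue)" for a b
      by (subst emeasure_density) auto
    have "(\<integral>\<^sup>+x. ennreal (m x powr s) \<partial>?\<mu>) \<le> ennreal (D * s / (s - 1) * 2 powr s) * (\<integral>\<^sup>+x. ennreal (f x powr s) \<partial>?\<mu>)"
    proof (rule strong_maximal[where B="{(c', \<rho>). 0 < \<rho> \<and> ball c' (5 * \<rho>) \<subseteq> ?S}"])
      show "sigma_finite_measure ?\<mu>" by (rule sigma_finite_density_real[OF v])
      fix c' \<rho>' assume "(c', \<rho>') \<in> {(c', \<rho>). 0 < \<rho> \<and> ball c' (5 * \<rho>) \<subseteq> ?S}"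
      then show "0 < \<rho>' \<and> emeasure ?\<mu> (ball c' (5 * \<rho>')) \<le> ennreal D * emeasure ?\<mu> (ball c' \<rho>')"
        unfolding em D_def using Ap_pair_doubling[OF t(1) A dual, of \<rho>' c'] by simp
    next
      fix x \<tau> assume \<tau>: "0 < \<tau>" "\<tau> < m x"
      define \<theta> where "\<theta> = \<tau> powr (1 / t1)"
      have \<theta>0: "0 < \<theta>" using \<tau> by (simp add: \<theta>_def)
      have \<theta>t: "\<theta> powr t1 = \<tau>" using \<tau> t by (simp add: \<theta>_def powr_powr)
      have x: "x \<in> ball c (2 * r)"
      proof (rule ccontr)
        assume "x \<notin> ball c (2 * r)"
        then have "m x = 0" by (simp add: m_def)
        then show False using \<tau> by simp
      qed
      have "\<theta> < enn2real (maximal F x)"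
      proof (rule ccontr)
        assume "\<not> ?thesis"
        then have "enn2real (maximal F x) powr t1 \<le> \<theta> powr t1" using t by (intro powr_mono2) auto
        then show False using \<tau> x \<theta>t by (simp add: m_def)
      qed
      then have lt: "ennreal \<theta> < maximal F x"
        using \<theta>0 by (cases "maximal F x") (auto simp: ennreal_less_iff)
      obtain c' \<rho>' where b: "0 < \<rho>'" and "\<rho>' \<le> 4 * r" and b': "x \<in> ball c' \<rho>'" "ball c' (5 * \<rho>') \<subseteq> ?S"
        and gt: "ennreal (\<theta> * measure lebesgue (ball c' \<rho>')) < (\<integral>\<^sup>+y\<in>ball c' \<rho>'. ennreal \<bar>F y\<bar> \<partial>lebesgue)"
        by (rule maximal_near_ball[OF Fb r x less_imp_le[OF \<theta>0] lt])
      note b = b b'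
      let ?m = "measure lebesgue (ball c' \<rho>')"
      have m: "0 < ?m" by (rule measure_ball_pos[OF b(1)])
      have sub: "ball c' \<rho>' \<subseteq> ?S" using b by (intro order_trans[OF subset_ball b(3)]) simp
      obtain V where V: "0 \<le> V" "(\<integral>\<^sup>+y\<in>ball c' \<rho>'. ennreal (v y) \<partial>lebesgue) = ennreal V"
        by (rule Ap_pairE[OF A b(1) sub])
      then have V0: "0 < V" using nn_integral_ball_pos[OF v AEd b(1) sub] by simp
      have If: "(\<integral>\<^sup>+y\<in>ball c' \<rho>'. ennreal (f y) \<partial>?\<mu>) = ennreal k * (\<integral>\<^sup>+y\<in>ball c' \<rho>'. ennreal (F y powr t1 * v y) \<partial>lebesgue)"
      proof -
        have "(\<integral>\<^sup>+y\<in>ball c' \<rho>'. ennreal (f y) \<partial>?\<mu>) = (\<integral>\<^sup>+y. ennreal (v y) * (ennreal (f y) * indicator (ball c' \<rho>') y) \<partial>lebesgue)"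
          by (rule nn_integral_density) measurable
        also have "\<dots> = (\<integral>\<^sup>+y. ennreal k * (ennreal (F y powr t1 * v y) * indicator (ball c' \<rho>') y) \<partial>lebesgue)"
          using v0 k by (intro nn_integral_cong) (simp add: f_def ennreal_mult mult_ac)
        also have "\<dots> = ennreal k * (\<integral>\<^sup>+y\<in>ball c' \<rho>'. ennreal (F y powr t1 * v y) \<partial>lebesgue)"
          by (rule nn_integral_cmult) measurable
        finally show ?thesis .
      qed
      have "ennreal \<tau> * ennreal V < ennreal k * (\<integral>\<^sup>+y\<in>ball c' \<rho>'. ennreal (F y powr t1 * v y) \<partial>lebesgue)"
      proof (cases "\<integral>\<^sup>+y\<in>ball c' \<rho>'. ennreal (F y powr t1 * v y) \<partial>lebesgue")
        case (real Y)
        have "(\<integral>\<^sup>+y\<in>ball c' \<rho>'. ennreal (F y) \<partial>lebesgue) \<le> ennreal ((K * Y / V) powr (1 / t1) * ?m)"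
          using real by (intro Ap_pair_average[OF t(1) A dual F F0 b(1) sub _ _ V0 V(2)]) auto
        then have "ennreal (\<theta> * ?m) < ennreal ((K * Y / V) powr (1 / t1) * ?m)"
          using gt F0 by simp
        then have "\<theta> * ?m < (K * Y / V) powr (1 / t1) * ?m" using \<theta>0 m by (simp add: ennreal_less_iff)
        then have "\<theta> < (K * Y / V) powr (1 / t1)" using m by simp
        then have "\<theta> powr t1 < ((K * Y / V) powr (1 / t1)) powr t1" using \<theta>0 t by (intro powr_less_mono2) auto
        then have "\<tau> < \<bar>K * Y / V\<bar>" unfolding \<theta>t using t by (simp add: powr_powr)
        then have "\<tau> * V < \<bar>K\<bar> * Y" using V0 real by (simp add: abs_mult field_simps)
        also have "\<dots> \<le> k * Y" using real by (intro mult_right_mono) (auto simp: k_def)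
        finally show ?thesis unfolding real using \<tau> V k real by (simp flip: ennreal_mult add: ennreal_less_iff)
      next
        case top
        then show ?thesis using k \<tau> V by (simp add: ennreal_mult_top flip: ennreal_mult)
      qed
      then show "\<exists>c' \<rho>. (c', \<rho>) \<in> {(c', \<rho>). 0 < \<rho> \<and> ball c' (5 * \<rho>) \<subseteq> ?S} \<and> x \<in> ball c' \<rho> \<and>
          ennreal \<tau> * emeasure ?\<mu> (ball c' \<rho>) < (\<integral>\<^sup>+y\<in>ball c' \<rho>. ennreal (f y) \<partial>?\<mu>)"
        using b by (intro exI[of _ c'] exI[of _ \<rho>'] conjI) (simp_all add: em V If del: mem_ball)
    qed (use s D k in \<open>auto simp: m_def f_def\<close>)
    also have "(\<integral>\<^sup>+x. ennreal (m x powr s) \<partial>?\<mu>) = (\<integral>\<^sup>+x\<in>ball c (2 * r). ennreal (enn2real (maximal F x) powr t * v x) \<partial>lebesgue)"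
    proof -
      have "(\<integral>\<^sup>+x. ennreal (m x powr s) \<partial>?\<mu>) = (\<integral>\<^sup>+x. ennreal (v x) * ennreal (m x powr s) \<partial>lebesgue)"
        by (rule nn_integral_density) measurable
      also have "\<dots> = (\<integral>\<^sup>+x\<in>ball c (2 * r). ennreal (enn2real (maximal F x) powr t * v x) \<partial>lebesgue)"
      proof (rule nn_integral_cong)
        fix x show "ennreal (v x) * ennreal (m x powr s) = ennreal (enn2real (maximal F x) powr t * v x) * indicator (ball c (2 * r)) x"
          using v0 s t by (cases "x \<in> ball c (2 * r)") (simp_all add: m_def powr_powr ts ennreal_mult mult.commute)
      qed
      finally show ?thesis .
    qed
    also have "(\<integral>\<^sup>+x. ennreal (f x powr s) \<partial>?\<mu>) = ennreal (k powr s) * (\<integral>\<^sup>+x. ennreal (F x powr t * v x) \<partial>lebesgue)"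
    proof -
      have "(\<integral>\<^sup>+x. ennreal (f x powr s) \<partial>?\<mu>) = (\<integral>\<^sup>+x. ennreal (v x) * ennreal (f x powr s) \<partial>lebesgue)"
        by (rule nn_integral_density) measurable
      also have "\<dots> = (\<integral>\<^sup>+x. ennreal (k powr s) * ennreal (F x powr t * v x) \<partial>lebesgue)"
        using v0 by (intro nn_integral_cong) (simp add: f_def powr_mult powr_powr ts ennreal_mult mult_ac)
      also have "\<dots> = ennreal (k powr s) * (\<integral>\<^sup>+x. ennreal (F x powr t * v x) \<partial>lebesgue)"
        by (rule nn_integral_cmult) measurable
      finally show ?thesis .
    qed
    also have "ennreal (D * s / (s - 1) * 2 powr s) * (ennreal (k powr s) * (\<integral>\<^sup>+x. ennreal (F x powr t * v x) \<partial>lebesgue)) =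
      ennreal C * (\<integral>\<^sup>+x. ennreal (F x powr t * v x) \<partial>lebesgue)"
      unfolding C_def using s D by (subst ennreal_mult[of "D * s / (s - 1) * 2 powr s"]) (auto simp: mult.assoc)
    finally show ?thesis .
  qed
  note main = this
  show ?thesis by (intro exI[of _ C] conjI C allI impI) (rule main, auto)
qed

section \<open>The local estimate\<close>

lemma dual_on_powr_eq_1:
  assumes p: "1 < p" and D: "dual_on p S w \<sigma>"
  shows "AE x in lebesgue. x \<in> S \<longrightarrow> w x powr (1 / p) * \<sigma> x powr (1 - 1 / p) = 1"
proof -
  have e: "- 1 / (p - 1) * (1 - 1 / p) = - (1 / p)" using p by (simp add: field_simps)
  have "AE x in lebesgue. x \<in> S \<longrightarrow> 0 < w x \<and> \<sigma> x = w x powr (- 1 / (p - 1))" using D by (simp add: dual_on_def)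
  then show ?thesis
  proof eventually_elim
    case (elim x)
    show ?case
    proof
      assume "x \<in> S"
      then have w: "0 < w x" "\<sigma> x = w x powr (- 1 / (p - 1))" using elim by auto
      have "w x powr (1 / p) * \<sigma> x powr (1 - 1 / p) = w x powr (1 / p) * w x powr (- (1 / p))"
        unfolding w(2) powr_powr e ..
      also have "\<dots> = 1" using w(1) by (simp flip: powr_add)
      finally show "w x powr (1 / p) * \<sigma> x powr (1 - 1 / p) = 1" .
    qed
  qed
qed

text \<open>The converse of the A_p inequality, which is plain Hoelder. It serves to cancel the
  masses of \<open>w\<close> and \<open>\<sigma>\<close> in the contribution from outside the
  doubled ball.\<close>

lemma measure_ball_le_dual:
  fixes w \<sigma> :: "'a::euclidean_space \<Rightarrow> real"
  assumes p: "1 < p" and D: "dual_on p S w \<sigma>" and r: "ball c r \<subseteq> S"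
    and W: "0 \<le> W" "(\<integral>\<^sup>+y\<in>ball c r. ennreal (w y) \<partial>lebesgue) = ennreal W"
    and V: "0 \<le> V" "(\<integral>\<^sup>+y\<in>ball c r. ennreal (\<sigma> y) \<partial>lebesgue) = ennreal V"
  shows "measure lebesgue (ball c r) \<le> W powr (1 / p) * V powr (1 - 1 / p)"
proof -
  have [measurable]: "w \<in> borel_measurable lebesgue" "\<sigma> \<in> borel_measurable lebesgue" and w0: "\<And>x. 0 \<le> w x" "\<And>x. 0 \<le> \<sigma> x"
    using D by (auto simp: dual_on_def)
  let ?f = "\<lambda>y. w y * indicator (ball c r) y" and ?g = "\<lambda>y. \<sigma> y * indicator (ball c r) y"
  have "ennreal (measure lebesgue (ball c r)) = (\<integral>\<^sup>+y. indicator (ball c r) y \<partial>lebesgue)"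
    by (simp add: emeasure_ball_eq_measure del: emeasure_completion)
  also have "\<dots> = (\<integral>\<^sup>+y. ennreal (?f y powr (1 / p) * ?g y powr (1 - 1 / p)) \<partial>lebesgue)"
  proof (rule nn_integral_cong_AE)
    show "AE y in lebesgue. indicator (ball c r) y = ennreal (?f y powr (1 / p) * ?g y powr (1 - 1 / p))"
      using dual_on_powr_eq_1[OF p D]
    proof eventually_elim
      case (elim y)
      then show ?case using r by (cases "y \<in> ball c r") (auto simp del: mem_ball)
    qed
  qed
  also have "\<dots> \<le> ennreal (W powr (1 / p) * V powr (1 - 1 / p))"
    by (rule nn_integral_holder_le) (use p w0 W V in \<open>auto simp: nn_integral_times_indicator\<close>)
  finally show ?thesis using W V by (simp add: ennreal_le_iff)
qed

text \<open>Hoelder for the measure v dx on the ball passes from the exponent \<open>t1\<close> of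
  the weight class to the larger \<open>t\<close>, the exponent in which the test function is
  controlled.\<close>

lemma Ap_pair_average_higher:
  fixes v \<rho> f :: "'a::euclidean_space \<Rightarrow> real"
  assumes t: "1 < t1" "t1 < t" and A: "Ap_pair t1 K S v \<rho>" and D: "dual_on t1 S v \<rho>" and K: "0 \<le> K"
    and f[measurable]: "f \<in> borel_measurable lebesgue" and f0: "\<And>x. 0 \<le> f x"
    and r: "0 < r" "ball c r \<subseteq> S"
    and Y: "0 \<le> Y" "(\<integral>\<^sup>+y\<in>ball c r. ennreal (f y powr t * v y) \<partial>lebesgue) \<le> ennreal Y"
    and V: "0 < V" "(\<integral>\<^sup>+y\<in>ball c r. ennreal (v y) \<partial>lebesgue) = ennreal V"
  shows "(\<integral>\<^sup>+y\<in>ball c r. ennreal (f y) \<partial>lebesgue) \<le>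
    ennreal (K powr (1 / t1) * (Y / V) powr (1 / t) * measure lebesgue (ball c r))"
proof -
  have [measurable]: "v \<in> borel_measurable lebesgue" and v0: "\<And>x. 0 \<le> v x" using D by (auto simp: dual_on_def)
  define \<theta> where "\<theta> = t1 / t"
  have \<theta>: "0 < \<theta>" "\<theta> < 1" using t by (auto simp: \<theta>_def)
  have t\<theta>: "t * \<theta> = t1" using t by (simp add: \<theta>_def)
  let ?f = "\<lambda>y. f y powr t * v y * indicator (ball c r) y" and ?g = "\<lambda>y. v y * indicator (ball c r) y"
  have "(\<integral>\<^sup>+y\<in>ball c r. ennreal (f y powr t1 * v y) \<partial>lebesgue) = (\<integral>\<^sup>+y. ennreal (?f y powr \<theta> * ?g y powr (1 - \<theta>)) \<partial>lebesgue)"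
  proof (rule nn_integral_cong)
    fix y
    show "ennreal (f y powr t1 * v y) * indicator (ball c r) y = ennreal (?f y powr \<theta> * ?g y powr (1 - \<theta>))"
    proof (cases "y \<in> ball c r")
      case True
      have "v y powr \<theta> * v y powr (1 - \<theta>) = v y" using v0[of y] by (cases "v y = 0") (auto simp flip: powr_add)
      then have "?f y powr \<theta> * ?g y powr (1 - \<theta>) = f y powr t1 * v y"
        using True by (simp add: powr_mult powr_powr t\<theta> mult.assoc)
      then show ?thesis using True by simp
    qed simp
  qed
  also have "\<dots> \<le> ennreal (Y powr \<theta> * V powr (1 - \<theta>))"
    by (rule nn_integral_holder_le) (use \<theta> v0 Y V in \<open>auto simp: nn_integral_times_indicator\<close>)
  finally have "(\<integral>\<^sup>+y\<in>ball c r. ennreal (f y) \<partial>lebesgue) \<le>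
     ennreal ((K * (Y powr \<theta> * V powr (1 - \<theta>)) / V) powr (1 / t1) * measure lebesgue (ball c r))"
    by (intro Ap_pair_average[OF t(1) A D f f0 r _ _ V]) auto
  also have "(K * (Y powr \<theta> * V powr (1 - \<theta>)) / V) powr (1 / t1) = K powr (1 / t1) * (Y / V) powr (1 / t)"
  proof -
    have "K * (Y powr \<theta> * V powr (1 - \<theta>)) / V = K * (Y / V) powr \<theta>"
      using V(1) Y(1) by (simp add: powr_diff powr_divide)
    moreover have "\<theta> * (1 / t1) = 1 / t" using t by (simp add: \<theta>_def)
    ultimately show ?thesis by (simp only: powr_mult powr_powr)
  qed
  finally show ?thesis .
qed

text \<open>The step common to p > 1, with u = h w, and p = 1, with u = w. The weight M(F)^(1/a)
  dominates \<open>u\<close> on the ball up to \<gamma> and has an A_1 constant \<open>k\<close>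
  independent of \<open>u\<close>, so the hypothesis passes from \<open>f\<close> to
  \<open>g\<close>. The part \<open>near\<close> is left as an assumption because it depends on the
  class of the weight.\<close>

lemma maximal_power_transfer:
  fixes f g u :: "'a::euclidean_space \<Rightarrow> real"
  assumes a: "1 < a" "a \<le> s"
    and CR: "\<forall>F::'a \<Rightarrow> real. F \<in> borel_measurable lebesgue \<longrightarrow> (AE x in lebesgue. maximal F x < top) \<longrightarrow>
      A1_bound k (\<lambda>x. enn2real (maximal F x) powr (1 / a))"
    and \<gamma>: "0 < \<gamma>" and LB: "\<forall>F::'a \<Rightarrow> real. F \<in> borel_measurable lebesgue \<longrightarrow> (\<forall>x. 0 \<le> F x) \<longrightarrow>
      (AE x in lebesgue. maximal F x < top) \<longrightarrow> (AE x in lebesgue. \<gamma> * F x \<le> enn2real (maximal F x))"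
    and C2: "0 \<le> C2" and H: "\<And>v A. A1_bound k v \<Longrightarrow> 0 \<le> A \<Longrightarrow> (\<integral>\<^sup>+x. ennreal (f x * v x) \<partial>lebesgue) \<le> ennreal A \<Longrightarrow>
      (\<integral>\<^sup>+x. ennreal (g x * v x) \<partial>lebesgue) \<le> ennreal (C2 * A)"
    and fg[measurable]: "f \<in> borel_measurable lebesgue" "g \<in> borel_measurable lebesgue"
    and f0: "\<And>x. 0 \<le> f x" and g0: "\<And>x. 0 \<le> g x"
    and u[measurable]: "u \<in> borel_measurable lebesgue" and u0: "\<And>x. 0 \<le> u x" and r: "0 < r"
    and F_def: "\<And>x. F x = (u x * indicator (ball c r) x) powr a"
    and Av0: "0 \<le> Av" and IF: "(\<integral>\<^sup>+x. ennreal \<bar>F x\<bar> \<partial>lebesgue) \<le> ennreal (Av * measure lebesgue (ball c r))"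
    and N: "0 \<le> N" and near: "(\<integral>\<^sup>+x\<in>ball c (2 * r). ennreal (f x * enn2real (maximal F x) powr (1 / a)) \<partial>lebesgue) \<le> ennreal N"
    and X: "0 \<le> X" and ii: "(\<integral>\<^sup>+x. ennreal (f x * enn2real (maximal (indicator (ball c r)) x) powr (1 / s)) \<partial>lebesgue) \<le> ennreal X"
  shows "(\<integral>\<^sup>+x\<in>ball c r. ennreal (g x * u x) \<partial>lebesgue) \<le>
    ennreal ((1 / \<gamma>) powr (1 / a) * C2 * (N + (5 ^ DIM('a) * Av) powr (1 / a) * X))"
proof -
  let ?B = "ball c r" and ?B2 = "ball c (2 * r)" and ?n = "DIM('a)"
  have F[measurable]: "F \<in> borel_measurable lebesgue" unfolding F_def[abs_def] by measurable
  have F0: "0 \<le> F x" for x by (simp add: F_def)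
  have Fb: "F x = 0" if "x \<notin> ?B" for x using that by (simp add: F_def del: mem_ball)
  have fin: "AE x in lebesgue. maximal F x < top"
    using IF by (intro AE_maximal_finite F) (simp add: le_less_trans)
  define v where "v x = enn2real (maximal F x) powr (1 / a)" for x
  have vm[measurable]: "v \<in> borel_measurable lebesgue" unfolding v_def by measurable
  have v0: "0 \<le> v x" for x by (simp add: v_def)
  have Av1: "A1_bound k v" unfolding v_def using CR F fin by blast
  have far: "(\<integral>\<^sup>+x\<in>- ?B2. ennreal (f x * v x) \<partial>lebesgue) \<le> ennreal ((5 ^ ?n * Av) powr (1 / a) * X)"
  proof -
    have "(\<integral>\<^sup>+x\<in>- ?B2. ennreal (f x * v x) \<partial>lebesgue) \<le>
       (\<integral>\<^sup>+x. ennreal ((5 ^ ?n * Av) powr (1 / a)) * ennreal (f x * enn2real (maximal (indicator ?B) x) powr (1 / s)) \<partial>lebesgue)"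
    proof (rule nn_integral_mono)
      fix x
      let ?M = "enn2real (maximal (indicator ?B) x)"
      show "ennreal (f x * v x) * indicator (- ?B2) x \<le> ennreal ((5 ^ ?n * Av) powr (1 / a)) * ennreal (f x * ?M powr (1 / s))"
      proof (cases "x \<in> ?B2")
        case False
        have M: "maximal (indicator ?B) x = ennreal ?M" "?M \<le> 1"
          using maximal_indicator_le_1[of c r x] by (cases "maximal (indicator ?B) x"; simp add: top_unique)+
        have "maximal F x \<le> ennreal (5 ^ ?n * Av) * maximal (indicator ?B) x"
          by (rule maximal_far[OF Fb r Av0 IF False])
        also have "\<dots> = ennreal (5 ^ ?n * Av * ?M)" by (subst M(1)) (use Av0 in \<open>simp add: ennreal_mult''\<close>)
        finally have "enn2real (maximal F x) \<le> 5 ^ ?n * Av * ?M" using Av0 by (intro enn2real_leI) auto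
        then have "v x \<le> (5 ^ ?n * Av * ?M) powr (1 / a)" unfolding v_def using a by (intro powr_mono2) auto
        also have "\<dots> = (5 ^ ?n * Av) powr (1 / a) * ?M powr (1 / a)" by (rule powr_mult)
        \<comment> \<open>Since \<open>?M \<le> 1\<close>, the larger exponent \<open>1 / a\<close>
          gives the smaller power; this is where \<open>a \<le> s\<close> enters.\<close>
        also have "\<dots> \<le> (5 ^ ?n * Av) powr (1 / a) * ?M powr (1 / s)"
          using M(2) a by (intro mult_left_mono powr_mono') (auto simp: frac_le)
        finally have "f x * v x \<le> (5 ^ ?n * Av) powr (1 / a) * (f x * ?M powr (1 / s))"
          using f0[of x] by (metis mult.left_commute mult_left_mono)
        then show ?thesis using f0[of x] False by (simp flip: ennreal_mult add: ennreal_leI del: mem_ball)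
      qed simp
    qed
    also have "\<dots> = ennreal ((5 ^ ?n * Av) powr (1 / a)) * (\<integral>\<^sup>+x. ennreal (f x * enn2real (maximal (indicator ?B) x) powr (1 / s)) \<partial>lebesgue)"
      by (rule nn_integral_cmult) measurable
    also have "\<dots> \<le> ennreal ((5 ^ ?n * Av) powr (1 / a)) * ennreal X"
      by (intro mult_left_mono ii) simp
    also have "\<dots> = ennreal ((5 ^ ?n * Av) powr (1 / a) * X)"
      using X by (simp flip: ennreal_mult)
    finally show ?thesis .
  qed
  let ?N = "N + (5 ^ ?n * Av) powr (1 / a) * X"
  have "(\<integral>\<^sup>+x. ennreal (f x * v x) \<partial>lebesgue) = (\<integral>\<^sup>+x. ennreal (f x * v x) * indicator ?B2 x + ennreal (f x * v x) * indicator (- ?B2) x \<partial>lebesgue)"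
    by (intro nn_integral_cong) (auto simp: indicator_def)
  also have "\<dots> = (\<integral>\<^sup>+x\<in>?B2. ennreal (f x * v x) \<partial>lebesgue) + (\<integral>\<^sup>+x\<in>- ?B2. ennreal (f x * v x) \<partial>lebesgue)"
    by (rule nn_integral_add) measurable
  also have "\<dots> \<le> ennreal N + ennreal ((5 ^ ?n * Av) powr (1 / a) * X)"
    using near far by (intro add_mono) (simp_all add: v_def)
  also have "\<dots> = ennreal (N + (5 ^ ?n * Av) powr (1 / a) * X)"
    using N X by (simp flip: ennreal_plus)
  finally have fv: "(\<integral>\<^sup>+x. ennreal (f x * v x) \<partial>lebesgue) \<le> ennreal ?N" .
  have kLJ: "0 \<le> ?N" using N X by simp
  have gv: "(\<integral>\<^sup>+x. ennreal (g x * v x) \<partial>lebesgue) \<le> ennreal (C2 * (?N))"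
    by (rule H[OF Av1 kLJ fv])
  have "AE x in lebesgue. \<gamma> * F x \<le> enn2real (maximal F x)" using LB F F0 fin by blast
  then have "AE x in lebesgue. ennreal (g x * u x) * indicator ?B x \<le> ennreal ((1 / \<gamma>) powr (1 / a)) * ennreal (g x * v x)"
  proof eventually_elim
    case (elim x)
    show ?case
    proof (cases "x \<in> ?B")
      case True
      have "u x = F x powr (1 / a)" using a True u0[of x] by (simp add: F_def powr_powr)
      also have "\<dots> \<le> (1 / \<gamma> * enn2real (maximal F x)) powr (1 / a)"
        using elim \<gamma> F0 a by (intro powr_mono2) (auto simp: field_simps)
      also have "\<dots> = (1 / \<gamma>) powr (1 / a) * v x" unfolding v_def by (rule powr_mult)
      finally have "g x * u x \<le> g x * ((1 / \<gamma>) powr (1 / a) * v x)" by (rule mult_left_mono[OF _ g0])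
      then have "g x * u x \<le> (1 / \<gamma>) powr (1 / a) * (g x * v x)" by (simp only: mult_ac)
      then show ?thesis using True g0[of x] v0[of x] by (simp flip: ennreal_mult add: ennreal_leI)
    qed simp
  qed
  then have "(\<integral>\<^sup>+x\<in>?B. ennreal (g x * u x) \<partial>lebesgue) \<le> (\<integral>\<^sup>+x. ennreal ((1 / \<gamma>) powr (1 / a)) * ennreal (g x * v x) \<partial>lebesgue)"
    by (rule nn_integral_mono_AE)
  also have "\<dots> = ennreal ((1 / \<gamma>) powr (1 / a)) * (\<integral>\<^sup>+x. ennreal (g x * v x) \<partial>lebesgue)"
    by (rule nn_integral_cmult) measurable
  also have "\<dots> \<le> ennreal ((1 / \<gamma>) powr (1 / a)) * ennreal (C2 * (?N))" by (intro mult_left_mono gv) simp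
  also have "\<dots> = ennreal ((1 / \<gamma>) powr (1 / a) * C2 * ?N)"
    using C2 kLJ by (subst ennreal_mult[symmetric]) (auto simp: mult.assoc)
  finally show ?thesis .
qed

text \<open>Because a t = p', the function F = (h w)^a on the ball satisfies: the integral of F^t
  \<sigma> equals that of h^p' w. Near the ball, f w^(1/p) is paired with M(F)^(1/a) \<sigma>^(1/p')
  and the local maximal theorem is used for \<sigma>. Far away, the average of \<open>F\<close> and
  assumption \<open>ii\<close> decide.\<close>

lemma core_dual_estimate:
  fixes f g h w \<sigma> \<rho> :: "'a::euclidean_space \<Rightarrow> real"
  assumes p: "1 < p" and a: "1 < a" "a \<le> s" and t: "1 < t1" "t1 < t" and at: "a * t = p / (p - 1)"
    and CR: "\<forall>F::'a \<Rightarrow> real. F \<in> borel_measurable lebesgue \<longrightarrow> (AE x in lebesgue. maximal F x < top) \<longrightarrow>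
      A1_bound k (\<lambda>x. enn2real (maximal F x) powr (1 / a))"
    and \<gamma>: "0 < \<gamma>" and LB: "\<forall>F::'a \<Rightarrow> real. F \<in> borel_measurable lebesgue \<longrightarrow> (\<forall>x. 0 \<le> F x) \<longrightarrow>
      (AE x in lebesgue. maximal F x < top) \<longrightarrow> (AE x in lebesgue. \<gamma> * F x \<le> enn2real (maximal F x))"
    and C1: "0 \<le> C1" and LM: "\<forall>(v::'a::euclidean_space \<Rightarrow> real) \<rho> c r F. 0 < r \<longrightarrow> dual_on t1 (ball c (26 * r)) v \<rho> \<longrightarrow>
      Ap_pair t1 K' (ball c (26 * r)) v \<rho> \<longrightarrow> F \<in> borel_measurable lebesgue \<longrightarrow> (\<forall>x. 0 \<le> F x) \<longrightarrow>
      (\<forall>x. x \<notin> ball c r \<longrightarrow> F x = 0) \<longrightarrow>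
      (\<integral>\<^sup>+x\<in>ball c (2 * r). ennreal (enn2real (maximal F x) powr t * v x) \<partial>lebesgue) \<le>
      ennreal C1 * (\<integral>\<^sup>+x. ennreal (F x powr t * v x) \<partial>lebesgue)"
    and C2: "0 \<le> C2" and H: "\<And>v A. A1_bound k v \<Longrightarrow> 0 \<le> A \<Longrightarrow> (\<integral>\<^sup>+x. ennreal (f x * v x) \<partial>lebesgue) \<le> ennreal A \<Longrightarrow>
      (\<integral>\<^sup>+x. ennreal (g x * v x) \<partial>lebesgue) \<le> ennreal (C2 * A)"
    and fg[measurable]: "f \<in> borel_measurable lebesgue" "g \<in> borel_measurable lebesgue"
    and f0: "\<And>x. 0 \<le> f x" and g0: "\<And>x. 0 \<le> g x"
    and r: "0 < r" and D: "dual_on p (ball c (26 * r)) w \<sigma>" and Dt: "dual_on t1 (ball c (26 * r)) \<sigma> \<rho>"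
    and A: "Ap_pair t1 K' (ball c (26 * r)) \<sigma> \<rho>" and K': "0 \<le> K'"
    and W: "0 < W" "(\<integral>\<^sup>+x\<in>ball c r. ennreal (w x) \<partial>lebesgue) = ennreal W"
    and L: "0 \<le> L"
    and i: "(\<integral>\<^sup>+x\<in>ball c (2 * r). ennreal (f x powr p * w x) \<partial>lebesgue) \<le> ennreal (L powr p)"
    and ii: "(\<integral>\<^sup>+x. ennreal (f x * enn2real (maximal (indicator (ball c r)) x) powr (1 / s)) \<partial>lebesgue) \<le>
      ennreal (L * measure lebesgue (ball c r) / W powr (1 / p))"
    and h[measurable]: "h \<in> borel_measurable lebesgue" and h0: "\<And>x. 0 \<le> h x"
    and J: "0 \<le> J" "(\<integral>\<^sup>+x\<in>ball c r. ennreal (h x powr (p / (p - 1)) * w x) \<partial>lebesgue) \<le> ennreal J"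
  shows "(\<integral>\<^sup>+x\<in>ball c r. ennreal (g x * h x * w x) \<partial>lebesgue) \<le>
    ennreal ((1 / \<gamma>) powr (1 / a) * C2 * (C1 powr (1 - 1 / p) + (5 ^ DIM('a) * K' powr (1 / t1)) powr (1 / a)) * L * J powr (1 - 1 / p))"
proof -
  let ?B = "ball c r" and ?B2 = "ball c (2 * r)" and ?S = "ball c (26 * r)" and ?n = "DIM('a)"
  let ?m = "measure lebesgue ?B"
  define p' where "p' = p / (p - 1)"
  have p': "1 < p'" using p by (simp add: p'_def)
  have p'i: "1 / p' = 1 - 1 / p" using p by (simp add: p'_def field_simps)
  have at': "a * t = p'" by (simp add: p'_def at)
  have m: "0 < ?m" by (rule measure_ball_pos[OF r])
  have sub1: "?B \<subseteq> ?S" and sub2: "?B2 \<subseteq> ?S" using r by (auto intro!: subset_ball simp del: mem_ball)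
  have [measurable]: "w \<in> borel_measurable lebesgue" "\<sigma> \<in> borel_measurable lebesgue" and w0: "\<And>x. 0 \<le> w x" "\<And>x. 0 \<le> \<sigma> x"
    using D by (auto simp: dual_on_def)
  obtain V where V: "0 \<le> V" "(\<integral>\<^sup>+y\<in>?B. ennreal (\<sigma> y) \<partial>lebesgue) = ennreal V"
    by (rule Ap_pairE[OF A r sub1])
  have "AE x in lebesgue. x \<in> ?S \<longrightarrow> 0 < \<sigma> x \<and> \<rho> x = \<sigma> x powr (- 1 / (t1 - 1))" using Dt by (simp add: dual_on_def)
  then have "AE x in lebesgue. x \<in> ?S \<longrightarrow> 0 < \<sigma> x" by eventually_elim simp
  then have V0: "0 < V" using V nn_integral_ball_pos[of \<sigma> ?S r c] r sub1 by simp
  define F where "F x = (h x * w x * indicator ?B x) powr a" for x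
  have F[measurable]: "F \<in> borel_measurable lebesgue" unfolding F_def by measurable
  have F0: "0 \<le> F x" for x by (simp add: F_def)
  have Fb: "F x = 0" if "x \<notin> ?B" for x using that by (simp add: F_def del: mem_ball)
  have AEd: "AE x in lebesgue. x \<in> ?S \<longrightarrow> 0 < w x \<and> \<sigma> x = w x powr (- 1 / (p - 1))" using D by (simp add: dual_on_def)
  have IFt: "(\<integral>\<^sup>+x. ennreal (F x powr t * \<sigma> x) \<partial>lebesgue) \<le> ennreal J"
  proof -
    have "(\<integral>\<^sup>+x. ennreal (F x powr t * \<sigma> x) \<partial>lebesgue) = (\<integral>\<^sup>+x\<in>?B. ennreal (h x powr p' * w x) \<partial>lebesgue)"
    proof (rule nn_integral_cong_AE)
      show "AE x in lebesgue. ennreal (F x powr t * \<sigma> x) = ennreal (h x powr p' * w x) * indicator ?B x"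
        using AEd
      proof eventually_elim
        case (elim x)
        show ?case
        proof (cases "x \<in> ?B")
          case True
          then have "x \<in> ?S" using sub1 by blast
          then have wx: "0 < w x" "\<sigma> x = w x powr (- 1 / (p - 1))" using elim by auto
          have e: "p' + - 1 / (p - 1) = 1" using p by (simp add: p'_def diff_divide_distrib[symmetric])
          have "F x powr t * \<sigma> x = h x powr p' * (w x powr p' * w x powr (- 1 / (p - 1)))"
            unfolding wx(2) F_def using True by (simp only: powr_powr at' powr_mult indicator_simps mult_1_right mult.assoc)
          also have "w x powr p' * w x powr (- 1 / (p - 1)) = w x powr (p' + - 1 / (p - 1))" by (rule powr_add[symmetric])
          also have "\<dots> = w x" unfolding e using wx(1) by simp
          finally show ?thesis using True by simp
        next
          case False
          then show ?thesis using Fb[OF False] by (simp del: mem_ball)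
        qed
      qed
    qed
    then show ?thesis using J(2) by (simp add: p'_def)
  qed
  define Av where "Av = K' powr (1 / t1) * (J / V) powr (1 / t)"
  have Av0: "0 \<le> Av" by (simp add: Av_def)
  have IF: "(\<integral>\<^sup>+x. ennreal \<bar>F x\<bar> \<partial>lebesgue) \<le> ennreal (Av * ?m)"
  proof -
    have "(\<integral>\<^sup>+x. ennreal \<bar>F x\<bar> \<partial>lebesgue) = (\<integral>\<^sup>+x\<in>?B. ennreal (F x) \<partial>lebesgue)"
    proof (rule nn_integral_cong)
      fix x show "ennreal \<bar>F x\<bar> = ennreal (F x) * indicator ?B x"
        using Fb[of x] F0[of x] by (cases "x \<in> ?B") (simp_all del: mem_ball)
    qed
    also have "\<dots> \<le> ennreal (K' powr (1 / t1) * (J / V) powr (1 / t) * ?m)"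
    proof (rule Ap_pair_average_higher[OF t A Dt K' F F0 r sub1 J(1) _ V0 V(2)])
      have "(\<integral>\<^sup>+y\<in>?B. ennreal (F y powr t * \<sigma> y) \<partial>lebesgue) \<le> (\<integral>\<^sup>+x. ennreal (F x powr t * \<sigma> x) \<partial>lebesgue)"
        by (intro nn_integral_mono) (auto simp: indicator_def)
      then show "(\<integral>\<^sup>+y\<in>?B. ennreal (F y powr t * \<sigma> y) \<partial>lebesgue) \<le> ennreal J" using IFt by (rule order_trans)
    qed
    finally show ?thesis unfolding Av_def .
  qed
  define v where "v x = enn2real (maximal F x) powr (1 / a)" for x
  have vm[measurable]: "v \<in> borel_measurable lebesgue" unfolding v_def by measurable
  have near: "(\<integral>\<^sup>+x\<in>?B2. ennreal (f x * v x) \<partial>lebesgue) \<le> ennreal (L * (C1 * J) powr (1 - 1 / p))"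
  proof -
    have "(\<integral>\<^sup>+x\<in>?B2. ennreal (enn2real (maximal F x) powr t * \<sigma> x) \<partial>lebesgue) \<le> ennreal C1 * (\<integral>\<^sup>+x. ennreal (F x powr t * \<sigma> x) \<partial>lebesgue)"
      using r Dt A F F0 Fb by (intro LM[rule_format]) auto
    also have "\<dots> \<le> ennreal C1 * ennreal J" by (intro mult_left_mono IFt) simp
    also have "\<dots> = ennreal (C1 * J)" using C1 J by (simp flip: ennreal_mult)
    finally have lm: "(\<integral>\<^sup>+x\<in>?B2. ennreal (enn2real (maximal F x) powr t * \<sigma> x) \<partial>lebesgue) \<le> ennreal (C1 * J)" .
    let ?f = "\<lambda>x. f x powr p * w x * indicator ?B2 x" and ?g = "\<lambda>x. enn2real (maximal F x) powr t * \<sigma> x * indicator ?B2 x"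
    have "(\<integral>\<^sup>+x\<in>?B2. ennreal (f x * v x) \<partial>lebesgue) = (\<integral>\<^sup>+x. ennreal (?f x powr (1 / p) * ?g x powr (1 - 1 / p)) \<partial>lebesgue)"
    proof (rule nn_integral_cong_AE)
      show "AE x in lebesgue. ennreal (f x * v x) * indicator ?B2 x = ennreal (?f x powr (1 / p) * ?g x powr (1 - 1 / p))"
        using dual_on_powr_eq_1[OF p D]
      proof eventually_elim
        case (elim x)
        show ?case
        proof (cases "x \<in> ?B2")
          case True
          then have one: "w x powr (1 / p) * \<sigma> x powr (1 - 1 / p) = 1" using elim sub2 by blast
          have ta: "t * (1 - 1 / p) = 1 / a" using at' a p' unfolding p'i[symmetric] by (simp add: field_simps)
          have pp: "p * (1 / p) = 1" using p by simp
          have "?f x powr (1 / p) * ?g x powr (1 - 1 / p) = f x powr 1 * w x powr (1 / p) * (v x * \<sigma> x powr (1 - 1 / p))"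
            using True by (simp only: powr_mult powr_powr ta pp indicator_simps mult_1_right v_def)
          also have "\<dots> = f x * v x * (w x powr (1 / p) * \<sigma> x powr (1 - 1 / p))" using f0[of x] by simp
          finally show ?thesis using True one by simp
        qed simp
      qed
    qed
    also have "\<dots> \<le> ennreal ((L powr p) powr (1 / p) * (C1 * J) powr (1 - 1 / p))"
      by (rule nn_integral_holder_le) (use p w0 i lm C1 J in \<open>auto simp: nn_integral_times_indicator\<close>)
    also have "(L powr p) powr (1 / p) = L" using p L by (simp add: powr_powr)
    finally show ?thesis .
  qed
  let ?k = "C1 powr (1 - 1 / p) + (5 ^ ?n * K' powr (1 / t1)) powr (1 / a)"
  let ?J = "J powr (1 - 1 / p)"
  let ?X = "L * ?m / W powr (1 / p)"
  have "(\<integral>\<^sup>+x\<in>?B. ennreal (g x * (h x * w x)) \<partial>lebesgue) \<le>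
    ennreal ((1 / \<gamma>) powr (1 / a) * C2 * (L * (C1 * J) powr (1 - 1 / p) + (5 ^ ?n * Av) powr (1 / a) * ?X))"
    by (rule maximal_power_transfer[OF a CR \<gamma> LB C2 H fg f0 g0 _ _ r F_def Av0 IF _ near[unfolded v_def] _ ii])
       (use h0 w0 L m in auto)
  also have "\<dots> \<le> ennreal ((1 / \<gamma>) powr (1 / a) * C2 * (?k * L * ?J))"
  proof (intro ennreal_leI mult_left_mono)
    have e1: "1 / t * (1 / a) = 1 - 1 / p" using at' p' a t unfolding p'i[symmetric] by (simp add: field_simps)
    have "(5 ^ ?n * Av) powr (1 / a) = (5 ^ ?n * K' powr (1 / t1)) powr (1 / a) * (J / V) powr (1 - 1 / p)"
      unfolding Av_def mult.assoc[symmetric] powr_mult[of _ "(J / V) powr (1 / t)"] powr_powr[of "J / V"] e1 ..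
    also have "(J / V) powr (1 - 1 / p) = ?J / V powr (1 - 1 / p)" using J V by (intro powr_divide)
    finally have e2: "(5 ^ ?n * Av) powr (1 / a) = (5 ^ ?n * K' powr (1 / t1)) powr (1 / a) * (?J / V powr (1 - 1 / p))" .
    \<comment> \<open>The negative power of \<open>V\<close> from the average of \<open>F\<close>
      and that of \<open>W\<close> from \<open>ii\<close> compensate the measure of the
      ball.\<close>
    have "?m \<le> W powr (1 / p) * V powr (1 - 1 / p)"
      by (rule measure_ball_le_dual[OF p D sub1 less_imp_le[OF W(1)] W(2) V])
    then have mm: "?m / (W powr (1 / p) * V powr (1 - 1 / p)) \<le> 1" using W(1) V0 by (subst divide_le_eq_1_pos) auto
    have "(5 ^ ?n * Av) powr (1 / a) * (L * ?m / W powr (1 / p)) =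
      (5 ^ ?n * K' powr (1 / t1)) powr (1 / a) * ?J * L * (?m / (W powr (1 / p) * V powr (1 - 1 / p)))"
      unfolding e2 by (simp add: mult_ac)
    also have "\<dots> \<le> (5 ^ ?n * K' powr (1 / t1)) powr (1 / a) * ?J * L"
      using mm L by (intro mult_left_le) auto
    finally show "L * (C1 * J) powr (1 - 1 / p) + (5 ^ ?n * Av) powr (1 / a) * (L * ?m / W powr (1 / p)) \<le> ?k * L * ?J"
      by (simp add: powr_mult algebra_simps)
  qed (use C2 in simp)
  finally show ?thesis by (simp only: mult.assoc)
qed

text \<open>The common target of the cases p0 = 1 and p0 > 1; in the latter, \<open>F\<close> is
  replaced by a family of powers. Bounding by real numbers \<open>A\<close> keeps infinite integrals
  of \<open>f\<close> out of the way, and \<open>C\<close> depends on the weight through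
  \<open>k\<close> only.\<close>

definition A1_inequality :: "(('a::euclidean_space \<Rightarrow> real) \<times> ('a \<Rightarrow> real)) set \<Rightarrow> bool" where
  "A1_inequality F \<longleftrightarrow> (\<forall>(f, g)\<in>F. f \<in> borel_measurable lebesgue \<and> g \<in> borel_measurable lebesgue \<and> (\<forall>x. 0 \<le> f x) \<and> (\<forall>x. 0 \<le> g x)) \<and>
    (\<forall>k. \<exists>C\<ge>0. \<forall>v f g A. A1_bound k v \<longrightarrow> (f, g) \<in> F \<longrightarrow> 0 \<le> A \<longrightarrow>
      (\<integral>\<^sup>+x. ennreal (f x * v x) \<partial>lebesgue) \<le> ennreal A \<longrightarrow> (\<integral>\<^sup>+x. ennreal (g x * v x) \<partial>lebesgue) \<le> ennreal (C * A))"

text \<open>Monotone convergence. It reduces the main estimate to bounded \<open>g\<close>, whose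
  weighted integral over a ball is finite.\<close>

lemma nn_integral_le_of_truncations:
  fixes g w :: "'a \<Rightarrow> real"
  assumes [measurable]: "g \<in> borel_measurable M" "w \<in> borel_measurable M" "B \<in> sets M"
    and g0: "\<And>x. 0 \<le> g x" and w0: "\<And>x. 0 \<le> w x" and p: "0 < p"
    and le: "\<And>k::nat. (\<integral>\<^sup>+x\<in>B. ennreal (min (g x) (real k) powr p * w x) \<partial>M) \<le> C"
  shows "(\<integral>\<^sup>+x\<in>B. ennreal (g x powr p * w x) \<partial>M) \<le> C"
proof -
  let ?f = "\<lambda>(k::nat) x. ennreal (min (g x) (real k) powr p * w x) * indicator B x"
  have "ennreal (g x powr p * w x) * indicator B x \<le> (SUP k. ?f k x)" for x
  proof -
    obtain k :: nat where k: "g x \<le> real k" using real_arch_simple by blast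
    then show ?thesis by (intro SUP_upper2[of k]) auto
  qed
  then have "(\<integral>\<^sup>+x\<in>B. ennreal (g x powr p * w x) \<partial>M) \<le> (\<integral>\<^sup>+x. (SUP k. ?f k x) \<partial>M)"
    by (intro nn_integral_mono)
  also have "\<dots> = (SUP k. \<integral>\<^sup>+x. ?f k x \<partial>M)"
  proof (rule nn_integral_monotone_convergence_SUP)
    show "incseq ?f"
      unfolding incseq_def le_fun_def using w0 g0 p
      by (auto intro!: ennreal_leI mult_right_mono powr_mono2)
  qed measurable
  also have "\<dots> \<le> C" by (intro SUP_least le)
  finally show ?thesis .
qed

text \<open>The extremal test function h = min(g,j)^(p-1) gives I \<le> C L I^(1-1/p) for the
  truncated integral I, and division by I^(1-1/p) is legitimate because the truncation makes I
  finite.\<close>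

lemma core_estimate:
  fixes F :: "(('a::euclidean_space \<Rightarrow> real) \<times> ('a \<Rightarrow> real)) set"
  assumes p: "1 < p" and s: "1 < s" and H: "A1_inequality F"
  shows "\<exists>C\<ge>0. \<forall>f g w \<sigma> c r L W. (f, g) \<in> F \<longrightarrow> 0 < r \<longrightarrow> dual_on p (ball c (52 * r)) w \<sigma> \<longrightarrow> Ap_pair p K (ball c (52 * r)) w \<sigma> \<longrightarrow>
    0 \<le> L \<longrightarrow> 0 < W \<longrightarrow> (\<integral>\<^sup>+x\<in>ball c r. ennreal (w x) \<partial>lebesgue) = ennreal W \<longrightarrow>
    (\<integral>\<^sup>+x\<in>ball c (2 * r). ennreal (f x powr p * w x) \<partial>lebesgue) \<le> ennreal (L powr p) \<longrightarrow>
    (\<integral>\<^sup>+x. ennreal (f x * enn2real (maximal (indicator (ball c r)) x) powr (1 / s)) \<partial>lebesgue) \<le>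
      ennreal (L * measure lebesgue (ball c r) / W powr (1 / p)) \<longrightarrow>
    (\<integral>\<^sup>+x\<in>ball c r. ennreal (g x powr p * w x) \<partial>lebesgue) \<le> ennreal ((C * L) powr p)"
proof -
  define p' where "p' = p / (p - 1)"
  have p': "1 < p'" using p by (simp add: p'_def)
  \<comment> \<open>Openness is applied to the swapped pair: \<sigma> lies in A_p' with constant
    \<open>K powr (1 / (p - 1))\<close> and dual weight \<open>w\<close>.\<close>
  obtain \<epsilon> where \<epsilon>: "0 < \<epsilon>" and op: "\<exists>K'\<ge>0. \<forall>(w::'a \<Rightarrow> real) \<sigma> c R.
    0 < R \<longrightarrow> dual_on p' (ball c (2 * R)) w \<sigma> \<longrightarrow> Ap_pair p' (K powr (1 / (p - 1))) (ball c (2 * R)) w \<sigma> \<longrightarrow>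
    Ap_pair (1 + (p' - 1) / (1 + \<epsilon>)) K' (ball c R) w (\<lambda>x. \<sigma> x powr (1 + \<epsilon>))"
  proof -
    from Ap_pair_open[OF p', where 'a='a and K="K powr (1 / (p - 1))"]
    obtain e0 where "0 < e0" and "\<forall>\<epsilon>. 0 < \<epsilon> \<and> \<epsilon> \<le> e0 \<longrightarrow> (\<exists>K'\<ge>0. \<forall>(w::'a \<Rightarrow> real) \<sigma> c R.
    0 < R \<longrightarrow> dual_on p' (ball c (2 * R)) w \<sigma> \<longrightarrow> Ap_pair p' (K powr (1 / (p - 1))) (ball c (2 * R)) w \<sigma> \<longrightarrow>
    Ap_pair (1 + (p' - 1) / (1 + \<epsilon>)) K' (ball c R) w (\<lambda>x. \<sigma> x powr (1 + \<epsilon>)))" by (elim exE conjE) (rule that)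
    then show ?thesis using that by simp
  qed
  define t1 where "t1 = 1 + (p' - 1) / (1 + \<epsilon>)"
  have t1: "1 < t1" using p' \<epsilon> by (simp add: t1_def)
  have t1p: "t1 < p'"
  proof -
    have "(p' - 1) / (1 + \<epsilon>) < p' - 1" using p' \<epsilon> by (simp add: divide_less_eq)
    then show ?thesis by (simp add: t1_def)
  qed
  from op[folded t1_def] obtain K' where K': "0 \<le> K'" and op': "\<forall>(w::'a \<Rightarrow> real) \<sigma> c R.
    0 < R \<longrightarrow> dual_on p' (ball c (2 * R)) w \<sigma> \<longrightarrow> Ap_pair p' (K powr (1 / (p - 1))) (ball c (2 * R)) w \<sigma> \<longrightarrow>
    Ap_pair t1 K' (ball c R) w (\<lambda>x. \<sigma> x powr (1 + \<epsilon>))" by (elim exE conjE) (rule that)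
  \<comment> \<open>The midpoint between \<open>1\<close> and \<open>p' / t1\<close>, cut at
    \<open>s\<close>: then \<open>t = p' / a\<close> still exceeds \<open>t1\<close> while
    \<open>a \<le> s\<close>.\<close>
  define a where "a = min s ((1 + p' / t1) / 2)"
  have pt: "1 < p' / t1" using t1p t1 by simp
  have a: "1 < a" "a \<le> s" using s pt by (auto simp: a_def)
  have half: "(1 + x) / 2 < x" if "1 < x" for x :: real using that by simp
  have apt: "a < p' / t1" using half[OF pt] by (simp only: a_def min_less_iff_disj) simp
  define t where "t = p' / a"
  have at: "a * t = p / (p - 1)" using a by (simp add: t_def p'_def)
  have t: "t1 < t" using apt a t1 by (simp add: t_def field_simps)
  from local_maximal[OF t1 t, where K=K' and 'a='a] obtain C1 where C1: "0 \<le> C1" and LM: "\<forall>(v::'a::euclidean_space \<Rightarrow> real) \<rho> c r F. 0 < r \<longrightarrow> dual_on t1 (ball c (26 * r)) v \<rho> \<longrightarrow>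
      Ap_pair t1 K' (ball c (26 * r)) v \<rho> \<longrightarrow> F \<in> borel_measurable lebesgue \<longrightarrow> (\<forall>x. 0 \<le> F x) \<longrightarrow>
      (\<forall>x. x \<notin> ball c r \<longrightarrow> F x = 0) \<longrightarrow>
      (\<integral>\<^sup>+x\<in>ball c (2 * r). ennreal (enn2real (maximal F x) powr t * v x) \<partial>lebesgue) \<le>
      ennreal C1 * (\<integral>\<^sup>+x. ennreal (F x powr t * v x) \<partial>lebesgue)" by (elim exE conjE) (rule that)
  have ai: "0 < 1 / a" "1 / a < 1" using a by auto
  from coifman_rochberg[OF ai, where 'a='a] obtain k where CR: "\<forall>F::'a \<Rightarrow> real. F \<in> borel_measurable lebesgue \<longrightarrow> (AE x in lebesgue. maximal F x < top) \<longrightarrow>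
      A1_bound k (\<lambda>x. enn2real (maximal F x) powr (1 / a))" by (elim exE conjE) (rule that)
  from maximal_lower_bound[where 'a='a] obtain \<gamma> where \<gamma>: "0 < \<gamma>" and LB: "\<forall>F::'a \<Rightarrow> real. F \<in> borel_measurable lebesgue \<longrightarrow> (\<forall>x. 0 \<le> F x) \<longrightarrow>
      (AE x in lebesgue. maximal F x < top) \<longrightarrow> (AE x in lebesgue. \<gamma> * F x \<le> enn2real (maximal F x))" by (elim exE conjE) (rule that)
  from H[unfolded A1_inequality_def, THEN conjunct2, THEN spec[of _ k]] obtain C2 where C2: "0 \<le> C2" and H2: "\<forall>v f g A. A1_bound k v \<longrightarrow> (f, g) \<in> F \<longrightarrow> 0 \<le> A \<longrightarrow>
      (\<integral>\<^sup>+x. ennreal (f x * v x) \<partial>lebesgue) \<le> ennreal A \<longrightarrow> (\<integral>\<^sup>+x. ennreal (g x * v x) \<partial>lebesgue) \<le> ennreal (C2 * A)"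
    by (elim exE conjE) (rule that)
  define C where "C = (1 / \<gamma>) powr (1 / a) * C2 * (C1 powr (1 - 1 / p) + (5 ^ DIM('a) * K' powr (1 / t1)) powr (1 / a))"
  have C: "0 \<le> C" using C2 by (simp add: C_def)
  have main: "(\<integral>\<^sup>+x\<in>ball c r. ennreal (g x powr p * w x) \<partial>lebesgue) \<le> ennreal ((C * L) powr p)"
    if FG: "(f, g) \<in> F" and r: "0 < r" and D: "dual_on p (ball c (52 * r)) w \<sigma>" and A: "Ap_pair p K (ball c (52 * r)) w \<sigma>"
      and L: "0 \<le> L" and W: "0 < W" "(\<integral>\<^sup>+x\<in>ball c r. ennreal (w x) \<partial>lebesgue) = ennreal W"
      and i: "(\<integral>\<^sup>+x\<in>ball c (2 * r). ennreal (f x powr p * w x) \<partial>lebesgue) \<le> ennreal (L powr p)"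
      and ii: "(\<integral>\<^sup>+x. ennreal (f x * enn2real (maximal (indicator (ball c r)) x) powr (1 / s)) \<partial>lebesgue) \<le>
        ennreal (L * measure lebesgue (ball c r) / W powr (1 / p))"
    for f g w \<sigma> c r L W
  proof -
    have fg[measurable]: "f \<in> borel_measurable lebesgue" "g \<in> borel_measurable lebesgue"
      and f0: "\<And>x. 0 \<le> f x" and g0: "\<And>x. 0 \<le> g x" using H FG unfolding A1_inequality_def by auto
    have [measurable]: "w \<in> borel_measurable lebesgue" and w0: "\<And>x. 0 \<le> w x" using D by (auto simp: dual_on_def)
    have s26: "ball c (26 * r) \<subseteq> ball c (52 * r)" using r by (intro subset_ball) simp
    \<comment> \<open>\<open>local_maximal\<close> needs the improved class of \<sigma> on 26 times
      the ball, and openness needs twice that.\<close>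
    have e52: "2 * (26 * r) = 52 * r" by simp
    have r26: "0 < 26 * r" using r by simp
    have Ds: "dual_on p' (ball c (2 * (26 * r))) \<sigma> w" unfolding p'_def e52 by (rule dual_on_swap[OF p D])
    have As: "Ap_pair p' (K powr (1 / (p - 1))) (ball c (2 * (26 * r))) \<sigma> w" unfolding p'_def e52 by (rule Ap_pair_swap[OF p A])
    have At: "Ap_pair t1 K' (ball c (26 * r)) \<sigma> (\<lambda>x. w x powr (1 + \<epsilon>))" by (rule op'[rule_format, OF r26 Ds As])
    have Dt: "dual_on t1 (ball c (26 * r)) \<sigma> (\<lambda>x. w x powr (1 + \<epsilon>))"
      unfolding t1_def by (rule dual_on_open[OF p' \<epsilon> dual_on_mono[OF Ds]]) (simp only: e52 s26)
    have D26: "dual_on p (ball c (26 * r)) w \<sigma>" by (rule dual_on_mono[OF D s26])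
    show ?thesis
    proof (rule nn_integral_le_of_truncations)
      fix j :: nat
      let ?gj = "\<lambda>x. min (g x) (real j)"
      let ?I = "\<integral>\<^sup>+x\<in>ball c r. ennreal (?gj x powr p * w x) \<partial>lebesgue"
      have gj0: "0 \<le> ?gj x" for x using g0 by simp
      have "?I \<le> (\<integral>\<^sup>+x. ennreal (real j powr p) * (ennreal (w x) * indicator (ball c r) x) \<partial>lebesgue)"
      proof (rule nn_integral_mono)
        fix x
        have "?gj x powr p * w x \<le> real j powr p * w x" using w0 gj0[of x] p by (intro mult_right_mono powr_mono2) auto
        then have "ennreal (?gj x powr p * w x) \<le> ennreal (real j powr p) * ennreal (w x)" using w0[of x] by (simp flip: ennreal_mult add: ennreal_leI)
        then show "ennreal (?gj x powr p * w x) * indicator (ball c r) x \<le> ennreal (real j powr p) * (ennreal (w x) * indicator (ball c r) x)"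
          by (simp add: indicator_def)
      qed
      also have "\<dots> = ennreal (real j powr p) * ennreal W" unfolding W(2)[symmetric] by (rule nn_integral_cmult) measurable
      also have "\<dots> < top" by (simp add: ennreal_mult_less_top)
      finally obtain I where I: "?I = ennreal I" "0 \<le> I" by (cases ?I) auto
      define h where "h x = ?gj x powr (p - 1)" for x
      have hm: "h \<in> borel_measurable lebesgue" unfolding h_def by measurable
      have h0: "0 \<le> h x" for x by (simp add: h_def)
      have hp: "h x powr (p / (p - 1)) = ?gj x powr p" for x using p by (simp add: h_def powr_powr)
      have "(\<integral>\<^sup>+x\<in>ball c r. ennreal (g x * h x * w x) \<partial>lebesgue) \<le> ennreal (C * L * I powr (1 - 1 / p))"
        unfolding C_def
        by (rule core_dual_estimate[where f=f and \<sigma>=\<sigma> and \<rho>="\<lambda>x. w x powr (1 + \<epsilon>)", OF p a t1 t at CR \<gamma> LB C1 LM C2 H2[rule_format, OF _ FG] fg f0 g0 r D26 Dt At K' W L i ii hm h0 I(2)])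
           (simp_all add: hp I)
      moreover have "?I \<le> (\<integral>\<^sup>+x\<in>ball c r. ennreal (g x * h x * w x) \<partial>lebesgue)"
      proof (rule nn_integral_mono)
        fix x
        have "?gj x powr p = ?gj x * ?gj x powr (p - 1)" using gj0[of x] by (cases "?gj x = 0") (auto simp: powr_diff)
        also have "\<dots> \<le> g x * h x" unfolding h_def by (intro mult_right_mono) auto
        finally have "?gj x powr p * w x \<le> g x * h x * w x" by (intro mult_right_mono w0)
        then show "ennreal (?gj x powr p * w x) * indicator (ball c r) x \<le> ennreal (g x * h x * w x) * indicator (ball c r) x"
          by (rule mult_right_mono[OF ennreal_leI]) simp_all
      qed
      ultimately have "ennreal I \<le> ennreal (C * L * I powr (1 - 1 / p))" unfolding I(1)[symmetric] by (rule order_trans[rotated])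
      then have le: "I \<le> C * L * I powr (1 - 1 / p)" using C L by (simp add: ennreal_le_iff)
      have "I \<le> (C * L) powr p"
      proof (cases "I = 0")
        case False
        then have I0: "0 < I" using I by simp
        have "I = I powr (1 / p) * I powr (1 - 1 / p)" using I0 by (simp flip: powr_add)
        then have "I powr (1 / p) * I powr (1 - 1 / p) \<le> C * L * I powr (1 - 1 / p)" using le by simp
        then have "I powr (1 / p) \<le> C * L" using I0 by simp
        then have "(I powr (1 / p)) powr p \<le> (C * L) powr p" using p by (intro powr_mono2) auto
        then show ?thesis using p I0 by (simp add: powr_powr)
      qed simp
      then show "?I \<le> ennreal ((C * L) powr p)" unfolding I(1) by (rule ennreal_leI)
    qed (use g0 w0 p in auto)
  qed
  show ?thesis by (intro exI[of _ C] conjI C allI impI) (rule main)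
qed

section \<open>The endpoint p = 1\<close>

definition A1_on :: "real \<Rightarrow> 'a::euclidean_space set \<Rightarrow> ('a \<Rightarrow> real) \<Rightarrow> bool" where
  "A1_on K S w \<longleftrightarrow> (\<forall>c r. 0 < r \<and> ball c r \<subseteq> S \<longrightarrow> (\<exists>W\<ge>0. (\<integral>\<^sup>+y\<in>ball c r. ennreal (w y) \<partial>lebesgue) = ennreal W \<and>
     (AE x in lebesgue. x \<in> ball c r \<longrightarrow> W \<le> K * measure lebesgue (ball c r) * w x)))"

lemma A1_onE:
  assumes "A1_on K S w" "0 < r" "ball c r \<subseteq> S"
  obtains W where "0 \<le> W" "(\<integral>\<^sup>+y\<in>ball c r. ennreal (w y) \<partial>lebesgue) = ennreal W"
    "AE x in lebesgue. x \<in> ball c r \<longrightarrow> W \<le> K * measure lebesgue (ball c r) * w x"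
  using assms(1)[unfolded A1_on_def, rule_format, OF conjI, OF assms(2,3)] by (elim exE conjE) (rule that)

text \<open>The A_1 inequality of the large ball, integrated over the small one.\<close>

lemma A1_on_doubling:
  fixes w :: "'a::euclidean_space \<Rightarrow> real"
  assumes A: "A1_on K S w" and K: "0 \<le> K" and \<kappa>: "1 \<le> \<kappa>" and [measurable]: "w \<in> borel_measurable lebesgue" and w0: "\<And>x. 0 \<le> w x"
    and r: "0 < r" "ball c (\<kappa> * r) \<subseteq> S"
  shows "(\<integral>\<^sup>+y\<in>ball c (\<kappa> * r). ennreal (w y) \<partial>lebesgue) \<le> ennreal (K * \<kappa> ^ DIM('a)) * (\<integral>\<^sup>+y\<in>ball c r. ennreal (w y) \<partial>lebesgue)"
proof -
  let ?m = "measure lebesgue (ball c r)"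
  have m: "0 < ?m" by (rule measure_ball_pos[OF r(1)])
  have r\<kappa>: "0 < \<kappa> * r" using r \<kappa> by simp
  have sub: "ball c r \<subseteq> ball c (\<kappa> * r)" using r \<kappa> by (intro subset_ball) simp
  obtain W where W: "0 \<le> W" "(\<integral>\<^sup>+y\<in>ball c (\<kappa> * r). ennreal (w y) \<partial>lebesgue) = ennreal W"
    "AE x in lebesgue. x \<in> ball c (\<kappa> * r) \<longrightarrow> W \<le> K * measure lebesgue (ball c (\<kappa> * r)) * w x"
    by (rule A1_onE[OF A r\<kappa> r(2)])
  have m\<kappa>: "measure lebesgue (ball c (\<kappa> * r)) = \<kappa> ^ DIM('a) * ?m" using r \<kappa> by (intro measure_ball_scale) auto
  have "ennreal W * ennreal ?m = (\<integral>\<^sup>+y. ennreal W * indicator (ball c r) y \<partial>lebesgue)"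
    by (simp add: nn_integral_cmult_indicator emeasure_ball_eq_measure del: emeasure_completion)
  also have "\<dots> \<le> (\<integral>\<^sup>+y. ennreal (K * (\<kappa> ^ DIM('a) * ?m)) * (ennreal (w y) * indicator (ball c r) y) \<partial>lebesgue)"
  proof (rule nn_integral_mono_AE)
    show "AE y in lebesgue. ennreal W * indicator (ball c r) y \<le> ennreal (K * (\<kappa> ^ DIM('a) * ?m)) * (ennreal (w y) * indicator (ball c r) y)"
      using W(3)
    proof eventually_elim
      case (elim y)
      show ?case
      proof (cases "y \<in> ball c r")
        case True
        then have "W \<le> K * (\<kappa> ^ DIM('a) * ?m) * w y" using elim sub unfolding m\<kappa> by blast
        then show ?thesis using True w0[of y] K \<kappa> m by (simp flip: ennreal_mult add: ennreal_leI)
      qed simp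
    qed
  qed
  also have "\<dots> = ennreal (K * (\<kappa> ^ DIM('a) * ?m)) * (\<integral>\<^sup>+y\<in>ball c r. ennreal (w y) \<partial>lebesgue)"
    by (rule nn_integral_cmult) measurable
  also have "\<dots> = ennreal (K * \<kappa> ^ DIM('a)) * (\<integral>\<^sup>+y\<in>ball c r. ennreal (w y) \<partial>lebesgue) * ennreal ?m"
    using K \<kappa> m by (simp add: ennreal_mult mult_ac)
  finally have "ennreal ?m * ennreal W \<le> ennreal ?m * (ennreal (K * \<kappa> ^ DIM('a)) * (\<integral>\<^sup>+y\<in>ball c r. ennreal (w y) \<partial>lebesgue))"
    by (simp add: mult.commute)
  then show ?thesis unfolding W(2) using m by (subst (asm) ennreal_mult_le_mult_iff) auto
qed

text \<open>Almost everywhere on the ball the weight is at least its average divided by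
  \<open>K\<close>, so the level set fills the ball up to a null set.\<close>

lemma A1_on_level:
  fixes w :: "'a::euclidean_space \<Rightarrow> real"
  assumes A: "A1_on K S w" and K: "0 < K" and [measurable]: "w \<in> borel_measurable lebesgue"
  shows "level_condition (1 / K) S w"
  unfolding level_condition_def
proof (intro allI impI, elim conjE)
  fix c :: 'a and r T assume r: "0 < r" "ball c r \<subseteq> S" and T: "0 \<le> T"
    "ennreal (T * measure lebesgue (ball c r)) \<le> (\<integral>\<^sup>+y\<in>ball c r. ennreal (w y) \<partial>lebesgue)"
  let ?m = "measure lebesgue (ball c r)" and ?G = "{y\<in>ball c r. 1 / K * T \<le> w y}"
  have m: "0 < ?m" by (rule measure_ball_pos[OF r(1)])
  obtain W where W: "0 \<le> W" "(\<integral>\<^sup>+y\<in>ball c r. ennreal (w y) \<partial>lebesgue) = ennreal W"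
    "AE x in lebesgue. x \<in> ball c r \<longrightarrow> W \<le> K * ?m * w x"
    by (rule A1_onE[OF A r])
  have TW: "T * ?m \<le> W" using T W m by (simp add: ennreal_le_iff)
  have "AE x in lebesgue. x \<in> ball c r \<longrightarrow> x \<in> ?G"
    using W(3)
  proof eventually_elim
    case (elim x)
    show ?case
    proof
      assume x: "x \<in> ball c r"
      then have "T * ?m \<le> (K * w x) * ?m" using elim TW by (simp add: mult_ac)
      then have "T \<le> K * w x" using m by simp
      then show "x \<in> ?G" using x K by (simp add: field_simps)
    qed
  qed
  moreover have "?G \<in> sets lebesgue"
  proof -
    have "?G = {y\<in>space lebesgue. 1 / K * T \<le> w y} \<inter> ball c r" by auto
    then show ?thesis by (simp only:) (intro sets.Int sets_lebesgue_ball; measurable)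
  qed
  ultimately have "1 * emeasure lebesgue (ball c r) \<le> emeasure lebesgue ?G" unfolding mult_1 by (intro emeasure_mono_AE) auto
  also have "\<dots> = 1 * emeasure lebesgue ?G" by simp
  also have "\<dots> \<le> 2 * emeasure lebesgue ?G" by (intro mult_right_mono) auto
  finally show "emeasure lebesgue (ball c r) \<le> 2 * emeasure lebesgue ?G" by simp
qed

text \<open>Here \<open>w\<close> itself is the function to be dominated. Reverse Hoelder for
  \<open>w\<close> bounds averages of w^a by the a-th power of averages of \<open>w\<close>, and A_1
  bounds those by \<open>w\<close>. So the weight M((w \<chi>_B)^a)^(1/a) is pointwise at most
  \<open>k1 * w\<close> on the doubled ball, which takes the place of the local maximal
  theorem.\<close>

lemma core_estimate_1:
  fixes F :: "(('a::euclidean_space \<Rightarrow> real) \<times> ('a \<Rightarrow> real)) set"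
  assumes s: "1 < s" and H: "A1_inequality F" and K: "0 < K"
  shows "\<exists>C\<ge>0. \<forall>f g w c r L W. (f, g) \<in> F \<longrightarrow> 0 < r \<longrightarrow> w \<in> borel_measurable lebesgue \<longrightarrow> (\<forall>x. 0 \<le> w x) \<longrightarrow> A1_on K (ball c (52 * r)) w \<longrightarrow>
    0 \<le> L \<longrightarrow> 0 < W \<longrightarrow> (\<integral>\<^sup>+x\<in>ball c r. ennreal (w x) \<partial>lebesgue) = ennreal W \<longrightarrow>
    (\<integral>\<^sup>+x\<in>ball c (2 * r). ennreal (f x * w x) \<partial>lebesgue) \<le> ennreal L \<longrightarrow>
    (\<integral>\<^sup>+x. ennreal (f x * enn2real (maximal (indicator (ball c r)) x) powr (1 / s)) \<partial>lebesgue) \<le>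
      ennreal (L * measure lebesgue (ball c r) / W) \<longrightarrow>
    (\<integral>\<^sup>+x\<in>ball c r. ennreal (g x * w x) \<partial>lebesgue) \<le> ennreal (C * L)"
proof -
  let ?n = "DIM('a)"
  have \<beta>: "0 < 1 / K" using K by simp
  from reverse_hoelder[OF \<beta>, where 'a='a] obtain \<epsilon>0 where \<epsilon>0: "0 < \<epsilon>0" and RH: "\<forall>\<epsilon>. 0 < \<epsilon> \<and> \<epsilon> \<le> \<epsilon>0 \<longrightarrow> (\<exists>C\<ge>0. \<forall>(\<tau>::'a \<Rightarrow> real) c R A.
    \<tau> \<in> borel_measurable lebesgue \<longrightarrow> (\<forall>x. 0 \<le> \<tau> x) \<longrightarrow> 0 < R \<longrightarrow> 0 \<le> A \<longrightarrow>
    (\<integral>\<^sup>+y\<in>ball c (2 * R). ennreal (\<tau> y) \<partial>lebesgue) \<le> ennreal (A * measure lebesgue (ball c R)) \<longrightarrow>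
    level_condition (1 / K) (ball c (2 * R)) \<tau> \<longrightarrow>
    (\<integral>\<^sup>+y\<in>ball c R. ennreal (\<tau> y powr (1 + \<epsilon>)) \<partial>lebesgue) \<le> ennreal (C * A powr (1 + \<epsilon>) * measure lebesgue (ball c R)))"
    by (elim exE conjE) (rule that)
  \<comment> \<open>Small enough for reverse Hoelder and for \<open>a \<le> s\<close>.\<close>
  define \<epsilon> where "\<epsilon> = min \<epsilon>0 (s - 1)"
  have \<epsilon>: "0 < \<epsilon>" "\<epsilon> \<le> \<epsilon>0" using \<epsilon>0 s by (auto simp: \<epsilon>_def)
  define a where "a = 1 + \<epsilon>"
  have a: "1 < a" "a \<le> s" using \<epsilon> by (auto simp: a_def \<epsilon>_def)
  from RH[rule_format, OF conjI[OF \<epsilon>], folded a_def] obtain C1 where C1: "0 \<le> C1" and rh: "\<forall>(\<tau>::'a \<Rightarrow> real) c R A.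
    \<tau> \<in> borel_measurable lebesgue \<longrightarrow> (\<forall>x. 0 \<le> \<tau> x) \<longrightarrow> 0 < R \<longrightarrow> 0 \<le> A \<longrightarrow>
    (\<integral>\<^sup>+y\<in>ball c (2 * R). ennreal (\<tau> y) \<partial>lebesgue) \<le> ennreal (A * measure lebesgue (ball c R)) \<longrightarrow>
    level_condition (1 / K) (ball c (2 * R)) \<tau> \<longrightarrow>
    (\<integral>\<^sup>+y\<in>ball c R. ennreal (\<tau> y powr a) \<partial>lebesgue) \<le> ennreal (C1 * A powr a * measure lebesgue (ball c R))"
    by (elim exE conjE) (rule that)
  have ai: "0 < 1 / a" "1 / a < 1" using a by auto
  from coifman_rochberg[OF ai, where 'a='a] obtain k where CR: "\<forall>F::'a \<Rightarrow> real. F \<in> borel_measurable lebesgue \<longrightarrow> (AE x in lebesgue. maximal F x < top) \<longrightarrow>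
      A1_bound k (\<lambda>x. enn2real (maximal F x) powr (1 / a))" by (elim exE conjE) (rule that)
  from maximal_lower_bound[where 'a='a] obtain \<gamma> where \<gamma>: "0 < \<gamma>" and LB: "\<forall>F::'a \<Rightarrow> real. F \<in> borel_measurable lebesgue \<longrightarrow> (\<forall>x. 0 \<le> F x) \<longrightarrow>
      (AE x in lebesgue. maximal F x < top) \<longrightarrow> (AE x in lebesgue. \<gamma> * F x \<le> enn2real (maximal F x))" by (elim exE conjE) (rule that)
  from H[unfolded A1_inequality_def, THEN conjunct2, THEN spec[of _ k]] obtain C2 where C2: "0 \<le> C2" and H2: "\<forall>v f g A. A1_bound k v \<longrightarrow> (f, g) \<in> F \<longrightarrow> 0 \<le> A \<longrightarrow>
      (\<integral>\<^sup>+x. ennreal (f x * v x) \<partial>lebesgue) \<le> ennreal A \<longrightarrow> (\<integral>\<^sup>+x. ennreal (g x * v x) \<partial>lebesgue) \<le> ennreal (C2 * A)"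
    by (elim exE conjE) (rule that)
  define k1 where "k1 = C1 powr (1 / a) * (2 ^ ?n * K)"
  define k2 where "k2 = (5 ^ ?n * C1) powr (1 / a) * (2 ^ ?n * K)"
  define C where "C = (1 / \<gamma>) powr (1 / a) * C2 * (k1 + k2)"
  have k12: "0 \<le> k1" "0 \<le> k2" using K by (auto simp: k1_def k2_def)
  have C: "0 \<le> C" using C2 k12 by (simp add: C_def)
  have main: "(\<integral>\<^sup>+x\<in>ball c r. ennreal (g x * w x) \<partial>lebesgue) \<le> ennreal (C * L)"
    if FG: "(f, g) \<in> F" and r: "0 < r" and w[measurable]: "w \<in> borel_measurable lebesgue" and w0: "\<And>x. 0 \<le> w x" and A: "A1_on K (ball c (52 * r)) w"
      and L: "0 \<le> L" and W: "0 < W" "(\<integral>\<^sup>+x\<in>ball c r. ennreal (w x) \<partial>lebesgue) = ennreal W"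
      and i: "(\<integral>\<^sup>+x\<in>ball c (2 * r). ennreal (f x * w x) \<partial>lebesgue) \<le> ennreal L"
      and ii: "(\<integral>\<^sup>+x. ennreal (f x * enn2real (maximal (indicator (ball c r)) x) powr (1 / s)) \<partial>lebesgue) \<le>
        ennreal (L * measure lebesgue (ball c r) / W)"
    for f g w c r L W
  proof -
    let ?S = "ball c (52 * r)" and ?m = "measure lebesgue (ball c r)"
    have fg[measurable]: "f \<in> borel_measurable lebesgue" "g \<in> borel_measurable lebesgue"
      and f0: "\<And>x. 0 \<le> f x" and g0: "\<And>x. 0 \<le> g x" using H FG unfolding A1_inequality_def by auto
    have m: "0 < ?m" by (rule measure_ball_pos[OF r])
    have lvl: "level_condition (1 / K) ?S w" by (rule A1_on_level[OF A K w])
    have RHb: "(\<integral>\<^sup>+y\<in>ball c' \<rho>. ennreal (w y powr a) \<partial>lebesgue) \<le> ennreal (C1 * (Q / measure lebesgue (ball c' \<rho>)) powr a * measure lebesgue (ball c' \<rho>))"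
      if "0 < \<rho>" "ball c' (2 * \<rho>) \<subseteq> ?S" "0 \<le> Q" "(\<integral>\<^sup>+y\<in>ball c' (2 * \<rho>). ennreal (w y) \<partial>lebesgue) \<le> ennreal Q" for c' \<rho> Q
      using that measure_ball_pos[OF that(1), of c'] w0 by (intro rh[rule_format] level_condition_mono[OF lvl] w) auto
    \<comment> \<open>A single null set for all balls: the maximal function at \<open>x\<close>
      involves uncountably many, while A_1 holds almost everywhere for each one.\<close>
    have AEb: "AE x in lebesgue. \<forall>c' R. (c', R) \<in> {(c', R). 0 < R \<and> ball c' R \<subseteq> ?S} \<and> x \<in> ball c' R \<longrightarrow>
        enn2real (\<integral>\<^sup>+y\<in>ball c' R. ennreal (w y) \<partial>lebesgue) / measure lebesgue (ball c' R) \<le> K * w x"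
    proof (rule AE_all_balls)
      fix c' R assume "(c', R) \<in> {(c', R). 0 < R \<and> ball c' R \<subseteq> ?S}"
      then have R: "0 < R" "ball c' R \<subseteq> ?S" by auto
      obtain Q where Q: "0 \<le> Q" "(\<integral>\<^sup>+y\<in>ball c' R. ennreal (w y) \<partial>lebesgue) = ennreal Q"
        "AE x in lebesgue. x \<in> ball c' R \<longrightarrow> Q \<le> K * measure lebesgue (ball c' R) * w x"
        by (rule A1_onE[OF A R])
      have mR: "0 < measure lebesgue (ball c' R)" by (rule measure_ball_pos[OF R(1)])
      show "AE x in lebesgue. x \<in> ball c' R \<longrightarrow>
        enn2real (\<integral>\<^sup>+y\<in>ball c' R. ennreal (w y) \<partial>lebesgue) / measure lebesgue (ball c' R) \<le> K * w x"
        using Q(3)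
      proof eventually_elim
        case (elim x)
        show ?case unfolding Q(2) using elim Q(1) mR by (auto simp: divide_le_eq mult_ac)
      qed
    qed
    define F where "F x = (w x * indicator (ball c r) x) powr a" for x
    have Fm[measurable]: "F \<in> borel_measurable lebesgue" unfolding F_def by measurable
    have F0: "0 \<le> F x" for x by (simp add: F_def)
    have Fb: "F x = 0" if "x \<notin> ball c r" for x using that by (simp add: F_def del: mem_ball)
    have Fw: "F x \<le> w x powr a" for x by (cases "x \<in> ball c r") (simp_all add: F_def del: mem_ball)
    have near: "(\<integral>\<^sup>+x\<in>ball c (2 * r). ennreal (f x * enn2real (maximal F x) powr (1 / a)) \<partial>lebesgue) \<le> ennreal (k1 * L)"
    proof -
      have "AE x in lebesgue. ennreal (f x * enn2real (maximal F x) powr (1 / a)) * indicator (ball c (2 * r)) x \<le>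
          ennreal k1 * (ennreal (f x * w x) * indicator (ball c (2 * r)) x)"
        using AEb
      proof eventually_elim
        case (elim x)
        show ?case
        proof (cases "x \<in> ball c (2 * r)")
          case True
          \<comment> \<open>The constant \<open>C1\<close> comes from reverse Hoelder on a ball
            through \<open>x\<close>, and \<open>2 ^ ?n * K * w x\<close> from A_1 on its
            double.\<close>
          define \<theta> where "\<theta> = C1 * (2 ^ ?n * K * w x) powr a"
          have \<theta>: "0 \<le> \<theta>" using C1 by (simp add: \<theta>_def)
          have "maximal F x \<le> ennreal \<theta>"
          proof (rule ccontr)
            assume "\<not> ?thesis"
            then have lt: "ennreal \<theta> < maximal F x" by simp
            obtain c' \<rho> where \<rho>: "0 < \<rho>" and "\<rho> \<le> 4 * r" and xb: "x \<in> ball c' \<rho>" and sub: "ball c' (5 * \<rho>) \<subseteq> ball c (26 * r)"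
              and gt: "ennreal (\<theta> * measure lebesgue (ball c' \<rho>)) < (\<integral>\<^sup>+y\<in>ball c' \<rho>. ennreal \<bar>F y\<bar> \<partial>lebesgue)"
              by (rule maximal_near_ball[OF Fb r True \<theta> lt])
            let ?m' = "measure lebesgue (ball c' \<rho>)"
            have m': "0 < ?m'" by (rule measure_ball_pos[OF \<rho>])
            have "ball c' (2 * \<rho>) \<subseteq> ball c' (5 * \<rho>)" using \<rho> by (intro subset_ball) simp
            moreover have "ball c (26 * r) \<subseteq> ?S" using r by (intro subset_ball) simp
            ultimately have sub2: "ball c' (2 * \<rho>) \<subseteq> ?S" using sub by blast
            have \<rho>2: "0 < 2 * \<rho>" using \<rho> by simp
            obtain Q where Q: "0 \<le> Q" "(\<integral>\<^sup>+y\<in>ball c' (2 * \<rho>). ennreal (w y) \<partial>lebesgue) = ennreal Q"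
              by (rule A1_onE[OF A \<rho>2 sub2])
            have x2: "x \<in> ball c' (2 * \<rho>)" using xb \<rho> by auto
            have m2: "measure lebesgue (ball c' (2 * \<rho>)) = 2 ^ ?n * ?m'" using \<rho> by (intro measure_ball_scale) auto
            have "enn2real (\<integral>\<^sup>+y\<in>ball c' (2 * \<rho>). ennreal (w y) \<partial>lebesgue) / measure lebesgue (ball c' (2 * \<rho>)) \<le> K * w x"
              using elim \<rho>2 sub2 x2 by blast
            then have "Q / (2 ^ ?n * ?m') \<le> K * w x" unfolding Q(2) m2 using Q(1) by simp
            then have Qm: "Q / ?m' \<le> 2 ^ ?n * K * w x" using m' by (simp add: field_simps)
            have "(\<integral>\<^sup>+y\<in>ball c' \<rho>. ennreal \<bar>F y\<bar> \<partial>lebesgue) \<le> (\<integral>\<^sup>+y\<in>ball c' \<rho>. ennreal (w y powr a) \<partial>lebesgue)"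
              using Fw F0 by (intro nn_integral_mono mult_right_mono ennreal_leI) auto
            also have "\<dots> \<le> ennreal (C1 * (Q / ?m') powr a * ?m')"
              by (rule RHb[OF \<rho> sub2 Q(1)]) (simp add: Q)
            also have "\<dots> \<le> ennreal (\<theta> * ?m')"
              unfolding \<theta>_def using Qm Q(1) m' C1 a by (intro ennreal_leI mult_right_mono mult_left_mono powr_mono2) auto
            finally show False using gt by simp
          qed
          then have "enn2real (maximal F x) \<le> \<theta>" using \<theta> by (intro enn2real_leI)
          then have "enn2real (maximal F x) powr (1 / a) \<le> \<theta> powr (1 / a)" using a by (intro powr_mono2) auto
          also have "\<dots> = k1 * w x" unfolding \<theta>_def k1_def using a K w0[of x] by (simp add: powr_mult powr_powr)
          finally have "f x * enn2real (maximal F x) powr (1 / a) \<le> f x * (k1 * w x)" by (rule mult_left_mono[OF _ f0])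
          then have "f x * enn2real (maximal F x) powr (1 / a) \<le> k1 * (f x * w x)" by (simp only: mult_ac)
          then show ?thesis using True k12 f0[of x] w0[of x] by (simp flip: ennreal_mult add: ennreal_leI)
        qed simp
      qed
      then have "(\<integral>\<^sup>+x\<in>ball c (2 * r). ennreal (f x * enn2real (maximal F x) powr (1 / a)) \<partial>lebesgue) \<le>
         (\<integral>\<^sup>+x. ennreal k1 * (ennreal (f x * w x) * indicator (ball c (2 * r)) x) \<partial>lebesgue)" by (rule nn_integral_mono_AE)
      also have "\<dots> = ennreal k1 * (\<integral>\<^sup>+x\<in>ball c (2 * r). ennreal (f x * w x) \<partial>lebesgue)" by (rule nn_integral_cmult) measurable
      also have "\<dots> \<le> ennreal k1 * ennreal L" by (intro mult_left_mono i) simp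
      also have "\<dots> = ennreal (k1 * L)" using k12 L by (simp flip: ennreal_mult)
      finally show ?thesis .
    qed
    have s2: "ball c (2 * r) \<subseteq> ?S" using r by (intro subset_ball) simp
    have W2: "(\<integral>\<^sup>+y\<in>ball c (2 * r). ennreal (w y) \<partial>lebesgue) \<le> ennreal (K * 2 ^ ?n * W)"
      using A1_on_doubling[OF A _ _ w w0 r s2] K W by (simp add: ennreal_mult)
    define Av where "Av = C1 * (K * 2 ^ ?n * W / ?m) powr a"
    have Av0: "0 \<le> Av" using C1 by (simp add: Av_def)
    have IF: "(\<integral>\<^sup>+x. ennreal \<bar>F x\<bar> \<partial>lebesgue) \<le> ennreal (Av * ?m)"
    proof -
      have "(\<integral>\<^sup>+x. ennreal \<bar>F x\<bar> \<partial>lebesgue) \<le> (\<integral>\<^sup>+x\<in>ball c r. ennreal (w x powr a) \<partial>lebesgue)"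
      proof (rule nn_integral_mono)
        fix x show "ennreal \<bar>F x\<bar> \<le> ennreal (w x powr a) * indicator (ball c r) x"
          by (cases "x \<in> ball c r") (simp_all add: F_def del: mem_ball)
      qed
      also have "\<dots> \<le> ennreal (Av * ?m)" unfolding Av_def using K W by (intro RHb[OF r s2 _ W2]) auto
      finally show ?thesis .
    qed
    have "(\<integral>\<^sup>+x\<in>ball c r. ennreal (g x * w x) \<partial>lebesgue) \<le>
       ennreal ((1 / \<gamma>) powr (1 / a) * C2 * (k1 * L + (5 ^ ?n * Av) powr (1 / a) * (L * ?m / W)))"
      by (rule maximal_power_transfer[OF a CR \<gamma> LB C2 H2[rule_format, OF _ FG] fg f0 g0 w w0 r F_def Av0 IF _ near _ ii])
         (use k12 L m W in auto)
    also have "(5 ^ ?n * Av) powr (1 / a) * (L * ?m / W) = k2 * L"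
    proof -
      have "(5 ^ ?n * Av) powr (1 / a) = (5 ^ ?n * C1) powr (1 / a) * ((K * 2 ^ ?n * W / ?m) powr a) powr (1 / a)"
        unfolding Av_def mult.assoc[symmetric] by (rule powr_mult)
      also have "((K * 2 ^ ?n * W / ?m) powr a) powr (1 / a) = K * 2 ^ ?n * W / ?m"
        using a K W m by (simp add: powr_powr)
      finally have e: "(5 ^ ?n * Av) powr (1 / a) = (5 ^ ?n * C1) powr (1 / a) * (K * 2 ^ ?n * W / ?m)" .
      show ?thesis unfolding e k2_def using m W by simp
    qed
    also have "(1 / \<gamma>) powr (1 / a) * C2 * (k1 * L + k2 * L) = C * L" by (simp add: C_def algebra_simps)
    finally show ?thesis .
  qed
  show ?thesis by (intro exI[of _ C] conjI C allI impI) (rule main, auto)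
qed

section \<open>Extrapolation from \<open>A\<^sub>p\<close> to powers of \<open>A\<^sub>1\<close> type\<close>

lemma weight_ball_finite:
  assumes "weight w"
  shows "(\<integral>\<^sup>+x\<in>ball c r. ennreal (w x) \<partial>lebesgue) < top"
proof -
  have w: "set_integrable lebesgue (cball c r) w" "\<And>x. 0 \<le> w x" using assms unfolding weight_def by auto
  have "(\<integral>\<^sup>+x\<in>ball c r. ennreal (w x) \<partial>lebesgue) \<le> (\<integral>\<^sup>+x. ennreal (norm (indicator (cball c r) x *\<^sub>R w x)) \<partial>lebesgue)"
    using w(2) by (intro nn_integral_mono) (auto simp: indicator_def)
  also have "\<dots> < top" using w(1) unfolding set_integrable_def by (simp add: integrable_iff_bounded)
  finally show ?thesis .
qed

lemma enn_powr_le: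
  assumes "x \<le> ennreal y" "0 \<le> y" "0 < a"
  shows "enn_powr a x \<le> ennreal (y powr a)"
proof -
  obtain z where z: "x = ennreal z" "0 \<le> z" using assms by (cases x) (auto simp: top_unique)
  then have "z \<le> y" using assms by simp
  then have "z powr a \<le> y powr a" using z assms by (intro powr_mono2) auto
  then show ?thesis using z by (simp add: enn_powr_def ennreal_leI)
qed

lemma enn_powr_leD:
  assumes "enn_powr a x \<le> ennreal y" "0 \<le> y" "0 < a"
  shows "x \<le> ennreal (y powr (1 / a))"
proof -
  have "x \<noteq> top" using assms(1) by (auto simp: enn_powr_def top_unique)
  then obtain z where z: "x = ennreal z" "0 \<le> z" by (cases x) auto
  then have "z powr a \<le> y" using assms by (simp add: enn_powr_def)
  then have "(z powr a) powr (1 / a) \<le> y powr (1 / a)" using assms by (intro powr_mono2) auto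
  then show ?thesis using z assms by (simp add: powr_powr ennreal_leI)
qed

text \<open>The constant of the hypothesis carries no sign condition; \<open>\<bar>C\<bar>\<close>
  makes it usable under powers.\<close>

lemma wLp_norm_leD:
  assumes le: "wLp_norm p v g \<le> ennreal C * wLp_norm p v f" and p: "0 < p" and A: "0 \<le> A"
    and f: "(\<integral>\<^sup>+x. ennreal (\<bar>f x\<bar> powr p * v x) \<partial>lebesgue) \<le> ennreal A"
  shows "(\<integral>\<^sup>+x. ennreal (\<bar>g x\<bar> powr p * v x) \<partial>lebesgue) \<le> ennreal (\<bar>C\<bar> powr p * A)"
proof -
  have "wLp_norm p v g \<le> ennreal C * wLp_norm p v f" by (rule le)
  also have "\<dots> \<le> ennreal \<bar>C\<bar> * ennreal (A powr (1 / p))"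
    unfolding wLp_norm_def using p A f by (intro mult_mono enn_powr_le ennreal_leI) auto
  also have "\<dots> = ennreal (\<bar>C\<bar> * A powr (1 / p))" by (simp flip: ennreal_mult)
  finally have "(\<integral>\<^sup>+x. ennreal (\<bar>g x\<bar> powr p * v x) \<partial>lebesgue) \<le> ennreal ((\<bar>C\<bar> * A powr (1 / p)) powr (1 / (1 / p)))"
    unfolding wLp_norm_def using p by (intro enn_powr_leD) auto
  also have "(\<bar>C\<bar> * A powr (1 / p)) powr (1 / (1 / p)) = \<bar>C\<bar> powr p * A"
    using p A by (simp add: powr_mult powr_powr)
  finally show ?thesis .
qed

lemma A1_bound_imp_A1_on:
  fixes v :: "'a::euclidean_space \<Rightarrow> real"
  assumes v: "A1_bound k v" and k: "0 \<le> k"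
  shows "A1_on k UNIV v"
  unfolding A1_on_def
proof (intro allI impI)
  fix c :: 'a and r :: real assume r: "0 < r \<and> ball c r \<subseteq> UNIV"
  have wv: "weight v" and M: "AE x in lebesgue. maximal v x \<le> ennreal (k * v x)" using v by (auto simp: A1_bound_def)
  have v0: "\<And>x. 0 \<le> v x" using wv by (simp add: weight_def)
  obtain V where V: "0 \<le> V" "(\<integral>\<^sup>+y\<in>ball c r. ennreal (v y) \<partial>lebesgue) = ennreal V"
    using weight_ball_finite[OF wv, of c r] by (cases "\<integral>\<^sup>+y\<in>ball c r. ennreal (v y) \<partial>lebesgue") auto
  have "AE x in lebesgue. x \<in> ball c r \<longrightarrow> V \<le> k * measure lebesgue (ball c r) * v x"
    using M
  proof eventually_elim
    case (elim x)
    show ?case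
    proof
      assume x: "x \<in> ball c r"
      have kv: "0 \<le> k * v x" using k v0 by simp
      have "ennreal V \<le> ennreal (k * v x * measure lebesgue (ball c r))"
        using nn_integral_ball_le_maximal[OF conjunct1[OF r] x elim kv] V(2) v0 by simp
      then show "V \<le> k * measure lebesgue (ball c r) * v x" using kv k v0[of x]
        by (subst (asm) ennreal_le_iff) (auto simp: mult_ac intro!: mult_nonneg_nonneg)
    qed
  qed
  then show "\<exists>W\<ge>0. (\<integral>\<^sup>+y\<in>ball c r. ennreal (v y) \<partial>lebesgue) = ennreal W \<and>
     (AE x in lebesgue. x \<in> ball c r \<longrightarrow> W \<le> k * measure lebesgue (ball c r) * v x)" using V by auto
qed

lemma AE_zero_of_balls:
  fixes h :: "'a::euclidean_space \<Rightarrow> real"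
  assumes [measurable]: "h \<in> borel_measurable lebesgue"
    and z: "\<And>N::nat. (\<integral>\<^sup>+y\<in>ball 0 (real N). ennreal \<bar>h y\<bar> \<partial>lebesgue) = 0"
  shows "AE x in lebesgue. h x = 0"
proof -
  have zN: "AE y in lebesgue. ennreal \<bar>h y\<bar> * indicator (ball 0 (real N)) y = 0" for N :: nat
    using z[of N] by (subst (asm) nn_integral_0_iff_AE) auto
  have "AE y in lebesgue. \<forall>N::nat. ennreal \<bar>h y\<bar> * indicator (ball 0 (real N)) y = 0"
    by (intro AE_all_countable[THEN iffD2] allI zN)
  then show ?thesis
  proof eventually_elim
    case (elim y)
    obtain N :: nat where N: "norm y < real N" using reals_Archimedean2 by blast
    then show ?case using elim[rule_format, of N] by simp
  qed
qed

text \<open>A large ball around the origin contains \<open>x\<close> together with some of the mass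
  of \<open>h\<close>. Positivity at every point is what makes negative powers of a maximal function
  meaningful.\<close>

lemma maximal_pos:
  fixes h :: "'a::euclidean_space \<Rightarrow> real"
  assumes h: "h \<in> borel_measurable lebesgue" and nz: "\<not> (AE x in lebesgue. h x = 0)"
  shows "0 < maximal h x"
proof -
  have "\<exists>N::nat. (\<integral>\<^sup>+y\<in>ball 0 (real N). ennreal \<bar>h y\<bar> \<partial>lebesgue) \<noteq> 0"
  proof (rule ccontr)
    assume "\<not> ?thesis"
    then have "(\<integral>\<^sup>+y\<in>ball 0 (real N). ennreal \<bar>h y\<bar> \<partial>lebesgue) = 0" for N :: nat by simp
    from AE_zero_of_balls[OF h this] show False using nz by simp
  qed
  then obtain N :: nat where N: "(\<integral>\<^sup>+y\<in>ball 0 (real N). ennreal \<bar>h y\<bar> \<partial>lebesgue) \<noteq> 0" ..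
  define R where "R = max (real N) (norm x + 1)"
  have "norm x < R" by (simp add: R_def less_max_iff_disj)
  then have R: "0 < R" "x \<in> ball 0 R" using norm_ge_zero[of x] by (linarith, simp)
  have "(\<integral>\<^sup>+y\<in>ball 0 (real N). ennreal \<bar>h y\<bar> \<partial>lebesgue) \<le> (\<integral>\<^sup>+y\<in>ball 0 R. ennreal \<bar>h y\<bar> \<partial>lebesgue)"
    by (intro nn_integral_mono) (auto simp: indicator_def R_def)
  then have nzR: "(\<integral>\<^sup>+y\<in>ball 0 R. ennreal \<bar>h y\<bar> \<partial>lebesgue) \<noteq> 0" using N by auto
  have "0 < ball_avg 0 R (\<lambda>y. ennreal \<bar>h y\<bar>)"
    using nzR unfolding ball_avg_times_measure[OF R(1)] by (simp add: zero_less_iff_neq_zero)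
  also have "\<dots> \<le> maximal h x" by (rule ball_avg_le_maximal[OF R])
  finally show ?thesis .
qed

text \<open>The dichotomy for A_1 weights: positive mass in one ball gives positive averages on all
  larger concentric balls, and the weight dominates a multiple of these averages almost
  everywhere.\<close>

lemma A1_bound_pos:
  fixes v :: "'a::euclidean_space \<Rightarrow> real"
  assumes v: "A1_bound k v" and k: "0 \<le> k" and nz: "\<not> (AE x in lebesgue. v x = 0)"
  shows "0 < k" "AE x in lebesgue. 0 < v x"
proof -
  have vm[measurable]: "v \<in> borel_measurable lebesgue" and v0: "\<And>x. 0 \<le> v x" using v by (auto simp: A1_bound_def weight_def)
  have A: "A1_on k UNIV v" by (rule A1_bound_imp_A1_on[OF v k])
  have "\<exists>N::nat. 0 < (\<integral>\<^sup>+y\<in>ball 0 (real N). ennreal (v y) \<partial>lebesgue)"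
  proof (rule ccontr)
    assume "\<not> ?thesis"
    then have "(\<integral>\<^sup>+y\<in>ball 0 (real N). ennreal \<bar>v y\<bar> \<partial>lebesgue) = 0" for N :: nat using v0 by (simp add: not_less)
    from AE_zero_of_balls[OF vm this] show False using nz by simp
  qed
  then obtain N :: nat where N: "0 < (\<integral>\<^sup>+y\<in>ball 0 (real N). ennreal (v y) \<partial>lebesgue)" ..
  have big: "AE x in lebesgue. x \<in> ball 0 (real (N + j) + 1) \<longrightarrow> 0 < v x \<and> 0 < k" for j :: nat
  proof -
    let ?R = "real (N + j) + 1"
    have R: "0 < ?R" by simp
    obtain W where W: "0 \<le> W" "(\<integral>\<^sup>+y\<in>ball 0 ?R. ennreal (v y) \<partial>lebesgue) = ennreal W"
      "AE x in lebesgue. x \<in> ball 0 ?R \<longrightarrow> W \<le> k * measure lebesgue (ball (0::'a) ?R) * v x"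
      by (rule A1_onE[OF A R subset_UNIV])
    have "(\<integral>\<^sup>+y\<in>ball 0 (real N). ennreal (v y) \<partial>lebesgue) \<le> ennreal W"
      unfolding W(2)[symmetric] by (intro nn_integral_mono) (auto simp: indicator_def)
    then have W0: "0 < W" using N W(1) by (cases "W = 0") auto
    show ?thesis
      using W(3)
    proof eventually_elim
      case (elim x)
      show ?case
      proof
        assume "x \<in> ball 0 ?R"
        then have "0 < k * measure lebesgue (ball (0::'a) ?R) * v x" using elim W0 by fastforce
        then show "0 < v x \<and> 0 < k" using k v0[of x] by (auto simp: zero_less_mult_iff)
      qed
    qed
  qed
  have "AE x in lebesgue. \<forall>j::nat. x \<in> ball 0 (real (N + j) + 1) \<longrightarrow> 0 < v x \<and> 0 < k"
    by (intro AE_all_countable[THEN iffD2] allI big)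
  then have both: "AE x in lebesgue. 0 < v x \<and> 0 < k"
  proof eventually_elim
    case (elim x)
    obtain j :: nat where j: "norm x < real j" using reals_Archimedean2 by blast
    then have "x \<in> ball 0 (real (N + j) + 1)" by simp
    then show ?case using elim by blast
  qed
  then show "AE x in lebesgue. 0 < v x" by eventually_elim simp
  show "0 < k"
  proof (rule ccontr)
    assume n: "\<not> 0 < k"
    have "AE x in lebesgue. v x = 0" using both by eventually_elim (use n in simp)
    then show False using nz by simp
  qed
qed

text \<open>The easy half of the Jones factorization. On a ball where \<open>v\<close> has average a
  and \<open>u\<close> has average h, A_1 gives \<open>v \<ge> a / k1\<close> and
  \<open>u \<ge> h / k2\<close> almost everywhere. These bounds are inserted where the functions
  carry negative powers; the averages then cancel and \<open>k1 * k2 powr (p - 1)\<close>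
  remains.\<close>

lemma A_class_factorization:
  fixes v u :: "'a::euclidean_space \<Rightarrow> real"
  assumes p: "1 < p" and v: "A1_bound k1 v" and u: "A1_bound k2 u" and k: "0 < k1" "0 < k2"
    and vp: "AE x in lebesgue. 0 < v x" and up: "AE x in lebesgue. 0 < u x"
  shows "A_class p (\<lambda>x. v x * u x powr (1 - p))" "Ap_const p (\<lambda>x. v x * u x powr (1 - p)) \<le> ennreal (k1 * k2 powr (p - 1))"
proof -
  let ?V = "\<lambda>x. v x * u x powr (1 - p)"
  have vm[measurable]: "v \<in> borel_measurable lebesgue" "u \<in> borel_measurable lebesgue" and v0: "\<And>x. 0 \<le> v x" "\<And>x. 0 \<le> u x"
    using v u by (auto simp: A1_bound_def weight_def)
  have Av: "A1_on k1 UNIV v" by (rule A1_bound_imp_A1_on[OF v less_imp_le[OF k(1)]])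
  have Au: "A1_on k2 UNIV u" by (rule A1_bound_imp_A1_on[OF u less_imp_le[OF k(2)]])
  have vp': "AE x in lebesgue. x \<in> UNIV \<longrightarrow> 0 < v x" and up': "AE x in lebesgue. x \<in> UNIV \<longrightarrow> 0 < u x" using vp up by auto
  have ball: "\<exists>a h. 0 < a \<and> 0 < h \<and>
     (\<integral>\<^sup>+y\<in>ball c r. ennreal (?V y) \<partial>lebesgue) \<le> ennreal (a * (h / k2) powr (1 - p) * measure lebesgue (ball c r)) \<and>
     (\<integral>\<^sup>+y\<in>ball c r. dual_weight p ?V y \<partial>lebesgue) \<le> ennreal ((a / k1) powr (- 1 / (p - 1)) * h * measure lebesgue (ball c r))"
    if r: "0 < r" for c r
  proof -
    let ?m = "measure lebesgue (ball c r)"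
    have m: "0 < ?m" by (rule measure_ball_pos[OF r])
    obtain A where A: "0 \<le> A" "(\<integral>\<^sup>+y\<in>ball c r. ennreal (v y) \<partial>lebesgue) = ennreal A"
      "AE x in lebesgue. x \<in> ball c r \<longrightarrow> A \<le> k1 * ?m * v x" by (rule A1_onE[OF Av r subset_UNIV])
    obtain H where H: "0 \<le> H" "(\<integral>\<^sup>+y\<in>ball c r. ennreal (u y) \<partial>lebesgue) = ennreal H"
      "AE x in lebesgue. x \<in> ball c r \<longrightarrow> H \<le> k2 * ?m * u x" by (rule A1_onE[OF Au r subset_UNIV])
    define a where "a = A / ?m"
    define h where "h = H / ?m"
    have "0 < A" using nn_integral_ball_pos[OF vm(1) vp' r subset_UNIV, of c] A by simp
    then have a: "0 < a" using m by (simp add: a_def)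
    have "0 < H" using nn_integral_ball_pos[OF vm(2) up' r subset_UNIV, of c] H by simp
    then have h: "0 < h" using m by (simp add: h_def)
    have av: "AE x in lebesgue. x \<in> ball c r \<longrightarrow> a / k1 \<le> v x"
      using A(3) by eventually_elim (use m k in \<open>auto simp: a_def field_simps\<close>)
    have hu: "AE x in lebesgue. x \<in> ball c r \<longrightarrow> h / k2 \<le> u x"
      using H(3) by eventually_elim (use m k in \<open>auto simp: h_def field_simps\<close>)
    have "(\<integral>\<^sup>+y\<in>ball c r. ennreal (?V y) \<partial>lebesgue) \<le> (\<integral>\<^sup>+y. ennreal ((h / k2) powr (1 - p)) * (ennreal (v y) * indicator (ball c r) y) \<partial>lebesgue)"
    proof (rule nn_integral_mono_AE)
      show "AE y in lebesgue. ennreal (?V y) * indicator (ball c r) y \<le> ennreal ((h / k2) powr (1 - p)) * (ennreal (v y) * indicator (ball c r) y)"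
        using hu
      proof eventually_elim
        case (elim y)
        show ?case
        proof (cases "y \<in> ball c r")
          case True
          then have "u y powr (1 - p) \<le> (h / k2) powr (1 - p)" using elim h k p by (intro powr_mono2') auto
          then have "v y * u y powr (1 - p) \<le> (h / k2) powr (1 - p) * v y" using v0(1)[of y] by (subst mult.commute) (rule mult_right_mono)
          then show ?thesis using True v0(1)[of y] by (simp flip: ennreal_mult add: ennreal_leI)
        qed simp
      qed
    qed
    also have "\<dots> = ennreal ((h / k2) powr (1 - p)) * ennreal A" unfolding A(2)[symmetric] by (rule nn_integral_cmult) measurable
    also have "\<dots> = ennreal (a * (h / k2) powr (1 - p) * ?m)" using A(1) m by (simp flip: ennreal_mult add: a_def)
    finally have 1: "(\<integral>\<^sup>+y\<in>ball c r. ennreal (?V y) \<partial>lebesgue) \<le> ennreal (a * (h / k2) powr (1 - p) * ?m)" .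
    have "(\<integral>\<^sup>+y\<in>ball c r. dual_weight p ?V y \<partial>lebesgue) \<le> (\<integral>\<^sup>+y. ennreal ((a / k1) powr (- 1 / (p - 1))) * (ennreal (u y) * indicator (ball c r) y) \<partial>lebesgue)"
    proof (rule nn_integral_mono_AE)
      show "AE y in lebesgue. dual_weight p ?V y * indicator (ball c r) y \<le> ennreal ((a / k1) powr (- 1 / (p - 1))) * (ennreal (u y) * indicator (ball c r) y)"
        using av vp up
      proof eventually_elim
        case (elim y)
        show ?case
        proof (cases "y \<in> ball c r")
          case True
          have e: "1 - p / (p - 1) = - 1 / (p - 1)" using p by (simp add: field_simps)
          have e2: "(1 - p) * (- 1 / (p - 1)) = 1" using p by (simp add: field_simps)
          have "?V y powr (1 - p / (p - 1)) = v y powr (- 1 / (p - 1)) * u y powr ((1 - p) * (- 1 / (p - 1)))"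
            unfolding e powr_mult powr_powr ..
          also have "\<dots> = v y powr (- 1 / (p - 1)) * u y" unfolding e2 using elim by simp
          also have "\<dots> \<le> (a / k1) powr (- 1 / (p - 1)) * u y"
            using True elim a k p by (intro mult_right_mono powr_mono2') auto
          finally have "?V y powr (1 - p / (p - 1)) \<le> (a / k1) powr (- 1 / (p - 1)) * u y" .
          \<comment> \<open>Excludes the value \<open>top\<close> of \<open>dual_weight\<close>,
            using positivity of both factors.\<close>
          moreover have "?V y \<noteq> 0" using elim by simp
          ultimately show ?thesis using True v0(2)[of y] by (simp add: dual_weight_def ennreal_leI flip: ennreal_mult)
        qed simp
      qed
    qed
    also have "\<dots> = ennreal ((a / k1) powr (- 1 / (p - 1))) * ennreal H" unfolding H(2)[symmetric] by (rule nn_integral_cmult) measurable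
    also have "\<dots> = ennreal ((a / k1) powr (- 1 / (p - 1)) * h * ?m)" using H(1) m by (simp flip: ennreal_mult add: h_def)
    finally have 2: "(\<integral>\<^sup>+y\<in>ball c r. dual_weight p ?V y \<partial>lebesgue) \<le> ennreal ((a / k1) powr (- 1 / (p - 1)) * h * ?m)" .
    show ?thesis using a h 1 2 by blast
  qed
  have bd: "ball_avg c r (\<lambda>y. ennreal (?V y)) * enn_powr (p - 1) (ball_avg c r (dual_weight p ?V)) \<le> ennreal (k1 * k2 powr (p - 1))"
    if r: "0 < r" for c r
  proof -
    obtain a h where a: "0 < a" and h: "0 < h"
      and 1: "(\<integral>\<^sup>+y\<in>ball c r. ennreal (?V y) \<partial>lebesgue) \<le> ennreal (a * (h / k2) powr (1 - p) * measure lebesgue (ball c r))"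
      and 2: "(\<integral>\<^sup>+y\<in>ball c r. dual_weight p ?V y \<partial>lebesgue) \<le> ennreal ((a / k1) powr (- 1 / (p - 1)) * h * measure lebesgue (ball c r))"
      using ball[OF r, of c] by (elim exE conjE) (rule that)
    have "ball_avg c r (\<lambda>y. ennreal (?V y)) \<le> ennreal (a * (h / k2) powr (1 - p))"
      using 1 a by (subst ball_avg_le_iff[OF r]) auto
    moreover have "ball_avg c r (dual_weight p ?V) \<le> ennreal ((a / k1) powr (- 1 / (p - 1)) * h)"
      using 2 h by (subst ball_avg_le_iff[OF r]) auto
    ultimately have "ball_avg c r (\<lambda>y. ennreal (?V y)) * enn_powr (p - 1) (ball_avg c r (dual_weight p ?V)) \<le>
       ennreal (a * (h / k2) powr (1 - p)) * ennreal (((a / k1) powr (- 1 / (p - 1)) * h) powr (p - 1))"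
      using p h by (intro mult_mono enn_powr_le) auto
    also have "\<dots> = ennreal (a * (h / k2) powr (1 - p) * ((a / k1) powr (- 1 / (p - 1)) * h) powr (p - 1))"
      using a by (simp flip: ennreal_mult)
    also have "a * (h / k2) powr (1 - p) * ((a / k1) powr (- 1 / (p - 1)) * h) powr (p - 1) = k1 * k2 powr (p - 1)"
    proof -
      have "(h / k2) powr (1 - p) = k2 powr (p - 1) / h powr (p - 1)"
      proof -
        have "(h / k2) powr (1 - p) = (h / k2) powr (- (p - 1))" by simp
        also have "\<dots> = 1 / (h / k2) powr (p - 1)" by (simp only: powr_minus inverse_eq_divide)
        finally show ?thesis using h k by (simp add: powr_divide)
      qed
      moreover have "((a / k1) powr (- 1 / (p - 1)) * h) powr (p - 1) = k1 / a * h powr (p - 1)"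
      proof -
        have e: "- 1 / (p - 1) * (p - 1) = - 1" using p by simp
        have "((a / k1) powr (- 1 / (p - 1)) * h) powr (p - 1) = (a / k1) powr (- 1) * h powr (p - 1)"
          unfolding powr_mult powr_powr e ..
        also have "(a / k1) powr (- 1) = k1 / a" using a k by (simp add: powr_minus)
        finally show ?thesis .
      qed
      ultimately show ?thesis using a h by simp
    qed
    finally show ?thesis .
  qed
  show const: "Ap_const p ?V \<le> ennreal (k1 * k2 powr (p - 1))"
    unfolding Ap_const_def using p bd by (auto intro!: SUP_least)
  have "weight ?V"
  proof (rule weightI)
    fix R :: real assume "0 < R"
    from ball[OF this, of 0] show "(\<integral>\<^sup>+y\<in>ball 0 R. ennreal (?V y) \<partial>lebesgue) < top"
      by (elim exE conjE) (simp add: le_less_trans)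
  qed (use v0 in auto)
  then show "A_class p ?V" unfolding A_class_def using const by (simp add: le_less_trans)
qed

lemma A1_bound_mono:
  assumes "A1_bound k v" "k \<le> k'"
  shows "A1_bound k' v"
proof -
  have w: "weight v" and M: "AE x in lebesgue. maximal v x \<le> ennreal (k * v x)" using assms by (auto simp: A1_bound_def)
  have "AE x in lebesgue. maximal v x \<le> ennreal (k' * v x)"
    using M
  proof eventually_elim
    case (elim x)
    have "k * v x \<le> k' * v x" using w assms(2) by (intro mult_right_mono) (auto simp: weight_def)
    then show ?case using elim by (meson ennreal_leI order_trans)
  qed
  then show ?thesis using w by (simp add: A1_bound_def)
qed

text \<open>By A_1, V \<le> k |B| v on a ball of v-mass V, so an unweighted average of
  \<open>f\<close> above t makes the v-average of \<open>k f\<close> exceed t. The function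
  \<open>m\<close> only has to lie below the maximal function; it may be chosen on the set where
  that function is infinite, and the lemma can then prove finiteness.\<close>

lemma maximal_A1_bound:
  assumes k: "0 < k" and p: "1 < p"
  shows "\<exists>C\<ge>0. \<forall>(v::'a::euclidean_space \<Rightarrow> real) f m A. A1_bound k v \<longrightarrow> (AE x in lebesgue. 0 < v x) \<longrightarrow>
    f \<in> borel_measurable lebesgue \<longrightarrow> (\<forall>x. 0 \<le> f x) \<longrightarrow> m \<in> borel_measurable lebesgue \<longrightarrow> (\<forall>x. 0 \<le> m x) \<longrightarrow>
    (\<forall>x t. 0 < t \<longrightarrow> t < m x \<longrightarrow> ennreal t < maximal f x) \<longrightarrow> 0 \<le> A \<longrightarrow>
    (\<integral>\<^sup>+x. ennreal (f x powr p * v x) \<partial>lebesgue) \<le> ennreal A \<longrightarrow> (\<integral>\<^sup>+x. ennreal (m x powr p * v x) \<partial>lebesgue) \<le> ennreal (C * A)"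
proof -
  define D where "D = k * 5 ^ DIM('a)"
  have D: "0 \<le> D" using k by (simp add: D_def)
  define C where "C = D * p / (p - 1) * 2 powr p * k powr p"
  have C: "0 \<le> C" using D p by (simp add: C_def)
  have main: "(\<integral>\<^sup>+x. ennreal (m x powr p * v x) \<partial>lebesgue) \<le> ennreal (C * A)"
    if v: "A1_bound k v" and vp: "AE x in lebesgue. 0 < v x" and f[measurable]: "f \<in> borel_measurable lebesgue" and f0: "\<And>x. 0 \<le> f x"
      and m[measurable]: "m \<in> borel_measurable lebesgue" and m0: "\<And>x. 0 \<le> m x"
      and mf: "\<And>x t. 0 < t \<Longrightarrow> t < m x \<Longrightarrow> ennreal t < maximal f x" and A: "0 \<le> A"
      and If: "(\<integral>\<^sup>+x. ennreal (f x powr p * v x) \<partial>lebesgue) \<le> ennreal A" for v f m :: "'a \<Rightarrow> real" and A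
  proof -
    have vm[measurable]: "v \<in> borel_measurable lebesgue" and v0: "\<And>x. 0 \<le> v x" using v by (auto simp: A1_bound_def weight_def)
    have Av: "A1_on k UNIV v" by (rule A1_bound_imp_A1_on[OF v less_imp_le[OF k]])
    have vp': "AE x in lebesgue. x \<in> UNIV \<longrightarrow> 0 < v x" using vp by simp
    let ?\<mu> = "density lebesgue (\<lambda>x. ennreal (v x))"
    have em: "emeasure ?\<mu> (ball a b) = (\<integral>\<^sup>+y\<in>ball a b. ennreal (v y) \<partial>lebesgue)" for a b
      by (subst emeasure_density) auto
    have "(\<integral>\<^sup>+x. ennreal (m x powr p) \<partial>?\<mu>) \<le> ennreal (D * p / (p - 1) * 2 powr p) * (\<integral>\<^sup>+x. ennreal ((k * f x) powr p) \<partial>?\<mu>)"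
    proof (rule strong_maximal[where B="{(c, r). 0 < r}"])
      show "sigma_finite_measure ?\<mu>" by (rule sigma_finite_density_real[OF vm])
      fix c :: 'a and r :: real assume "(c, r) \<in> {(c, r). 0 < r}"
      then have r: "0 < r" by simp
      show "0 < r \<and> emeasure ?\<mu> (ball c (5 * r)) \<le> ennreal D * emeasure ?\<mu> (ball c r)"
        unfolding em D_def using r A1_on_doubling[OF Av less_imp_le[OF k] _ vm v0 r subset_UNIV, of 5] by simp
    next
      fix x :: 'a and t :: real assume t: "0 < t" "t < m x"
      from mf[OF t] obtain c r where r: "0 < r" "x \<in> ball c r" and gt: "ennreal t < ball_avg c r (\<lambda>y. ennreal \<bar>f y\<bar>)"
        unfolding less_maximal_iff by (elim exE conjE) (rule that)
      let ?m = "measure lebesgue (ball c r)"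
      have mp: "0 < ?m" by (rule measure_ball_pos[OF r(1)])
      have gt: "ennreal (t * ?m) < (\<integral>\<^sup>+y\<in>ball c r. ennreal \<bar>f y\<bar> \<partial>lebesgue)"
        using gt unfolding not_le[symmetric] ball_avg_le_iff[OF r(1) less_imp_le[OF t(1)]] .
      obtain V where V: "0 \<le> V" "(\<integral>\<^sup>+y\<in>ball c r. ennreal (v y) \<partial>lebesgue) = ennreal V"
        "AE x in lebesgue. x \<in> ball c r \<longrightarrow> V \<le> k * ?m * v x" by (rule A1_onE[OF Av r(1) subset_UNIV])
      have V0: "0 < V" using nn_integral_ball_pos[OF vm vp' r(1) subset_UNIV, of c] V by simp
      let ?I = "\<integral>\<^sup>+y\<in>ball c r. ennreal (k * f y) \<partial>?\<mu>"
      have I: "?I = (\<integral>\<^sup>+y. ennreal (v y) * (ennreal (k * f y) * indicator (ball c r) y) \<partial>lebesgue)"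
        by (rule nn_integral_density) measurable
      \<comment> \<open>The measure of the ball is carried along on both sides and cancelled at the
        end, since the integral of \<open>f\<close> may be infinite.\<close>
      have "ennreal ?m * (ennreal t * ennreal V) = ennreal V * ennreal (t * ?m)" using t V mp by (simp flip: ennreal_mult add: mult_ac)
      also have "\<dots> < ennreal V * (\<integral>\<^sup>+y\<in>ball c r. ennreal \<bar>f y\<bar> \<partial>lebesgue)"
        using V0 gt by (intro ennreal_mult_strict_left_mono) auto
      also have "\<dots> = (\<integral>\<^sup>+y. ennreal V * (ennreal \<bar>f y\<bar> * indicator (ball c r) y) \<partial>lebesgue)"
        by (rule nn_integral_cmult[symmetric]) measurable
      also have "\<dots> \<le> (\<integral>\<^sup>+y. ennreal ?m * (ennreal (v y) * (ennreal (k * f y) * indicator (ball c r) y)) \<partial>lebesgue)"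
      proof (rule nn_integral_mono_AE)
        show "AE y in lebesgue. ennreal V * (ennreal \<bar>f y\<bar> * indicator (ball c r) y) \<le> ennreal ?m * (ennreal (v y) * (ennreal (k * f y) * indicator (ball c r) y))"
          using V(3)
        proof eventually_elim
          case (elim y)
          show ?case
          proof (cases "y \<in> ball c r")
            case True
            then have "V * f y \<le> (k * ?m * v y) * f y" using elim f0 by (intro mult_right_mono) auto
            then have "V * f y \<le> ?m * (v y * (k * f y))" by (simp only: mult_ac)
            then show ?thesis using True f0[of y] v0[of y] V k mp by (simp flip: ennreal_mult add: ennreal_leI)
          qed simp
        qed
      qed
      also have "\<dots> = ennreal ?m * ?I" unfolding I by (rule nn_integral_cmult) measurable
      finally have lt: "ennreal ?m * (ennreal t * ennreal V) < ennreal ?m * ?I" .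
      have "ennreal t * ennreal V < ?I"
      proof (rule ccontr)
        assume "\<not> ?thesis"
        then have "?I \<le> ennreal t * ennreal V" by (simp only: not_less)
        then have "ennreal ?m * ?I \<le> ennreal ?m * (ennreal t * ennreal V)" by (intro mult_left_mono) auto
        from leD[OF this] lt show False by (rule notE)
      qed
      then show "\<exists>c r. (c, r) \<in> {(c, r). 0 < r} \<and> x \<in> ball c r \<and> ennreal t * emeasure ?\<mu> (ball c r) < (\<integral>\<^sup>+y\<in>ball c r. ennreal (k * f y) \<partial>?\<mu>)"
        using r by (intro exI[of _ c] exI[of _ r] conjI) (simp_all only: em V(2) mem_Collect_eq case_prod_conv)
    qed (use p D k f0 m0 in auto)
    also have "(\<integral>\<^sup>+x. ennreal (m x powr p) \<partial>?\<mu>) = (\<integral>\<^sup>+x. ennreal (v x) * ennreal (m x powr p) \<partial>lebesgue)"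
      by (rule nn_integral_density) measurable
    also have "\<dots> = (\<integral>\<^sup>+x. ennreal (m x powr p * v x) \<partial>lebesgue)"
      using v0 by (intro nn_integral_cong) (simp add: ennreal_mult mult.commute)
    also have "(\<integral>\<^sup>+x. ennreal ((k * f x) powr p) \<partial>?\<mu>) = (\<integral>\<^sup>+x. ennreal (v x) * ennreal ((k * f x) powr p) \<partial>lebesgue)"
      by (rule nn_integral_density) measurable
    also have "\<dots> = (\<integral>\<^sup>+x. ennreal (k powr p) * ennreal (f x powr p * v x) \<partial>lebesgue)"
      using v0 by (intro nn_integral_cong) (simp add: powr_mult ennreal_mult mult_ac)
    also have "\<dots> = ennreal (k powr p) * (\<integral>\<^sup>+x. ennreal (f x powr p * v x) \<partial>lebesgue)" by (rule nn_integral_cmult) measurable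
    also have "ennreal (D * p / (p - 1) * 2 powr p) * \<dots> \<le> ennreal (D * p / (p - 1) * 2 powr p) * (ennreal (k powr p) * ennreal A)"
      by (intro mult_left_mono If) auto
    also have "\<dots> = ennreal (C * A)" unfolding C_def using D p A by (simp flip: ennreal_mult add: mult_ac)
    finally show ?thesis .
  qed
  show ?thesis by (intro exI[of _ C] conjI C allI impI) (rule main, auto)
qed

text \<open>With H = M f, the weight v H^(p1-p0) is \<open>v\<close> times the power 1 - p0 of
  H^\<beta>, \<beta> = (p0 - p1) / (p0 - 1) < 1. Coifman-Rochberg and factorization place it in A_p0
  with a constant independent of \<open>f\<close>. Hoelder separates \<open>g\<close> from H, and H
  is controlled in L^p1(v) because p1 > 1.\<close>

lemma extrapolation_pair:
  fixes f g v :: "'a::euclidean_space \<Rightarrow> real"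
  assumes p: "1 < p1" "p1 < p0" and k: "0 < k" and k2: "0 < k2" and \<gamma>: "0 < \<gamma>" and C3: "0 \<le> C3"
    and fg[measurable]: "f \<in> borel_measurable lebesgue" "g \<in> borel_measurable lebesgue" and f0: "\<And>x. 0 \<le> f x" and g0: "\<And>x. 0 \<le> g x"
    and v: "A1_bound k v" and vp: "AE x in lebesgue. 0 < v x"
    and MB: "\<forall>(v::'a::euclidean_space \<Rightarrow> real) f m A. A1_bound k v \<longrightarrow> (AE x in lebesgue. 0 < v x) \<longrightarrow>
      f \<in> borel_measurable lebesgue \<longrightarrow> (\<forall>x. 0 \<le> f x) \<longrightarrow> m \<in> borel_measurable lebesgue \<longrightarrow> (\<forall>x. 0 \<le> m x) \<longrightarrow>
      (\<forall>x t. 0 < t \<longrightarrow> t < m x \<longrightarrow> ennreal t < maximal f x) \<longrightarrow> 0 \<le> A \<longrightarrow>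
      (\<integral>\<^sup>+x. ennreal (f x powr p1 * v x) \<partial>lebesgue) \<le> ennreal A \<longrightarrow> (\<integral>\<^sup>+x. ennreal (m x powr p1 * v x) \<partial>lebesgue) \<le> ennreal (C3 * A)"
    and CR: "\<forall>F::'a \<Rightarrow> real. F \<in> borel_measurable lebesgue \<longrightarrow> (AE x in lebesgue. maximal F x < top) \<longrightarrow>
      A1_bound k2 (\<lambda>x. enn2real (maximal F x) powr ((p0 - p1) / (p0 - 1)))"
    and LB: "\<forall>F::'a \<Rightarrow> real. F \<in> borel_measurable lebesgue \<longrightarrow> (\<forall>x. 0 \<le> F x) \<longrightarrow>
      (AE x in lebesgue. maximal F x < top) \<longrightarrow> (AE x in lebesgue. \<gamma> * F x \<le> enn2real (maximal F x))"
    and hyp: "\<And>V. A_class p0 V \<Longrightarrow> Ap_const p0 V \<le> ennreal (k * k2 powr (p0 - 1)) \<Longrightarrow> wLp_norm p0 V g \<le> ennreal C0 * wLp_norm p0 V f"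
    and A: "0 \<le> A" "(\<integral>\<^sup>+x. ennreal (f x powr p1 * v x) \<partial>lebesgue) \<le> ennreal A"
  shows "(\<integral>\<^sup>+x. ennreal (g x powr p1 * v x) \<partial>lebesgue) \<le>
    ennreal ((\<bar>C0\<bar> powr p0 * (1 / \<gamma>) powr (p0 - p1)) powr (p1 / p0) * C3 powr (1 - p1 / p0) * A)"
proof -
  define \<beta> where "\<beta> = (p0 - p1) / (p0 - 1)"
  have p0: "1 < p0" using p by simp
  have \<beta>p: "\<beta> * (1 - p0) = - (p0 - p1)"
  proof -
    have "\<beta> * (p0 - 1) = p0 - p1" using p by (simp add: \<beta>_def)
    then show ?thesis by (simp add: algebra_simps)
  qed
  have vm[measurable]: "v \<in> borel_measurable lebesgue" and v0: "\<And>x. 0 \<le> v x" using v by (auto simp: A1_bound_def weight_def)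
  have step: "(\<integral>\<^sup>+x. ennreal (g x powr p0 * (v x * enn2real (maximal F x) powr (- (p0 - p1)))) \<partial>lebesgue) \<le> ennreal (\<bar>C0\<bar> powr p0 * B)"
    if F[measurable]: "F \<in> borel_measurable lebesgue" and fin: "AE x in lebesgue. maximal F x < top" and pos: "\<And>x. 0 < maximal F x"
      and B: "0 \<le> B" "(\<integral>\<^sup>+x. ennreal (f x powr p0 * (v x * enn2real (maximal F x) powr (- (p0 - p1)))) \<partial>lebesgue) \<le> ennreal B" for F B
  proof -
    let ?u = "\<lambda>x. enn2real (maximal F x) powr \<beta>"
    have u: "A1_bound k2 ?u" unfolding \<beta>_def by (rule CR[rule_format, OF F fin])
    have up: "AE x in lebesgue. 0 < ?u x" using fin
    proof eventually_elim
      case (elim x)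
      then have "0 < enn2real (maximal F x)" using pos[of x] by (simp add: enn2real_positive_iff)
      then show ?case by simp
    qed
    have eq: "?u x powr (1 - p0) = enn2real (maximal F x) powr (- (p0 - p1))" for x unfolding powr_powr \<beta>p ..
    have "wLp_norm p0 (\<lambda>x. v x * ?u x powr (1 - p0)) g \<le> ennreal C0 * wLp_norm p0 (\<lambda>x. v x * ?u x powr (1 - p0)) f"
      by (intro hyp A_class_factorization[OF p0 v u k k2 vp up])
    from wLp_norm_leD[OF this _ B(1)] show ?thesis using B(2) p0 f0 g0 unfolding eq by simp
  qed
  show ?thesis
  proof (cases "AE x in lebesgue. f x = 0")
    case True
    \<comment> \<open>Now the maximal function of \<open>f\<close> vanishes and has no useful
      negative power. The maximal function of an indicator is positive and finite everywhere; the
      weight built from it forces \<open>g\<close> to vanish almost everywhere.\<close>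
    let ?F = "indicator (ball 0 1) :: 'a \<Rightarrow> real"
    have F: "?F \<in> borel_measurable lebesgue" by measurable
    have fin: "maximal ?F x < top" for x using maximal_indicator_le_1[of 0 1 x] by (simp add: le_less_trans)
    have nz: "\<not> (AE x in lebesgue. ?F x = 0)"
    proof
      assume "AE x in lebesgue. ?F x = 0"
      then have "AE x in lebesgue. x \<notin> ball (0::'a) 1" by eventually_elim (simp add: indicator_def split: if_splits)
      then have "emeasure lebesgue (ball (0::'a) 1) = 0"
        by (subst (asm) AE_iff_null_sets[symmetric]) (auto simp: null_sets_def simp del: emeasure_completion)
      then show False using measure_ball_pos[of 1 "0::'a"] by (simp add: emeasure_ball_eq_measure del: emeasure_completion)
    qed
    have pos: "0 < maximal ?F x" for x by (rule maximal_pos[OF F nz])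
    have z: "(\<integral>\<^sup>+x. ennreal (f x powr p0 * (v x * enn2real (maximal ?F x) powr (- (p0 - p1)))) \<partial>lebesgue) = 0"
    proof (subst nn_integral_0_iff_AE)
      show "AE x in lebesgue. ennreal (f x powr p0 * (v x * enn2real (maximal ?F x) powr (- (p0 - p1)))) = 0"
        using True by eventually_elim simp
    qed measurable
    have "(\<integral>\<^sup>+x. ennreal (g x powr p0 * (v x * enn2real (maximal ?F x) powr (- (p0 - p1)))) \<partial>lebesgue) \<le> ennreal (\<bar>C0\<bar> powr p0 * 0)"
      by (rule step[OF F]) (use fin pos z in auto)
    then have "(\<integral>\<^sup>+x. ennreal (g x powr p0 * (v x * enn2real (maximal ?F x) powr (- (p0 - p1)))) \<partial>lebesgue) = 0" by simp
    then have "AE x in lebesgue. ennreal (g x powr p0 * (v x * enn2real (maximal ?F x) powr (- (p0 - p1)))) = 0"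
      by (subst (asm) nn_integral_0_iff_AE) auto
    then have "AE x in lebesgue. ennreal (g x powr p1 * v x) = 0"
      using vp
    proof eventually_elim
      case (elim x)
      have "0 < enn2real (maximal ?F x)" using pos[of x] fin[of x] by (simp add: enn2real_positive_iff)
      then have "0 < v x * enn2real (maximal ?F x) powr (- (p0 - p1))" using elim by simp
      moreover have "g x powr p0 * (v x * enn2real (maximal ?F x) powr (- (p0 - p1))) = 0"
      proof (rule antisym)
        show "g x powr p0 * (v x * enn2real (maximal ?F x) powr (- (p0 - p1))) \<le> 0"
          using elim(1) by (simp only: ennreal_eq_0_iff)
      qed (use v0[of x] in simp)
      ultimately have "g x = 0" by auto
      then show ?case by simp
    qed
    then have "(\<integral>\<^sup>+x. ennreal (g x powr p1 * v x) \<partial>lebesgue) = 0" by (subst nn_integral_0_iff_AE) auto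
    then show ?thesis by simp
  next
    case False
    have pos: "0 < maximal f x" for x by (rule maximal_pos[OF fg(1) False])
    \<comment> \<open>Integrability of \<open>f\<close> against \<open>v\<close> is all that is
      known. The multiples j of the indicator of the set where the maximal function is
      \<open>top\<close> lie below it, so their weighted norms stay bounded as j grows and the set
      has v-mass zero.\<close>
    have fin: "AE x in lebesgue. maximal f x < top"
    proof -
      let ?N = "{x. maximal f x = top}"
      have N[measurable]: "?N \<in> sets lebesgue"
        using measurable_sets[OF borel_measurable_maximal, of "{top}" f] by (simp add: vimage_def)
      have bd: "ennreal (real j) * (\<integral>\<^sup>+x\<in>?N. ennreal (v x) \<partial>lebesgue) \<le> ennreal (C3 * A)" if "1 \<le> j" for j :: nat
      proof -
        let ?m = "\<lambda>x. real j * indicator ?N x"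
        have "(\<integral>\<^sup>+x. ennreal (?m x powr p1 * v x) \<partial>lebesgue) \<le> ennreal (C3 * A)"
        proof (rule MB[rule_format, OF v vp fg(1) f0 _ _ _ A])
          fix x t assume "0 < t" "t < ?m x"
          then have "maximal f x = top" by (cases "maximal f x = top") auto
          then show "ennreal t < maximal f x" by simp
        qed auto
        moreover have "ennreal (real j) * (\<integral>\<^sup>+x\<in>?N. ennreal (v x) \<partial>lebesgue) \<le> (\<integral>\<^sup>+x. ennreal (?m x powr p1 * v x) \<partial>lebesgue)"
        proof -
          have "ennreal (real j) * (\<integral>\<^sup>+x\<in>?N. ennreal (v x) \<partial>lebesgue) = (\<integral>\<^sup>+x. ennreal (real j) * (ennreal (v x) * indicator ?N x) \<partial>lebesgue)"
            by (rule nn_integral_cmult[symmetric]) measurable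
          also have "\<dots> \<le> (\<integral>\<^sup>+x. ennreal (?m x powr p1 * v x) \<partial>lebesgue)"
          proof (rule nn_integral_mono)
            fix x
            have "real j powr 1 \<le> real j powr p1" using that p by (intro powr_mono) auto
            then have "real j * v x \<le> real j powr p1 * v x" using v0[of x] that by (intro mult_right_mono) auto
            then show "ennreal (real j) * (ennreal (v x) * indicator ?N x) \<le> ennreal (?m x powr p1 * v x)"
              using v0[of x] by (cases "x \<in> ?N") (simp_all flip: ennreal_mult add: ennreal_leI)
          qed
          finally show ?thesis .
        qed
        ultimately show ?thesis by (rule order_trans[rotated])
      qed
      have "(\<integral>\<^sup>+x\<in>?N. ennreal (v x) \<partial>lebesgue) = 0"
      proof (cases "\<integral>\<^sup>+x\<in>?N. ennreal (v x) \<partial>lebesgue")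
        case (real y)
        have "y = 0"
        proof (rule ccontr)
          assume "y \<noteq> 0"
          then have y: "0 < y" using real by simp
          obtain j :: nat where j: "C3 * A / y < real j" using reals_Archimedean2 by blast
          have "ennreal (real (Suc j) * y) \<le> ennreal (C3 * A)" using bd[of "Suc j"] real by (simp add: ennreal_mult)
          then have "real (Suc j) * y \<le> C3 * A" using C3 A y by (subst (asm) ennreal_le_iff) auto
          moreover have "C3 * A < real (Suc j) * y" using j y by (simp add: field_simps)
          ultimately show False by simp
        qed
        then show ?thesis using real by simp
      next
        case top
        then show ?thesis using bd[of 1] by (simp add: top_unique)
      qed
      then have "AE x in lebesgue. ennreal (v x) * indicator ?N x = 0" by (subst (asm) nn_integral_0_iff_AE) auto
      then show ?thesis using vp
      proof eventually_elim
        case (elim x)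
        then have "x \<notin> ?N" by (cases "x \<in> ?N") auto
        then show ?case by (simp add: less_top)
      qed
    qed
    let ?H = "\<lambda>x. enn2real (maximal f x)"
    have Hpos: "AE x in lebesgue. 0 < ?H x" using fin
    proof eventually_elim
      case (elim x)
      then show ?case using pos[of x] by (simp add: enn2real_positive_iff)
    qed
    have IH: "(\<integral>\<^sup>+x. ennreal (?H x powr p1 * v x) \<partial>lebesgue) \<le> ennreal (C3 * A)"
    proof (rule MB[rule_format, OF v vp fg(1) f0 _ _ _ A])
      fix x t assume "0 < t" "t < ?H x"
      then show "ennreal t < maximal f x" by (cases "maximal f x") (auto simp: ennreal_less_iff)
    qed auto
    have fH: "AE x in lebesgue. \<gamma> * f x \<le> ?H x" by (rule LB[rule_format, OF fg(1) f0 fin])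
    \<comment> \<open>From \<open>\<gamma> * f x \<le> ?H x\<close>, the factor f^(p0-p1) is
      absorbed by the negative power of H and the exponent p1 is left.\<close>
    define B where "B = (1 / \<gamma>) powr (p0 - p1) * A"
    have B0: "0 \<le> B" using A by (simp add: B_def)
    have "(\<integral>\<^sup>+x. ennreal (f x powr p0 * (v x * ?H x powr (- (p0 - p1)))) \<partial>lebesgue) \<le>
      (\<integral>\<^sup>+x. ennreal ((1 / \<gamma>) powr (p0 - p1)) * ennreal (f x powr p1 * v x) \<partial>lebesgue)"
    proof (rule nn_integral_mono_AE)
      show "AE x in lebesgue. ennreal (f x powr p0 * (v x * ?H x powr (- (p0 - p1)))) \<le> ennreal ((1 / \<gamma>) powr (p0 - p1)) * ennreal (f x powr p1 * v x)"
        using Hpos fH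
      proof eventually_elim
        case (elim x)
        have "f x powr p0 = f x powr p1 * f x powr (p0 - p1)" by (simp flip: powr_add)
        moreover have "f x powr (p0 - p1) \<le> (1 / \<gamma> * ?H x) powr (p0 - p1)"
          using elim f0[of x] \<gamma> p by (intro powr_mono2) (auto simp: field_simps)
        moreover have "(1 / \<gamma> * ?H x) powr (p0 - p1) = (1 / \<gamma>) powr (p0 - p1) * ?H x powr (p0 - p1)" by (rule powr_mult)
        ultimately have "f x powr p0 \<le> f x powr p1 * ((1 / \<gamma>) powr (p0 - p1) * ?H x powr (p0 - p1))"
          by (simp add: mult_left_mono)
        then have "f x powr p0 * (v x * ?H x powr (- (p0 - p1))) \<le>
           f x powr p1 * ((1 / \<gamma>) powr (p0 - p1) * ?H x powr (p0 - p1)) * (v x * ?H x powr (- (p0 - p1)))"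
          using v0[of x] by (intro mult_right_mono) auto
        also have "\<dots> = (1 / \<gamma>) powr (p0 - p1) * (f x powr p1 * v x) * (?H x powr (p0 - p1) * ?H x powr (- (p0 - p1)))"
          by (simp only: mult_ac)
        also have "?H x powr (p0 - p1) * ?H x powr (- (p0 - p1)) = 1" using elim by (simp flip: powr_add)
        finally show ?case using v0[of x] by (simp flip: ennreal_mult add: ennreal_leI)
      qed
    qed
    also have "\<dots> = ennreal ((1 / \<gamma>) powr (p0 - p1)) * (\<integral>\<^sup>+x. ennreal (f x powr p1 * v x) \<partial>lebesgue)" by (rule nn_integral_cmult) measurable
    also have "\<dots> \<le> ennreal ((1 / \<gamma>) powr (p0 - p1)) * ennreal A" by (intro mult_left_mono A) simp
    also have "\<dots> = ennreal B" using A by (simp add: B_def flip: ennreal_mult)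
    finally have Ig: "(\<integral>\<^sup>+x. ennreal (g x powr p0 * (v x * ?H x powr (- (p0 - p1)))) \<partial>lebesgue) \<le> ennreal (\<bar>C0\<bar> powr p0 * B)"
      by (intro step[OF fg(1) fin pos B0])
    \<comment> \<open>The exponent for which the powers of H cancel and those of \<open>v\<close>
      add up to one.\<close>
    define \<theta> where "\<theta> = p1 / p0"
    have \<theta>: "0 < \<theta>" "\<theta> < 1" using p by (auto simp: \<theta>_def)
    let ?a = "\<lambda>x. g x powr p0 * (v x * ?H x powr (- (p0 - p1)))" and ?b = "\<lambda>x. ?H x powr p1 * v x"
    have "(\<integral>\<^sup>+x. ennreal (g x powr p1 * v x) \<partial>lebesgue) = (\<integral>\<^sup>+x. ennreal (?a x powr \<theta> * ?b x powr (1 - \<theta>)) \<partial>lebesgue)"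
    proof (rule nn_integral_cong_AE)
      show "AE x in lebesgue. ennreal (g x powr p1 * v x) = ennreal (?a x powr \<theta> * ?b x powr (1 - \<theta>))"
        using Hpos vp
      proof eventually_elim
        case (elim x)
        have e1: "p0 * \<theta> = p1" using p by (simp add: \<theta>_def)
        have e2: "- (p0 - p1) * \<theta> = - (p1 * (1 - \<theta>))" using p by (simp add: \<theta>_def field_simps)
        have "?a x powr \<theta> * ?b x powr (1 - \<theta>) =
           g x powr p1 * (v x powr \<theta> * ?H x powr (- (p1 * (1 - \<theta>)))) * (?H x powr (p1 * (1 - \<theta>)) * v x powr (1 - \<theta>))"
          by (simp only: powr_mult powr_powr e1 e2)
        also have "\<dots> = g x powr p1 * (v x powr \<theta> * v x powr (1 - \<theta>)) * (?H x powr (p1 * (1 - \<theta>)) * ?H x powr (- (p1 * (1 - \<theta>))))"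
          by (simp only: mult_ac)
        also have "v x powr \<theta> * v x powr (1 - \<theta>) = v x" using elim by (simp flip: powr_add)
        also have "?H x powr (p1 * (1 - \<theta>)) * ?H x powr (- (p1 * (1 - \<theta>))) = 1" using elim by (simp flip: powr_add)
        finally show ?case by simp
      qed
    qed
    also have "\<dots> \<le> ennreal ((\<bar>C0\<bar> powr p0 * B) powr \<theta> * (C3 * A) powr (1 - \<theta>))"
      by (rule nn_integral_holder_le) (use \<theta> v0 Ig IH B0 C3 A in auto)
    also have "(\<bar>C0\<bar> powr p0 * B) powr \<theta> * (C3 * A) powr (1 - \<theta>) = (\<bar>C0\<bar> powr p0 * (1 / \<gamma>) powr (p0 - p1)) powr \<theta> * C3 powr (1 - \<theta>) * A"
    proof -
      have AA: "A powr \<theta> * A powr (1 - \<theta>) = A" using A by (cases "A = 0") (auto simp flip: powr_add)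
      have "(\<bar>C0\<bar> powr p0 * B) powr \<theta> * (C3 * A) powr (1 - \<theta>) =
        (\<bar>C0\<bar> powr p0 * (1 / \<gamma>) powr (p0 - p1)) powr \<theta> * A powr \<theta> * (C3 powr (1 - \<theta>) * A powr (1 - \<theta>))"
        unfolding B_def mult.assoc[symmetric] by (simp only: powr_mult mult.assoc)
      also have "\<dots> = (\<bar>C0\<bar> powr p0 * (1 / \<gamma>) powr (p0 - p1)) powr \<theta> * C3 powr (1 - \<theta>) * (A powr \<theta> * A powr (1 - \<theta>))"
        by (simp only: mult_ac)
      finally show ?thesis unfolding AA .
    qed
    finally show ?thesis unfolding \<theta>_def .
  qed
qed

theorem extrapolation_down:
  fixes F :: "(('a::euclidean_space \<Rightarrow> real) \<times> ('a \<Rightarrow> real)) set"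
  assumes p: "1 < p1" "p1 < p0" and hyp: "extrap_hyp p0 F"
    and F: "\<forall>(f, g)\<in>F. f \<in> borel_measurable lebesgue \<and> g \<in> borel_measurable lebesgue \<and> (\<forall>x. 0 \<le> f x) \<and> (\<forall>x. 0 \<le> g x)"
  shows "A1_inequality ((\<lambda>(f, g). (\<lambda>x. f x powr p1, \<lambda>x. g x powr p1)) ` F)"
  unfolding A1_inequality_def
proof (intro conjI allI)
  show "\<forall>(f, g)\<in>(\<lambda>(f, g). (\<lambda>x. f x powr p1, \<lambda>x. g x powr p1)) ` F.
     f \<in> borel_measurable lebesgue \<and> g \<in> borel_measurable lebesgue \<and> (\<forall>x. 0 \<le> f x) \<and> (\<forall>x. 0 \<le> g x)"
    using F by auto
  fix k0 :: real
  \<comment> \<open>The maximum here and \<open>k2 + 1\<close> below provide the strictly positive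
    constants of the factorization; the zero weight is treated apart.\<close>
  define k where "k = max k0 1"
  have k: "0 < k" "k0 \<le> k" by (auto simp: k_def)
  from maximal_A1_bound[OF k(1) p(1), where 'a='a] obtain C3 where C3: "0 \<le> C3"
    and MB: "\<forall>(v::'a::euclidean_space \<Rightarrow> real) f m A. A1_bound k v \<longrightarrow> (AE x in lebesgue. 0 < v x) \<longrightarrow>
      f \<in> borel_measurable lebesgue \<longrightarrow> (\<forall>x. 0 \<le> f x) \<longrightarrow> m \<in> borel_measurable lebesgue \<longrightarrow> (\<forall>x. 0 \<le> m x) \<longrightarrow>
      (\<forall>x t. 0 < t \<longrightarrow> t < m x \<longrightarrow> ennreal t < maximal f x) \<longrightarrow> 0 \<le> A \<longrightarrow>
      (\<integral>\<^sup>+x. ennreal (f x powr p1 * v x) \<partial>lebesgue) \<le> ennreal A \<longrightarrow> (\<integral>\<^sup>+x. ennreal (m x powr p1 * v x) \<partial>lebesgue) \<le> ennreal (C3 * A)"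
    by (elim exE conjE) (rule that)
  have \<beta>: "0 < (p0 - p1) / (p0 - 1)" "(p0 - p1) / (p0 - 1) < 1" using p by auto
  from coifman_rochberg[OF \<beta>, where 'a='a] obtain k2 where k2: "0 \<le> k2" and CR0: "\<forall>F::'a \<Rightarrow> real. F \<in> borel_measurable lebesgue \<longrightarrow> (AE x in lebesgue. maximal F x < top) \<longrightarrow>
      A1_bound k2 (\<lambda>x. enn2real (maximal F x) powr ((p0 - p1) / (p0 - 1)))" by (elim exE conjE) (rule that)
  have CR: "\<forall>F::'a \<Rightarrow> real. F \<in> borel_measurable lebesgue \<longrightarrow> (AE x in lebesgue. maximal F x < top) \<longrightarrow>
      A1_bound (k2 + 1) (\<lambda>x. enn2real (maximal F x) powr ((p0 - p1) / (p0 - 1)))"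
    using CR0 by (auto intro: A1_bound_mono)
  have k2': "0 < k2 + 1" using k2 by simp
  from maximal_lower_bound[where 'a='a] obtain \<gamma> where \<gamma>: "0 < \<gamma>" and LB: "\<forall>F::'a \<Rightarrow> real. F \<in> borel_measurable lebesgue \<longrightarrow> (\<forall>x. 0 \<le> F x) \<longrightarrow>
      (AE x in lebesgue. maximal F x < top) \<longrightarrow> (AE x in lebesgue. \<gamma> * F x \<le> enn2real (maximal F x))" by (elim exE conjE) (rule that)
  \<comment> \<open>The hypothesis is invoked once, at a level that bounds the A_p0 constants of all
    weights constructed from \<open>v\<close> and any \<open>f\<close>.\<close>
  from hyp[unfolded extrap_hyp_def, THEN spec, of "k * (k2 + 1) powr (p0 - 1)"] obtain C0
    where C0: "\<forall>v. A_class p0 v \<and> Ap_const p0 v \<le> ennreal (k * (k2 + 1) powr (p0 - 1)) \<longrightarrow>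
      (\<forall>(f, g)\<in>F. wLp_norm p0 v g \<le> ennreal C0 * wLp_norm p0 v f)" ..
  define C where "C = (\<bar>C0\<bar> powr p0 * (1 / \<gamma>) powr (p0 - p1)) powr (p1 / p0) * C3 powr (1 - p1 / p0)"
  have C: "0 \<le> C" by (simp add: C_def)
  have main: "(\<integral>\<^sup>+x. ennreal (g x powr p1 * v x) \<partial>lebesgue) \<le> ennreal (C * A)"
    if v0: "A1_bound k0 v" and FG: "(f, g) \<in> F" and A: "0 \<le> A" "(\<integral>\<^sup>+x. ennreal (f x powr p1 * v x) \<partial>lebesgue) \<le> ennreal A" for f g v A
  proof (cases "AE x in lebesgue. v x = 0")
    case True
    then have z: "AE x in lebesgue. ennreal (g x powr p1 * v x) = 0" by eventually_elim simp
    have "(\<integral>\<^sup>+x. ennreal (g x powr p1 * v x) \<partial>lebesgue) = (\<integral>\<^sup>+x. 0 \<partial>(lebesgue::'a measure))" by (rule nn_integral_cong_AE[OF z])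
    then show ?thesis by simp
  next
    case False
    have v: "A1_bound k v" by (rule A1_bound_mono[OF v0 k(2)])
    have vp: "AE x in lebesgue. 0 < v x" by (rule A1_bound_pos(2)[OF v less_imp_le[OF k(1)] False])
    have fg: "f \<in> borel_measurable lebesgue" "g \<in> borel_measurable lebesgue" "\<And>x. 0 \<le> f x" "\<And>x. 0 \<le> g x" using F FG by auto
    show ?thesis unfolding C_def
      by (rule extrapolation_pair[OF p k(1) k2' \<gamma> C3 fg v vp MB CR LB _ A]) (use C0 FG in blast)
  qed
  show "\<exists>C\<ge>0. \<forall>v f g A. A1_bound k0 v \<longrightarrow> (f, g) \<in> (\<lambda>(f, g). (\<lambda>x. f x powr p1, \<lambda>x. g x powr p1)) ` F \<longrightarrow> 0 \<le> A \<longrightarrow>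
      (\<integral>\<^sup>+x. ennreal (f x * v x) \<partial>lebesgue) \<le> ennreal A \<longrightarrow> (\<integral>\<^sup>+x. ennreal (g x * v x) \<partial>lebesgue) \<le> ennreal (C * A)"
  proof (intro exI[of _ C] conjI C allI impI)
    fix v f g A assume a: "A1_bound k0 v" "(f, g) \<in> (\<lambda>(f, g). (\<lambda>x. f x powr p1, \<lambda>x. g x powr p1)) ` F" "0 \<le> A"
      "(\<integral>\<^sup>+x. ennreal (f x * v x) \<partial>lebesgue) \<le> ennreal A"
    from a(2) obtain f' g' where "(f', g') \<in> F" "f = (\<lambda>x. f' x powr p1)" "g = (\<lambda>x. g' x powr p1)" by auto
    then show "(\<integral>\<^sup>+x. ennreal (g x * v x) \<partial>lebesgue) \<le> ennreal (C * A)" using main[OF a(1), of f' g' A] a by simp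
  qed
qed

lemma A1_inequality_of_extrap_hyp_1:
  fixes F :: "(('a::euclidean_space \<Rightarrow> real) \<times> ('a \<Rightarrow> real)) set"
  assumes hyp: "extrap_hyp 1 F"
    and F: "\<forall>(f, g)\<in>F. f \<in> borel_measurable lebesgue \<and> g \<in> borel_measurable lebesgue \<and> (\<forall>x. 0 \<le> f x) \<and> (\<forall>x. 0 \<le> g x)"
  shows "A1_inequality F"
  unfolding A1_inequality_def
proof (intro conjI allI)
  fix k :: real
  from hyp[unfolded extrap_hyp_def, THEN spec, of "max k 0"] obtain C0
    where C0: "\<forall>v. A_class 1 v \<and> Ap_const 1 v \<le> ennreal (max k 0) \<longrightarrow>
      (\<forall>(f, g)\<in>F. wLp_norm 1 v g \<le> ennreal C0 * wLp_norm 1 v f)" ..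
  show "\<exists>C\<ge>0. \<forall>v f g A. A1_bound k v \<longrightarrow> (f, g) \<in> F \<longrightarrow> 0 \<le> A \<longrightarrow>
      (\<integral>\<^sup>+x. ennreal (f x * v x) \<partial>lebesgue) \<le> ennreal A \<longrightarrow> (\<integral>\<^sup>+x. ennreal (g x * v x) \<partial>lebesgue) \<le> ennreal (C * A)"
  proof (intro exI[of _ "\<bar>C0\<bar>"] conjI allI impI)
    fix v f g A assume v: "A1_bound k v" and FG: "(f, g) \<in> F" and A: "0 \<le> A" "(\<integral>\<^sup>+x. ennreal (f x * v x) \<partial>lebesgue) \<le> ennreal A"
    have v': "A1_bound (max k 0) v" by (rule A1_bound_mono[OF v]) simp
    then have wv: "weight v" and M: "AE x in lebesgue. maximal v x \<le> ennreal (max k 0 * v x)" by (auto simp: A1_bound_def)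
    have v0: "\<And>x. 0 \<le> v x" using wv by (simp add: weight_def)
    have "AE x in lebesgue. maximal v x \<le> ennreal (max k 0) * ennreal (v x)"
      using M by eventually_elim (use v0 in \<open>simp add: ennreal_mult\<close>)
    then have c: "Ap_const 1 v \<le> ennreal (max k 0)" unfolding Ap_const_def by (simp add: Inf_lower)
    have "A_class 1 v" unfolding A_class_def using wv c by (simp add: le_less_trans)
    then have "wLp_norm 1 v g \<le> ennreal C0 * wLp_norm 1 v f" using C0 c FG by blast
    from wLp_norm_leD[OF this _ A(1)] show "(\<integral>\<^sup>+x. ennreal (g x * v x) \<partial>lebesgue) \<le> ennreal (\<bar>C0\<bar> * A)"
      using A(2) F FG by auto
  qed simp
qed (use F in auto)

section \<open>Morrey norms and the dual condition\<close>

lemma morrey_norm_le_iff: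
  fixes \<phi> :: "'a::euclidean_space set \<Rightarrow> real"
  assumes \<phi>: "\<forall>c r. 0 < r \<longrightarrow> 0 < \<phi> (ball c r)" and p: "0 < p" and L: "0 \<le> L"
  shows "morrey_norm p \<phi> w f \<le> ennreal L \<longleftrightarrow>
    (\<forall>c r. 0 < r \<longrightarrow> (\<integral>\<^sup>+x\<in>ball c r. ennreal (\<bar>f x\<bar> powr p * w x) \<partial>lebesgue) \<le> ennreal (L powr p * \<phi> (ball c r)))"
proof -
  have eq: "enn_powr (1 / p) (ennreal (1 / \<phi> (ball c r)) * I) \<le> ennreal L \<longleftrightarrow> I \<le> ennreal (L powr p * \<phi> (ball c r))"
    if r: "0 < r" for c r I
  proof -
    have f: "0 < \<phi> (ball c r)" using \<phi> r by blast
    have m: "ennreal (\<phi> (ball c r)) * (ennreal (1 / \<phi> (ball c r)) * J) = J" for J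
    proof -
      have "ennreal (\<phi> (ball c r)) * ennreal (1 / \<phi> (ball c r)) = 1" using f by (simp flip: ennreal_mult)
      then show ?thesis by (simp flip: mult.assoc)
    qed
    show ?thesis
    proof
      assume "enn_powr (1 / p) (ennreal (1 / \<phi> (ball c r)) * I) \<le> ennreal L"
      then have "ennreal (1 / \<phi> (ball c r)) * I \<le> ennreal (L powr (1 / (1 / p)))" using p L by (intro enn_powr_leD) auto
      then have "ennreal (\<phi> (ball c r)) * (ennreal (1 / \<phi> (ball c r)) * I) \<le> ennreal (\<phi> (ball c r)) * ennreal (L powr p)"
        by (intro mult_left_mono) auto
      then show "I \<le> ennreal (L powr p * \<phi> (ball c r))" unfolding m using f by (simp flip: ennreal_mult add: mult.commute)
    next
      assume "I \<le> ennreal (L powr p * \<phi> (ball c r))"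
      then have "ennreal (1 / \<phi> (ball c r)) * I \<le> ennreal (1 / \<phi> (ball c r)) * ennreal (L powr p * \<phi> (ball c r))"
        by (intro mult_left_mono) auto
      also have "\<dots> = ennreal (L powr p)" using f by (simp flip: ennreal_mult)
      finally have "enn_powr (1 / p) (ennreal (1 / \<phi> (ball c r)) * I) \<le> ennreal ((L powr p) powr (1 / p))"
        using p by (intro enn_powr_le) auto
      also have "(L powr p) powr (1 / p) = L" using p L by (simp add: powr_powr)
      finally show "enn_powr (1 / p) (ennreal (1 / \<phi> (ball c r)) * I) \<le> ennreal L" .
    qed
  qed
  show ?thesis unfolding morrey_norm_def SUP_le_iff using eq by auto
qed

text \<open>What is used of the dual condition. The norm of the indicator is replaced by its lower
  bound \<open>(W / \<phi> (ball c r)) powr (1 / q)\<close>, obtained by testing the supremum on the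
  ball itself, and the Koethe norm by its action on functions of norm at most
  \<open>\<Lambda>\<close>. A positive real \<open>\<Lambda>\<close> in place of the norm also
  covers functions of norm zero.\<close>

definition star_bound :: "real \<Rightarrow> real \<Rightarrow> real \<Rightarrow> ('a::euclidean_space set \<Rightarrow> real) \<Rightarrow> ('a \<Rightarrow> real) \<Rightarrow> bool" where
  "star_bound K q s \<phi> w \<longleftrightarrow> (\<forall>c r W f \<Lambda>. 0 < r \<longrightarrow> 0 < W \<longrightarrow> (\<integral>\<^sup>+x\<in>ball c r. ennreal (w x) \<partial>lebesgue) = ennreal W \<longrightarrow>
     f \<in> borel_measurable lebesgue \<longrightarrow> (\<forall>x. 0 \<le> f x) \<longrightarrow> 0 < \<Lambda> \<longrightarrow> morrey_norm q \<phi> w f \<le> ennreal \<Lambda> \<longrightarrow>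
     (\<integral>\<^sup>+x. ennreal (f x * enn2real (maximal (indicator (ball c r)) x) powr (1 / s)) \<partial>lebesgue) \<le>
       ennreal (\<Lambda> * K * measure lebesgue (ball c r) * (\<phi> (ball c r) / W) powr (1 / q)))"

lemma star_bound_of_cond_star:
  fixes \<phi> :: "'a::euclidean_space set \<Rightarrow> real"
  assumes \<phi>: "\<forall>c r. 0 < r \<longrightarrow> 0 < \<phi> (ball c r)" and q: "1 \<le> q" and star: "cond_star q s \<phi> w" and w: "weight w"
  shows "\<exists>K\<ge>0. star_bound K q s \<phi> w"
proof -
  let ?M = "\<lambda>c r x. enn2real (maximal (indicator (ball c r)) x) powr (1 / s)"
  let ?S = "SUP cr \<in> {(c, r). (0::real) < r}.
        ennreal (1 / measure lebesgue (ball (fst cr) (snd cr))) *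
        morrey_norm q \<phi> w (indicator (ball (fst cr) (snd cr))) *
        koethe_dual (morrey_norm q \<phi> w) (?M (fst cr) (snd cr))"
  have "?S < top" using star unfolding cond_star_def .
  then obtain K where K: "?S = ennreal K" "0 \<le> K" by (cases ?S) auto
  have "star_bound K q s \<phi> w"
    unfolding star_bound_def
  proof (intro allI impI)
    fix c :: 'a and r W f \<Lambda>
    assume r: "0 < r" and W: "0 < W" "(\<integral>\<^sup>+x\<in>ball c r. ennreal (w x) \<partial>lebesgue) = ennreal W"
      and f[measurable]: "f \<in> borel_measurable lebesgue" and f0: "\<forall>x. 0 \<le> f x" and \<Lambda>: "0 < \<Lambda>" "morrey_norm q \<phi> w f \<le> ennreal \<Lambda>"
    let ?m = "measure lebesgue (ball c r)" and ?I = "\<integral>\<^sup>+x. ennreal (f x * ?M c r x) \<partial>lebesgue"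
    have m: "0 < ?m" by (rule measure_ball_pos[OF r])
    have fp: "0 < \<phi> (ball c r)" using \<phi> r by blast
    have q0: "0 < q" using q by simp
    have bound: "ennreal (1 / ?m) * morrey_norm q \<phi> w (indicator (ball c r)) * koethe_dual (morrey_norm q \<phi> w) (?M c r) \<le> ennreal K"
      unfolding K(1)[symmetric] by (rule SUP_upper2[of "(c, r)"]) (use r in auto)
    have N: "ennreal ((W / \<phi> (ball c r)) powr (1 / q)) \<le> morrey_norm q \<phi> w (indicator (ball c r))"
    proof -
      have e: "(\<integral>\<^sup>+x\<in>ball c r. ennreal (\<bar>indicator (ball c r) x\<bar> powr q * w x) \<partial>lebesgue) = ennreal W"
        unfolding W(2)[symmetric] by (intro nn_integral_cong) (auto simp: indicator_def)
      have "enn_powr (1 / q) (ennreal (1 / \<phi> (ball c r)) * (\<integral>\<^sup>+x\<in>ball c r. ennreal (\<bar>indicator (ball c r) x\<bar> powr q * w x) \<partial>lebesgue)) \<le>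
        morrey_norm q \<phi> w (indicator (ball c r))"
        unfolding morrey_norm_def by (rule SUP_upper2[of "(c, r)"]) (use r in auto)
      moreover have "ennreal (1 / \<phi> (ball c r)) * ennreal W = ennreal (W / \<phi> (ball c r))" using fp W by (simp flip: ennreal_mult)
      ultimately show ?thesis unfolding e using fp W by (simp add: enn_powr_def)
    qed
    have D: "ennreal (1 / \<Lambda>) * ?I \<le> koethe_dual (morrey_norm q \<phi> w) (?M c r)"
    proof -
      let ?g = "\<lambda>x. f x / \<Lambda>"
      have "morrey_norm q \<phi> w ?g \<le> ennreal 1"
        unfolding morrey_norm_le_iff[OF \<phi> q0 zero_le_one]
      proof (intro allI impI)
        fix c' :: 'a and r' :: real assume r': "0 < r'"
        have w0: "\<And>x. 0 \<le> w x" and [measurable]: "w \<in> borel_measurable lebesgue" using w by (auto simp: weight_def)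
        have "(\<integral>\<^sup>+x\<in>ball c' r'. ennreal (\<bar>?g x\<bar> powr q * w x) \<partial>lebesgue) =
           (\<integral>\<^sup>+x. ennreal (1 / \<Lambda> powr q) * (ennreal (\<bar>f x\<bar> powr q * w x) * indicator (ball c' r') x) \<partial>lebesgue)"
        proof (rule nn_integral_cong)
          fix x
          have "\<bar>?g x\<bar> powr q * w x = 1 / \<Lambda> powr q * (\<bar>f x\<bar> powr q * w x)" using \<Lambda> by (simp add: powr_divide)
          then show "ennreal (\<bar>?g x\<bar> powr q * w x) * indicator (ball c' r') x = ennreal (1 / \<Lambda> powr q) * (ennreal (\<bar>f x\<bar> powr q * w x) * indicator (ball c' r') x)"
            using w0[of x] by (simp only: mult.assoc[symmetric] ennreal_mult[symmetric]) (simp add: ennreal_mult[symmetric])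
        qed
        also have "\<dots> = ennreal (1 / \<Lambda> powr q) * (\<integral>\<^sup>+x\<in>ball c' r'. ennreal (\<bar>f x\<bar> powr q * w x) \<partial>lebesgue)"
          by (rule nn_integral_cmult) measurable
        also have "\<dots> \<le> ennreal (1 / \<Lambda> powr q) * ennreal (\<Lambda> powr q * \<phi> (ball c' r'))"
          using \<Lambda>(2) r' unfolding morrey_norm_le_iff[OF \<phi> q0 less_imp_le[OF \<Lambda>(1)]] by (intro mult_left_mono) auto
        also have "\<dots> = ennreal (1 powr q * \<phi> (ball c' r'))" using \<Lambda>(1) \<phi> r' by (simp flip: ennreal_mult add: less_imp_le)
        finally show "(\<integral>\<^sup>+x\<in>ball c' r'. ennreal (\<bar>?g x\<bar> powr q * w x) \<partial>lebesgue) \<le> ennreal (1 powr q * \<phi> (ball c' r'))" .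
      qed
      then have "(\<integral>\<^sup>+x. ennreal \<bar>?g x * ?M c r x\<bar> \<partial>lebesgue) \<le> koethe_dual (morrey_norm q \<phi> w) (?M c r)"
        unfolding koethe_dual_def by (intro SUP_upper) simp
      moreover have "ennreal (1 / \<Lambda>) * ?I = (\<integral>\<^sup>+x. ennreal \<bar>?g x * ?M c r x\<bar> \<partial>lebesgue)"
      proof -
        have "ennreal (1 / \<Lambda>) * ?I = (\<integral>\<^sup>+x. ennreal (1 / \<Lambda>) * ennreal (f x * ?M c r x) \<partial>lebesgue)"
          by (rule nn_integral_cmult[symmetric]) measurable
        also have "\<dots> = (\<integral>\<^sup>+x. ennreal \<bar>?g x * ?M c r x\<bar> \<partial>lebesgue)"
          using f0 \<Lambda> by (intro nn_integral_cong) (simp flip: ennreal_mult)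
        finally show ?thesis .
      qed
      ultimately show ?thesis by simp
    qed
    let ?z = "(W / \<phi> (ball c r)) powr (1 / q)"
    have z: "0 < ?z" using W fp by simp
    have "ennreal (1 / ?m) * ennreal ?z * (ennreal (1 / \<Lambda>) * ?I) \<le> ennreal K"
      by (rule order_trans[OF mult_mono[OF mult_left_mono[OF N] D] bound]) auto
    moreover have "ennreal (1 / ?m * ?z * (1 / \<Lambda>)) = ennreal (1 / ?m) * ennreal ?z * ennreal (1 / \<Lambda>)"
    proof -
      have "0 \<le> 1 / ?m" "0 \<le> ?z" "0 \<le> 1 / ?m * ?z" "0 \<le> 1 / \<Lambda>" using m z \<Lambda> by auto
      then show ?thesis by (simp only: ennreal_mult)
    qed
    ultimately have le: "ennreal (1 / ?m * ?z * (1 / \<Lambda>)) * ?I \<le> ennreal K"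
      by (simp only: mult.assoc)
    define k where "k = 1 / ?m * ?z * (1 / \<Lambda>)"
    have k: "0 < k" using m z \<Lambda> by (simp add: k_def)
    have "?I = ennreal (1 / k) * (ennreal k * ?I)"
    proof -
      have "ennreal (1 / k) * ennreal k = 1" using k by (simp flip: ennreal_mult)
      then show ?thesis by (simp only: mult.assoc[symmetric] mult_1)
    qed
    also have "\<dots> \<le> ennreal (1 / k) * ennreal K" using le by (intro mult_left_mono) (simp_all add: k_def)
    also have "\<dots> = ennreal (1 / k * K)" using k K by (simp flip: ennreal_mult)
    also have "1 / k * K = \<Lambda> * K * ?m * (\<phi> (ball c r) / W) powr (1 / q)"
    proof -
      have "(\<phi> (ball c r) / W) powr (1 / q) = 1 / ?z" using fp W by (simp add: powr_divide)
      then show ?thesis unfolding k_def using m z \<Lambda> by simp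
    qed
    finally show "?I \<le> ennreal (\<Lambda> * K * ?m * (\<phi> (ball c r) / W) powr (1 / q))" .
  qed
  then show ?thesis using K by blast
qed

lemma A1_bound_one: "A1_bound 1 (\<lambda>_::'a::euclidean_space. 1)"
  unfolding A1_bound_def
proof
  have b: "(\<integral>\<^sup>+x\<in>ball c r. ennreal 1 \<partial>lebesgue) = ennreal (measure lebesgue (ball c r))" for c :: 'a and r
    by (simp add: emeasure_ball_eq_measure del: emeasure_completion)
  show "weight (\<lambda>_::'a. 1)" using b by (intro weightI) auto
  have "maximal (\<lambda>_::'a. 1) x \<le> ennreal (1 * 1)" for x :: 'a
  proof (rule maximal_leI)
    fix c :: 'a and r :: real assume r: "0 < r"
    show "ball_avg c r (\<lambda>y. ennreal \<bar>1\<bar>) \<le> ennreal (1 * 1)" using b[of c r] by (subst ball_avg_le_iff[OF r]) auto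
  qed
  then show "AE x::'a in lebesgue. maximal (\<lambda>_. 1) x \<le> ennreal (1 * 1)" by simp
qed

text \<open>The case of the constant weight \<open>1\<close> in
  \<open>maximal_A1_bound\<close>.\<close>

lemma nn_integral_maximal_indicator_powr:
  assumes a: "1 < a"
  shows "\<exists>C\<ge>0. \<forall>(c::'a::euclidean_space) r. 0 < r \<longrightarrow>
    (\<integral>\<^sup>+x. ennreal (enn2real (maximal (indicator (ball c r)) x) powr a) \<partial>lebesgue) \<le> ennreal (C * measure lebesgue (ball c r))"
proof -
  from maximal_A1_bound[OF zero_less_one a, where 'a='a] obtain C where C: "0 \<le> C"
    and MB: "\<forall>(v::'a::euclidean_space \<Rightarrow> real) f m A. A1_bound 1 v \<longrightarrow> (AE x in lebesgue. 0 < v x) \<longrightarrow>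
      f \<in> borel_measurable lebesgue \<longrightarrow> (\<forall>x. 0 \<le> f x) \<longrightarrow> m \<in> borel_measurable lebesgue \<longrightarrow> (\<forall>x. 0 \<le> m x) \<longrightarrow>
      (\<forall>x t. 0 < t \<longrightarrow> t < m x \<longrightarrow> ennreal t < maximal f x) \<longrightarrow> 0 \<le> A \<longrightarrow>
      (\<integral>\<^sup>+x. ennreal (f x powr a * v x) \<partial>lebesgue) \<le> ennreal A \<longrightarrow> (\<integral>\<^sup>+x. ennreal (m x powr a * v x) \<partial>lebesgue) \<le> ennreal (C * A)"
    by (elim exE conjE) (rule that)
  have "(\<integral>\<^sup>+x. ennreal (enn2real (maximal (indicator (ball c r)) x) powr a) \<partial>lebesgue) \<le> ennreal (C * measure lebesgue (ball c r))" for c :: 'a and r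
  proof -
    let ?f = "indicator (ball c r) :: 'a \<Rightarrow> real" and ?m = "\<lambda>x. enn2real (maximal (indicator (ball c r)) x)"
    have "(\<integral>\<^sup>+x. ennreal (?m x powr a * 1) \<partial>lebesgue) \<le> ennreal (C * measure lebesgue (ball c r))"
    proof (rule MB[rule_format, OF A1_bound_one])
      have "(\<integral>\<^sup>+x. ennreal (?f x powr a * 1) \<partial>lebesgue) = (\<integral>\<^sup>+x. indicator (ball c r) x \<partial>lebesgue)"
        using a by (intro nn_integral_cong) (auto simp: indicator_def)
      then show "(\<integral>\<^sup>+x. ennreal (?f x powr a * 1) \<partial>lebesgue) \<le> ennreal (measure lebesgue (ball c r))"
        by (simp add: emeasure_ball_eq_measure del: emeasure_completion)
      fix x t assume "0 < t" "t < ?m x"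
      then show "ennreal t < maximal ?f x" by (cases "maximal ?f x") (auto simp: ennreal_less_iff)
    qed auto
    then show ?thesis by simp
  qed
  then show ?thesis using C by blast
qed

text \<open>Interpolation with \<theta> = q / q': f M^(1/s') is the product of the power \<theta> of
  f^(q'/q) M^(1/s), covered by the given bound, and the power 1 - \<theta> of M^a, whose integral is
  a multiple of |B|. Here M stands for the maximal function of the indicator. The condition
  \<open>1 < s'\<close> survives because \<open>a\<close> may be close to 1.\<close>

lemma star_bound_increase:
  fixes \<phi> :: "'a::euclidean_space set \<Rightarrow> real"
  assumes \<phi>: "\<forall>c r. 0 < r \<longrightarrow> 0 < \<phi> (ball c r)" and q: "1 \<le> q" "q < q'" and s: "1 < s" and K: "0 \<le> K"
    and star: "star_bound K q s \<phi> w"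
  shows "\<exists>s'>1. \<exists>K'\<ge>0. star_bound K' q' s' \<phi> w"
proof -
  define \<theta> where "\<theta> = q / q'"
  have \<theta>: "0 < \<theta>" "\<theta> < 1" using q by (auto simp: \<theta>_def)
  \<comment> \<open>The exponent of the maximal function that a = 1 would give. It is below 1, so
    \<open>\<alpha>\<close> fits strictly between and yields both \<open>1 < a\<close> and
    \<open>1 < s'\<close>.\<close>
  define \<beta> where "\<beta> = \<theta> / s + (1 - \<theta>)"
  have \<beta>: "0 < \<beta>" "\<beta> < 1"
  proof -
    have "\<theta> / s < \<theta>" using \<theta> s by (simp add: divide_less_eq)
    then show "\<beta> < 1" by (simp add: \<beta>_def)
    have "0 < \<theta> / s" using \<theta> s by simp
    then show "0 < \<beta>" using \<theta> by (simp add: \<beta>_def add_pos_pos)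
  qed
  define \<alpha> where "\<alpha> = (\<beta> + 1) / 2"
  have \<alpha>: "\<beta> < \<alpha>" "\<alpha> < 1" "0 < \<alpha>" using \<beta> by (auto simp: \<alpha>_def)
  define s' where "s' = 1 / \<alpha>"
  have s': "1 < s'" "1 / s' = \<alpha>" using \<alpha> by (auto simp: s'_def)
  define a where "a = (\<alpha> - \<theta> / s) / (1 - \<theta>)"
  have a: "1 < a" using \<alpha> \<theta> by (simp add: a_def \<beta>_def field_simps)
  have aeq: "1 / s * \<theta> + a * (1 - \<theta>) = \<alpha>" using \<theta> by (simp add: a_def)
  from nn_integral_maximal_indicator_powr[OF a, where 'a='a] obtain C where C: "0 \<le> C" and MI: "\<forall>(c::'a) r. 0 < r \<longrightarrow>
    (\<integral>\<^sup>+x. ennreal (enn2real (maximal (indicator (ball c r)) x) powr a) \<partial>lebesgue) \<le> ennreal (C * measure lebesgue (ball c r))"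
    by (elim exE conjE) (rule that)
  define K' where "K' = K powr \<theta> * C powr (1 - \<theta>)"
  have "star_bound K' q' s' \<phi> w"
    unfolding star_bound_def
  proof (intro allI impI)
    fix c :: 'a and r W f \<Lambda>
    assume r: "0 < r" and W: "0 < W" "(\<integral>\<^sup>+x\<in>ball c r. ennreal (w x) \<partial>lebesgue) = ennreal W"
      and f[measurable]: "f \<in> borel_measurable lebesgue" and f0: "\<forall>x. 0 \<le> f x" and \<Lambda>: "0 < \<Lambda>" "morrey_norm q' \<phi> w f \<le> ennreal \<Lambda>"
    let ?m = "measure lebesgue (ball c r)" and ?M = "\<lambda>x. enn2real (maximal (indicator (ball c r)) x)"
    have m: "0 < ?m" by (rule measure_ball_pos[OF r])
    have fp: "0 < \<phi> (ball c r)" using \<phi> r by blast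
    have q0: "0 < q" "0 < q'" using q by auto
    let ?g = "\<lambda>x. f x powr (q' / q)"
    have "morrey_norm q \<phi> w ?g \<le> ennreal (\<Lambda> powr (q' / q))"
      using \<Lambda>(2) unfolding morrey_norm_le_iff[OF \<phi> q0(1) powr_ge_zero] morrey_norm_le_iff[OF \<phi> q0(2) less_imp_le[OF \<Lambda>(1)]]
      using q0 f0 by (simp add: powr_powr)
    then have I1: "(\<integral>\<^sup>+x. ennreal (?g x * ?M x powr (1 / s)) \<partial>lebesgue) \<le>
       ennreal (\<Lambda> powr (q' / q) * K * ?m * (\<phi> (ball c r) / W) powr (1 / q))" (is "_ \<le> ennreal ?A")
      using star[unfolded star_bound_def, rule_format, OF r W, of ?g "\<Lambda> powr (q' / q)"] \<Lambda> by simp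
    have I2: "(\<integral>\<^sup>+x. ennreal (?M x powr a) \<partial>lebesgue) \<le> ennreal (C * ?m)" using MI r by blast
    have "(\<integral>\<^sup>+x. ennreal (f x * ?M x powr (1 / s')) \<partial>lebesgue) = (\<integral>\<^sup>+x. ennreal ((?g x * ?M x powr (1 / s)) powr \<theta> * (?M x powr a) powr (1 - \<theta>)) \<partial>lebesgue)"
    proof (rule nn_integral_cong)
      fix x
      have e: "q' / q * \<theta> = 1" using q by (simp add: \<theta>_def)
      have "(?g x * ?M x powr (1 / s)) powr \<theta> * (?M x powr a) powr (1 - \<theta>) = f x powr 1 * (?M x powr (1 / s * \<theta>) * ?M x powr (a * (1 - \<theta>)))"
        by (simp only: powr_mult powr_powr e mult.assoc)
      also have "\<dots> = f x * ?M x powr (1 / s')" unfolding powr_add[symmetric] aeq s'(2) using f0 by simp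
      finally show "ennreal (f x * ?M x powr (1 / s')) = ennreal ((?g x * ?M x powr (1 / s)) powr \<theta> * (?M x powr a) powr (1 - \<theta>))" by simp
    qed
    also have "\<dots> \<le> ennreal (?A powr \<theta> * (C * ?m) powr (1 - \<theta>))"
      by (rule nn_integral_holder_le) (use \<theta> I1 I2 C K m in auto)
    also have "?A powr \<theta> * (C * ?m) powr (1 - \<theta>) = \<Lambda> * K' * ?m * (\<phi> (ball c r) / W) powr (1 / q')"
    proof -
      have e1: "q' / q * \<theta> = 1" "1 / q * \<theta> = 1 / q'" using q by (auto simp: \<theta>_def)
      have "?A powr \<theta> * (C * ?m) powr (1 - \<theta>) =
        \<Lambda> powr 1 * K powr \<theta> * ?m powr \<theta> * (\<phi> (ball c r) / W) powr (1 / q') * (C powr (1 - \<theta>) * ?m powr (1 - \<theta>))"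
        by (simp only: powr_mult powr_powr e1)
      also have "\<dots> = \<Lambda> powr 1 * K' * (?m powr \<theta> * ?m powr (1 - \<theta>)) * (\<phi> (ball c r) / W) powr (1 / q')"
        unfolding K'_def by (simp only: mult_ac)
      also have "?m powr \<theta> * ?m powr (1 - \<theta>) = ?m" using m by (simp flip: powr_add)
      finally show ?thesis using \<Lambda> by simp
    qed
    finally show "(\<integral>\<^sup>+x. ennreal (f x * ?M x powr (1 / s')) \<partial>lebesgue) \<le> ennreal (\<Lambda> * K' * ?m * (\<phi> (ball c r) / W) powr (1 / q'))" .
  qed
  moreover have "0 \<le> K'" by (simp add: K'_def)
  ultimately show ?thesis using s'(1) by blast
qed

section \<open>Local weight classes and the estimate on small balls\<close>

text \<open>The first alternative does occur: as \<open>0 * top = 0\<close>, \<open>A_loc\<close>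
  admits weights vanishing almost everywhere on a ball, and there no dual pair exists.\<close>

definition local_Ap :: "real \<Rightarrow> real \<Rightarrow> real \<Rightarrow> ('a::euclidean_space \<Rightarrow> real) \<Rightarrow> bool" where
  "local_Ap \<kappa> K p w \<longleftrightarrow> (\<forall>c R. 0 < R \<and> R \<le> \<kappa> * norm c \<longrightarrow>
     (AE x in lebesgue. x \<in> ball c R \<longrightarrow> w x = 0) \<or>
     (\<exists>\<sigma>. dual_on p (ball c R) w \<sigma> \<and> Ap_pair p K (ball c R) w \<sigma>))"

text \<open>The centre of the smaller ball keeps at least 3/4 of the norm of \<open>c\<close>, while
  its radius is at most a quarter of \<open>\<kappa> * norm c\<close>. So the local condition is
  available on every ball inside, as \<open>Ap_pair\<close> and \<open>A1_on\<close> demand.\<close>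

lemma subball_is_local:
  fixes c c' :: "'a::euclidean_space"
  assumes \<kappa>: "0 < \<kappa>" "\<kappa> < 1" and R: "0 < R" "R \<le> \<kappa> / 4 * norm c" and r: "0 < r" "ball c' r \<subseteq> ball c R"
  shows "r < \<kappa> * norm c'"
proof -
  have d: "dist c' c + r \<le> R" using r by (auto simp: ball_subset_ball_iff)
  have "norm c \<le> norm c' + dist c' c" using norm_triangle_ineq2[of c c'] by (simp add: dist_norm norm_minus_commute)
  then have "norm c - R \<le> norm c'" using d r by linarith
  moreover have R4: "4 * R \<le> \<kappa> * norm c" using R(2) by simp
  moreover have "\<kappa> * norm c \<le> 1 * norm c" using \<kappa> by (intro mult_right_mono) auto
  ultimately have n: "3 / 4 * norm c \<le> norm c'" by linarith
  have "\<kappa> * (3 / 4 * norm c) \<le> \<kappa> * norm c'" using n \<kappa> by (intro mult_left_mono) auto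
  then have "3 / 4 * (4 * R) \<le> \<kappa> * norm c'" using R4 by linarith
  moreover have "r \<le> R" using d zero_le_dist[of c' c] by linarith
  ultimately show ?thesis using R(1) by linarith
qed

text \<open>If the ball has positive w-mass, the bound on the product makes the integral of
  \<open>dual_weight\<close> finite. As that function is \<open>top\<close> on the zeros of
  \<open>w\<close>, the weight is positive almost everywhere in the ball and its dual may be taken
  real-valued.\<close>

lemma local_Ap_of_A_loc:
  fixes w :: "'a::euclidean_space \<Rightarrow> real"
  assumes \<kappa>: "0 < \<kappa>" "\<kappa> < 1" and p: "1 < p" and A: "A_loc \<kappa> p w"
  shows "\<exists>K. local_Ap (\<kappa> / 4) K p w"
proof -
  have ww: "weight w" using A by (simp add: A_loc_def)
  have wm[measurable]: "w \<in> borel_measurable lebesgue" and w0: "\<And>x. 0 \<le> w x" using ww by (auto simp: weight_def)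
  from A p obtain C where C: "\<And>c r. 0 < r \<Longrightarrow> r < \<kappa> * norm c \<Longrightarrow>
           enn_powr (1/p) (\<integral>\<^sup>+ y \<in> ball c r. ennreal (w y) \<partial>lebesgue) *
           enn_powr ((p - 1) / p) (\<integral>\<^sup>+ y \<in> ball c r. dual_weight p w y \<partial>lebesgue)
             \<le> ennreal (C * measure lebesgue (ball c r))"
    unfolding A_loc_def by auto
  define \<sigma> where "\<sigma> x = w x powr (- 1 / (p - 1))" for x
  have sm[measurable]: "\<sigma> \<in> borel_measurable lebesgue" unfolding \<sigma>_def by measurable
  have s0: "0 \<le> \<sigma> x" for x by (simp add: \<sigma>_def)
  have dw: "dual_weight p w x = (if w x = 0 then top else ennreal (\<sigma> x))" for x
  proof -
    have "1 - p / (p - 1) = - 1 / (p - 1)" using p by (simp add: field_simps)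
    then show ?thesis by (simp add: dual_weight_def \<sigma>_def)
  qed
  have dwm[measurable]: "dual_weight p w \<in> borel_measurable lebesgue" unfolding dw by measurable
  have "local_Ap (\<kappa> / 4) (\<bar>C\<bar> powr p) p w"
    unfolding local_Ap_def
  proof (intro allI impI)
    fix c :: 'a and R assume R: "0 < R \<and> R \<le> \<kappa> / 4 * norm c"
    have loc: "r < \<kappa> * norm c'" if "0 < r" "ball c' r \<subseteq> ball c R" for c' r
      using subball_is_local[OF \<kappa> _ _ that] R by blast
    show "(AE x in lebesgue. x \<in> ball c R \<longrightarrow> w x = 0) \<or>
     (\<exists>\<sigma>. dual_on p (ball c R) w \<sigma> \<and> Ap_pair p (\<bar>C\<bar> powr p) (ball c R) w \<sigma>)"
    proof (cases "(\<integral>\<^sup>+ y \<in> ball c R. ennreal (w y) \<partial>lebesgue) = 0")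
      case True
      then have "AE x in lebesgue. ennreal (w x) * indicator (ball c R) x = 0" by (subst (asm) nn_integral_0_iff_AE) auto
      then have "AE x in lebesgue. x \<in> ball c R \<longrightarrow> w x = 0"
      proof eventually_elim
        case (elim x)
        then show ?case using w0[of x] by (cases "x \<in> ball c R") auto
      qed
      then show ?thesis ..
    next
      case False
      then obtain W where W: "(\<integral>\<^sup>+ y \<in> ball c R. ennreal (w y) \<partial>lebesgue) = ennreal W" "0 < W"
        using weight_ball_finite[OF ww, of c R]
        by (cases "\<integral>\<^sup>+ y \<in> ball c R. ennreal (w y) \<partial>lebesgue") (auto simp: less_le)
      let ?D = "\<integral>\<^sup>+ y \<in> ball c R. dual_weight p w y \<partial>lebesgue"
      have Dfin: "?D \<noteq> top"
      proof
        assume t: "?D = top"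
        have "enn_powr (1 / p) (ennreal W) * top \<le> ennreal (C * measure lebesgue (ball c R))"
          using C[of R c] R loc[of R c] unfolding W(1) t by (simp add: enn_powr_def)
        moreover have "enn_powr (1 / p) (ennreal W) \<noteq> 0" using W(2) by (simp add: enn_powr_def)
        ultimately show False by (simp add: ennreal_mult_top top_unique)
      qed
      then have "AE y in lebesgue. dual_weight p w y * indicator (ball c R) y \<noteq> \<infinity>"
        by (intro nn_integral_noteq_infinite) auto
      then have pos: "AE y in lebesgue. y \<in> ball c R \<longrightarrow> 0 < w y"
      proof eventually_elim
        case (elim y)
        then show ?case using w0[of y] by (cases "y \<in> ball c R") (auto simp: dw less_le)
      qed
      then have "AE y in lebesgue. y \<in> ball c R \<longrightarrow> 0 < w y \<and> \<sigma> y = w y powr (- 1 / (p - 1))"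
        by eventually_elim (simp add: \<sigma>_def)
      then have dual: "dual_on p (ball c R) w \<sigma>" using w0 s0 by (simp add: dual_on_def)
      have "Ap_pair p (\<bar>C\<bar> powr p) (ball c R) w \<sigma>"
        unfolding Ap_pair_def
      proof (intro allI impI)
        fix c' :: 'a and r assume r: "0 < r \<and> ball c' r \<subseteq> ball c R"
        let ?m = "measure lebesgue (ball c' r)"
        obtain W' where W': "(\<integral>\<^sup>+ y \<in> ball c' r. ennreal (w y) \<partial>lebesgue) = ennreal W'" "0 \<le> W'"
          using weight_ball_finite[OF ww, of c' r] by (cases "\<integral>\<^sup>+ y \<in> ball c' r. ennreal (w y) \<partial>lebesgue") auto
        have De: "(\<integral>\<^sup>+ y \<in> ball c' r. dual_weight p w y \<partial>lebesgue) = (\<integral>\<^sup>+ y \<in> ball c' r. ennreal (\<sigma> y) \<partial>lebesgue)"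
        proof (rule nn_integral_cong_AE)
          show "AE y in lebesgue. dual_weight p w y * indicator (ball c' r) y = ennreal (\<sigma> y) * indicator (ball c' r) y"
            using pos
          proof eventually_elim
            case (elim y)
            then show ?case using r by (cases "y \<in> ball c' r") (auto simp: dw simp del: mem_ball)
          qed
        qed
        have "(\<integral>\<^sup>+ y \<in> ball c' r. dual_weight p w y \<partial>lebesgue) \<le> ?D"
          using r by (intro nn_set_integral_set_mono) auto
        then have "(\<integral>\<^sup>+ y \<in> ball c' r. ennreal (\<sigma> y) \<partial>lebesgue) \<noteq> top" unfolding De using Dfin by (auto simp: top_unique)
        then obtain T where T: "(\<integral>\<^sup>+ y \<in> ball c' r. ennreal (\<sigma> y) \<partial>lebesgue) = ennreal T" "0 \<le> T"
          by (cases "\<integral>\<^sup>+ y \<in> ball c' r. ennreal (\<sigma> y) \<partial>lebesgue") auto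
        have "ennreal (W' powr (1 / p) * T powr ((p - 1) / p)) \<le> ennreal (C * ?m)"
          using C[of r c'] r loc[of r c'] W'(2) T(2) unfolding De W'(1) T(1) by (simp add: enn_powr_def ennreal_mult)
        also have "\<dots> \<le> ennreal (\<bar>C\<bar> * ?m)" by (intro ennreal_leI mult_right_mono) auto
        finally have "W' powr (1 / p) * T powr ((p - 1) / p) \<le> \<bar>C\<bar> * ?m" by (subst (asm) ennreal_le_iff) auto
        then have "(W' powr (1 / p) * T powr ((p - 1) / p)) powr p \<le> (\<bar>C\<bar> * ?m) powr p" using p by (intro powr_mono2) auto
        moreover have "(W' powr (1 / p) * T powr ((p - 1) / p)) powr p = W' * T powr (p - 1)"
          using p W'(2) T(2) by (simp add: powr_mult powr_powr)
        ultimately have "W' * T powr (p - 1) \<le> \<bar>C\<bar> powr p * ?m powr p" by (simp only: powr_mult)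
        then show "\<exists>W\<ge>0. \<exists>T\<ge>0. (\<integral>\<^sup>+y\<in>ball c' r. ennreal (w y) \<partial>lebesgue) = ennreal W \<and>
          (\<integral>\<^sup>+y\<in>ball c' r. ennreal (\<sigma> y) \<partial>lebesgue) = ennreal T \<and> W * T powr (p - 1) \<le> \<bar>C\<bar> powr p * ?m powr p"
          using W' T by blast
      qed
      then show ?thesis using dual by blast
    qed
  qed
  then show ?thesis ..
qed

lemma A1_on_of_A_loc:
  fixes w :: "'a::euclidean_space \<Rightarrow> real"
  assumes \<kappa>: "0 < \<kappa>" "\<kappa> < 1" and A: "A_loc \<kappa> 1 w"
  shows "\<exists>K>0. \<forall>c R. 0 < R \<and> R \<le> \<kappa> / 4 * norm c \<longrightarrow> A1_on K (ball c R) w"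
proof -
  have ww: "weight w" using A by (simp add: A_loc_def)
  have w0: "\<And>x. 0 \<le> w x" using ww by (auto simp: weight_def)
  from A obtain C where C: "\<And>c r. 0 < r \<Longrightarrow> r < \<kappa> * norm c \<Longrightarrow>
           AE x in lebesgue. x \<in> ball c r \<longrightarrow>
              (\<integral>\<^sup>+ y \<in> ball c r. ennreal (w y) \<partial>lebesgue) / ennreal (measure lebesgue (ball c r)) \<le> ennreal (C * w x)"
    unfolding A_loc_def by auto
  have "A1_on (\<bar>C\<bar> + 1) (ball c R) w" if R: "0 < R" "R \<le> \<kappa> / 4 * norm c" for c R
    unfolding A1_on_def
  proof (intro allI impI)
    fix c' :: 'a and r assume r: "0 < r \<and> ball c' r \<subseteq> ball c R"
    let ?m = "measure lebesgue (ball c' r)"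
    have m: "0 < ?m" using r by (intro measure_ball_pos) simp
    obtain W where W: "(\<integral>\<^sup>+ y \<in> ball c' r. ennreal (w y) \<partial>lebesgue) = ennreal W" "0 \<le> W"
      using weight_ball_finite[OF ww, of c' r] by (cases "\<integral>\<^sup>+ y \<in> ball c' r. ennreal (w y) \<partial>lebesgue") auto
    have "r < \<kappa> * norm c'" using subball_is_local[OF \<kappa> R] r by blast
    then have "AE x in lebesgue. x \<in> ball c' r \<longrightarrow> ennreal W / ennreal ?m \<le> ennreal (C * w x)" using C[of r c'] r W(1) by simp
    then have "AE x in lebesgue. x \<in> ball c' r \<longrightarrow> W \<le> (\<bar>C\<bar> + 1) * ?m * w x"
    proof eventually_elim
      case (elim x)
      show ?case
      proof
        assume "x \<in> ball c' r"
        then have "ennreal (W / ?m) \<le> ennreal (C * w x)" using elim W m by (simp add: divide_ennreal)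
        also have "\<dots> \<le> ennreal ((\<bar>C\<bar> + 1) * w x)" using w0[of x] by (intro ennreal_leI mult_right_mono) auto
        finally have "W / ?m \<le> (\<bar>C\<bar> + 1) * w x" using w0[of x] by (subst (asm) ennreal_le_iff) auto
        then have "W \<le> (\<bar>C\<bar> + 1) * w x * ?m" using m by (simp only: pos_divide_le_eq)
        then show "W \<le> (\<bar>C\<bar> + 1) * ?m * w x" by (simp only: mult_ac)
      qed
    qed
    then show "\<exists>W\<ge>0. (\<integral>\<^sup>+y\<in>ball c' r. ennreal (w y) \<partial>lebesgue) = ennreal W \<and>
       (AE x in lebesgue. x \<in> ball c' r \<longrightarrow> W \<le> (\<bar>C\<bar> + 1) * ?m * w x)" using W by blast
  qed
  then show ?thesis by (intro exI[of _ "\<bar>C\<bar> + 1"]) auto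
qed

text \<open>\<open>m\<close> is a barrier that the improved exponent must stay above: the later
  ratio p1 = p / t has to remain below p0 and the dual condition has to be raised to t.\<close>

lemma local_Ap_open:
  fixes w :: "'a::euclidean_space \<Rightarrow> real"
  assumes p: "1 < p" and A: "local_Ap \<kappa> K p w" and m: "1 \<le> m" "m < p"
  shows "\<exists>q. m < q \<and> q < p \<and> (\<exists>K'. local_Ap (\<kappa> / 2) K' q w)"
proof -
  from Ap_pair_open[OF p, where 'a='a and K=K] obtain \<epsilon>0 where \<epsilon>0: "0 < \<epsilon>0" and op: "\<forall>\<epsilon>. 0 < \<epsilon> \<and> \<epsilon> \<le> \<epsilon>0 \<longrightarrow> (\<exists>K'\<ge>0. \<forall>(w::'a::euclidean_space \<Rightarrow> real) \<sigma> c R.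
    0 < R \<longrightarrow> dual_on p (ball c (2 * R)) w \<sigma> \<longrightarrow> Ap_pair p K (ball c (2 * R)) w \<sigma> \<longrightarrow>
    Ap_pair (1 + (p - 1) / (1 + \<epsilon>)) K' (ball c R) w (\<lambda>x. \<sigma> x powr (1 + \<epsilon>)))" by (elim exE conjE) (rule that)
  \<comment> \<open>The second bound ensures \<open>(m - 1) * (1 + \<epsilon>) < p - 1\<close>,
    which is the barrier condition \<open>m < q\<close>.\<close>
  define \<epsilon> where "\<epsilon> = min \<epsilon>0 ((p - m) / (2 * m))"
  have \<epsilon>: "0 < \<epsilon>" "\<epsilon> \<le> \<epsilon>0" "\<epsilon> \<le> (p - m) / (2 * m)" using \<epsilon>0 m by (auto simp: \<epsilon>_def)
  define q where "q = 1 + (p - 1) / (1 + \<epsilon>)"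
  have "(p - 1) / (1 + \<epsilon>) < p - 1" using p \<epsilon> by (simp add: divide_less_eq)
  then have qp: "q < p" by (simp add: q_def)
  have mq: "m < q"
  proof -
    have "(m - 1) * \<epsilon> \<le> m * \<epsilon>" using \<epsilon> by (intro mult_right_mono) auto
    also have "\<dots> \<le> m * ((p - m) / (2 * m))" using \<epsilon>(3) m by (intro mult_left_mono) auto
    also have "\<dots> = (p - m) / 2" using m by simp
    finally have "(m - 1) * (1 + \<epsilon>) < p - 1" using m by (simp add: algebra_simps)
    then have "m - 1 < (p - 1) / (1 + \<epsilon>)" using \<epsilon> by (simp add: less_divide_eq)
    then show ?thesis by (simp add: q_def)
  qed
  from op[rule_format, OF conjI[OF \<epsilon>(1,2)], folded q_def] obtain K' where op': "\<forall>(w::'a::euclidean_space \<Rightarrow> real) \<sigma> c R.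
    0 < R \<longrightarrow> dual_on p (ball c (2 * R)) w \<sigma> \<longrightarrow> Ap_pair p K (ball c (2 * R)) w \<sigma> \<longrightarrow>
    Ap_pair q K' (ball c R) w (\<lambda>x. \<sigma> x powr (1 + \<epsilon>))" by (elim exE conjE) (rule that)
  have "local_Ap (\<kappa> / 2) K' q w"
    unfolding local_Ap_def
  proof (intro allI impI)
    fix c :: 'a and R assume R: "0 < R \<and> R \<le> \<kappa> / 2 * norm c"
    have sub: "ball c R \<subseteq> ball c (2 * R)" using R by (intro subset_ball) simp
    have R2: "0 < 2 * R \<and> 2 * R \<le> \<kappa> * norm c" using R by simp
    from A[unfolded local_Ap_def, rule_format, OF R2]
    show "(AE x in lebesgue. x \<in> ball c R \<longrightarrow> w x = 0) \<or> (\<exists>\<sigma>. dual_on q (ball c R) w \<sigma> \<and> Ap_pair q K' (ball c R) w \<sigma>)"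
    proof (elim disjE exE conjE)
      assume "AE x in lebesgue. x \<in> ball c (2 * R) \<longrightarrow> w x = 0"
      then have "AE x in lebesgue. x \<in> ball c R \<longrightarrow> w x = 0" by eventually_elim (use sub in blast)
      then show ?thesis ..
    next
      fix \<sigma> assume D: "dual_on p (ball c (2 * R)) w \<sigma>" and P: "Ap_pair p K (ball c (2 * R)) w \<sigma>"
      have "Ap_pair q K' (ball c R) w (\<lambda>x. \<sigma> x powr (1 + \<epsilon>))" by (rule op'[rule_format, OF conjunct1[OF R] D P])
      moreover have "dual_on q (ball c R) w (\<lambda>x. \<sigma> x powr (1 + \<epsilon>))"
        unfolding q_def by (rule dual_on_open[OF p \<epsilon>(1) dual_on_mono[OF D sub]])
      ultimately show ?thesis by blast
    qed
  qed
  then show ?thesis using mq qp by blast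
qed

text \<open>The two inputs of \<open>core_estimate\<close> have the same size L = k \<Lambda>
  \<phi>(B)^(1/p): the integral over the doubled ball by doubling of \<open>\<phi>\<close>, the
  integral against the maximal function by \<open>star_bound\<close>. If the weight vanishes on the
  ball, the left-hand side is zero.\<close>

lemma small_ball_estimate:
  fixes \<phi> :: "'a::euclidean_space set \<Rightarrow> real" and F :: "(('a \<Rightarrow> real) \<times> ('a \<Rightarrow> real)) set"
  assumes p: "1 < p" and s: "1 < s" and H: "A1_inequality F" and w: "weight w"
    and A: "local_Ap \<kappa> K p w" and star: "star_bound K1 p s \<phi> w" and K1: "0 \<le> K1"
    and \<phi>: "\<forall>c r. 0 < r \<longrightarrow> 0 < \<phi> (ball c r)" and D: "0 \<le> D" "\<forall>c r. 0 < r \<longrightarrow> \<phi> (ball c (2 * r)) \<le> D * \<phi> (ball c r)"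
  shows "\<exists>C\<ge>0. \<forall>f g \<Lambda> c r. (f, g) \<in> F \<longrightarrow> 0 < \<Lambda> \<longrightarrow> morrey_norm p \<phi> w f \<le> ennreal \<Lambda> \<longrightarrow> 0 < r \<longrightarrow> r \<le> \<kappa> / 52 * norm c \<longrightarrow>
    (\<integral>\<^sup>+x\<in>ball c r. ennreal (g x powr p * w x) \<partial>lebesgue) \<le> ennreal ((C * \<Lambda>) powr p * \<phi> (ball c r))"
proof -
  from core_estimate[OF p s H, where K=K] obtain C where C: "0 \<le> C"
    and core: "\<forall>f g w \<sigma> c r L W. (f, g) \<in> F \<longrightarrow> 0 < r \<longrightarrow> dual_on p (ball c (52 * r)) w \<sigma> \<longrightarrow> Ap_pair p K (ball c (52 * r)) w \<sigma> \<longrightarrow>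
    0 \<le> L \<longrightarrow> 0 < W \<longrightarrow> (\<integral>\<^sup>+x\<in>ball c r. ennreal (w x) \<partial>lebesgue) = ennreal W \<longrightarrow>
    (\<integral>\<^sup>+x\<in>ball c (2 * r). ennreal (f x powr p * w x) \<partial>lebesgue) \<le> ennreal (L powr p) \<longrightarrow>
    (\<integral>\<^sup>+x. ennreal (f x * enn2real (maximal (indicator (ball c r)) x) powr (1 / s)) \<partial>lebesgue) \<le>
      ennreal (L * measure lebesgue (ball c r) / W powr (1 / p)) \<longrightarrow>
    (\<integral>\<^sup>+x\<in>ball c r. ennreal (g x powr p * w x) \<partial>lebesgue) \<le> ennreal ((C * L) powr p)" by (elim exE conjE) (rule that)
  \<comment> \<open>One factor for both inputs: \<open>D powr (1 / p)\<close> from doubling and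
    \<open>K1\<close> from the dual condition.\<close>
  define k where "k = max (D powr (1 / p)) K1"
  have k: "D powr (1 / p) \<le> k" "K1 \<le> k" "0 \<le> k" using K1 by (auto simp: k_def le_max_iff_disj)
  have main: "(\<integral>\<^sup>+x\<in>ball c r. ennreal (g x powr p * w x) \<partial>lebesgue) \<le> ennreal ((C * k * \<Lambda>) powr p * \<phi> (ball c r))"
    if FG: "(f, g) \<in> F" and \<Lambda>: "0 < \<Lambda>" "morrey_norm p \<phi> w f \<le> ennreal \<Lambda>" and r: "0 < r" and loc: "r \<le> \<kappa> / 52 * norm c" for f g \<Lambda> c r
  proof -
    have wm: "w \<in> borel_measurable lebesgue" and w0: "\<And>x. 0 \<le> w x" using w by (auto simp: weight_def)
    have f: "f \<in> borel_measurable lebesgue" "\<And>x. 0 \<le> f x" using H FG unfolding A1_inequality_def by auto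
    have fp: "0 < \<phi> (ball c r)" using \<phi> r by blast
    have p0: "0 < p" using p by simp
    have sub: "ball c r \<subseteq> ball c (52 * r)" using r by (intro subset_ball) simp
    have R: "0 < 52 * r \<and> 52 * r \<le> \<kappa> * norm c" using r loc by simp
    from A[unfolded local_Ap_def, rule_format, OF R] show ?thesis
    proof (elim disjE exE conjE)
      assume z: "AE x in lebesgue. x \<in> ball c (52 * r) \<longrightarrow> w x = 0"
      have "(\<integral>\<^sup>+x\<in>ball c r. ennreal (g x powr p * w x) \<partial>lebesgue) = (\<integral>\<^sup>+x. 0 \<partial>(lebesgue::'a measure))"
      proof (rule nn_integral_cong_AE)
        show "AE x in lebesgue. ennreal (g x powr p * w x) * indicator (ball c r) x = 0"
          using z
        proof eventually_elim
          case (elim x)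
          then show ?case using sub by (cases "x \<in> ball c r") (auto simp del: mem_ball)
        qed
      qed
      then show ?thesis by simp
    next
      fix \<sigma> assume dual: "dual_on p (ball c (52 * r)) w \<sigma>" and P: "Ap_pair p K (ball c (52 * r)) w \<sigma>"
      obtain W where W: "0 \<le> W" "(\<integral>\<^sup>+y\<in>ball c r. ennreal (w y) \<partial>lebesgue) = ennreal W"
        by (rule Ap_pairE[OF P r sub])
      have "AE x in lebesgue. x \<in> ball c (52 * r) \<longrightarrow> 0 < w x \<and> \<sigma> x = w x powr (- 1 / (p - 1))" using dual by (simp add: dual_on_def)
      then have "AE x in lebesgue. x \<in> ball c (52 * r) \<longrightarrow> 0 < w x" by eventually_elim simp
      then have W0: "0 < W" using nn_integral_ball_pos[OF wm _ r sub] W by simp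
      define L where "L = k * \<Lambda> * \<phi> (ball c r) powr (1 / p)"
      have L: "0 \<le> L" using k \<Lambda> by (simp add: L_def)
      have Lp: "L powr p = (k * \<Lambda>) powr p * \<phi> (ball c r)"
        unfolding L_def using fp p by (simp add: powr_mult powr_powr)
      have i: "(\<integral>\<^sup>+x\<in>ball c (2 * r). ennreal (f x powr p * w x) \<partial>lebesgue) \<le> ennreal (L powr p)"
      proof -
        have "(\<integral>\<^sup>+x\<in>ball c (2 * r). ennreal (\<bar>f x\<bar> powr p * w x) \<partial>lebesgue) \<le> ennreal (\<Lambda> powr p * \<phi> (ball c (2 * r)))"
          using \<Lambda>(2) r unfolding morrey_norm_le_iff[OF \<phi> p0 less_imp_le[OF \<Lambda>(1)]] by simp
        also have "\<dots> \<le> ennreal (L powr p)"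
        proof (rule ennreal_leI)
          have "\<Lambda> powr p * \<phi> (ball c (2 * r)) \<le> \<Lambda> powr p * (D * \<phi> (ball c r))" using D(2) r by (intro mult_left_mono) auto
          also have "D = (D powr (1 / p)) powr p" using D p by (simp add: powr_powr)
          also have "\<Lambda> powr p * ((D powr (1 / p)) powr p * \<phi> (ball c r)) \<le> \<Lambda> powr p * (k powr p * \<phi> (ball c r))"
            using k fp p by (intro mult_left_mono mult_right_mono powr_mono2) auto
          also have "\<dots> = L powr p" unfolding Lp by (simp add: powr_mult)
          finally show "\<Lambda> powr p * \<phi> (ball c (2 * r)) \<le> L powr p" .
        qed
        finally show ?thesis using f(2) by simp
      qed
      have ii: "(\<integral>\<^sup>+x. ennreal (f x * enn2real (maximal (indicator (ball c r)) x) powr (1 / s)) \<partial>lebesgue) \<le>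
        ennreal (L * measure lebesgue (ball c r) / W powr (1 / p))"
      proof -
        have "(\<integral>\<^sup>+x. ennreal (f x * enn2real (maximal (indicator (ball c r)) x) powr (1 / s)) \<partial>lebesgue) \<le>
          ennreal (\<Lambda> * K1 * measure lebesgue (ball c r) * (\<phi> (ball c r) / W) powr (1 / p))"
          using star[unfolded star_bound_def, rule_format, OF r W0 W(2) f \<Lambda>] .
        also have "\<dots> \<le> ennreal (\<Lambda> * k * measure lebesgue (ball c r) * (\<phi> (ball c r) / W) powr (1 / p))"
          using \<Lambda> k by (intro ennreal_leI mult_right_mono mult_left_mono) auto
        also have "\<Lambda> * k * measure lebesgue (ball c r) * (\<phi> (ball c r) / W) powr (1 / p) = L * measure lebesgue (ball c r) / W powr (1 / p)"
          using fp W by (simp add: L_def powr_divide)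
        finally show ?thesis .
      qed
      have "(\<integral>\<^sup>+x\<in>ball c r. ennreal (g x powr p * w x) \<partial>lebesgue) \<le> ennreal ((C * L) powr p)"
        by (rule core[rule_format, OF FG r dual P L W0 W(2) i ii])
      also have "(C * L) powr p = (C * k * \<Lambda>) powr p * \<phi> (ball c r)"
        using Lp by (simp add: powr_mult)
      finally show ?thesis .
    qed
  qed
  have "0 \<le> C * k" using C k by simp
  then show ?thesis using main by (intro exI[of _ "C * k"] conjI allI impI) auto
qed

lemma small_ball_estimate_1:
  fixes \<phi> :: "'a::euclidean_space set \<Rightarrow> real" and F :: "(('a \<Rightarrow> real) \<times> ('a \<Rightarrow> real)) set"
  assumes s: "1 < s" and H: "A1_inequality F" and w: "weight w"
    and K: "0 < K" and A: "\<forall>c R. 0 < R \<and> R \<le> \<kappa> * norm c \<longrightarrow> A1_on K (ball c R) w"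
    and star: "star_bound K1 1 s \<phi> w" and K1: "0 \<le> K1"
    and \<phi>: "\<forall>c r. 0 < r \<longrightarrow> 0 < \<phi> (ball c r)" and D: "0 \<le> D" "\<forall>c r. 0 < r \<longrightarrow> \<phi> (ball c (2 * r)) \<le> D * \<phi> (ball c r)"
  shows "\<exists>C\<ge>0. \<forall>f g \<Lambda> c r. (f, g) \<in> F \<longrightarrow> 0 < \<Lambda> \<longrightarrow> morrey_norm 1 \<phi> w f \<le> ennreal \<Lambda> \<longrightarrow> 0 < r \<longrightarrow> r \<le> \<kappa> / 52 * norm c \<longrightarrow>
    (\<integral>\<^sup>+x\<in>ball c r. ennreal (g x powr 1 * w x) \<partial>lebesgue) \<le> ennreal ((C * \<Lambda>) powr 1 * \<phi> (ball c r))"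
proof -
  from core_estimate_1[OF s H K] obtain C where C: "0 \<le> C"
    and core: "\<forall>f g w c r L W. (f, g) \<in> F \<longrightarrow> 0 < r \<longrightarrow> w \<in> borel_measurable lebesgue \<longrightarrow> (\<forall>x. 0 \<le> w x) \<longrightarrow> A1_on K (ball c (52 * r)) w \<longrightarrow>
    0 \<le> L \<longrightarrow> 0 < W \<longrightarrow> (\<integral>\<^sup>+x\<in>ball c r. ennreal (w x) \<partial>lebesgue) = ennreal W \<longrightarrow>
    (\<integral>\<^sup>+x\<in>ball c (2 * r). ennreal (f x * w x) \<partial>lebesgue) \<le> ennreal L \<longrightarrow>
    (\<integral>\<^sup>+x. ennreal (f x * enn2real (maximal (indicator (ball c r)) x) powr (1 / s)) \<partial>lebesgue) \<le>
      ennreal (L * measure lebesgue (ball c r) / W) \<longrightarrow>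
    (\<integral>\<^sup>+x\<in>ball c r. ennreal (g x * w x) \<partial>lebesgue) \<le> ennreal (C * L)" by (elim exE conjE) (rule that)
  define k where "k = max D K1"
  have k: "D \<le> k" "K1 \<le> k" "0 \<le> k" using K1 by (auto simp: k_def le_max_iff_disj)
  have Ck: "0 \<le> C * k" using C k by simp
  have main: "(\<integral>\<^sup>+x\<in>ball c r. ennreal (g x powr 1 * w x) \<partial>lebesgue) \<le> ennreal ((C * k * \<Lambda>) powr 1 * \<phi> (ball c r))"
    if FG: "(f, g) \<in> F" and \<Lambda>: "0 < \<Lambda>" "morrey_norm 1 \<phi> w f \<le> ennreal \<Lambda>" and r: "0 < r" and loc: "r \<le> \<kappa> / 52 * norm c" for f g \<Lambda> c r
  proof -
    have wm[measurable]: "w \<in> borel_measurable lebesgue" and w0: "\<And>x. 0 \<le> w x" using w by (auto simp: weight_def)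
    have f: "f \<in> borel_measurable lebesgue" "\<And>x. 0 \<le> f x" and g: "g \<in> borel_measurable lebesgue" "\<And>x. 0 \<le> g x"
      using H FG unfolding A1_inequality_def by auto
    have fp: "0 < \<phi> (ball c r)" using \<phi> r by blast
    have R: "0 < 52 * r \<and> 52 * r \<le> \<kappa> * norm c" using r loc by simp
    have P: "A1_on K (ball c (52 * r)) w" using A R by blast
    have sub: "ball c r \<subseteq> ball c (52 * r)" using r by (intro subset_ball) simp
    obtain W where W: "0 \<le> W" "(\<integral>\<^sup>+y\<in>ball c r. ennreal (w y) \<partial>lebesgue) = ennreal W"
      by (rule A1_onE[OF P r sub])
    show ?thesis
    proof (cases "W = 0")
      \<comment> \<open>\<open>A1_on\<close> admits weights without mass on the ball, for which
        \<open>star_bound\<close> says nothing.\<close>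
      case True
      then have "(\<integral>\<^sup>+y\<in>ball c r. ennreal (w y) \<partial>lebesgue) = 0" using W by simp
      then have z: "AE y in lebesgue. ennreal (w y) * indicator (ball c r) y = 0" by (subst (asm) nn_integral_0_iff_AE) auto
      have "(\<integral>\<^sup>+x\<in>ball c r. ennreal (g x powr 1 * w x) \<partial>lebesgue) = (\<integral>\<^sup>+x. 0 \<partial>(lebesgue::'a measure))"
      proof (rule nn_integral_cong_AE)
        show "AE x in lebesgue. ennreal (g x powr 1 * w x) * indicator (ball c r) x = 0"
          using z
        proof eventually_elim
          case (elim x)
          then show ?case using g(2)[of x] w0[of x] by (cases "x \<in> ball c r") (auto simp: ennreal_mult simp del: mem_ball)
        qed
      qed
      then show ?thesis by simp
    next
      case False
      then have W0: "0 < W" using W by simp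
      define L where "L = k * \<Lambda> * \<phi> (ball c r)"
      have L: "0 \<le> L" using k \<Lambda> fp by (simp add: L_def)
      have i: "(\<integral>\<^sup>+x\<in>ball c (2 * r). ennreal (f x * w x) \<partial>lebesgue) \<le> ennreal L"
      proof -
        have "(\<integral>\<^sup>+x\<in>ball c (2 * r). ennreal (\<bar>f x\<bar> powr 1 * w x) \<partial>lebesgue) \<le> ennreal (\<Lambda> powr 1 * \<phi> (ball c (2 * r)))"
          using \<Lambda>(2) r unfolding morrey_norm_le_iff[OF \<phi> zero_less_one less_imp_le[OF \<Lambda>(1)]] by simp
        also have "\<dots> \<le> ennreal L"
        proof (rule ennreal_leI)
          have "\<Lambda> * \<phi> (ball c (2 * r)) \<le> \<Lambda> * (D * \<phi> (ball c r))" using D(2) r \<Lambda> by (intro mult_left_mono) auto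
          also have "\<dots> \<le> \<Lambda> * (k * \<phi> (ball c r))" using k fp \<Lambda> by (intro mult_left_mono mult_right_mono) auto
          finally show "\<Lambda> powr 1 * \<phi> (ball c (2 * r)) \<le> L" using \<Lambda> by (simp add: L_def mult_ac)
        qed
        finally show ?thesis using f(2) by simp
      qed
      have ii: "(\<integral>\<^sup>+x. ennreal (f x * enn2real (maximal (indicator (ball c r)) x) powr (1 / s)) \<partial>lebesgue) \<le>
        ennreal (L * measure lebesgue (ball c r) / W)"
      proof -
        have "(\<integral>\<^sup>+x. ennreal (f x * enn2real (maximal (indicator (ball c r)) x) powr (1 / s)) \<partial>lebesgue) \<le>
          ennreal (\<Lambda> * K1 * measure lebesgue (ball c r) * (\<phi> (ball c r) / W) powr (1 / 1))"
          using star[unfolded star_bound_def, rule_format, OF r W0 W(2) f \<Lambda>] .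
        also have "\<dots> \<le> ennreal (\<Lambda> * k * measure lebesgue (ball c r) * (\<phi> (ball c r) / W) powr (1 / 1))"
          using \<Lambda> k by (intro ennreal_leI mult_right_mono mult_left_mono) auto
        also have "\<Lambda> * k * measure lebesgue (ball c r) * (\<phi> (ball c r) / W) powr (1 / 1) = L * measure lebesgue (ball c r) / W"
          using fp W0 by (simp add: L_def)
        finally show ?thesis .
      qed
      have "(\<integral>\<^sup>+x\<in>ball c r. ennreal (g x * w x) \<partial>lebesgue) \<le> ennreal (C * L)"
        by (rule core[rule_format, OF FG r wm w0 P L W0 W(2) i ii])
      also have "C * L = (C * k * \<Lambda>) powr 1 * \<phi> (ball c r)"
        using Ck \<Lambda> by (simp add: L_def)
      finally show ?thesis using g(2) by simp
    qed
  qed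
  show ?thesis using main Ck by (intro exI[of _ "C * k"] conjI allI impI) auto
qed

section \<open>From small balls to all balls\<close>

lemma dyadic_scale:
  fixes y :: "'a::euclidean_space"
  assumes R: "0 < R" and y: "y \<noteq> 0" "norm y < R"
  obtains j :: nat where "R / 2 ^ Suc j \<le> norm y" "norm y < R / 2 ^ j"
proof -
  have "\<exists>j. R / 2 ^ Suc j \<le> norm y"
  proof -
    obtain j where j: "(1 / 2 :: real) ^ j < norm y / R" using real_arch_pow_inv[of "norm y / R" "1 / 2"] R y by auto
    have "R / 2 ^ Suc j \<le> R / 2 ^ j" using R by (intro divide_left_mono) auto
    also have "\<dots> \<le> norm y" using j R by (simp add: field_simps power_one_over)
    finally show ?thesis by blast
  qed
  define j where "j = (LEAST j. R / 2 ^ Suc j \<le> norm y)"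
  have j1: "R / 2 ^ Suc j \<le> norm y" unfolding j_def by (rule LeastI_ex) fact
  have j2: "norm y < R / 2 ^ j"
  proof (cases j)
    case 0
    then show ?thesis using y by simp
  next
    case (Suc i)
    then have "\<not> R / 2 ^ Suc i \<le> norm y" unfolding j_def by (intro not_less_Least) simp
    then show ?thesis using Suc by simp
  qed
  show ?thesis by (rule that[OF j1 j2])
qed

text \<open>All dyadic annuli are dilates of one compact annulus, so a single finite set of centres
  serves every scale. At scale 2^(-j) reverse doubling contributes the factor \<theta>^j with
  \<theta> = 2^(-\<delta>), which makes the sum geometric.\<close>

lemma all_balls_of_small_balls:
  fixes \<phi> :: "'a::euclidean_space set \<Rightarrow> real"
  assumes \<phi>: "\<forall>c r. 0 < r \<longrightarrow> 0 < \<phi> (ball c r)"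
    and D: "0 \<le> D" "\<forall>c r. 0 < r \<longrightarrow> \<phi> (ball c (2 * r)) \<le> D * \<phi> (ball c r)"
    and rd: "0 < \<delta>" "\<forall>c1 r1 c2 r2. 0 < r1 \<and> 0 < r2 \<and> ball c1 r1 \<subseteq> ball c2 r2 \<longrightarrow>
           \<phi> (ball c1 r1) / \<phi> (ball c2 r2) \<le> Q * (measure lebesgue (ball c1 r1) / measure lebesgue (ball c2 r2)) powr \<delta>"
    and \<epsilon>: "0 < \<epsilon>" "\<epsilon> < 1"
  shows "\<exists>C\<ge>0. \<forall>(h::'a \<Rightarrow> real) A. h \<in> borel_measurable lebesgue \<longrightarrow> 0 \<le> A \<longrightarrow>
    (\<forall>c r. 0 < r \<and> r \<le> \<epsilon> * norm c \<longrightarrow> (\<integral>\<^sup>+x\<in>ball c r. ennreal (h x) \<partial>lebesgue) \<le> ennreal (A * \<phi> (ball c r))) \<longrightarrow>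
    (\<forall>c r. 0 < r \<longrightarrow> (\<integral>\<^sup>+x\<in>ball c r. ennreal (h x) \<partial>lebesgue) \<le> ennreal (C * A * \<phi> (ball c r)))"
proof -
  have Q0: "0 \<le> Q"
  proof -
    have "0 < \<phi> (ball (0::'a) 1)" "0 < measure lebesgue (ball (0::'a) 1)" using \<phi> measure_ball_pos[of 1 "0::'a"] by auto
    then show ?thesis using rd(2)[rule_format, of 1 1 "0::'a" "0::'a"] by simp
  qed
  \<comment> \<open>Reverse doubling in terms of a ratio \<open>t \<le> 1\<close> of radii; the
    measures contribute t^n, which is at most \<open>t\<close>.\<close>
  have rd': "\<phi> (ball c1 r1) \<le> Q * t powr \<delta> * \<phi> (ball c2 r2)"
    if "0 < r1" "0 < r2" "ball c1 r1 \<subseteq> ball c2 r2" "r1 \<le> t * r2" "0 < t" "t \<le> 1" for c1 r1 c2 r2 t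
  proof -
    have m2: "0 < measure lebesgue (ball c2 r2)" by (rule measure_ball_pos[OF that(2)])
    have f2: "0 < \<phi> (ball c2 r2)" using \<phi> that by blast
    have "measure lebesgue (ball c1 r1) \<le> measure lebesgue (ball c1 (t * r2))"
    proof -
      have "r1 ^ DIM('a) \<le> (t * r2) ^ DIM('a)" using that by (intro power_mono) auto
      then show ?thesis using that by (simp add: measure_lebesgue_ball)
    qed
    also have "\<dots> = t ^ DIM('a) * measure lebesgue (ball c2 r2)" using that by (intro measure_ball_scale) auto
    also have "\<dots> \<le> t * measure lebesgue (ball c2 r2)"
    proof (rule mult_right_mono)
      have "t ^ DIM('a) \<le> t ^ 1" using that DIM_positive[where 'a='a] by (intro power_decreasing) auto
      then show "t ^ DIM('a) \<le> t" by simp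
    qed simp
    finally have "measure lebesgue (ball c1 r1) / measure lebesgue (ball c2 r2) \<le> t" using m2 by (simp only: pos_divide_le_eq)
    then have "(measure lebesgue (ball c1 r1) / measure lebesgue (ball c2 r2)) powr \<delta> \<le> t powr \<delta>"
      using rd(1) by (intro powr_mono2) auto
    then have "Q * (measure lebesgue (ball c1 r1) / measure lebesgue (ball c2 r2)) powr \<delta> \<le> Q * t powr \<delta>"
      using Q0 by (intro mult_left_mono)
    then have "\<phi> (ball c1 r1) / \<phi> (ball c2 r2) \<le> Q * t powr \<delta>" using rd(2)[rule_format, of r1 r2 c1 c2] that by linarith
    then show ?thesis using f2 by (simp only: pos_divide_le_eq)
  qed
  have dbl: "\<phi> (ball c (2 ^ m * r)) \<le> D ^ m * \<phi> (ball c r)" if "0 < r" for c r and m :: nat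
  proof (induction m)
    case (Suc m)
    have "\<phi> (ball c (2 ^ Suc m * r)) = \<phi> (ball c (2 * (2 ^ m * r)))" by (simp add: mult.assoc)
    also have "\<dots> \<le> D * \<phi> (ball c (2 ^ m * r))" using D(2) that by simp
    also have "\<dots> \<le> D * (D ^ m * \<phi> (ball c r))" using Suc D(1) by (intro mult_left_mono)
    finally show ?case by (simp add: mult.assoc)
  qed simp
  have "compact (cball (0::'a) 1 - ball 0 (1 / 2))" by (rule compact_diff) auto
  \<comment> \<open>Centres of norm at least 1/2 with radius \<open>\<epsilon> / 4\<close> satisfy
    the smallness condition, which is invariant under dilation.\<close>
  from compactE_image[OF this, of "cball 0 1 - ball 0 (1 / 2)" "\<lambda>x. ball x (\<epsilon> / 4)"]
  obtain X where X: "X \<subseteq> cball (0::'a) 1 - ball 0 (1 / 2)" "finite X" "cball (0::'a) 1 - ball 0 (1 / 2) \<subseteq> (\<Union>x\<in>X. ball x (\<epsilon> / 4))"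
    using \<epsilon> by (metis (no_types, lifting) UN_I centre_in_ball divide_pos_pos open_ball subsetI zero_less_numeral)
  \<comment> \<open>For a ball that is not small, \<open>norm c + 2 * R\<close> is at most
    \<open>(2 + 3 / \<epsilon>) * r\<close>, so \<open>ball 0 (2 * R)\<close> lies in
    \<open>ball c (2 ^ m * r)\<close>.\<close>
  obtain m :: nat where m: "2 + 3 / \<epsilon> < 2 ^ m" using real_arch_pow[of 2 "2 + 3 / \<epsilon>"] by auto
  define \<theta> where "\<theta> = (1 / 2 :: real) powr \<delta>"
  have \<theta>: "0 < \<theta>" "\<theta> < 1"
  proof -
    show "0 < \<theta>" by (simp add: \<theta>_def)
    have "(1 / 2 :: real) powr \<delta> < 1 powr \<delta>" using rd(1) by (intro powr_less_mono2) auto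
    then show "\<theta> < 1" by (simp add: \<theta>_def)
  qed
  define N where "N = real (card X)"
  \<comment> \<open>The summand \<open>1\<close> makes \<open>C\<close> at least one, as required
    for balls that are already small.\<close>
  define C where "C = N * Q / (1 - \<theta>) * (Q * D ^ m) + 1"
  have C0: "0 \<le> N * Q / (1 - \<theta>) * (Q * D ^ m)" using Q0 D \<theta> by (simp add: N_def)
  have C: "0 \<le> C" using C0 by (simp add: C_def)
  have main: "(\<integral>\<^sup>+x\<in>ball c r. ennreal (h x) \<partial>lebesgue) \<le> ennreal (C * A * \<phi> (ball c r))"
    if h[measurable]: "h \<in> borel_measurable lebesgue" and A: "0 \<le> A"
      and small: "\<And>c r. 0 < r \<Longrightarrow> r \<le> \<epsilon> * norm c \<Longrightarrow> (\<integral>\<^sup>+x\<in>ball c r. ennreal (h x) \<partial>lebesgue) \<le> ennreal (A * \<phi> (ball c r))"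
      and r: "0 < r" for h :: "'a \<Rightarrow> real" and A c r
  proof -
    have fp: "0 < \<phi> (ball c r)" using \<phi> r by blast
    show ?thesis
    proof (cases "r \<le> \<epsilon> * norm c")
      case True
      have "(\<integral>\<^sup>+x\<in>ball c r. ennreal (h x) \<partial>lebesgue) \<le> ennreal (A * \<phi> (ball c r))" by (rule small[OF r True])
      also have "\<dots> \<le> ennreal (C * A * \<phi> (ball c r))"
      proof (rule ennreal_leI)
        have "1 * (A * \<phi> (ball c r)) \<le> C * (A * \<phi> (ball c r))" using C0 A fp by (intro mult_right_mono) (auto simp: C_def)
        then show "A * \<phi> (ball c r) \<le> C * A * \<phi> (ball c r)" by simp
      qed
      finally show ?thesis .
    next
      case False
      define R where "R = (1 + 1 / \<epsilon>) * r"
      have nc: "norm c \<le> r / \<epsilon>" using False \<epsilon> by (simp add: field_simps)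
      have R: "0 < R" using r \<epsilon> by (simp add: R_def add_pos_pos)
      have R': "norm c + r \<le> R" using nc by (simp add: R_def algebra_simps)
      have sub: "ball c r \<subseteq> ball 0 R" using R' by (intro ball_subset_ball_dist) simp
      let ?b = "\<lambda>(j::nat) x. ball ((R / 2 ^ j) *\<^sub>R x) (R / 2 ^ j * (\<epsilon> / 4))"
      let ?P = "\<phi> (ball (0::'a) (2 * R))"
      have P: "0 < ?P" using \<phi> R by simp
      have b1: "(\<integral>\<^sup>+y\<in>?b j x. ennreal (h y) \<partial>lebesgue) \<le> ennreal (A * (Q * \<theta> ^ j * ?P))" if x: "x \<in> X" for j x
      proof -
        let ?s = "R / 2 ^ j"
        have s: "0 < ?s" using R by simp
        have sR: "?s \<le> R" using R by (simp add: divide_le_eq)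
        have xn: "1 / 2 \<le> norm x" "norm x \<le> 1" using x X(1) by auto
        have rad: "0 < ?s * (\<epsilon> / 4)" by (intro mult_pos_pos s) (use \<epsilon> in simp)
        have "?s * (\<epsilon> / 4) \<le> \<epsilon> * norm (?s *\<^sub>R x)"
        proof -
          have "\<epsilon> / 4 \<le> \<epsilon> * norm x" using xn \<epsilon> mult_left_mono[of "1 / 2" "norm x" \<epsilon>] by simp
          then have "?s * (\<epsilon> / 4) \<le> ?s * (\<epsilon> * norm x)" using s by (intro mult_left_mono) auto
          then show ?thesis unfolding norm_scaleR abs_of_pos[OF s] by (simp only: mult_ac)
        qed
        then have "(\<integral>\<^sup>+y\<in>?b j x. ennreal (h y) \<partial>lebesgue) \<le> ennreal (A * \<phi> (?b j x))" by (rule small[OF rad])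
        also have "\<dots> \<le> ennreal (A * (Q * \<theta> ^ j * ?P))"
        proof (intro ennreal_leI mult_left_mono A)
          have "\<phi> (?b j x) \<le> Q * (1 / 2 ^ j) powr \<delta> * ?P"
          proof (rule rd'[OF rad])
            show "0 < 2 * R" using R by simp
            have "norm (?s *\<^sub>R x) \<le> ?s * 1"
              unfolding norm_scaleR abs_of_pos[OF s] using xn s by (intro mult_left_mono) auto
            then have n: "norm (?s *\<^sub>R x) \<le> R" using sR by linarith
            have "?s * (\<epsilon> / 4) \<le> ?s * 1" using \<epsilon> s by (intro mult_left_mono) auto
            then have e: "?s * (\<epsilon> / 4) \<le> R" using sR by linarith
            show "?b j x \<subseteq> ball 0 (2 * R)" using n e by (intro ball_subset_ball_dist) simp
            have "?s * (\<epsilon> / 4) \<le> ?s * 2" using \<epsilon> s by (intro mult_left_mono) auto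
            then show "?s * (\<epsilon> / 4) \<le> 1 / 2 ^ j * (2 * R)" by simp
          qed auto
          also have "(1 / 2 ^ j :: real) powr \<delta> = \<theta> ^ j"
          proof -
            have e: "1 / 2 ^ j = (1 / 2 :: real) powr real j" by (simp add: powr_realpow power_one_over)
            have "\<theta> ^ j = (1 / 2) powr (real j * \<delta>)" unfolding \<theta>_def by (rule powr_power) simp
            then show ?thesis unfolding e powr_powr by simp
          qed
          finally show "\<phi> (?b j x) \<le> Q * \<theta> ^ j * ?P" .
        qed
        finally show ?thesis .
      qed
      have "(\<integral>\<^sup>+x\<in>ball c r. ennreal (h x) \<partial>lebesgue) \<le> (\<integral>\<^sup>+y. (\<Sum>j. \<Sum>x\<in>X. ennreal (h y) * indicator (?b j x) y) \<partial>lebesgue)"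
      proof (rule nn_integral_mono_AE)
        \<comment> \<open>The origin lies in none of the annuli.\<close>
        have "AE y in lebesgue. y \<notin> {0::'a}" by (rule AE_not_in) (simp add: negligible_iff_null_sets[symmetric])
        then show "AE y in lebesgue. ennreal (h y) * indicator (ball c r) y \<le> (\<Sum>j. \<Sum>x\<in>X. ennreal (h y) * indicator (?b j x) y)"
        proof eventually_elim
          case (elim y)
          show ?case
          proof (cases "y \<in> ball c r")
            case True
            then have yR: "norm y < R" using sub by auto
            have y0: "y \<noteq> 0" using elim by simp
            obtain j where j: "R / 2 ^ Suc j \<le> norm y" "norm y < R / 2 ^ j" by (rule dyadic_scale[OF R y0 yR])
            let ?s = "R / 2 ^ j"
            have s: "0 < ?s" using R by simp
            define z where "z = (1 / ?s) *\<^sub>R y"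
            have yz: "y = ?s *\<^sub>R z" using R by (simp add: z_def)
            have nz: "norm z = norm y / ?s" using R by (simp add: z_def)
            have "?s / 2 \<le> norm y" using j(1) by simp
            then have "1 / 2 \<le> norm z" unfolding nz using s by (simp only: pos_le_divide_eq) simp
            moreover have "norm z \<le> 1" unfolding nz using j(2) s by (simp only: pos_divide_le_eq)
            ultimately have "z \<in> cball 0 1 - ball 0 (1 / 2)" by simp
            then obtain x where x: "x \<in> X" "z \<in> ball x (\<epsilon> / 4)" using X(3) by blast
            have "dist (?s *\<^sub>R x) y = ?s * dist x z"
              unfolding yz dist_norm scaleR_diff_right[symmetric] using R by simp
            also have "\<dots> < ?s * (\<epsilon> / 4)" using x(2) s by (intro mult_strict_left_mono) auto
            finally have yb: "y \<in> ?b j x" by simp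
            have "ennreal (h y) * indicator (ball c r) y = ennreal (h y) * indicator (?b j x) y" using True yb by simp
            also have "\<dots> \<le> (\<Sum>x\<in>X. ennreal (h y) * indicator (?b j x) y)"
              by (rule member_le_sum[OF x(1) _ X(2)]) simp
            also have "\<dots> \<le> (\<Sum>j. \<Sum>x\<in>X. ennreal (h y) * indicator (?b j x) y)"
              using sum_le_suminf[of "\<lambda>j. \<Sum>x\<in>X. ennreal (h y) * indicator (?b j x) y" "{j}"] by simp
            finally show ?thesis .
          qed simp
        qed
      qed
      also have "\<dots> = (\<Sum>j. \<integral>\<^sup>+y. (\<Sum>x\<in>X. ennreal (h y) * indicator (?b j x) y) \<partial>lebesgue)"
        by (rule nn_integral_suminf) measurable
      also have "\<dots> = (\<Sum>j. \<Sum>x\<in>X. \<integral>\<^sup>+y\<in>?b j x. ennreal (h y) \<partial>lebesgue)"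
        by (intro suminf_cong nn_integral_sum) measurable
      also have "\<dots> \<le> (\<Sum>j. ennreal (N * A * Q * ?P * \<theta> ^ j))"
      proof (rule suminf_le)
        fix j
        have "(\<Sum>x\<in>X. \<integral>\<^sup>+y\<in>?b j x. ennreal (h y) \<partial>lebesgue) \<le> (\<Sum>x\<in>X. ennreal (A * (Q * \<theta> ^ j * ?P)))"
          by (intro sum_mono b1)
        also have "\<dots> = of_nat (card X) * ennreal (A * (Q * \<theta> ^ j * ?P))" by simp
        also have "\<dots> = ennreal (N * (A * (Q * \<theta> ^ j * ?P)))"
          unfolding N_def ennreal_of_nat_eq_real_of_nat using A Q0 \<theta> P by (intro ennreal_mult[symmetric]) auto
        also have "N * (A * (Q * \<theta> ^ j * ?P)) = N * A * Q * ?P * \<theta> ^ j" by (simp only: mult_ac)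
        finally show "(\<Sum>x\<in>X. \<integral>\<^sup>+y\<in>?b j x. ennreal (h y) \<partial>lebesgue) \<le> ennreal (N * A * Q * ?P * \<theta> ^ j)" .
      qed auto
      also have "\<dots> = ennreal (\<Sum>j. N * A * Q * ?P * \<theta> ^ j)"
        using A Q0 P \<theta> by (intro suminf_ennreal2 summable_mult summable_geometric) (auto simp: N_def)
      also have "(\<Sum>j. N * A * Q * ?P * \<theta> ^ j) = N * A * Q * ?P * (1 / (1 - \<theta>))"
        using \<theta> by (simp add: suminf_mult suminf_geometric summable_geometric)
      also have "\<dots> \<le> C * A * \<phi> (ball c r)"
      proof -
        have "?P \<le> Q * 1 powr \<delta> * \<phi> (ball c (2 ^ m * r))"
        proof (rule rd')
          have "2 * R = 2 * r + 2 * (r / \<epsilon>)" by (simp add: R_def algebra_simps)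
          moreover have "(2 + 3 / \<epsilon>) * r = 2 * r + 3 * (r / \<epsilon>)" by (simp add: algebra_simps)
          ultimately have "norm c + 2 * R \<le> (2 + 3 / \<epsilon>) * r" using nc by linarith
          also have "\<dots> \<le> 2 ^ m * r" using m r by (intro mult_right_mono) auto
          finally have le: "norm c + 2 * R \<le> 2 ^ m * r" .
          show "ball 0 (2 * R) \<subseteq> ball c (2 ^ m * r)" using le by (intro ball_subset_ball_dist) simp
          show "2 * R \<le> 1 * (2 ^ m * r)" using le norm_ge_zero[of c] by linarith
        qed (use R r in auto)
        also have "\<dots> \<le> Q * 1 powr \<delta> * (D ^ m * \<phi> (ball c r))" using Q0 by (intro mult_left_mono dbl r) auto
        finally have PQ: "?P \<le> Q * D ^ m * \<phi> (ball c r)" by simp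
        have "N * A * Q * ?P * (1 / (1 - \<theta>)) = (N * A * Q * (1 / (1 - \<theta>))) * ?P" by (simp only: mult_ac)
        also have "\<dots> \<le> (N * A * Q * (1 / (1 - \<theta>))) * (Q * D ^ m * \<phi> (ball c r))"
          using PQ A Q0 \<theta> by (intro mult_left_mono) (auto simp: N_def)
        also have "\<dots> = (N * Q / (1 - \<theta>) * (Q * D ^ m)) * (A * \<phi> (ball c r))" by simp
        also have "\<dots> \<le> C * (A * \<phi> (ball c r))" using A fp by (intro mult_right_mono) (auto simp: C_def)
        finally show ?thesis by (simp only: mult.assoc)
      qed
      finally show ?thesis by (simp only: ennreal_leI)
    qed
  qed
  show ?thesis by (rule exI[of _ C]) (use C main in blast)
qed

section \<open>Assembly of the norm inequality\<close>

text \<open>For norm zero, arbitrarily small \<Lambda> are admissible, which forces \<open>M\<close>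
  to vanish. For norm \<open>top\<close>, the factor must be positive because
  \<open>0 * top = 0\<close>; hence \<open>C + 1\<close>.\<close>

lemma le_times_of_scalar_bounds:
  assumes "0 \<le> C" and le: "\<And>\<Lambda>. 0 < \<Lambda> \<Longrightarrow> N \<le> ennreal \<Lambda> \<Longrightarrow> M \<le> ennreal (C * \<Lambda>)"
  shows "M \<le> ennreal (C + 1) * N"
proof (cases N)
  case (real n)
  show ?thesis
  proof (cases "n = 0")
    case True
    have "M \<le> 0"
    proof (rule ennreal_le_epsilon)
      fix e :: real assume e: "0 < e"
      have "M \<le> ennreal (C * (e / (C + 1)))" using real True e assms(1) by (intro le) auto
      also have "\<dots> \<le> ennreal e"
      proof (rule ennreal_leI)
        have "C * (e / (C + 1)) = e * (C / (C + 1))" by simp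
        also have "\<dots> \<le> e" using e assms(1) by (intro mult_left_le) auto
        finally show "C * (e / (C + 1)) \<le> e" .
      qed
      finally show "M \<le> 0 + ennreal e" by simp
    qed
    then show ?thesis by simp
  next
    case False
    then have "M \<le> ennreal (C * n)" using real by (intro le) auto
    also have "\<dots> \<le> ennreal ((C + 1) * n)" using real by (intro ennreal_leI mult_right_mono) auto
    also have "\<dots> = ennreal (C + 1) * N" using real assms(1) by (simp add: ennreal_mult)
    finally show ?thesis .
  qed
next
  case top
  then show ?thesis using assms(1) by (simp add: ennreal_mult_top)
qed

lemma morrey_bound_of_small_balls:
  fixes \<phi> :: "'a::euclidean_space set \<Rightarrow> real" and F :: "(('a \<Rightarrow> real) \<times> ('a \<Rightarrow> real)) set"
  assumes \<phi>: "\<forall>c r. 0 < r \<longrightarrow> 0 < \<phi> (ball c r)"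
    and D: "0 \<le> D" "\<forall>c r. 0 < r \<longrightarrow> \<phi> (ball c (2 * r)) \<le> D * \<phi> (ball c r)"
    and rd: "0 < \<delta>" "\<forall>c1 r1 c2 r2. 0 < r1 \<and> 0 < r2 \<and> ball c1 r1 \<subseteq> ball c2 r2 \<longrightarrow>
           \<phi> (ball c1 r1) / \<phi> (ball c2 r2) \<le> Q * (measure lebesgue (ball c1 r1) / measure lebesgue (ball c2 r2)) powr \<delta>"
    and \<epsilon>: "0 < \<epsilon>" "\<epsilon> < 1" and p: "1 \<le> p" and w: "weight w" and H: "A1_inequality F"
    and small: "\<exists>C\<ge>0. \<forall>f g \<Lambda> c r. (f, g) \<in> F \<longrightarrow> 0 < \<Lambda> \<longrightarrow> morrey_norm p \<phi> w f \<le> ennreal \<Lambda> \<longrightarrow> 0 < r \<longrightarrow> r \<le> \<epsilon> * norm c \<longrightarrow>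
      (\<integral>\<^sup>+x\<in>ball c r. ennreal (g x powr p * w x) \<partial>lebesgue) \<le> ennreal ((C * \<Lambda>) powr p * \<phi> (ball c r))"
  shows "\<exists>C\<ge>0. \<forall>f g \<Lambda>. (f, g) \<in> F \<longrightarrow> 0 < \<Lambda> \<longrightarrow> morrey_norm p \<phi> w f \<le> ennreal \<Lambda> \<longrightarrow> morrey_norm p \<phi> w g \<le> ennreal (C * \<Lambda>)"
proof -
  have p0: "0 < p" using p by simp
  from small obtain C1 where C1: "0 \<le> C1" and sm: "\<forall>f g \<Lambda> c r. (f, g) \<in> F \<longrightarrow> 0 < \<Lambda> \<longrightarrow> morrey_norm p \<phi> w f \<le> ennreal \<Lambda> \<longrightarrow> 0 < r \<longrightarrow> r \<le> \<epsilon> * norm c \<longrightarrow>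
      (\<integral>\<^sup>+x\<in>ball c r. ennreal (g x powr p * w x) \<partial>lebesgue) \<le> ennreal ((C1 * \<Lambda>) powr p * \<phi> (ball c r))" by (elim exE conjE) (rule that)
  from all_balls_of_small_balls[OF \<phi> D rd \<epsilon>] obtain C2 where C2: "0 \<le> C2" and al: "\<forall>(h::'a \<Rightarrow> real) A. h \<in> borel_measurable lebesgue \<longrightarrow> 0 \<le> A \<longrightarrow>
    (\<forall>c r. 0 < r \<and> r \<le> \<epsilon> * norm c \<longrightarrow> (\<integral>\<^sup>+x\<in>ball c r. ennreal (h x) \<partial>lebesgue) \<le> ennreal (A * \<phi> (ball c r))) \<longrightarrow>
    (\<forall>c r. 0 < r \<longrightarrow> (\<integral>\<^sup>+x\<in>ball c r. ennreal (h x) \<partial>lebesgue) \<le> ennreal (C2 * A * \<phi> (ball c r)))" by (elim exE conjE) (rule that)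
  define C where "C = C2 powr (1 / p) * C1"
  have C: "0 \<le> C" using C1 by (simp add: C_def)
  have "morrey_norm p \<phi> w g \<le> ennreal (C * \<Lambda>)" if FG: "(f, g) \<in> F" and \<Lambda>: "0 < \<Lambda>" "morrey_norm p \<phi> w f \<le> ennreal \<Lambda>" for f g \<Lambda>
  proof -
    have [measurable]: "w \<in> borel_measurable lebesgue" using w by (simp add: weight_def)
    have [measurable]: "g \<in> borel_measurable lebesgue" and g0: "\<And>x. 0 \<le> g x" using H FG unfolding A1_inequality_def by auto
    have C\<Lambda>: "0 \<le> C * \<Lambda>" using C \<Lambda> by simp
    have e: "(C * \<Lambda>) powr p = C2 * (C1 * \<Lambda>) powr p" using p0 C2 by (simp add: C_def powr_mult powr_powr mult.assoc)
    have hm: "(\<lambda>x. g x powr p * w x) \<in> borel_measurable lebesgue" by measurable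
    have "(\<integral>\<^sup>+x\<in>ball c r. ennreal (g x powr p * w x) \<partial>lebesgue) \<le> ennreal (C2 * (C1 * \<Lambda>) powr p * \<phi> (ball c r))" if "0 < r" for c r
      by (rule al[rule_format, OF hm _ _ that]) (use sm FG \<Lambda> in auto)
    then show ?thesis unfolding morrey_norm_le_iff[OF \<phi> p0 C\<Lambda>] e using g0 by simp
  qed
  then show ?thesis using C by blast
qed

theorem theorem7p1:
  fixes \<phi> :: "'a::euclidean_space set \<Rightarrow> real"
    and F :: "(('a \<Rightarrow> real) \<times> ('a \<Rightarrow> real)) set"
    and \<kappa> :: real
  assumes kappa: "0 < \<kappa>" "\<kappa> < 1"
    and phi_pos: "\<forall>c r. 0 < r \<longrightarrow> 0 < \<phi> (ball c r)"
    and phi_doubling: "\<exists>C. \<forall>c r. 0 < r \<longrightarrow> \<phi> (ball c (2 * r)) \<le> C * \<phi> (ball c r)"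
    and phi_rev_doubling: "\<exists>\<delta>>0. \<exists>C. \<forall>c1 r1 c2 r2. 0 < r1 \<and> 0 < r2 \<and> ball c1 r1 \<subseteq> ball c2 r2 \<longrightarrow>
           \<phi> (ball c1 r1) / \<phi> (ball c2 r2) \<le>
           C * (measure lebesgue (ball c1 r1) / measure lebesgue (ball c2 r2)) powr \<delta>"
    and F_nonneg: "\<forall>(f, g) \<in> F. f \<in> borel_measurable lebesgue \<and> g \<in> borel_measurable lebesgue \<and>
                      (\<forall>x. 0 \<le> f x) \<and> (\<forall>x. 0 \<le> g x)"
  shows
    "(\<forall>p0 p q s w. 1 \<le> p0 \<and> extrap_hyp p0 F \<and>
        1 < p \<and> 1 \<le> q \<and> q < p \<and> 1 < s \<and> A_loc \<kappa> p w \<and> cond_star q s \<phi> w \<and>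
        balls_in_morrey p \<phi> w \<and> balls_in_morrey q \<phi> w \<longrightarrow>
        (\<exists>C'::real. \<forall>(f, g) \<in> F. morrey_norm p \<phi> w g \<le> ennreal C' * morrey_norm p \<phi> w f))
   \<and> (extrap_hyp 1 F \<longrightarrow>
      (\<forall>p s w. 1 \<le> p \<and> 1 < s \<and> A_loc \<kappa> p w \<and> cond_star p s \<phi> w \<and>
        balls_in_morrey p \<phi> w \<longrightarrow>
        (\<exists>C'::real. \<forall>(f, g) \<in> F. morrey_norm p \<phi> w g \<le> ennreal C' * morrey_norm p \<phi> w f)))"
proof -
  obtain D0 where D0: "\<forall>c r. 0 < r \<longrightarrow> \<phi> (ball c (2 * r)) \<le> D0 * \<phi> (ball c r)" using phi_doubling ..
  define D where "D = \<bar>D0\<bar>"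
  have D: "0 \<le> D" "\<forall>c r. 0 < r \<longrightarrow> \<phi> (ball c (2 * r)) \<le> D * \<phi> (ball c r)"
  proof -
    show "\<forall>c r. 0 < r \<longrightarrow> \<phi> (ball c (2 * r)) \<le> D * \<phi> (ball c r)"
    proof (intro allI impI)
      fix c :: 'a and r :: real assume r: "0 < r"
      have "\<phi> (ball c (2 * r)) \<le> D0 * \<phi> (ball c r)" using D0 r by blast
      also have "\<dots> \<le> D * \<phi> (ball c r)" using phi_pos r by (intro mult_right_mono) (auto simp: D_def less_imp_le)
      finally show "\<phi> (ball c (2 * r)) \<le> D * \<phi> (ball c r)" .
    qed
  qed (simp add: D_def)
  obtain \<delta> Q where rd: "0 < \<delta>" "\<forall>c1 r1 c2 r2. 0 < r1 \<and> 0 < r2 \<and> ball c1 r1 \<subseteq> ball c2 r2 \<longrightarrow>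
           \<phi> (ball c1 r1) / \<phi> (ball c2 r2) \<le> Q * (measure lebesgue (ball c1 r1) / measure lebesgue (ball c2 r2)) powr \<delta>"
    using phi_rev_doubling by (elim exE conjE) (rule that)
  have kk: "0 < \<kappa> / n" "\<kappa> / n < 1" if "1 \<le> n" for n :: real
    using kappa that by (auto simp: divide_less_eq)
  \<comment> \<open>\<open>n\<close> records the shrinking of the locality parameter:
    \<open>4\<close> after passing from \<open>A_loc\<close> to sub-balls, \<open>8\<close> after
    the openness step.\<close>
  have bound_gt1: "\<exists>C\<ge>0. \<forall>f g \<Lambda>. (f, g) \<in> G \<longrightarrow> 0 < \<Lambda> \<longrightarrow> morrey_norm p \<phi> w f \<le> ennreal \<Lambda> \<longrightarrow> morrey_norm p \<phi> w g \<le> ennreal (C * \<Lambda>)"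
    if p: "1 < p" and s: "1 < s" and H: "A1_inequality G" and w: "weight w" and A: "local_Ap (\<kappa> / n) K p w" and n: "1 \<le> n"
      and star: "star_bound K1 p s \<phi> w" and K1: "0 \<le> K1" for p s G w K K1 n
  proof (rule morrey_bound_of_small_balls[OF phi_pos D rd _ _ _ w H small_ball_estimate[OF p s H w A star K1 phi_pos D]])
    show "0 < \<kappa> / n / 52" "\<kappa> / n / 52 < 1" using kk[OF n] by auto
  qed (use p in simp)
  have fin: "\<exists>C'::real. \<forall>(f, g)\<in>F. morrey_norm p \<phi> w g \<le> ennreal C' * morrey_norm p \<phi> w f"
    if "\<exists>C\<ge>0. \<forall>f g \<Lambda>. (f, g) \<in> F \<longrightarrow> 0 < \<Lambda> \<longrightarrow> morrey_norm p \<phi> w f \<le> ennreal \<Lambda> \<longrightarrow> morrey_norm p \<phi> w g \<le> ennreal (C * \<Lambda>)" for p w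
  proof -
    from that obtain C where C: "0 \<le> C" "\<forall>f g \<Lambda>. (f, g) \<in> F \<longrightarrow> 0 < \<Lambda> \<longrightarrow> morrey_norm p \<phi> w f \<le> ennreal \<Lambda> \<longrightarrow> morrey_norm p \<phi> w g \<le> ennreal (C * \<Lambda>)"
      by (elim exE conjE) (rule that)
    have "morrey_norm p \<phi> w g \<le> ennreal (C + 1) * morrey_norm p \<phi> w f" if "(f, g) \<in> F" for f g
      using C(2) that by (intro le_times_of_scalar_bounds[OF C(1)]) blast
    then show ?thesis by blast
  qed
  have first: "\<exists>C'::real. \<forall>(f, g)\<in>F. morrey_norm p \<phi> w g \<le> ennreal C' * morrey_norm p \<phi> w f"
    if p0: "1 \<le> p0" and hyp: "extrap_hyp p0 F" and p: "1 < p" and q: "1 \<le> q" "q < p" and s: "1 < s"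
      and A: "A_loc \<kappa> p w" and cs: "cond_star q s \<phi> w" for p0 p q s w
  proof (rule fin)
    have w: "weight w" using A by (simp add: A_loc_def)
    from star_bound_of_cond_star[OF phi_pos q(1) cs w] obtain K1 where K1: "0 \<le> K1" "star_bound K1 q s \<phi> w" by (elim exE conjE) (rule that)
    from local_Ap_of_A_loc[OF kappa p A] obtain K where K: "local_Ap (\<kappa> / 4) K p w" ..
    show "\<exists>C\<ge>0. \<forall>f g \<Lambda>. (f, g) \<in> F \<longrightarrow> 0 < \<Lambda> \<longrightarrow> morrey_norm p \<phi> w f \<le> ennreal \<Lambda> \<longrightarrow> morrey_norm p \<phi> w g \<le> ennreal (C * \<Lambda>)"
    proof (cases "p0 = 1")
      case True
      \<comment> \<open>For p0 = 1 the exponent of the weight class stays at \<open>p\<close>; only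
        the dual condition has to be raised from \<open>q\<close> to \<open>p\<close>.\<close>
      have H: "A1_inequality F" using A1_inequality_of_extrap_hyp_1 hyp F_nonneg True by blast
      from star_bound_increase[OF phi_pos q s K1] obtain s' K2 where s': "1 < s'" and K2: "0 \<le> K2" "star_bound K2 p s' \<phi> w"
        by (elim exE conjE) (rule that)
      show ?thesis by (rule bound_gt1[OF p s' H w K _ K2(2,1)]) simp
    next
      case False
      then have p01: "1 < p0" using p0 by simp
      \<comment> \<open>The new exponent t must exceed \<open>q\<close>, so that the dual condition
        can be raised to it, and \<open>p / p0\<close>, so that p1 = p / t is below p0. From t < p
        follows p1 > 1.\<close>
      have m: "1 \<le> max q (p / p0)" "max q (p / p0) < p" using q p p01 by (auto simp: divide_less_eq)
      from local_Ap_open[OF p K m] obtain t K' where t: "max q (p / p0) < t" "t < p" and K': "local_Ap (\<kappa> / 4 / 2) K' t w"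
        by (elim exE conjE) (rule that)
      have qt: "q < t" "p / p0 < t" using t by auto
      have t1: "1 < t" using qt q by simp
      define p1 where "p1 = p / t"
      have p1: "1 < p1" "p1 < p0" using t t1 qt p01 by (auto simp: p1_def field_simps)
      have p1t: "p1 * t = p" using t1 by (simp add: p1_def)
      let ?G = "(\<lambda>(f, g). (\<lambda>x. f x powr p1, \<lambda>x. g x powr p1)) ` F"
      have H: "A1_inequality ?G" by (rule extrapolation_down[OF p1 hyp F_nonneg])
      from star_bound_increase[OF phi_pos q(1) qt(1) s K1] obtain s' K2 where s': "1 < s'" and K2: "0 \<le> K2" "star_bound K2 t s' \<phi> w"
        by (elim exE conjE) (rule that)
      have K'': "local_Ap (\<kappa> / 8) K' t w" using K' by simp
      from bound_gt1[OF t1 s' H w K'' _ K2(2,1)] obtain C where C: "0 \<le> C"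
        and bd: "\<forall>f g \<Lambda>. (f, g) \<in> ?G \<longrightarrow> 0 < \<Lambda> \<longrightarrow> morrey_norm t \<phi> w f \<le> ennreal \<Lambda> \<longrightarrow> morrey_norm t \<phi> w g \<le> ennreal (C * \<Lambda>)"
        by (auto intro: that)
      have pt: "0 < p" "0 < t" using p t1 by auto
      \<comment> \<open>The p1-th power turns the Morrey norm of exponent p = p1 t into that of
        exponent t, for the same weight and the same \<open>\<phi>\<close>.\<close>
      have eq: "morrey_norm t \<phi> w (\<lambda>x. f x powr p1) \<le> ennreal (L powr p1) \<longleftrightarrow> morrey_norm p \<phi> w f \<le> ennreal L"
        if "0 \<le> L" "\<And>x. 0 \<le> f x" for f L
        unfolding morrey_norm_le_iff[OF phi_pos pt(1) that(1)] morrey_norm_le_iff[OF phi_pos pt(2) powr_ge_zero]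
        using that(2) by (simp add: powr_powr p1t)
      show ?thesis
      proof (intro exI[of _ "C powr (1 / p1)"] conjI allI impI)
        fix f g \<Lambda> assume FG: "(f, g) \<in> F" and \<Lambda>: "0 < \<Lambda>" "morrey_norm p \<phi> w f \<le> ennreal \<Lambda>"
        have fg: "\<And>x. 0 \<le> f x" "\<And>x. 0 \<le> g x" using F_nonneg FG by auto
        have "morrey_norm t \<phi> w (\<lambda>x. f x powr p1) \<le> ennreal (\<Lambda> powr p1)" using \<Lambda> fg by (subst eq) auto
        then have "morrey_norm t \<phi> w (\<lambda>x. g x powr p1) \<le> ennreal (C * \<Lambda> powr p1)" using bd FG \<Lambda> by force
        also have "C * \<Lambda> powr p1 = (C powr (1 / p1) * \<Lambda>) powr p1" using p1 C by (simp add: powr_mult powr_powr)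
        finally show "morrey_norm p \<phi> w g \<le> ennreal (C powr (1 / p1) * \<Lambda>)" using \<Lambda> fg by (subst (asm) eq) auto
      qed simp
    qed
  qed
  have second: "\<exists>C'::real. \<forall>(f, g)\<in>F. morrey_norm p \<phi> w g \<le> ennreal C' * morrey_norm p \<phi> w f"
    if hyp: "extrap_hyp 1 F" and p: "1 \<le> p" and s: "1 < s" and A: "A_loc \<kappa> p w" and cs: "cond_star p s \<phi> w" for p s w
  proof (rule fin)
    have w: "weight w" using A by (simp add: A_loc_def)
    have H: "A1_inequality F" by (rule A1_inequality_of_extrap_hyp_1[OF hyp F_nonneg])
    from star_bound_of_cond_star[OF phi_pos p cs w] obtain K1 where K1: "0 \<le> K1" "star_bound K1 p s \<phi> w" by (elim exE conjE) (rule that)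
    show "\<exists>C\<ge>0. \<forall>f g \<Lambda>. (f, g) \<in> F \<longrightarrow> 0 < \<Lambda> \<longrightarrow> morrey_norm p \<phi> w f \<le> ennreal \<Lambda> \<longrightarrow> morrey_norm p \<phi> w g \<le> ennreal (C * \<Lambda>)"
    proof (cases "p = 1")
      case True
      from A1_on_of_A_loc[OF kappa A[unfolded True]] obtain K where K: "0 < K" and A1: "\<forall>c R. 0 < R \<and> R \<le> \<kappa> / 4 * norm c \<longrightarrow> A1_on K (ball c R) w"
        by (elim exE conjE) (rule that)
      show ?thesis unfolding True
      proof (rule morrey_bound_of_small_balls[OF phi_pos D rd _ _ order_refl w H small_ball_estimate_1[OF s H w K A1 K1(2)[unfolded True] K1(1) phi_pos D]])
        show "0 < \<kappa> / 4 / 52" "\<kappa> / 4 / 52 < 1" using kk[of 4] by auto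
      qed
    next
      case False
      then have p1: "1 < p" using p by simp
      from local_Ap_of_A_loc[OF kappa p1 A] obtain K where K: "local_Ap (\<kappa> / 4) K p w" ..
      show ?thesis by (rule bound_gt1[OF p1 s H w K _ K1(2,1)]) simp
    qed
  qed
  show ?thesis
  proof (intro conjI allI impI; elim conjE)
    fix p0 p q s w
    assume "1 \<le> p0" "extrap_hyp p0 F" "1 < p" "1 \<le> q" "q < p" "1 < s" "A_loc \<kappa> p w" "cond_star q s \<phi> w"
    then show "\<exists>C'::real. \<forall>(f, g)\<in>F. morrey_norm p \<phi> w g \<le> ennreal C' * morrey_norm p \<phi> w f" by (rule first)
  next
    fix p s w
    assume "extrap_hyp 1 F" "1 \<le> p" "1 < s" "A_loc \<kappa> p w" "cond_star p s \<phi> w"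
    then show "\<exists>C'::real. \<forall>(f, g)\<in>F. morrey_norm p \<phi> w g \<le> ennreal C' * morrey_norm p \<phi> w f" by (rule second)
  qed
qed

end
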